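(* The following systems (with $1\le K\le d_1+1$, $1\le J\le d_2+1$) are compatible, and hence sequences of simultaneous fundamental (invertible matrix) solutions to all the equations of each system exist. (1) For a sequence of $(d_2+1)\times(d_2+1)$ matrices $\{\mathbf\Psi_N(x)\}_{N\ge d_2+1}$: $$(\partial_x+D_1^N)\mathbf\Psi_N=0,\quad(\partial_{u_K}-\mathbf U_K^{N,\Psi})\mathbf\Psi_N=0,\quad(\partial_{v_J}+\mathbf V_J^{N,\Psi})\mathbf\Psi_N=0,\quad\mathbf\Psi_{N+1}=\mathbf a_N(x)\mathbf\Psi_N,\qquad N\ge d_2+1.$$ (2) For a sequence of $(d_1+1)\times(d_1+1)$ matrices $\{\mathbf\Phi_N(y)\}_{N\ge d_1+1}$: $$(\partial_y+D_2^N)\mathbf\Phi_N=0,\quad(\partial_{u_K}+\mathbf U_K^{N,\Phi})\mathbf\Phi_N=0,\quad(\partial_{v_J}-\mathbf V_J^{N,\Phi})\mathbf\Phi_N=0,\quad\mathbf\Phi_{N+1}=\mathbf b_N(y)\mathbf\Phi_N,\qquad N\ge d_1+1.$$ (3) The corresponding systems for the barred sequences are also compatible, and hence also admit simultaneous sequences of fundamental solutions $\underline{\mathbf\Psi}^{N-1}(y)$ (of size $(d_1+1)\times(d_1+1)$) and $\underline{\mathbf\Phi}^{N-1}(x)$ (of size $(d_2+1)\times(d_2+1)$). These systems are: the shift relation $\underline{\mathbf\Psi}^{N-1}=\underline{\mathbf\Psi}^N\underline{\mathbf b}^N(y)$, the differential equation $\partial_y\underline{\mathbf\Psi}^{N-1}=\underline{\mathbf\Psi}^{N-1}\underline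 D_2^N$ ($N\ge d_1+1$), and the deformation equations $\partial_{u_K}\underline{\mathbf\Psi}^{N-1}=\underline{\mathbf\Psi}^{N-1}\underline{\mathbf U}_K^{N,\Psi}$, $\partial_{v_J}\underline{\mathbf\Psi}^{N-1}=-\underline{\mathbf\Psi}^{N-1}\underline{\mathbf V}_J^{N,\Psi}$ ($N\ge1$); respectively the shift relation $\underline{\mathbf\Phi}^{N-1}=\underline{\mathbf\Phi}^N\underline{\mathbf a}^N(x)$, the differential equation $\partial_x\underline{\mathbf\Phi}^{N-1}=\underline{\mathbf\Phi}^{N-1}\underline D_1^N$ ($N\ge d_2+1$), and the deformation equations $\partial_{u_K}\underline{\mathbf\Phi}^{N-1}=-\underline{\mathbf\Phi}^{N-1}\underline{\mathbf U}_K^{N,\Phi}$, $\partial_{v_J}\underline{\mathbf\Phi}^{N-1}=\underline{\mathbf\Phi}^{N-1}\underline{\mathbf V}_J^{N,\Phi}$ ($N\ge1$).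
   Context: **Setting.** Fix integers $d_1,d_2\ge1$ and $V_1(x)=\sum_{K=1}^{d_1+1}\frac{u_K}{K}x^K$, $V_2(y)=\sum_{J=1}^{d_2+1}\frac{v_J}{J}y^J$ with $u_{d_1+1}\ne0$, $v_{d_2+1}\ne0$, and contours $\Gamma_x,\Gamma_y$ such that all integrals below converge and integrations by parts produce no boundary terms. Assume there are monic polynomials $\pi_n,\sigma_n$ of degree $n$ ($n\ge0$) with $\int_{\Gamma_x}\int_{\Gamma_y}\pi_n(x)\sigma_m(y)e^{-V_1(x)-V_2(y)+xy}\,dy\,dx=h_n\delta_{nm}$, $h_n\neq0$. The coefficients $u_K,v_J$ are regarded as smoothly varying deformation parameters. Put $\psi_n(x)=\pi_n(x)e^{-V_1(x)}/\sqrt{h_n}$, $\phi_n(y)=\sigma_n(y)e^{-V_2(y)}/\sqrt{h_n}$. **Compatible** means: admitting a basis of simultaneous solutions (fundamental systems). **Recursion coefficients.** There are unique numbers $\alpha_j(n)$ ($-1\le j\le d_2$), $\beta_j(n)$ ($-1\le j\le d_1$), with $\alpha_{-1}(n)=\beta_{-1}(n)=\gamma(n)=\sqrt{h_{n+1}/h_n}$ and $\alpha_j(n)=\beta_j(n)=0$ for $n<j$, such that (terms with negative index omitted) $x\psi_n=\sum_{j=-1}^{d_2}\alpha_j(n)\psi_{n-j}$ and $\partial_x\psi_n=-\sum_{j=-1}^{d_1}\beta_j(n+j)\psi_{n+j}$. Moreover $\alpha_{d_2}(n)\ne0$ ($n\ge d_2$) and $\beta_{d_1}(n)\neq0$ ($n\ge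 d_1$). Let $Q,P$ be the (finite band) semi-infinite matrices (indices $\ge0$) with $x\psi_n=\sum_mQ_{nm}\psi_m$, $\partial_x\psi_n=\sum_mP_{nm}\psi_m$; they satisfy $[P,Q]=\mathbf 1$. **Ladder matrices.** $\mathbf a_N(x)$ ($N\ge d_2$) is the $(d_2+1)\times(d_2+1)$ matrix with $1$'s on the first superdiagonal, last row $\frac1{\gamma(N)}(-\alpha_{d_2}(N),\dots,-\alpha_1(N),x-\alpha_0(N))$, other entries $0$; $\mathbf b_N(y)$ ($N\ge d_1$) is the $(d_1+1)\times(d_1+1)$ matrix with $1$'s on the first superdiagonal, last row $\frac1{\gamma(N)}(-\beta_{d_1}(N),\dots,-\beta_1(N),y-\beta_0(N))$, other entries $0$. Write $\mathbf a^N=\mathbf a_N^{-1}$, $\mathbf b^N=\mathbf b_N^{-1}$. $\underline{\mathbf a}^N(x)$ is the $(d_2+1)\times(d_2+1)$ matrix with $1$'s on the first superdiagonal, first column $\frac1{\gamma(N-1)}(x-\alpha_0(N),-\alpha_1(N+1),\dots,-\alpha_{d_2}(N+d_2))^t$, other entries $0$; $\underline{\mathbf b}^N(y)$ is the $(d_1+1)\times(d_1+1)$ matrix with $1$'s on the first superdiagonal, first column $\frac1{\gamma(N-1)}(y-\beta_0(N),-\beta_1(N+1),\dots,-\beta_{d_1}(N+d_1))^t$, other entries $0$. Write $\underline{\mathbf a}_N=(\underline{\mathbf a}^N)^{-1}$, $\underline{\mathbf b}_N=(\underline{\mathbf b}^N)^{-1}$. **Differential matrices.** For $j\ge-1$ put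 $\beta^N_j=\mathrm{diag}(\beta_j(N+j-d_2),\dots,\beta_j(N+j))$, $\alpha^N_j=\mathrm{diag}(\alpha_j(N+j-d_1),\dots,\alpha_j(N+j))$, $\underline\alpha^N_j=\mathrm{diag}(\alpha_j(N),\dots,\alpha_j(N+d_1))$, $\underline\beta^N_j=\mathrm{diag}(\beta_j(N),\dots,\beta_j(N+d_2))$. Then $D_1^N(x)=\beta^N_{-1}\mathbf a^{N-1}+\beta_0^N+\sum_{j=1}^{d_1}\beta_j^N\mathbf a_{N+j-1}\cdots\mathbf a_N$, $D_2^N(y)=\alpha^N_{-1}\mathbf b^{N-1}+\alpha_0^N+\sum_{j=1}^{d_2}\alpha_j^N\mathbf b_{N+j-1}\cdots\mathbf b_N$, $\underline D_2^N(y)=\underline{\mathbf b}_N\underline\alpha_{-1}^{N-1}+\underline\alpha_0^{N-1}+\sum_{j=1}^{d_2}\underline{\mathbf b}^{N-1}\cdots\underline{\mathbf b}^{N-j}\underline\alpha_j^{N-1}$, $\underline D_1^N(x)=\underline{\mathbf a}_N\underline\beta_{-1}^{N-1}+\underline\beta_0^{N-1}+\sum_{j=1}^{d_1}\underline{\mathbf a}^{N-1}\cdots\underline{\mathbf a}^{N-j}\underline\beta_j^{N-1}$. **Deformation matrices.** $U^K:=-\frac1K\{(Q^K)_{>0}+\frac12(Q^K)_0\}$, $V^J:=-\frac1J\{((-P^t)^J)_{>0}+\frac12((-P^t)^J)_0\}$ ($>0$: strictly upper triangular part; $0$: diagonal part), $U^K_j(n)=(U^K)_{n,n+j}$, $V^J_j(n)=(V^J)_{n,n+j}$.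 Write $U^K_j[p;d]=\mathrm{diag}(U^K_j(p),\dots,U^K_j(p+d))$ and similarly $V^J_j[p;d]$. Empty products are $\mathbf 1$. Then $\mathbf U_K^{N,\Psi}=\sum_{j=0}^KU^K_j[N-d_2;d_2]\,\mathbf a_{N+j-1}\cdots\mathbf a_N$; $\mathbf V_J^{N,\Psi}=\sum_{j=0}^JV^J_j[N-d_2-j;d_2]\,\mathbf a^{N-j}\cdots\mathbf a^{N-1}$; $\underline{\mathbf U}_K^{N,\Psi}=\sum_{j=0}^K\underline{\mathbf b}_N\cdots\underline{\mathbf b}_{N+j-1}\,U^K_j[N-1;d_1]$; $\underline{\mathbf V}_J^{N,\Psi}=\sum_{j=0}^J\underline{\mathbf b}^{N-1}\cdots\underline{\mathbf b}^{N-j}\,V^J_j[N-1-j;d_1]$; $\mathbf U_K^{N,\Phi}=\sum_{j=0}^KU^K_j[N-j-d_1;d_1]\,\mathbf b^{N-j}\cdots\mathbf b^{N-1}$; $\mathbf V_J^{N,\Phi}=\sum_{j=0}^JV^J_j[N-d_1;d_1]\,\mathbf b_{N+j-1}\cdots\mathbf b_N$; $\underline{\mathbf U}_K^{N,\Phi}=\sum_{j=0}^K\underline{\mathbf a}^{N-1}\cdots\underline{\mathbf a}^{N-j}\,U^K_j[N-1-j;d_2]$; $\underline{\mathbf V}_J^{N,\Phi}=\sum_{j=0}^J\underline{\mathbf a}_N\cdots\underline{\mathbf a}_{N+j-1}\,V^J_j[N-1;d_2]$.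
   Formalization: Each equation is imposed only for N where its matrix is defined: N≥d2+J for V_J^Ψ, N≥d1+K for U_K^Φ, N≥J+1 and N≥K+1 for barred V_J^Ψ, U_K^Φ, N≥max(d1,d2)+1 for barred D_1, D_2. Solutions exist over any convex open set of parameters. *)

theory Defs
  imports
    "HOL-Analysis.Analysis"
    "HOL-Computational_Algebra.Polynomial"
    "Jordan_Normal_Form.Gauss_Jordan_Elimination"
begin

text \<open>
  A point is a pair \<open>(u, v)\<close> with \<open>u\<close> indexed by \<open>{1..d1+1}\<close> and \<open>v\<close> by \<open>{1..d2+1}\<close>.
  The product of two spaces of extensional functions below, with the subspace topology,
  is the complex space of dimension \<open>(d1+1) + (d2+1)\<close>.
\<close>

type_synonym params = "(nat \<Rightarrow> complex) \<times> (nat \<Rightarrow> complex)"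

definition param_space :: "nat \<Rightarrow> nat \<Rightarrow> params set" where
  "param_space d1 d2 = ({1..d1+1} \<rightarrow>\<^sub>E UNIV) \<times> ({1..d2+1} \<rightarrow>\<^sub>E UNIV)"

definition open_params :: "nat \<Rightarrow> nat \<Rightarrow> params set \<Rightarrow> bool" where
  "open_params d1 d2 W \<longleftrightarrow> openin (top_of_set (param_space d1 d2)) W"

definition convex_params :: "nat \<Rightarrow> nat \<Rightarrow> params set \<Rightarrow> bool" where
  "convex_params d1 d2 W \<longleftrightarrow>
     (\<forall>(u, v)\<in>W. \<forall>(u', v')\<in>W. \<forall>t\<in>{0..1::real}.
        ((\<lambda>K\<in>{1..d1+1}. of_real (1 - t) * u K + of_real t * u' K),
         (\<lambda>J\<in>{1..d2+1}. of_real (1 - t) * v J + of_real t * v' J)) \<in> W)"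

definition potential :: "nat \<Rightarrow> (nat \<Rightarrow> complex) \<Rightarrow> complex \<Rightarrow> complex" where
  "potential d u x = (\<Sum>K=1..d+1. u K / of_nat K * x ^ K)"

definition weight :: "nat \<Rightarrow> nat \<Rightarrow> params \<Rightarrow> complex \<Rightarrow> complex \<Rightarrow> complex" where
  "weight d1 d2 p x y = exp (- potential d1 (fst p) x - potential d2 (snd p) y + x * y)"

definition contour :: "(real \<Rightarrow> complex) \<Rightarrow> bool" where
  "contour g \<longleftrightarrow> (\<forall>a b. g piecewise_C1_differentiable_on {a..b})"

text \<open>The derivative may fail to exist at countably many points, which do not affect the integral.\<close>

definition contour_int :: "(real \<Rightarrow> complex) \<Rightarrow> (complex \<Rightarrow> complex) \<Rightarrow> complex" where
  "contour_int g f = (LINT t|lborel. f (g t) * vector_derivative g (at t))"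

definition contour_int2 ::
  "(real \<Rightarrow> complex) \<Rightarrow> (real \<Rightarrow> complex) \<Rightarrow> (complex \<Rightarrow> complex \<Rightarrow> complex) \<Rightarrow> complex" where
  "contour_int2 gx gy f = contour_int gx (\<lambda>x. contour_int gy (f x))"

definition contour_integrable2 ::
  "(real \<Rightarrow> complex) \<Rightarrow> (real \<Rightarrow> complex) \<Rightarrow> (complex \<Rightarrow> complex \<Rightarrow> complex) \<Rightarrow> bool" where
  "contour_integrable2 gx gy f \<longleftrightarrow>
     integrable (lborel \<Otimes>\<^sub>M lborel)
       (\<lambda>(s, t). f (gx s) (gy t) * vector_derivative gx (at s) * vector_derivative gy (at t))"

text \<open>
  The parameters vary in an open set \<open>\<Omega>\<close>, the contours being kept fixed. \<open>rt n\<close> is the branch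
  of the square root of \<open>h n\<close> used in the normalisation. \<open>\<alpha> p j n\<close> and \<open>\<beta> p j n\<close> are the recursion
  coefficients with subscript \<open>j\<close> at the point \<open>p\<close>; only \<open>-1 \<le> j \<le> d2\<close>, respectively
  \<open>-1 \<le> j \<le> d1\<close>, is meaningful. The normalised dual functions \<open>\<phi>\<close> do not enter the systems.
\<close>

locale biorthogonal_family =
  fixes d1 d2 :: nat
    and gx gy :: "real \<Rightarrow> complex"
    and \<Omega> :: "params set"
    and \<pi> \<sigma> :: "nat \<Rightarrow> params \<Rightarrow> complex poly"
    and h rt :: "nat \<Rightarrow> params \<Rightarrow> complex"
    and \<psi> :: "nat \<Rightarrow> params \<Rightarrow> complex \<Rightarrow> complex"
    and \<alpha> \<beta> :: "params \<Rightarrow> int \<Rightarrow> nat \<Rightarrow> complex"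
  assumes d1: "d1 \<ge> 1" and d2: "d2 \<ge> 1"
    and contour_x: "contour gx" and contour_y: "contour gy"
    and open_Omega: "open_params d1 d2 \<Omega>"
    and leading: "\<And>u v. (u, v) \<in> \<Omega> \<Longrightarrow> u (d1 + 1) \<noteq> 0 \<and> v (d2 + 1) \<noteq> 0"
    and convergent:
      "\<And>p i j. p \<in> \<Omega> \<Longrightarrow> contour_integrable2 gx gy (\<lambda>x y. x ^ i * y ^ j * weight d1 d2 p x y)"
    and no_boundary_x:
      "\<And>p i j. p \<in> \<Omega> \<Longrightarrow>
         contour_int2 gx gy (\<lambda>x y. deriv (\<lambda>z. z ^ i * y ^ j * weight d1 d2 p z y) x) = 0"
    and no_boundary_y:
      "\<And>p i j. p \<in> \<Omega> \<Longrightarrow>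
         contour_int2 gx gy (\<lambda>x y. deriv (\<lambda>z. x ^ i * z ^ j * weight d1 d2 p x z) y) = 0"
    and monic_pi: "\<And>p n. p \<in> \<Omega> \<Longrightarrow> degree (\<pi> n p) = n \<and> lead_coeff (\<pi> n p) = 1"
    and monic_sigma: "\<And>p n. p \<in> \<Omega> \<Longrightarrow> degree (\<sigma> n p) = n \<and> lead_coeff (\<sigma> n p) = 1"
    and biorthogonal:
      "\<And>p n m. p \<in> \<Omega> \<Longrightarrow>
         contour_int2 gx gy (\<lambda>x y. poly (\<pi> n p) x * poly (\<sigma> m p) y * weight d1 d2 p x y)
           = (if n = m then h n p else 0)"
    and h_nonzero: "\<And>p n. p \<in> \<Omega> \<Longrightarrow> h n p \<noteq> 0"
    and rt_square: "\<And>p n. p \<in> \<Omega> \<Longrightarrow> (rt n p)\<^sup>2 = h n p"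
    and rt_continuous: "\<And>n. continuous_on \<Omega> (rt n)"
    and psi_eq:
      "\<And>p n x. p \<in> \<Omega> \<Longrightarrow> \<psi> n p x = poly (\<pi> n p) x * exp (- potential d1 (fst p) x) / rt n p"
    and gamma:
      "\<And>p n. p \<in> \<Omega> \<Longrightarrow>
         \<alpha> p (-1) n = rt (Suc n) p / rt n p \<and> \<beta> p (-1) n = rt (Suc n) p / rt n p"
    and alpha_vanish:
      "\<And>p n j. p \<in> \<Omega> \<Longrightarrow> j \<in> {-1..int d2} \<Longrightarrow> int n < j \<Longrightarrow> \<alpha> p j n = 0"
    and beta_vanish:
      "\<And>p n j. p \<in> \<Omega> \<Longrightarrow> j \<in> {-1..int d1} \<Longrightarrow> int n < j \<Longrightarrow> \<beta> p j n = 0"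
    and x_recursion:
      "\<And>p n x. p \<in> \<Omega> \<Longrightarrow>
         x * \<psi> n p x =
           (\<Sum>j\<in>{j \<in> {-1..int d2}. 0 \<le> int n - j}. \<alpha> p j n * \<psi> (nat (int n - j)) p x)"
    and derivative_recursion:
      "\<And>p n x. p \<in> \<Omega> \<Longrightarrow>
         deriv (\<psi> n p) x =
           - (\<Sum>j\<in>{j \<in> {-1..int d1}. 0 \<le> int n + j}.
                \<beta> p j (nat (int n + j)) * \<psi> (nat (int n + j)) p x)"

definition minv :: "complex mat \<Rightarrow> complex mat" where
  "minv A = the (mat_inverse A)"

definition mprod :: "nat \<Rightarrow> complex mat list \<Rightarrow> complex mat" where
  "mprod n As = foldr (*) As (1\<^sub>m n)"

definition msum :: "nat \<Rightarrow> (nat \<Rightarrow> complex mat) \<Rightarrow> nat set \<Rightarrow> complex mat" where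
  "msum n F S = Matrix.mat n n (\<lambda>(i, k). \<Sum>j\<in>S. F j $$ (i, k))"

text \<open>\<open>diag_from d f q\<close> is the diagonal matrix with entries \<open>f q, \<dots>, f (q + d)\<close>.\<close>

definition diag_from :: "nat \<Rightarrow> (nat \<Rightarrow> complex) \<Rightarrow> nat \<Rightarrow> complex mat" where
  "diag_from d f q = mat_diag (d + 1) (\<lambda>i. f (q + i))"

definition has_mat_derivative :: "(complex \<Rightarrow> complex mat) \<Rightarrow> complex mat \<Rightarrow> complex \<Rightarrow> bool" where
  "has_mat_derivative F D z \<longleftrightarrow>
     (\<forall>i<dim_row D. \<forall>j<dim_col D.
        ((\<lambda>w. F w $$ (i, j)) has_field_derivative D $$ (i, j)) (at z))"

definition fundamental_sequence ::
  "nat \<Rightarrow> params set \<Rightarrow> nat set \<Rightarrow> (nat \<Rightarrow> params \<Rightarrow> complex \<Rightarrow> complex mat) \<Rightarrow> bool" where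
  "fundamental_sequence n W I F \<longleftrightarrow>
     (\<forall>N\<in>I.
        (\<forall>p\<in>W. \<forall>z. F N p z \<in> carrier_mat n n \<and> invertible_mat (F N p z)) \<and>
        (\<forall>i<n. \<forall>j<n. continuous_on (W \<times> UNIV) (\<lambda>(p, z). F N p z $$ (i, j))))"

text \<open>
  In the matrix definitions below \<open>c j n\<close> stands for either family of recursion coefficients
  at a fixed point of the parameter space. In both cases \<open>c (-1) n\<close> is \<open>\<gamma>(n)\<close>.
  With \<open>\<a>\<close>, \<open>\<b>\<close> the two ladder families, \<open>ladder d2 \<alpha> N x\<close> is \<open>\<a>\<^sub>N(x)\<close> and
  \<open>ladder d1 \<beta> N y\<close> is \<open>\<b>\<^sub>N(y)\<close>; \<open>ladder_bar\<close> gives the barred matrices with upper index.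
\<close>

definition ladder :: "nat \<Rightarrow> (int \<Rightarrow> nat \<Rightarrow> complex) \<Rightarrow> nat \<Rightarrow> complex \<Rightarrow> complex mat" where
  "ladder d c N z = Matrix.mat (d + 1) (d + 1) (\<lambda>(i, k).
     if i < d then (if k = i + 1 then 1 else 0)
     else ((if k = d then z else 0) - c (int (d - k)) N) / c (-1) N)"

definition ladder_inv :: "nat \<Rightarrow> (int \<Rightarrow> nat \<Rightarrow> complex) \<Rightarrow> nat \<Rightarrow> complex \<Rightarrow> complex mat" where
  "ladder_inv d c N z = minv (ladder d c N z)"

definition ladder_bar :: "nat \<Rightarrow> (int \<Rightarrow> nat \<Rightarrow> complex) \<Rightarrow> nat \<Rightarrow> complex \<Rightarrow> complex mat" where
  "ladder_bar d c N z = Matrix.mat (d + 1) (d + 1) (\<lambda>(i, k).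
     if k = 0 then ((if i = 0 then z else 0) - c (int i) (N + i)) / c (-1) (N - 1)
     else if k = i + 1 then 1 else 0)"

definition ladder_bar_inv :: "nat \<Rightarrow> (int \<Rightarrow> nat \<Rightarrow> complex) \<Rightarrow> nat \<Rightarrow> complex \<Rightarrow> complex mat" where
  "ladder_bar_inv d c N z = minv (ladder_bar d c N z)"

text \<open>
  For \<open>d = d2, c = \<alpha>\<close> these are the products of ladder matrices
  \<open>\<a>\<^sub>N\<^sub>+\<^sub>j\<^sub>-\<^sub>1 \<dots> \<a>\<^sub>N\<close> (\<open>up_prod\<close>) and \<open>\<a>\<^sup>N\<^sup>-\<^sup>j \<dots> \<a>\<^sup>N\<^sup>-\<^sup>1\<close> (\<open>down_prod\<close>), and in the barred case
  those with lower indices \<open>N, \<dots>, N+j-1\<close> (\<open>up_prod_bar\<close>) and with upper indices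
  \<open>N-1, \<dots>, N-j\<close> (\<open>down_prod_bar\<close>), always written from left to right.

  The unbarred inverses exist for index at least \<open>d\<close> only (for smaller index the first column of
  the ladder matrix vanishes), and the barred matrices exist for index at least \<open>1\<close> only (they
  involve \<open>\<gamma>(N-1)\<close>). So \<open>down_prod\<close> is meaningful for \<open>N \<ge> d + j\<close> and \<open>down_prod_bar\<close>
  for \<open>N \<ge> j + 1\<close>, and a matrix built from such products only where all of them are;
  an equation is to be imposed only for such \<open>N\<close>. In these ranges no subtraction on \<open>nat\<close> below is truncated.
\<close>

definition up_prod :: "nat \<Rightarrow> (int \<Rightarrow> nat \<Rightarrow> complex) \<Rightarrow> nat \<Rightarrow> nat \<Rightarrow> complex \<Rightarrow> complex mat" where
  "up_prod d c N j z = mprod (d + 1) (map (\<lambda>m. ladder d c m z) (rev [N..<N + j]))"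

definition down_prod :: "nat \<Rightarrow> (int \<Rightarrow> nat \<Rightarrow> complex) \<Rightarrow> nat \<Rightarrow> nat \<Rightarrow> complex \<Rightarrow> complex mat" where
  "down_prod d c N j z = mprod (d + 1) (map (\<lambda>m. ladder_inv d c m z) [N - j..<N])"

definition up_prod_bar :: "nat \<Rightarrow> (int \<Rightarrow> nat \<Rightarrow> complex) \<Rightarrow> nat \<Rightarrow> nat \<Rightarrow> complex \<Rightarrow> complex mat" where
  "up_prod_bar d c N j z = mprod (d + 1) (map (\<lambda>m. ladder_bar_inv d c m z) [N..<N + j])"

definition down_prod_bar :: "nat \<Rightarrow> (int \<Rightarrow> nat \<Rightarrow> complex) \<Rightarrow> nat \<Rightarrow> nat \<Rightarrow> complex \<Rightarrow> complex mat" where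
  "down_prod_bar d c N j z = mprod (d + 1) (map (\<lambda>m. ladder_bar d c m z) (rev [N - j..<N]))"

text \<open>
  Here \<open>c\<close> (with \<open>d\<close>) gives the ladder matrices and \<open>b\<close> (with \<open>e\<close>) the diagonal coefficients.
\<close>

definition diff_mat ::
  "nat \<Rightarrow> nat \<Rightarrow> (int \<Rightarrow> nat \<Rightarrow> complex) \<Rightarrow> (int \<Rightarrow> nat \<Rightarrow> complex) \<Rightarrow> nat \<Rightarrow> complex \<Rightarrow> complex mat" where
  "diff_mat d e c b N z =
     diag_from d (b (-1)) (N - 1 - d) * ladder_inv d c (N - 1) z
     + diag_from d (b 0) (N - d)
     + msum (d + 1) (\<lambda>j. diag_from d (b (int j)) (N + j - d) * up_prod d c N j z) {1..e}"

definition diff_mat_bar ::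
  "nat \<Rightarrow> nat \<Rightarrow> (int \<Rightarrow> nat \<Rightarrow> complex) \<Rightarrow> (int \<Rightarrow> nat \<Rightarrow> complex) \<Rightarrow> nat \<Rightarrow> complex \<Rightarrow> complex mat" where
  "diff_mat_bar d e c b N z =
     ladder_bar_inv d c N z * diag_from d (b (-1)) (N - 1)
     + diag_from d (b 0) (N - 1)
     + msum (d + 1) (\<lambda>j. down_prod_bar d c N j z * diag_from d (b (int j)) (N - 1)) {1..e}"

definition "D1 d1 d2 \<alpha> \<beta> N x = diff_mat d2 d1 \<alpha> \<beta> N x"
definition "D2 d1 d2 \<alpha> \<beta> N y = diff_mat d1 d2 \<beta> \<alpha> N y"
definition "D1_bar d1 d2 \<alpha> \<beta> N x = diff_mat_bar d2 d1 \<alpha> \<beta> N x"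
definition "D2_bar d1 d2 \<alpha> \<beta> N y = diff_mat_bar d1 d2 \<beta> \<alpha> N y"

type_synonym infmat = "nat \<Rightarrow> nat \<Rightarrow> complex"

definition Q_mat :: "nat \<Rightarrow> (int \<Rightarrow> nat \<Rightarrow> complex) \<Rightarrow> infmat" where
  "Q_mat d2 \<alpha> n m = (if int n - int m \<in> {-1..int d2} then \<alpha> (int n - int m) n else 0)"

definition P_mat :: "nat \<Rightarrow> (int \<Rightarrow> nat \<Rightarrow> complex) \<Rightarrow> infmat" where
  "P_mat d1 \<beta> n m = (if int m - int n \<in> {-1..int d1} then - \<beta> (int m - int n) m else 0)"

text \<open>Only used for matrices whose rows have finite support, where the sum is the full one.\<close>

definition inf_mult :: "infmat \<Rightarrow> infmat \<Rightarrow> infmat" where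
  "inf_mult A B n m = (\<Sum>k | A n k \<noteq> 0. A n k * B k m)"

fun inf_power :: "infmat \<Rightarrow> nat \<Rightarrow> infmat" where
  "inf_power A 0 = (\<lambda>n m. if n = m then 1 else 0)"
| "inf_power A (Suc k) = inf_mult A (inf_power A k)"

definition deformation :: "infmat \<Rightarrow> nat \<Rightarrow> infmat" where
  "deformation A K n m =
     - (1 / of_nat K) * (if n < m then inf_power A K n m
                         else if n = m then 1 / 2 * inf_power A K n m else 0)"

definition U_mat :: "nat \<Rightarrow> (int \<Rightarrow> nat \<Rightarrow> complex) \<Rightarrow> nat \<Rightarrow> infmat" where
  "U_mat d2 \<alpha> K = deformation (Q_mat d2 \<alpha>) K"

definition V_mat :: "nat \<Rightarrow> (int \<Rightarrow> nat \<Rightarrow> complex) \<Rightarrow> nat \<Rightarrow> infmat" where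
  "V_mat d1 \<beta> J = deformation (\<lambda>n m. - P_mat d1 \<beta> m n) J"

text \<open>\<open>band_diag d M j q\<close> is \<open>M\<^sub>j[q; d]\<close>: the entries on the \<open>j\<close>-th superdiagonal of \<open>M\<close> from row \<open>q\<close> on.\<close>

definition band_diag :: "nat \<Rightarrow> infmat \<Rightarrow> nat \<Rightarrow> nat \<Rightarrow> complex mat" where
  "band_diag d M j q = diag_from d (\<lambda>n. M n (n + j)) q"

definition fold_up ::
  "nat \<Rightarrow> (int \<Rightarrow> nat \<Rightarrow> complex) \<Rightarrow> infmat \<Rightarrow> nat \<Rightarrow> nat \<Rightarrow> complex \<Rightarrow> complex mat" where
  "fold_up d c M K N z = msum (d + 1) (\<lambda>j. band_diag d M j (N - d) * up_prod d c N j z) {0..K}"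

definition fold_down ::
  "nat \<Rightarrow> (int \<Rightarrow> nat \<Rightarrow> complex) \<Rightarrow> infmat \<Rightarrow> nat \<Rightarrow> nat \<Rightarrow> complex \<Rightarrow> complex mat" where
  "fold_down d c M K N z =
     msum (d + 1) (\<lambda>j. band_diag d M j (N - d - j) * down_prod d c N j z) {0..K}"

definition fold_up_bar ::
  "nat \<Rightarrow> (int \<Rightarrow> nat \<Rightarrow> complex) \<Rightarrow> infmat \<Rightarrow> nat \<Rightarrow> nat \<Rightarrow> complex \<Rightarrow> complex mat" where
  "fold_up_bar d c M K N z =
     msum (d + 1) (\<lambda>j. up_prod_bar d c N j z * band_diag d M j (N - 1)) {0..K}"

definition fold_down_bar ::
  "nat \<Rightarrow> (int \<Rightarrow> nat \<Rightarrow> complex) \<Rightarrow> infmat \<Rightarrow> nat \<Rightarrow> nat \<Rightarrow> complex \<Rightarrow> complex mat" where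
  "fold_down_bar d c M K N z =
     msum (d + 1) (\<lambda>j. down_prod_bar d c N j z * band_diag d M j (N - 1 - j)) {0..K}"

definition "U_Psi d1 d2 \<alpha> \<beta> K N x = fold_up d2 \<alpha> (U_mat d2 \<alpha> K) K N x"
definition "V_Psi d1 d2 \<alpha> \<beta> J N x = fold_down d2 \<alpha> (V_mat d1 \<beta> J) J N x"
definition "U_Psi_bar d1 d2 \<alpha> \<beta> K N y = fold_up_bar d1 \<beta> (U_mat d2 \<alpha> K) K N y"
definition "V_Psi_bar d1 d2 \<alpha> \<beta> J N y = fold_down_bar d1 \<beta> (V_mat d1 \<beta> J) J N y"
definition "U_Phi d1 d2 \<alpha> \<beta> K N y = fold_down d1 \<beta> (U_mat d2 \<alpha> K) K N y"
definition "V_Phi d1 d2 \<alpha> \<beta> J N y = fold_up d1 \<beta> (V_mat d1 \<beta> J) J N y"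
definition "U_Phi_bar d1 d2 \<alpha> \<beta> K N x = fold_down_bar d2 \<alpha> (U_mat d2 \<alpha> K) K N x"
definition "V_Phi_bar d1 d2 \<alpha> \<beta> J N x = fold_up_bar d2 \<alpha> (V_mat d1 \<beta> J) J N x"

end

theory Submission
  imports Defs "Jordan_Normal_Form.Determinant"
begin

text \<open>
  Let the direction \<open>i\<close> be a deformation parameter or the spectral parameter. The Lax matrix \<open>L\<close>
  (\<open>Q - x\<close>, \<open>- P - y\<close> or a transpose of these) and the deformation matrices \<open>C\<^sub>i\<close> satisfy
  \<open>\<partial>\<^sub>i L = [C\<^sub>i, L]\<close>, where the spectral direction is the string equation \<open>[P, Q] = 1\<close>. The curvature of
  \<open>C\<close> vanishes because the \<open>C\<^sub>i\<close> are triangular parts of powers of \<open>Q\<close> and \<open>P\<close>. Each of the four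
  systems is the linear problem \<open>L f = 0\<close>, \<open>\<partial>\<^sub>i f = C\<^sub>i f\<close> seen through windows of consecutive entries of \<open>f\<close>.

  As \<open>L\<close> is banded and its outer diagonals do not vanish, a solution of \<open>L f = 0\<close> is determined by any
  window, on which \<open>\<partial>\<^sub>i f = C\<^sub>i f\<close> becomes a linear connection. For a window far from row \<open>0\<close> the
  equations above hold without boundary terms and make the connection flat, so on the convex
  parameter domain it has a fundamental solution; the recurrence carries it to all other windows.
\<close>

section \<open>Linear differential equations\<close>

text \<open>The obstacle is row \<open>0\<close>. If \<open>L f = 0\<close> held in every row,
  \<open>f\<close> would be fixed by fewer entries than a fundamental matrix needs, so the first
  rows are dropped. This costs compatibility near the boundary: \<open>L f = 0\<close> is carried
  along by \<open>C\<^sub>i\<close> only where the rows of \<open>C\<^sub>i\<close> do not reach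
  back into the dropped ones. Hence \<open>\<partial>\<^sub>i f = C\<^sub>i f\<close> is obtained
  from row \<open>lo i\<close> on, with \<open>lo i\<close> the lower bandwidth of
  \<open>C\<^sub>i\<close>. These are the ranges of \<open>N\<close> in which the products of
  inverse or barred ladder matrices make sense.

  The triangular shape of the deformation matrices comes from differentiating the biorthonormality
  relations: minus a power of \<open>Q\<close> or of \<open>- P\<close>, up to a factor, is split
  into a strictly lower and a strictly upper part, and its diagonal is shared equally because both
  families of polynomials carry the same normalisation.

  Differentiability in the parameters is not among the hypotheses. It is derived from the
  convergence of all moments on an open set, carried to the polynomials by Gram-Schmidt, and to the
  roots \<open>rt n\<close> by their continuity.\<close>

lemma linear_ode_solution:
  fixes B :: "nat \<Rightarrow> nat \<Rightarrow> real \<Rightarrow> complex"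
  assumes cont: "\<And>i j. i < n \<Longrightarrow> j < n \<Longrightarrow> continuous_on {0..1} (B i j)"
    and bound: "\<And>i j s. i < n \<Longrightarrow> j < n \<Longrightarrow> s \<in> {0..1} \<Longrightarrow> norm (B i j s) \<le> M"
    and "0 \<le> M"
  obtains X :: "nat \<Rightarrow> nat \<Rightarrow> real \<Rightarrow> complex" where
    "\<And>i j. i < n \<Longrightarrow> j < n \<Longrightarrow> X i j 0 = (if i = j then 1 else 0)"
    "\<And>i j s. i < n \<Longrightarrow> j < n \<Longrightarrow> s \<in> {0..1} \<Longrightarrow>
       (X i j has_vector_derivative (\<Sum>l<n. B i l s * X l j s)) (at s within {0..1})"
    "\<And>i j s. i < n \<Longrightarrow> j < n \<Longrightarrow> s \<in> {0..1} \<Longrightarrow> norm (X i j s) \<le> exp (real n * M)"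
proof -
  \<comment> \<open>Peano-Baker series: \<open>T k\<close> is the \<open>k\<close>-fold iterated
    integral of the coefficient matrix, and the solution is the sum over \<open>k\<close>.\<close>
  define T :: "nat \<Rightarrow> nat \<Rightarrow> nat \<Rightarrow> real \<Rightarrow> complex" where
    "T = rec_nat (\<lambda>i j s. if i = j then 1 else 0)
       (\<lambda>k R i j s. integral {0..s} (\<lambda>r. \<Sum>l<n. B i l r * R l j r))"
  have T0: "T 0 i j s = (if i = j then 1 else 0)" for i j s by (simp add: T_def)
  have TS: "T (Suc k) i j s = integral {0..s} (\<lambda>r. \<Sum>l<n. B i l r * T k l j r)" for k i j s
    by (simp add: T_def)
  \<comment> \<open>Candidate for the derivative of \<open>T k\<close>; index \<open>0\<close> gives
    zero because \<open>T 0\<close> is the constant identity.\<close>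
  define T' where "T' k i j s = (case k of 0 \<Rightarrow> 0 | Suc k \<Rightarrow> \<Sum>l<n. B i l s * T k l j s)"
    for k i j and s :: real
  have contT: "continuous_on {0..1} (T k i j)" if "i < n" "j < n" for k i j
    using that
  proof (induction k arbitrary: i)
    case 0 then show ?case by (simp add: T0)
  next
    case (Suc k)
    then have c: "continuous_on {0..1} (\<lambda>r. \<Sum>l<n. B i l r * T k l j r)"
      by (intro continuous_intros cont) auto
    show ?case
      unfolding TS
      by (rule indefinite_integral_continuous_1) (rule integrable_continuous_interval[OF c])
  qed
  have contT': "continuous_on {0..1} (T' k i j)" if "i < n" "j < n" for k i j
    unfolding T'_def using that
    by (cases k) (auto intro!: continuous_intros cont contT)
  have derT: "(T k i j has_vector_derivative T' k i j s) (at s within {0..1})"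
    if "i < n" "j < n" "s \<in> {0..1}" for k i j s
  proof (cases k)
    case 0
    then have "T k i j = (\<lambda>s. if i = j then 1 else 0)" by (auto simp: T0)
    then show ?thesis using 0 by (simp add: T'_def)
  next
    case (Suc k')
    have "((\<lambda>u. integral {0..u} (\<lambda>r. \<Sum>l<n. B i l r * T k' l j r)) has_vector_derivative
        (\<Sum>l<n. B i l s * T k' l j s)) (at s within {0..1})"
      by (rule integral_has_vector_derivative) (use that in \<open>auto intro!: continuous_intros cont contT\<close>)
    then show ?thesis using Suc by (simp add: T'_def TS[abs_def])
  qed
  \<comment> \<open>The power of \<open>s\<close> is kept in the bound, since integrating it
    produces the next factor of the factorial.\<close>
  have bT: "norm (T k i j s) \<le> (real n * M) ^ k * s ^ k / fact k"
    if "i < n" "j < n" "s \<in> {0..1}" for k i j s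
    using that
  proof (induction k arbitrary: i s)
    case 0 then show ?case by (simp add: T0)
  next
    case (Suc k)
    have c: "continuous_on {0..s} (\<lambda>r. \<Sum>l<n. B i l r * T k l j r)"
      using Suc.prems by (intro continuous_intros continuous_on_subset[OF cont] continuous_on_subset[OF contT]) auto
    have hi: "((\<lambda>r. real n * M * ((real n * M) ^ k * r ^ k / fact k)) has_integral
        ((real n * M) ^ Suc k * s ^ Suc k / fact (Suc k) - (real n * M) ^ Suc k * 0 ^ Suc k / fact (Suc k))) {0..s}"
    proof (rule fundamental_theorem_of_calculus)
      fix r assume "r \<in> {0..s}"
      have "((\<lambda>r. (real n * M) ^ Suc k * r ^ Suc k / fact (Suc k)) has_real_derivative
          (real n * M) ^ Suc k * (real (Suc k) * r ^ k) / fact (Suc k)) (at r within {0..s})"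
        by (auto intro!: derivative_eq_intros simp del: fact_Suc power_Suc)
      moreover have "(real n * M) ^ Suc k * (real (Suc k) * r ^ k) / fact (Suc k)
          = real n * M * ((real n * M) ^ k * r ^ k / fact k)"
        by (simp add: field_simps del: of_nat_Suc)
      ultimately show "((\<lambda>r. (real n * M) ^ Suc k * r ^ Suc k / fact (Suc k)) has_vector_derivative
          real n * M * ((real n * M) ^ k * r ^ k / fact k)) (at r within {0..s})"
        by (simp only: has_real_derivative_iff_has_vector_derivative)
    qed (use Suc.prems in auto)
    have "norm (integral {0..s} (\<lambda>r. \<Sum>l<n. B i l r * T k l j r))
        \<le> integral {0..s} (\<lambda>r. real n * M * ((real n * M) ^ k * r ^ k / fact k))"
    proof (rule integral_norm_bound_integral)
      show "(\<lambda>r. \<Sum>l<n. B i l r * T k l j r) integrable_on {0..s}"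
        by (rule integrable_continuous_interval[OF c])
      show "(\<lambda>r. real n * M * ((real n * M) ^ k * r ^ k / fact k)) integrable_on {0..s}"
        using hi by (auto simp: integrable_on_def)
      fix r assume r: "r \<in> {0..s}"
      have "norm (\<Sum>l<n. B i l r * T k l j r) \<le> (\<Sum>l<n. M * ((real n * M) ^ k * r ^ k / fact k))"
        by (rule sum_norm_le, unfold norm_mult, rule mult_mono)
          (use r Suc.prems \<open>0 \<le> M\<close> in \<open>auto intro!: bound Suc.IH\<close>)
      then show "norm (\<Sum>l<n. B i l r * T k l j r) \<le> real n * M * ((real n * M) ^ k * r ^ k / fact k)"
        by (simp add: mult.assoc)
    qed
    then show ?case unfolding TS integral_unique[OF hi] by simp
  qed
  have bT1: "norm (T k i j s) \<le> (real n * M) ^ k / fact k" if "i < n" "j < n" "s \<in> {0..1}" for k i j s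
  proof -
    have "(real n * M) ^ k * s ^ k / fact k \<le> (real n * M) ^ k * 1 / fact k"
      using that \<open>0 \<le> M\<close> by (intro divide_right_mono mult_left_mono power_le_one) auto
    then show ?thesis using bT[OF that, of k] by simp
  qed
  have se: "summable (\<lambda>k. (real n * M) ^ k / fact k)"
    using summable_exp[of "real n * M"] by (simp add: field_simps)
  \<comment> \<open>Summable majorant of the derivative series: the exponential series shifted by
    one index.\<close>
  define bb where "bb k = (case k of 0 \<Rightarrow> 0 | Suc k \<Rightarrow> real n * M * ((real n * M) ^ k / fact k))" for k
  have sbb: "summable bb"
    unfolding summable_Suc_iff[of bb, symmetric]
    using summable_mult[OF se, of "real n * M"] by (simp add: bb_def)
  have bT': "norm (T' k i j s) \<le> bb k" if "i < n" "j < n" "s \<in> {0..1}" for k i j s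
  proof (cases k)
    case (Suc k')
    have "norm (\<Sum>l<n. B i l s * T k' l j s) \<le> (\<Sum>l<n. M * ((real n * M) ^ k' / fact k'))"
      by (rule sum_norm_le, unfold norm_mult, rule mult_mono)
        (use that \<open>0 \<le> M\<close> in \<open>auto intro!: bound bT1\<close>)
    then show ?thesis using Suc by (simp add: T'_def bb_def mult.assoc)
  qed (simp add: T'_def bb_def)
  have sT: "summable (\<lambda>k. T k i j s)" if "i < n" "j < n" "s \<in> {0..1}" for i j s
    by (rule summable_comparison_test'[OF se]) (use bT1[OF that] in auto)
  define X where "X i j s = (\<Sum>k. T k i j s)" for i j s
  have der: "(X i j has_vector_derivative (\<Sum>l<n. B i l s * X l j s)) (at s within {0..1})"
    if ij: "i < n" "j < n" and s: "s \<in> {0..1}" for i j s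
  proof -
    have ul: "uniform_limit {0..1} (\<lambda>N s. \<Sum>k<N. T' k i j s) (\<lambda>s. \<Sum>k. T' k i j s) sequentially"
      by (rule Weierstrass_m_test[OF _ sbb]) (use bT' ij in auto)
    have "\<exists>g. \<forall>x\<in>{0..1}. (\<lambda>k. T k i j x) sums g x \<and>
       (g has_derivative (\<lambda>h. h *\<^sub>R (\<Sum>k. T' k i j x))) (at x within {0..1})"
    proof (rule has_derivative_series)
      show "convex {0..1::real}" by simp
      show "(T k i j has_derivative (\<lambda>h. h *\<^sub>R T' k i j x)) (at x within {0..1})"
        if "x \<in> {0..1}" for k x
        using derT[OF ij that] by (simp add: has_vector_derivative_def)
      show "0 \<in> {0..1::real}" by simp
      show "(\<lambda>k. T k i j 0) sums X i j 0"
        unfolding X_def by (rule summable_sums, rule sT) (use ij in auto)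
      fix e :: real assume e: "e > 0"
      show "\<forall>\<^sub>F N in sequentially. \<forall>x\<in>{0..1}. \<forall>h.
          norm ((\<Sum>k<N. h *\<^sub>R T' k i j x) - h *\<^sub>R (\<Sum>k. T' k i j x)) \<le> e * norm h"
        using uniform_limitD[OF ul e]
      proof eventually_elim
        case (elim N)
        show ?case
        proof (intro ballI allI)
          fix x h :: real assume "x \<in> {0..1}"
          then have "norm ((\<Sum>k<N. T' k i j x) - (\<Sum>k. T' k i j x)) \<le> e"
            using elim by (auto simp: dist_norm less_imp_le)
          then have "\<bar>h\<bar> * norm ((\<Sum>k<N. T' k i j x) - (\<Sum>k. T' k i j x)) \<le> \<bar>h\<bar> * e"
            by (intro mult_left_mono) auto
          then show "norm ((\<Sum>k<N. h *\<^sub>R T' k i j x) - h *\<^sub>R (\<Sum>k. T' k i j x)) \<le> e * norm h"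
            by (simp add: scaleR_sum_right[symmetric] scaleR_diff_right[symmetric] mult.commute)
        qed
      qed
    qed
    then obtain g where g: "\<And>x. x \<in> {0..1} \<Longrightarrow> (\<lambda>k. T k i j x) sums g x"
      "\<And>x. x \<in> {0..1} \<Longrightarrow> (g has_derivative (\<lambda>h. h *\<^sub>R (\<Sum>k. T' k i j x))) (at x within {0..1})"
      by blast
    have gX: "g x = X i j x" if "x \<in> {0..1}" for x
      using g(1)[OF that] by (simp add: X_def sums_unique)
    \<comment> \<open>The derivative series starts with zero and continues with \<open>B\<close>
      times the series of \<open>X\<close>.\<close>
    have "(\<lambda>k. T' k i j s) sums (0 + (\<Sum>l<n. B i l s * X l j s))"
    proof -
      have "(\<lambda>k. \<Sum>l<n. B i l s * T k l j s) sums (\<Sum>l<n. B i l s * X l j s)"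
        unfolding X_def by (intro sums_sum sums_mult summable_sums sT) (use ij s in auto)
      then show ?thesis
        using sums_Suc_iff[of "\<lambda>k. T' k i j s" "\<Sum>l<n. B i l s * X l j s"] by (simp add: T'_def)
    qed
    then have "(\<Sum>k. T' k i j s) = (\<Sum>l<n. B i l s * X l j s)"
      by (simp add: sums_unique[symmetric])
    with g(2)[OF s] have "(g has_vector_derivative (\<Sum>l<n. B i l s * X l j s)) (at s within {0..1})"
      by (simp add: has_vector_derivative_def)
    then show ?thesis
      by (rule has_vector_derivative_transform[OF s gX[symmetric], rotated]) 
  qed
  have X0: "X i j 0 = (if i = j then 1 else 0)" if "i < n" "j < n" for i j
  proof -
    have "T k i j 0 = (if k = 0 then if i = j then 1 else 0 else 0)" for k
      using bT[OF that, of 0 k] by (cases k) (auto simp: T0)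
    then have "X i j 0 = (\<Sum>k\<in>{0}. T k i j 0)" unfolding X_def by (intro suminf_finite) auto
    then show ?thesis by (simp add: T0)
  qed
  have Xb: "norm (X i j s) \<le> exp (real n * M)" if "i < n" "j < n" "s \<in> {0..1}" for i j s
  proof -
    have "norm (X i j s) \<le> (\<Sum>k. (real n * M) ^ k / fact k)"
      unfolding X_def
    proof (rule order.trans[OF summable_norm suminf_le])
      show "summable (\<lambda>k. norm (T k i j s))"
        by (rule summable_comparison_test'[OF se]) (use bT1[OF that] in auto)
    qed (use bT1[OF that] se in \<open>auto intro: summable_comparison_test'[OF se]\<close>)
    also have "\<dots> = exp (real n * M)" by (simp add: exp_def field_simps)
    finally show ?thesis .
  qed
  show thesis using that[of X] X0 der Xb by blast
qed

section \<open>Continuously differentiable functions of several complex variables\<close>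

text \<open>Vectors with finite index set \<open>I\<close> are encoded as functions vanishing
  outside \<open>I\<close>, so that parameters and spectral variable can share one index type.
  \<open>open_D\<close> is openness relative to this coordinate space.\<close>

locale coord_domain =
  fixes I :: "'i set" and D :: "('i \<Rightarrow> complex) set"
  assumes finite_I: "finite I"
    and supported: "\<And>y i. y \<in> D \<Longrightarrow> i \<notin> I \<Longrightarrow> y i = 0"
    and open_D: "\<And>y. y \<in> D \<Longrightarrow>
       \<exists>r>0. \<forall>y'. (\<forall>i. i \<notin> I \<longrightarrow> y' i = 0) \<longrightarrow> (\<forall>i\<in>I. norm (y' i - y i) < r) \<longrightarrow> y' \<in> D"
begin

definition direction :: "('i \<Rightarrow> complex) \<Rightarrow> bool" where
  "direction h \<longleftrightarrow> (\<forall>i. i \<notin> I \<longrightarrow> h i = 0)"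

text \<open>Complex differentiability along all complex lines, with continuous partial derivatives.
  The gradient is an argument so that the calculus rules compute it. As \<open>D\<close> is open,
  only the values on \<open>D\<close> matter.\<close>

definition c1 :: "(('i \<Rightarrow> complex) \<Rightarrow> complex) \<Rightarrow> ('i \<Rightarrow> ('i \<Rightarrow> complex) \<Rightarrow> complex) \<Rightarrow> bool" where
  "c1 F G \<longleftrightarrow> continuous_on D F \<and> (\<forall>i\<in>I. continuous_on D (G i)) \<and>
     (\<forall>y\<in>D. \<forall>h. direction h \<longrightarrow>
        ((\<lambda>e. F (\<lambda>i. y i + e * h i)) has_field_derivative (\<Sum>i\<in>I. h i * G i y)) (at 0))"

lemma c1I:
  assumes "continuous_on D F" "\<And>i. i \<in> I \<Longrightarrow> continuous_on D (G i)"
    "\<And>y h. y \<in> D \<Longrightarrow> direction h \<Longrightarrow>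
        ((\<lambda>e. F (\<lambda>i. y i + e * h i)) has_field_derivative (\<Sum>i\<in>I. h i * G i y)) (at 0)"
  shows "c1 F G"
  using assms by (auto simp: c1_def)

lemma c1_cont: "c1 F G \<Longrightarrow> continuous_on D F"
  and c1_cont_grad: "c1 F G \<Longrightarrow> i \<in> I \<Longrightarrow> continuous_on D (G i)"
  and c1_deriv: "c1 F G \<Longrightarrow> y \<in> D \<Longrightarrow> direction h \<Longrightarrow>
        ((\<lambda>e. F (\<lambda>i. y i + e * h i)) has_field_derivative (\<Sum>i\<in>I. h i * G i y)) (at 0)"
  by (auto simp: c1_def)

lemma near_line:
  assumes "y \<in> D" "direction h"
  obtains r where "r > 0" "\<And>e. norm e < r \<Longrightarrow> (\<lambda>i. y i + e * h i) \<in> D"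
proof -
  obtain r where r: "r > 0" "\<And>y'. (\<forall>i. i \<notin> I \<longrightarrow> y' i = 0) \<Longrightarrow> (\<forall>i\<in>I. norm (y' i - y i) < r) \<Longrightarrow> y' \<in> D"
    using open_D[OF assms(1)] by blast
  define C where "C = 1 + (\<Sum>i\<in>I. norm (h i))"
  have C: "C > 0" unfolding C_def by (simp add: add_pos_nonneg sum_nonneg)
  show thesis
  proof (rule that)
    show "r / C > 0" using r C by simp
    fix e :: complex assume e: "norm e < r / C"
    have "norm (e * h i) < r" if "i \<in> I" for i
    proof -
      have "norm (h i) \<le> (\<Sum>i\<in>I. norm (h i))" using that finite_I by (intro member_le_sum) auto
      then have "norm (e * h i) \<le> norm e * C"
        unfolding norm_mult C_def by (intro mult_left_mono) auto
      also have "\<dots> < r" using e C by (simp add: field_simps)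
      finally show ?thesis .
    qed
    then show "(\<lambda>i. y i + e * h i) \<in> D"
      using assms supported by (intro r(2)) (auto simp: direction_def)
  qed
qed

lemma eventually_line:
  assumes "y \<in> D" "direction h"
  shows "\<forall>\<^sub>F e in nhds 0. (\<lambda>i. y i + e * h i) \<in> D"
  using near_line[OF assms] by (metis (no_types, lifting) dist_norm diff_zero eventually_nhds_metric)

lemma c1_cong:
  assumes c: "c1 F G" and F: "\<And>y. y \<in> D \<Longrightarrow> F' y = F y"
    and G: "\<And>i y. i \<in> I \<Longrightarrow> y \<in> D \<Longrightarrow> G' i y = G i y"
  shows "c1 F' G'"
proof (rule c1I)
  show "continuous_on D F'" using c1_cont[OF c] F by (simp cong: continuous_on_cong)
  show "continuous_on D (G' i)" if "i \<in> I" for i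
    using c1_cont_grad[OF c that] G[OF that] by (simp cong: continuous_on_cong)
  fix y h assume y: "y \<in> D" and h: "direction h"
  have e: "(\<Sum>i\<in>I. h i * G' i y) = (\<Sum>i\<in>I. h i * G i y)" using G y by simp
  have "\<forall>\<^sub>F e in nhds 0. F' (\<lambda>i. y i + e * h i) = F (\<lambda>i. y i + e * h i)"
    using eventually_line[OF y h] by eventually_elim (simp add: F)
  then show "((\<lambda>e. F' (\<lambda>i. y i + e * h i)) has_field_derivative (\<Sum>i\<in>I. h i * G' i y)) (at 0)"
    unfolding e using c1_deriv[OF c y h] by (subst DERIV_cong_ev) auto
qed

lemma c1_const: "c1 (\<lambda>y. c) (\<lambda>i y. 0)"
  by (rule c1I) auto

lemma c1_coord:
  assumes "k \<in> I" shows "c1 (\<lambda>y. y k) (\<lambda>i y. if i = k then 1 else 0)"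
proof (rule c1I)
  show "continuous_on D (\<lambda>y. y k)"
    by (rule continuous_on_subset[OF continuous_on_product_coordinates]) simp
  fix y h assume "y \<in> D" "direction h"
  have "(\<Sum>i\<in>I. h i * (if i = k then 1 else 0)) = h k"
    using assms finite_I by (simp add: if_distrib[of "\<lambda>x. _ * x"] cong: if_cong)
  then show "((\<lambda>e. y k + e * h k) has_field_derivative (\<Sum>i\<in>I. h i * (if i = k then 1 else 0))) (at 0)"
    by (auto intro!: derivative_eq_intros)
qed (auto intro!: continuous_intros)

lemma c1_add:
  assumes "c1 F G" "c1 F' G'" shows "c1 (\<lambda>y. F y + F' y) (\<lambda>i y. G i y + G' i y)"
proof (rule c1I)
  fix y h assume y: "y \<in> D" "direction h"
  from DERIV_add[OF assms(1)[THEN c1_deriv, OF y] assms(2)[THEN c1_deriv, OF y]]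
  show "((\<lambda>e. F (\<lambda>i. y i + e * h i) + F' (\<lambda>i. y i + e * h i)) has_field_derivative
      (\<Sum>i\<in>I. h i * (G i y + G' i y))) (at 0)"
    by (simp add: sum.distrib ring_distribs)
qed (use assms in \<open>auto simp: c1_def intro!: continuous_intros\<close>)

lemma c1_mult:
  assumes "c1 F G" "c1 F' G'" shows "c1 (\<lambda>y. F y * F' y) (\<lambda>i y. G i y * F' y + F y * G' i y)"
proof (rule c1I)
  fix y h assume y: "y \<in> D" "direction h"
  from DERIV_mult'[OF assms(1)[THEN c1_deriv, OF y] assms(2)[THEN c1_deriv, OF y]]
  show "((\<lambda>e. F (\<lambda>i. y i + e * h i) * F' (\<lambda>i. y i + e * h i)) has_field_derivative
      (\<Sum>i\<in>I. h i * (G i y * F' y + F y * G' i y))) (at 0)"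
    by (simp add: sum.distrib ring_distribs sum_distrib_left sum_distrib_right ac_simps)
qed (use assms in \<open>auto simp: c1_def intro!: continuous_intros\<close>)

lemma c1_inverse:
  assumes "c1 F G" "\<And>y. y \<in> D \<Longrightarrow> F y \<noteq> 0"
  shows "c1 (\<lambda>y. inverse (F y)) (\<lambda>i y. - (G i y / (F y)\<^sup>2))"
proof (rule c1I)
  fix y h assume y: "y \<in> D" "direction h"
  from DERIV_inverse'[OF assms(1)[THEN c1_deriv, OF y]] assms(2)[OF y(1)]
  show "((\<lambda>e. inverse (F (\<lambda>i. y i + e * h i))) has_field_derivative
      (\<Sum>i\<in>I. h i * - (G i y / (F y)\<^sup>2))) (at 0)"
    by (simp add: sum_negf sum_divide_distrib sum_distrib_left sum_distrib_right power2_eq_square field_simps)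
qed (use assms in \<open>auto simp: c1_def intro!: continuous_intros\<close>)

lemma c1_cmult: "c1 F G \<Longrightarrow> c1 (\<lambda>y. c * F y) (\<lambda>i y. c * G i y)"
  by (rule c1_cong[OF c1_mult[OF c1_const]]) auto

lemma c1_minus: "c1 F G \<Longrightarrow> c1 (\<lambda>y. - F y) (\<lambda>i y. - G i y)"
  by (rule c1_cong[OF c1_cmult[of F G "-1"]]) auto

lemma c1_diff: "c1 F G \<Longrightarrow> c1 F' G' \<Longrightarrow> c1 (\<lambda>y. F y - F' y) (\<lambda>i y. G i y - G' i y)"
  by (rule c1_cong[OF c1_add[OF _ c1_minus]]) auto

lemma c1_sum:
  assumes "\<And>k. k \<in> A \<Longrightarrow> c1 (F k) (G k)"
  shows "c1 (\<lambda>y. \<Sum>k\<in>A. F k y) (\<lambda>i y. \<Sum>k\<in>A. G k i y)"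
  using assms
  by (induction A rule: infinite_finite_induct) (auto intro!: c1_const c1_add)

lemma c1_divide:
  assumes "c1 F G" "c1 F' G'" "\<And>y. y \<in> D \<Longrightarrow> F' y \<noteq> 0"
  shows "c1 (\<lambda>y. F y / F' y) (\<lambda>i y. (G i y * F' y - F y * G' i y) / (F' y)\<^sup>2)"
  by (rule c1_cong[OF c1_mult[OF assms(1) c1_inverse[OF assms(2,3)]]])
    (auto simp: field_simps power2_eq_square assms(3))

lemma direction_unit: "i \<in> I \<Longrightarrow> direction (\<lambda>k. if k = i then 1 else 0)"
  by (auto simp: direction_def)

lemma c1_partial:
  assumes "c1 F G" "y \<in> D" "i \<in> I"
  shows "((\<lambda>e. F (y(i := e))) has_field_derivative G i y) (at (y i))"
proof -
  have "((\<lambda>e. F (\<lambda>k. y k + e * (if k = i then 1 else 0))) has_field_derivative G i y) (at 0)"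
    using c1_deriv[OF assms(1,2) direction_unit[OF assms(3)]] assms(3) finite_I
    by (simp add: if_distrib[of "\<lambda>x. x * _"] cong: if_cong)
  moreover have "(\<lambda>k. y k + e * (if k = i then 1 else 0)) = y(i := e + y i)" for e by auto
  ultimately show ?thesis
    using DERIV_shift[of "\<lambda>e. F (y(i := e))" "G i y" 0 "y i"] by simp
qed

lemma c1_unique:
  assumes "c1 F G" "c1 F' G'" "\<And>y. y \<in> D \<Longrightarrow> F y = F' y" "y \<in> D" "i \<in> I"
  shows "G i y = G' i y"
proof -
  have "c1 F G'" by (rule c1_cong[OF assms(2)]) (use assms(3) in auto)
  from c1_partial[OF assms(1,4,5)] c1_partial[OF this assms(4,5)] show ?thesis
    by (rule DERIV_unique)
qed

lemma c1_line:
  assumes c: "c1 F G" and y: "(\<lambda>i. y i + a * h i) \<in> D" and h: "direction h"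
  shows "((\<lambda>e. F (\<lambda>i. y i + e * h i)) has_field_derivative
     (\<Sum>i\<in>I. h i * G i (\<lambda>i. y i + a * h i))) (at a)"
  using c1_deriv[OF c y h] DERIV_shift[of "\<lambda>e. F (\<lambda>i. y i + e * h i)" _ 0 a]
  by (simp add: algebra_simps)

text \<open>A continuous root is as smooth as its square: with \<open>l\<close> tending to
  \<open>y\<close>, the identity \<open>H l - H y = (F l - F y) * (F l + F y)\<close> makes the
  difference quotient of \<open>F\<close> that of \<open>H\<close> divided by
  \<open>F l + F y\<close>, and the divisor tends to \<open>2 * F y\<close> by continuity.\<close>

lemma c1_sqrt:
  assumes c: "c1 H G" and cont: "continuous_on D F"
    and sq: "\<And>y. y \<in> D \<Longrightarrow> (F y)\<^sup>2 = H y" and nz: "\<And>y. y \<in> D \<Longrightarrow> H y \<noteq> 0"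
  shows "c1 F (\<lambda>i y. G i y / (2 * F y))"
proof (rule c1I)
  have F0: "F y \<noteq> 0" if "y \<in> D" for y using sq[OF that] nz[OF that] by auto
  show "continuous_on D F" by (rule cont)
  show "continuous_on D (\<lambda>y. G i y / (2 * F y))" if "i \<in> I" for i
    using c1_cont_grad[OF c that] cont F0 by (auto intro!: continuous_intros)
  fix y h assume y: "y \<in> D" and h: "direction h"
  define l where "l e = (\<lambda>i. y i + e * h i)" for e
  have l0: "l 0 = y" by (simp add: l_def)
  have ev: "\<forall>\<^sub>F e in nhds 0. l e \<in> D" using eventually_line[OF y h] by (simp add: l_def)
  have "continuous_on UNIV l" unfolding l_def
    by (intro continuous_on_coordinatewise_then_product continuous_intros)
  then have "(l \<longlongrightarrow> y) (at 0)"
    using l0 by (metis continuous_on_def UNIV_I)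
  moreover have "\<forall>\<^sub>F e in at 0. l e \<in> D" using ev by (simp add: eventually_nhds_conv_at)
  ultimately have "((\<lambda>e. F (l e)) \<longlongrightarrow> F y) (at 0)"
    by (rule continuous_on_tendsto_compose[OF cont _ y])
  then have t1: "((\<lambda>e. F (l e) + F y) \<longlongrightarrow> F y + F y) (at 0)" by (intro tendsto_intros)
  have t2: "((\<lambda>e. (H (l e) - H y) / e) \<longlongrightarrow> (\<Sum>i\<in>I. h i * G i y)) (at 0)"
    using c1_deriv[OF c y h] by (simp add: has_field_derivative_iff l_def)
  have "((\<lambda>e. (H (l e) - H y) / e / (F (l e) + F y)) \<longlongrightarrow> (\<Sum>i\<in>I. h i * G i y) / (F y + F y)) (at 0)"
    by (rule tendsto_divide[OF t2 t1]) (use F0[OF y] in simp)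
  moreover have "\<forall>\<^sub>F e in at 0. (H (l e) - H y) / e / (F (l e) + F y) = (F (l e) - F y) / e"
  proof -
    have "\<forall>\<^sub>F e in at 0. F (l e) + F y \<noteq> 0"
      by (rule tendsto_imp_eventually_ne[OF t1]) (use F0[OF y] in simp)
    with \<open>\<forall>\<^sub>F e in at 0. l e \<in> D\<close> show ?thesis
    proof eventually_elim
      case (elim e)
      have "H (l e) - H y = (F (l e) - F y) * (F (l e) + F y)"
        using sq[OF elim(1)] sq[OF y] by (simp add: power2_eq_square algebra_simps)
      then show ?case using elim(2) by simp
    qed
  qed
  ultimately have "((\<lambda>e. (F (l e) - F y) / e) \<longlongrightarrow> (\<Sum>i\<in>I. h i * G i y) / (F y + F y)) (at 0)"
    by (rule Lim_transform_eventually)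
  moreover have "(\<Sum>i\<in>I. h i * G i y) / (F y + F y) = (\<Sum>i\<in>I. h i * (G i y / (2 * F y)))"
    by (simp add: sum_divide_distrib)
  ultimately show "((\<lambda>e. F (\<lambda>i. y i + e * h i)) has_field_derivative (\<Sum>i\<in>I. h i * (G i y / (2 * F y)))) (at 0)"
    by (simp add: has_field_derivative_iff l_def)
qed

end

section \<open>Adjoint equations and comparison of solutions\<close>

lemma linear_ode_solution_uniform:
  fixes B :: "nat \<Rightarrow> nat \<Rightarrow> real \<Rightarrow> complex"
  assumes cont: "\<And>i j. i < n \<Longrightarrow> j < n \<Longrightarrow> continuous_on {0..1} (B i j)"
  obtains X :: "nat \<Rightarrow> nat \<Rightarrow> real \<Rightarrow> complex" where
    "\<And>i j. i < n \<Longrightarrow> j < n \<Longrightarrow> X i j 0 = (if i = j then 1 else 0)"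
    "\<And>i j s. i < n \<Longrightarrow> j < n \<Longrightarrow> s \<in> {0..1} \<Longrightarrow>
       (X i j has_vector_derivative (\<Sum>l<n. B i l s * X l j s)) (at s within {0..1})"
    "\<And>M i j s. 0 \<le> M \<Longrightarrow> (\<And>i j s. i < n \<Longrightarrow> j < n \<Longrightarrow> s \<in> {0..1} \<Longrightarrow> norm (B i j s) \<le> M)
       \<Longrightarrow> i < n \<Longrightarrow> j < n \<Longrightarrow> s \<in> {0..1} \<Longrightarrow> norm (X i j s) \<le> exp (real n * M)"
proof -
  \<comment> \<open>The supremum is the least admissible bound, so the one solution chosen for it
    satisfies the exponential estimate for every admissible \<open>M\<close>. Inserting
    \<open>0\<close> keeps the set nonempty when \<open>n = 0\<close>.\<close>
  define S where "S = insert 0 (\<Union>i<n. \<Union>j<n. (\<lambda>s. norm (B i j s)) ` {0..1})"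
  have "compact (\<Union>i<n. \<Union>j<n. (\<lambda>s. norm (B i j s)) ` {0..1})"
    using cont by (intro compact_UN compact_continuous_image continuous_intros) auto
  then have bdd: "bdd_above S"
    unfolding S_def by (meson bdd_above_insert bounded_imp_bdd_above compact_imp_bounded)
  have M0: "0 \<le> Sup S" by (rule cSup_upper[OF _ bdd]) (simp add: S_def)
  have nb: "norm (B i j s) \<le> Sup S" if "i < n" "j < n" "s \<in> {0..1}" for i j s
    by (rule cSup_upper[OF _ bdd]) (unfold S_def, use that in blast)
  obtain X where X: "\<And>i j. i < n \<Longrightarrow> j < n \<Longrightarrow> X i j 0 = (if i = j then 1 else 0)"
    "\<And>i j s. i < n \<Longrightarrow> j < n \<Longrightarrow> s \<in> {0..1} \<Longrightarrow>
       (X i j has_vector_derivative (\<Sum>l<n. B i l s * X l j s)) (at s within {0..1})"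
    "\<And>i j s. i < n \<Longrightarrow> j < n \<Longrightarrow> s \<in> {0..1} \<Longrightarrow> norm (X i j s) \<le> exp (real n * Sup S)"
    using linear_ode_solution[where B = B and n = n, OF cont nb M0] by blast
  show thesis
  proof (rule that[OF X(1,2)])
    fix M i j s assume M: "0 \<le> M" and b: "\<And>i j s. i < n \<Longrightarrow> j < n \<Longrightarrow> s \<in> {0..1} \<Longrightarrow> norm (B i j s) \<le> M"
      and ij: "i < n" "j < n" "s \<in> {0..1::real}"
    have "Sup S \<le> M" by (rule cSup_least) (use M b in \<open>auto simp: S_def\<close>)
    then have "exp (real n * Sup S) \<le> exp (real n * M)" by (simp add: mult_left_mono)
    with X(3)[OF ij] show "norm (X i j s) \<le> exp (real n * M)" by linarith
  qed auto
qed

lemma left_inverse_imp_right_inverse: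
  fixes W X :: "nat \<Rightarrow> nat \<Rightarrow> 'a::field"
  assumes "\<And>a b. a < n \<Longrightarrow> b < n \<Longrightarrow> (\<Sum>l<n. W a l * X l b) = (if a = b then 1 else 0)"
    and "a < n" "b < n"
  shows "(\<Sum>l<n. X a l * W l b) = (if a = b then 1 else 0)"
proof -
  define w where "w = Matrix.mat n n (\<lambda>(i, j). W i j)"
  define x where "x = Matrix.mat n n (\<lambda>(i, j). X i j)"
  have c: "w \<in> carrier_mat n n" "x \<in> carrier_mat n n" by (auto simp: w_def x_def)
  have "w * x = 1\<^sub>m n"
    by (rule eq_matI) (use assms(1) in \<open>auto simp: w_def x_def scalar_prod_def lessThan_atLeast0\<close>)
  then have "x * w = 1\<^sub>m n" by (rule mat_mult_left_right_inverse[OF c])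
  then have "(x * w) $$ (a, b) = 1\<^sub>m n $$ (a, b)" by simp
  then show ?thesis
    using assms(2,3) by (simp add: w_def x_def scalar_prod_def lessThan_atLeast0)
qed

text \<open>From \<open>X' = B X\<close> and \<open>W' = - W B\<close> follows
  \<open>(W X)' = 0\<close>, and \<open>W X\<close> starts at the identity. The inverse thus comes
  from an equation of its own and obeys the same bounds as \<open>X\<close>.\<close>

lemma adjoint_solution_inverse:
  fixes B X W :: "nat \<Rightarrow> nat \<Rightarrow> real \<Rightarrow> complex"
  assumes X: "\<And>i j s. i < n \<Longrightarrow> j < n \<Longrightarrow> s \<in> {0..1} \<Longrightarrow>
       (X i j has_vector_derivative (\<Sum>l<n. B i l s * X l j s)) (at s within {0..1})"
    and W: "\<And>i j s. i < n \<Longrightarrow> j < n \<Longrightarrow> s \<in> {0..1} \<Longrightarrow>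
       (W i j has_vector_derivative - (\<Sum>l<n. W i l s * B l j s)) (at s within {0..1})"
    and X0: "\<And>i j. i < n \<Longrightarrow> j < n \<Longrightarrow> X i j 0 = (if i = j then 1 else 0)"
    and W0: "\<And>i j. i < n \<Longrightarrow> j < n \<Longrightarrow> W i j 0 = (if i = j then 1 else 0)"
    and ab: "a < n" "b < n" and s: "s \<in> {0..1}"
  shows "(\<Sum>l<n. W a l s * X l b s) = (if a = b then 1 else 0)"
proof -
  have d: "((\<lambda>s. \<Sum>l<n. W a l s * X l b s) has_vector_derivative 0) (at s within {0..1})"
    if s: "s \<in> {0..1}" for s
  proof -
    have "((\<lambda>s. \<Sum>l<n. W a l s * X l b s) has_vector_derivative
        (\<Sum>l<n. W a l s * (\<Sum>m<n. B l m s * X m b s) + - (\<Sum>m<n. W a m s * B m l s) * X l b s))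
        (at s within {0..1})"
      by (intro has_vector_derivative_sum has_vector_derivative_mult X W) (use ab s in auto)
    moreover have "(\<Sum>l<n. W a l s * (\<Sum>m<n. B l m s * X m b s) + - (\<Sum>m<n. W a m s * B m l s) * X l b s)
      = (\<Sum>l<n. \<Sum>m<n. W a l s * B l m s * X m b s) - (\<Sum>l<n. \<Sum>m<n. W a m s * B m l s * X l b s)"
      by (simp add: sum.distrib sum_negf sum_subtractf sum_distrib_left sum_distrib_right mult.assoc)
    moreover have "(\<Sum>l<n. \<Sum>m<n. W a m s * B m l s * X l b s) = (\<Sum>l<n. \<Sum>m<n. W a l s * B l m s * X m b s)"
      by (rule sum.swap)
    ultimately show ?thesis by simp
  qed
  obtain c where "\<And>s. s \<in> {0..1} \<Longrightarrow> (\<Sum>l<n. W a l s * X l b s) = c"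
    using has_vector_derivative_zero_constant[OF _ d] by (metis convex_real_interval(5))
  then have "(\<Sum>l<n. W a l s * X l b s) = (\<Sum>l<n. W a l 0 * X l b 0)" using s by simp
  also have "\<dots> = (\<Sum>l<n. (if a = l then 1 else 0) * (if l = b then 1 else 0))"
    using ab by (intro sum.cong) (auto simp: W0 X0)
  also have "\<dots> = (if a = b then 1 else 0)" using ab by (simp add: if_distrib[of "\<lambda>x. x * _"] cong: if_cong)
  finally show ?thesis .
qed

text \<open>Variation of constants: \<open>Z' = B Z + R\<close> gives \<open>(W Z)' = W R\<close>,
  so \<open>W Z\<close> stays within \<open>n * c * r\<close> of the identity, and
  \<open>Z - X = X (W Z - 1)\<close> costs a second factor \<open>n * c\<close>.\<close>

lemma linear_ode_compare:
  fixes B X W Z R :: "nat \<Rightarrow> nat \<Rightarrow> real \<Rightarrow> complex"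
  assumes X: "\<And>i j s. i < n \<Longrightarrow> j < n \<Longrightarrow> s \<in> {0..1} \<Longrightarrow>
       (X i j has_vector_derivative (\<Sum>l<n. B i l s * X l j s)) (at s within {0..1})"
    and W: "\<And>i j s. i < n \<Longrightarrow> j < n \<Longrightarrow> s \<in> {0..1} \<Longrightarrow>
       (W i j has_vector_derivative - (\<Sum>l<n. W i l s * B l j s)) (at s within {0..1})"
    and Z: "\<And>i j s. i < n \<Longrightarrow> j < n \<Longrightarrow> s \<in> {0..1} \<Longrightarrow>
       (Z i j has_vector_derivative (\<Sum>l<n. B i l s * Z l j s) + R i j s) (at s within {0..1})"
    and X0: "\<And>i j. i < n \<Longrightarrow> j < n \<Longrightarrow> X i j 0 = (if i = j then 1 else 0)"
    and W0: "\<And>i j. i < n \<Longrightarrow> j < n \<Longrightarrow> W i j 0 = (if i = j then 1 else 0)"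
    and Z0: "\<And>i j. i < n \<Longrightarrow> j < n \<Longrightarrow> Z i j 0 = (if i = j then 1 else 0)"
    and bX: "\<And>i j. i < n \<Longrightarrow> j < n \<Longrightarrow> norm (X i j 1) \<le> c"
    and bW: "\<And>i j s. i < n \<Longrightarrow> j < n \<Longrightarrow> s \<in> {0..1} \<Longrightarrow> norm (W i j s) \<le> c"
    and bR: "\<And>i j s. i < n \<Longrightarrow> j < n \<Longrightarrow> s \<in> {0..1} \<Longrightarrow> norm (R i j s) \<le> r"
    and ab: "a < n" "b < n"
  shows "norm (Z a b 1 - X a b 1) \<le> (real n * c)\<^sup>2 * r"
proof -
  have c0: "c \<ge> 0" using bX[OF ab] norm_ge_zero order.trans by blast
  have r0: "r \<ge> 0" using order.trans[OF norm_ge_zero bR[OF ab, of 0]] by simp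
  define G where "G l s = (\<Sum>m<n. W l m s * Z m b s)" for l s
  have dG: "(G l has_vector_derivative (\<Sum>m<n. W l m s * R m b s)) (at s within {0..1})"
    if s: "s \<in> {0..1}" and l: "l < n" for l s
  proof -
    have "(G l has_vector_derivative
        (\<Sum>k<n. W l k s * ((\<Sum>m<n. B k m s * Z m b s) + R k b s) + - (\<Sum>m<n. W l m s * B m k s) * Z k b s))
        (at s within {0..1})"
      unfolding G_def
      by (intro has_vector_derivative_sum has_vector_derivative_mult Z W) (use ab s l in auto)
    moreover have "(\<Sum>k<n. W l k s * ((\<Sum>m<n. B k m s * Z m b s) + R k b s) + - (\<Sum>m<n. W l m s * B m k s) * Z k b s)
      = (\<Sum>k<n. W l k s * R k b s) + ((\<Sum>k<n. \<Sum>m<n. W l k s * B k m s * Z m b s) - (\<Sum>k<n. \<Sum>m<n. W l m s * B m k s * Z k b s))"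
      by (simp add: sum.distrib sum_negf sum_subtractf sum_distrib_left sum_distrib_right ring_distribs mult.assoc)
    moreover have "(\<Sum>k<n. \<Sum>m<n. W l m s * B m k s * Z k b s) = (\<Sum>k<n. \<Sum>m<n. W l k s * B k m s * Z m b s)"
      by (rule sum.swap)
    ultimately show ?thesis by simp
  qed
  have Gb: "norm (G l 1 - (if l = b then 1 else 0)) \<le> real n * c * r" if l: "l < n" for l
  proof -
    have "norm (G l 1 - G l 0) \<le> (real n * c * r) * norm (1 - 0 :: real)"
    proof (rule differentiable_bound)
      show "(G l has_derivative (\<lambda>h. h *\<^sub>R (\<Sum>m<n. W l m s * R m b s))) (at s within {0..1})"
        if "s \<in> {0..1}" for s
        using dG[OF that l] by (simp add: has_vector_derivative_def)
      fix s :: real assume s: "s \<in> {0..1}"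
      have "norm (\<Sum>m<n. W l m s * R m b s) \<le> (\<Sum>m<n. c * r)"
        by (rule sum_norm_le, unfold norm_mult, rule mult_mono) (use bW bR l ab s c0 in auto)
      then have k: "norm (\<Sum>m<n. W l m s * R m b s) \<le> real n * c * r" by (simp add: mult.assoc)
      show "onorm (\<lambda>h. h *\<^sub>R (\<Sum>m<n. W l m s * R m b s)) \<le> real n * c * r"
      proof (rule onorm_le)
        fix h :: real
        show "norm (h *\<^sub>R (\<Sum>m<n. W l m s * R m b s)) \<le> real n * c * r * norm h"
          using mult_right_mono[OF k, of "\<bar>h\<bar>"] by (simp add: mult.commute)
      qed
    qed auto
    moreover have "G l 0 = (\<Sum>m<n. (if l = m then 1 else 0) * (if m = b then 1 else 0))"
      unfolding G_def using ab l by (intro sum.cong) (auto simp: W0 Z0)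
    moreover have "\<dots> = (if l = b then 1 else 0)"
      using ab l by (simp add: if_distrib[of "\<lambda>x. x * _"] cong: if_cong)
    ultimately show ?thesis by simp
  qed
  have WX: "(\<Sum>l<n. W i l 1 * X l j 1) = (if i = j then 1 else 0)" if "i < n" "j < n" for i j
    by (rule adjoint_solution_inverse[OF X W X0 W0]) (use that in auto)
  have XW: "(\<Sum>l<n. X i l 1 * W l j 1) = (if i = j then 1 else 0)" if "i < n" "j < n" for i j
    by (rule left_inverse_imp_right_inverse[OF WX that])
  have "(\<Sum>l<n. X a l 1 * G l 1) = (\<Sum>l<n. \<Sum>m<n. X a l 1 * W l m 1 * Z m b 1)"
    by (simp add: G_def sum_distrib_left mult.assoc)
  also have "\<dots> = (\<Sum>m<n. (\<Sum>l<n. X a l 1 * W l m 1) * Z m b 1)"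
    by (subst sum.swap) (simp add: sum_distrib_right)
  also have "\<dots> = (\<Sum>m<n. (if a = m then 1 else 0) * Z m b 1)"
    using XW ab by (intro sum.cong) auto
  also have "\<dots> = Z a b 1" using ab by (simp add: if_distrib[of "\<lambda>x. x * _"] cong: if_cong)
  finally have "Z a b 1 - X a b 1 = (\<Sum>l<n. X a l 1 * (G l 1 - (if l = b then 1 else 0)))"
    using ab by (simp add: ring_distribs sum_subtractf if_distrib[of "\<lambda>x. _ * x"] cong: if_cong)
  also have "norm \<dots> \<le> (\<Sum>l<n. c * (real n * c * r))"
    by (rule sum_norm_le, unfold norm_mult, rule mult_mono) (use bX Gb ab c0 in auto)
  finally show ?thesis by (simp add: power2_eq_square mult.assoc mult.left_commute)
qed

text \<open>\<open>X\<close> with its inverse \<open>W\<close>, bundled so that both can be chosen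
  for all points at once. The estimate is quantified over \<open>M\<close> because one bound must
  later serve a point and its neighbours.\<close>

definition fundamental_pair ::
  "nat \<Rightarrow> (nat \<Rightarrow> nat \<Rightarrow> real \<Rightarrow> complex) \<Rightarrow> (nat \<Rightarrow> nat \<Rightarrow> real \<Rightarrow> complex) \<Rightarrow>
   (nat \<Rightarrow> nat \<Rightarrow> real \<Rightarrow> complex) \<Rightarrow> bool" where
  "fundamental_pair n B X W \<longleftrightarrow>
    (\<forall>i<n. \<forall>j<n. X i j 0 = (if i = j then 1 else 0) \<and> W i j 0 = (if i = j then 1 else 0)) \<and>
    (\<forall>i<n. \<forall>j<n. \<forall>s\<in>{0..1}.
       (X i j has_vector_derivative (\<Sum>l<n. B i l s * X l j s)) (at s within {0..1}) \<and>
       (W i j has_vector_derivative - (\<Sum>l<n. W i l s * B l j s)) (at s within {0..1})) \<and>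
    (\<forall>M\<ge>0. (\<forall>i<n. \<forall>j<n. \<forall>s\<in>{0..1}. norm (B i j s) \<le> M) \<longrightarrow>
       (\<forall>i<n. \<forall>j<n. \<forall>s\<in>{0..1}. norm (X i j s) \<le> exp (real n * M) \<and> norm (W i j s) \<le> exp (real n * M)))"

lemma fundamental_pairD:
  assumes "fundamental_pair n B X W" "i < n" "j < n"
  shows "X i j 0 = (if i = j then 1 else 0)" "W i j 0 = (if i = j then 1 else 0)"
    and "s \<in> {0..1} \<Longrightarrow> (X i j has_vector_derivative (\<Sum>l<n. B i l s * X l j s)) (at s within {0..1})"
    and "s \<in> {0..1} \<Longrightarrow> (W i j has_vector_derivative - (\<Sum>l<n. W i l s * B l j s)) (at s within {0..1})"
    and "0 \<le> M \<Longrightarrow> (\<And>i j s. i < n \<Longrightarrow> j < n \<Longrightarrow> s \<in> {0..1} \<Longrightarrow> norm (B i j s) \<le> M) \<Longrightarrow> s \<in> {0..1} \<Longrightarrow>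
      norm (X i j s) \<le> exp (real n * M)"
    and "0 \<le> M \<Longrightarrow> (\<And>i j s. i < n \<Longrightarrow> j < n \<Longrightarrow> s \<in> {0..1} \<Longrightarrow> norm (B i j s) \<le> M) \<Longrightarrow> s \<in> {0..1} \<Longrightarrow>
      norm (W i j s) \<le> exp (real n * M)"
proof -
  note F = assms(1)[unfolded fundamental_pair_def]
  show "X i j 0 = (if i = j then 1 else 0)" "W i j 0 = (if i = j then 1 else 0)"
    using conjunct1[OF F] assms(2,3) by blast+
  show "(X i j has_vector_derivative (\<Sum>l<n. B i l s * X l j s)) (at s within {0..1})"
    "(W i j has_vector_derivative - (\<Sum>l<n. W i l s * B l j s)) (at s within {0..1})" if "s \<in> {0..1}"
    using conjunct1[OF conjunct2[OF F]] assms(2,3) that by blast+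
  assume M: "0 \<le> M" "\<And>i j s. i < n \<Longrightarrow> j < n \<Longrightarrow> s \<in> {0..1} \<Longrightarrow> norm (B i j s) \<le> M" and s: "s \<in> {0..1}"
  from conjunct2[OF conjunct2[OF F], rule_format, OF M(1,2) assms(2,3) s]
  show "norm (X i j s) \<le> exp (real n * M)" "norm (W i j s) \<le> exp (real n * M)" by auto
qed

lemma ex_fundamental_pair:
  fixes B :: "nat \<Rightarrow> nat \<Rightarrow> real \<Rightarrow> complex"
  assumes cont: "\<And>i j. i < n \<Longrightarrow> j < n \<Longrightarrow> continuous_on {0..1} (B i j)"
  shows "\<exists>X W. fundamental_pair n B X W"
proof -
  obtain X where X: "\<And>i j. i < n \<Longrightarrow> j < n \<Longrightarrow> X i j 0 = (if i = j then 1 else 0)"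
    "\<And>i j s. i < n \<Longrightarrow> j < n \<Longrightarrow> s \<in> {0..1} \<Longrightarrow>
       (X i j has_vector_derivative (\<Sum>l<n. B i l s * X l j s)) (at s within {0..1})"
    "\<And>M i j s. 0 \<le> M \<Longrightarrow> (\<And>i j s. i < n \<Longrightarrow> j < n \<Longrightarrow> s \<in> {0..1} \<Longrightarrow> norm (B i j s) \<le> M)
       \<Longrightarrow> i < n \<Longrightarrow> j < n \<Longrightarrow> s \<in> {0..1} \<Longrightarrow> norm (X i j s) \<le> exp (real n * M)"
    using linear_ode_solution_uniform[where B = B and n = n, OF cont] by blast
  \<comment> \<open>The adjoint equation in standard form: the transpose of \<open>W\<close> solves
    the equation whose matrix is minus the transpose of \<open>B\<close>.\<close>
  define B' where "B' i j s = - B j i s" for i j s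
  have cont': "continuous_on {0..1} (B' i j)" if "i < n" "j < n" for i j
    unfolding B'_def using cont that by (intro continuous_intros) auto
  obtain V where V: "\<And>i j. i < n \<Longrightarrow> j < n \<Longrightarrow> V i j 0 = (if i = j then 1 else 0)"
    "\<And>i j s. i < n \<Longrightarrow> j < n \<Longrightarrow> s \<in> {0..1} \<Longrightarrow>
       (V i j has_vector_derivative (\<Sum>l<n. B' i l s * V l j s)) (at s within {0..1})"
    "\<And>M i j s. 0 \<le> M \<Longrightarrow> (\<And>i j s. i < n \<Longrightarrow> j < n \<Longrightarrow> s \<in> {0..1} \<Longrightarrow> norm (B' i j s) \<le> M)
       \<Longrightarrow> i < n \<Longrightarrow> j < n \<Longrightarrow> s \<in> {0..1} \<Longrightarrow> norm (V i j s) \<le> exp (real n * M)"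
    using linear_ode_solution_uniform[where B = B' and n = n, OF cont'] by blast
  have dV: "(V j i has_vector_derivative - (\<Sum>l<n. V l i s * B l j s)) (at s within {0..1})"
    if "i < n" "j < n" "s \<in> {0..1}" for i j s
    using V(2)[OF that(2,1,3)] by (simp add: B'_def sum_negf mult.commute)
  have bV: "norm (V j i s) \<le> exp (real n * M)"
    if "0 \<le> M" "\<forall>i<n. \<forall>j<n. \<forall>s\<in>{0..1}. norm (B i j s) \<le> M" "i < n" "j < n" "s \<in> {0..1}"
    for M i j s
    by (rule V(3)) (use that in \<open>auto simp: B'_def\<close>)
  show ?thesis unfolding fundamental_pair_def
  proof (rule exI[of _ X], rule exI[of _ "\<lambda>i j. V j i"], intro conjI allI impI ballI)
    fix i j assume ij: "i < n" "j < n"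
    show "X i j 0 = (if i = j then 1 else 0)" "V j i 0 = (if i = j then 1 else 0)"
      using X(1)[OF ij] V(1)[OF ij(2,1)] by simp_all
    fix s :: real assume s: "s \<in> {0..1}"
    show "(X i j has_vector_derivative (\<Sum>l<n. B i l s * X l j s)) (at s within {0..1})"
      by (rule X(2)[OF ij s])
    show "(V j i has_vector_derivative - (\<Sum>l<n. V l i s * B l j s)) (at s within {0..1})"
      by (rule dV[OF ij s])
  next
    fix M :: real and i j and s :: real
    assume M: "0 \<le> M" "\<forall>i<n. \<forall>j<n. \<forall>s\<in>{0..1}. norm (B i j s) \<le> M"
      and ij: "i < n" "j < n" and s: "s \<in> {0..1}"
    show "norm (X i j s) \<le> exp (real n * M)"
      using M(2) by (intro X(3)[OF M(1) _ ij s]) blast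
    show "norm (V j i s) \<le> exp (real n * M)" by (rule bV[OF M ij s])
  qed
qed

section \<open>Flat connections\<close>

context coord_domain
begin

text \<open>An error term \<open>o(1)\<close> for complex \<open>e\<close> tending to
  \<open>0\<close>, uniform in the time \<open>s\<close> along the segment.\<close>

abbreviation uniformly_null :: "(complex \<Rightarrow> real \<Rightarrow> complex) \<Rightarrow> bool" where
  "uniformly_null f \<equiv> uniform_limit {0..1} f (\<lambda>_. 0) (at 0)"

lemma uniformly_null_iff:
  "uniformly_null f \<longleftrightarrow> (\<forall>r>0. \<forall>\<^sub>F e in at 0. \<forall>s\<in>{0..1}. norm (f e s) < r)"
  by (simp add: uniform_limit_iff)

lemma uniformly_null_add:
  assumes "uniformly_null f" "uniformly_null g" shows "uniformly_null (\<lambda>e s. f e s + g e s)"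
  using uniform_limit_add[OF assms] by simp

lemma uniformly_null_sum:
  assumes "\<And>k. k \<in> S \<Longrightarrow> uniformly_null (f k)"
  shows "uniformly_null (\<lambda>e s. \<Sum>k\<in>S. f k e s)"
  using assms by (induction S rule: infinite_finite_induct) (auto intro!: uniformly_null_add uniform_limit_const)

lemma uniformly_null_mult:
  assumes f: "uniformly_null f" and g: "continuous_on {0..1} g"
  shows "uniformly_null (\<lambda>e s. g s * f e s)"
proof -
  have "bounded (g ` {0..1})"
    by (intro compact_imp_bounded compact_continuous_image g) auto
  then have "uniform_limit {0..1} (\<lambda>e s. g s * f e s) (\<lambda>s. g s * 0) (at 0)"
    by (intro uniform_lim_mult uniform_limit_const f) (auto simp: image_constant_conv)
  then show ?thesis by simp
qed

lemma uniformly_null_eventually_cong: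
  assumes "uniformly_null f" "\<forall>\<^sub>F e in at 0. \<forall>s\<in>{0..1}. g e s = f e s"
  shows "uniformly_null g"
proof -
  have "uniformly_null g \<longleftrightarrow> uniformly_null f"
    by (rule uniform_limit_cong[OF assms(2)]) simp
  with assms(1) show ?thesis by simp
qed

lemma uniformly_null_scale:
  assumes "uniformly_null f" shows "uniformly_null (\<lambda>e s. e * f e s)"
proof -
  have "\<forall>\<^sub>F e::complex in at 0. norm e < 1"
    using eventually_at[of "\<lambda>e. norm e < 1" "0::complex"] by (auto intro!: exI[of _ 1])
  show ?thesis unfolding uniformly_null_iff
  proof (intro allI impI)
    fix r :: real assume "r > 0"
    with assms have "\<forall>\<^sub>F e in at 0. \<forall>s\<in>{0..1}. norm (f e s) < r" by (simp add: uniformly_null_iff)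
    with \<open>\<forall>\<^sub>F e::complex in at 0. norm e < 1\<close>
    show "\<forall>\<^sub>F e in at 0. \<forall>s\<in>{0..1}. norm (e * f e s) < r"
    proof eventually_elim
      case (elim e)
      show ?case
      proof
        fix s :: real assume "s \<in> {0..1}"
        have "norm e * norm (f e s) \<le> 1 * norm (f e s)" using elim by (intro mult_right_mono) auto
        then show "norm (e * f e s) < r" using elim \<open>s \<in> {0..1}\<close>
            by (metis norm_mult mult_1 order.strict_trans1)
      qed
    qed
  qed
qed

lemma uniformly_null_linear:
  assumes "continuous_on {0..1} g" shows "uniformly_null (\<lambda>e s. e * g s)"
proof -
  have "uniformly_null (\<lambda>e s. e)"
    unfolding uniformly_null_iff eventually_at by (auto simp: dist_norm)
  from uniformly_null_mult[OF this assms] show ?thesis by (simp add: mult.commute)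
qed

text \<open>
  Flat connections on a convex domain: the solution at \<open>y\<close> is the transport along the segment
  from the base point. To first order in \<open>e\<close> the transport to \<open>y + e k\<close> is \<open>X + e s (\<Omega> X)\<close>,
  where \<open>\<Omega>\<close> is the connection in the direction \<open>k\<close>; flatness makes the defect in the
  transport equation \<open>o(e)\<close>, uniformly along the segment.
\<close>

theorem flat_connection_fundamental_solution:
  fixes A :: "'i \<Rightarrow> nat \<Rightarrow> nat \<Rightarrow> ('i \<Rightarrow> complex) \<Rightarrow> complex"
  assumes ne: "D \<noteq> {}"
    and convex: "\<And>y y' s. y \<in> D \<Longrightarrow> y' \<in> D \<Longrightarrow> s \<in> {0..1} \<Longrightarrow> (\<lambda>i. y i + of_real s * (y' i - y i)) \<in> D"
    and A: "\<And>i a b. i \<in> I \<Longrightarrow> a < n \<Longrightarrow> b < n \<Longrightarrow> c1 (A i a b) (dA i a b)"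
    and flat: "\<And>i j a b y. i \<in> I \<Longrightarrow> j \<in> I \<Longrightarrow> a < n \<Longrightarrow> b < n \<Longrightarrow> y \<in> D \<Longrightarrow>
      dA i a b j y + (\<Sum>l<n. A i a l y * A j l b y) = dA j a b i y + (\<Sum>l<n. A j a l y * A i l b y)"
  obtains Y where
    "\<And>a b. a < n \<Longrightarrow> b < n \<Longrightarrow> c1 (Y a b) (\<lambda>i y. \<Sum>l<n. A i a l y * Y l b y)"
    "\<And>y c b. y \<in> D \<Longrightarrow> (\<And>a. a < n \<Longrightarrow> (\<Sum>b<n. Y a b y * c b) = 0) \<Longrightarrow> b < n \<Longrightarrow> c b = 0"
proof -
  obtain y0 where y0: "y0 \<in> D" using ne by blast
  define seg where "seg y s = (\<lambda>i. y0 i + complex_of_real s * (y i - y0 i))" for y s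
  have segD: "seg y s \<in> D" if "y \<in> D" "s \<in> {0..1}" for y s
    using convex[OF y0 that] by (simp add: seg_def)
  have cseg: "continuous_on S (\<lambda>p. seg (f p) (g p))" if "continuous_on S f" "continuous_on S g"
    for S :: "'z::topological_space set" and f g
    unfolding seg_def
    by (rule continuous_on_coordinatewise_then_product)
      (intro continuous_on_add continuous_on_mult continuous_on_diff continuous_on_const
        continuous_on_of_real that(2) continuous_on_product_then_coordinatewise[OF that(1)])
  \<comment> \<open>The connection pulled back to the segment from \<open>y0\<close> to
    \<open>y\<close>.\<close>
  define B where "B y a b s = (\<Sum>i\<in>I. (y i - y0 i) * A i a b (seg y s))" for y a b s
  have cA: "continuous_on S (\<lambda>p. A i a b (seg (f p) (g p)))"
    if "continuous_on S f" "continuous_on S g" "i \<in> I" "a < n" "b < n"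
      "\<And>p. p \<in> S \<Longrightarrow> f p \<in> D \<and> g p \<in> {0..1}"
    for S :: "'z::topological_space set" and f g i a b
    by (rule continuous_on_compose2[OF c1_cont[OF A[OF that(3-5)]] cseg[OF that(1,2)]])
      (use segD that(6) in auto)
  have cB: "continuous_on S (\<lambda>p. B (f p) a b (g p))"
    if "continuous_on S f" "continuous_on S g" "a < n" "b < n"
      "\<And>p. p \<in> S \<Longrightarrow> f p \<in> D \<and> g p \<in> {0..1}"
    for S :: "'z::topological_space set" and f g a b
    unfolding B_def
    by (intro continuous_on_sum continuous_on_mult continuous_on_diff continuous_on_const
        continuous_on_product_then_coordinatewise[OF that(1)] cA) (use that in auto)
  have cBy: "continuous_on {0..1} (B y a b)" if "y \<in> D" "a < n" "b < n" for y a b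
    using cB[of "{0..1}" "\<lambda>_. y" "\<lambda>s. s" a b] that by auto
  have "\<forall>y\<in>D. \<exists>X W. fundamental_pair n (B y) X W"
    by (intro ballI ex_fundamental_pair cBy)
  then obtain X W where XW: "\<And>y. y \<in> D \<Longrightarrow> fundamental_pair n (B y) (X y) (W y)"
    by metis
  note X0 = fundamental_pairD(1)[OF XW] and W0 = fundamental_pairD(2)[OF XW]
    and dX = fundamental_pairD(3)[OF XW] and dW = fundamental_pairD(4)[OF XW]
    and bX = fundamental_pairD(5)[OF XW] and bW = fundamental_pairD(6)[OF XW]
  have BM: "\<exists>M\<ge>0. \<forall>i<n. \<forall>j<n. \<forall>s\<in>{0..1}. norm (B y i j s) \<le> M" if "y \<in> D" for y
  proof -
    have "compact (\<Union>i<n. \<Union>j<n. (B y i j) ` {0..1})"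
      using cBy[OF that] by (intro compact_UN compact_continuous_image) auto
    then obtain M where "\<And>x. x \<in> (\<Union>i<n. \<Union>j<n. (B y i j) ` {0..1}) \<Longrightarrow> norm x \<le> M"
      using compact_imp_bounded bounded_iff by metis
    then have "\<forall>i<n. \<forall>j<n. \<forall>s\<in>{0..1}. norm (B y i j s) \<le> M" by blast
    then show ?thesis by (intro exI[of _ "max M 0"]) (auto intro: max.coboundedI1)
  qed
  \<comment> \<open>Over the compact time interval the coefficients for nearby end points are
    uniformly close, and \<open>linear_ode_compare\<close> turns this into closeness of the
    transports.\<close>
  have cont: "continuous_on D (\<lambda>y. X y a b 1)" if ab: "a < n" "b < n" for a b
    unfolding continuous_on_def
  proof (intro ballI tendstoI)
    fix y and r :: real assume y: "y \<in> D" and r: "r > 0"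
    obtain M where M: "M \<ge> 0" "\<And>i j s. i < n \<Longrightarrow> j < n \<Longrightarrow> s \<in> {0..1} \<Longrightarrow> norm (B y i j s) \<le> M"
      using BM[OF y] by blast
    \<comment> \<open>Bounds the solutions at \<open>y\<close> and at every \<open>y'\<close> whose
      coefficients differ by at most \<open>d\<close>; this is why \<open>d\<close> is capped by
      \<open>1\<close>.\<close>
    define c where "c = exp (real n * (M + 1))"
    \<comment> \<open>\<open>C - 1\<close> is the factor from the comparison estimate; the added
      \<open>1\<close> makes \<open>C\<close> positive and the final inequality strict.\<close>
    define C where "C = (real n * c)\<^sup>2 * (real n * c) + 1"
    have c: "c > 0" by (simp add: c_def)
    have C: "C > 0" using c by (simp add: C_def add_nonneg_pos)
    define d where "d = min 1 (r / C)"
    have d: "d > 0" using r C by (simp add: d_def)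
    have "\<exists>N. open N \<and> y \<in> N \<and> (\<forall>y'\<in>N \<inter> D. \<forall>s\<in>{0..1}. norm (B y' i j s - B y i j s) \<le> d)"
      if "i < n" "j < n" for i j
    proof -
      have "continuous_on (D \<times> {0..1}) (\<lambda>p. B (fst p) i j (snd p))"
        by (rule cB[OF continuous_on_fst[OF continuous_on_id] continuous_on_snd[OF continuous_on_id]])
          (use that in auto)
      from this compact_Icc y d
      obtain N where "y \<in> N" "open N" "\<forall>y'\<in>N \<inter> D. \<forall>s\<in>{0..1}.
          dist (B (fst (y', s)) i j (snd (y', s))) (B (fst (y, s)) i j (snd (y, s))) \<le> d"
        by (rule continuous_on_prod_compactE)
      then show ?thesis by (intro exI[of _ N]) (simp add: dist_norm)
    qed
    then obtain N where N: "\<And>i j. i < n \<Longrightarrow> j < n \<Longrightarrow> open (N i j) \<and> y \<in> N i j \<and>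
       (\<forall>y'\<in>N i j \<inter> D. \<forall>s\<in>{0..1}. norm (B y' i j s - B y i j s) \<le> d)" by metis
    define U where "U = (\<Inter>i<n. \<Inter>j<n. N i j)"
    have "open U" "y \<in> U" unfolding U_def using N by (auto intro!: open_INT)
    moreover have "dist (X y' a b 1) (X y a b 1) < r" if y': "y' \<in> U" "y' \<in> D" for y'
    proof -
      have close: "norm (B y' i j s - B y i j s) \<le> d" if "i < n" "j < n" "s \<in> {0..1}" for i j s
        using N[OF that(1,2)] y' that by (auto simp: U_def)
      have M': "norm (B y' i j s) \<le> M + 1" if "i < n" "j < n" "s \<in> {0..1}" for i j s
        using M(2)[OF that] close[OF that] norm_triangle_ineq[of "B y' i j s - B y i j s" "B y i j s"]
        by (simp add: d_def)
      have M'': "norm (B y i j s) \<le> M + 1" if "i < n" "j < n" "s \<in> {0..1}" for i j s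
        using M(2)[OF that] by simp
      have "norm (X y a b 1 - X y' a b 1) \<le> (real n * c)\<^sup>2 * (real n * (d * c))"
      proof (rule linear_ode_compare[where B = "B y'" and X = "X y'" and W = "W y'" and Z = "X y"
            and R = "\<lambda>i j s. \<Sum>l<n. (B y i l s - B y' i l s) * X y l j s"])
        show "(X y i j has_vector_derivative (\<Sum>l<n. B y' i l s * X y l j s) +
              (\<Sum>l<n. (B y i l s - B y' i l s) * X y l j s)) (at s within {0..1})"
          if "i < n" "j < n" "s \<in> {0..1}" for i j s
          using dX[OF y that] by (simp add: sum.distrib[symmetric] ring_distribs)
        show "norm (\<Sum>l<n. (B y i l s - B y' i l s) * X y l j s) \<le> real n * (d * c)"
          if "i < n" "j < n" "s \<in> {0..1}" for i j s
        proof -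
          have "norm (\<Sum>l<n. (B y i l s - B y' i l s) * X y l j s) \<le> (\<Sum>l<n. d * c)"
          proof (rule sum_norm_le, unfold norm_mult, rule mult_mono)
            fix l assume "l \<in> {..<n}"
            then show "norm (B y i l s - B y' i l s) \<le> d"
              using close[of i l s] that by (simp add: norm_minus_commute)
            show "norm (X y l j s) \<le> c"
              unfolding c_def by (rule bX[OF y _ _ _ M'']) (use \<open>l \<in> {..<n}\<close> that M in auto)
          qed (use d in auto)
          then show ?thesis by simp
        qed
      qed (use dX dW X0 W0 y y' ab bX[OF y'(2) _ _ _ M'] bW[OF y'(2) _ _ _ M'] M in \<open>auto simp: c_def\<close>)
      also have "\<dots> = d * (C - 1)" by (simp add: C_def power2_eq_square mult_ac)
      also have "\<dots> < d * C" using d by simp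
      also have "\<dots> \<le> r" using C by (simp add: d_def min_def field_simps)
      finally show ?thesis by (simp add: dist_norm norm_minus_commute)
    qed
    ultimately show "\<forall>\<^sub>F y' in at y within D. dist (X y' a b 1) (X y a b 1) < r"
      by (auto simp: eventually_at_topological)
  qed
  show thesis
  proof (rule that[of "\<lambda>a b y. X y a b 1"])
    fix y c b assume y: "y \<in> D" and z: "\<And>a. a < n \<Longrightarrow> (\<Sum>b<n. X y a b 1 * c b) = 0" and b: "b < n"
    have WX: "(\<Sum>l<n. W y i l 1 * X y l j 1) = (if i = j then 1 else 0)" if "i < n" "j < n" for i j
      by (rule adjoint_solution_inverse[where B = "B y"]) (use that y dX dW X0 W0 in auto)
    have "(\<Sum>a<n. W y b a 1 * (\<Sum>j<n. X y a j 1 * c j)) = (\<Sum>j<n. (\<Sum>a<n. W y b a 1 * X y a j 1) * c j)"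
      unfolding sum_distrib_left sum_distrib_right by (subst sum.swap) (simp add: mult.assoc)
    also have "\<dots> = (\<Sum>j<n. (if b = j then 1 else 0) * c j)" using b WX by (intro sum.cong) auto
    also have "\<dots> = c b" using b by (simp add: if_distrib[of "\<lambda>x. x * _"] cong: if_cong)
    finally show "c b = 0" using z by simp
  next
    fix a b assume ab: "a < n" "b < n"
    show "c1 (\<lambda>y. X y a b 1) (\<lambda>i y. \<Sum>l<n. A i a l y * X y l b 1)"
    proof (rule c1I[OF cont[OF ab]])
      show "continuous_on D (\<lambda>y. \<Sum>l<n. A i a l y * X y l b 1)" if "i \<in> I" for i
        by (intro continuous_intros cont c1_cont[OF A]) (use ab that in auto)
      fix y k assume y: "y \<in> D" and k: "direction k"
      define h where "h i = y i - y0 i" for i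
      have h: "direction h" using supported[OF y] supported[OF y0] by (simp add: direction_def h_def)
      define ye where "ye e = (\<lambda>i. y i + e * k i)" for e
      have ye0: "ye 0 = y" by (simp add: ye_def)
      obtain r where r: "r > 0" "\<And>e. norm e < r \<Longrightarrow> ye e \<in> D"
        using near_line[OF y k] unfolding ye_def by blast
      have ev: "\<forall>\<^sub>F e in at 0. ye e \<in> D"
        using eventually_line[OF y k] by (simp add: ye_def eventually_nhds_conv_at)
      \<comment> \<open>Tube lemma: continuity on a disc times the compact interval yields a
        \<open>\<delta>\<close> that serves all \<open>s\<close>.\<close>
      have null_diff: "\<exists>\<delta>>0. \<delta> \<le> r \<and> (\<forall>e. norm e < \<delta> \<longrightarrow> (\<forall>s\<in>{0..1}. norm (F (seg (ye e) s) - F (seg y s)) \<le> \<eta>))"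
        if F: "continuous_on D F" and \<eta>: "\<eta> > 0" for F :: "_ \<Rightarrow> complex" and \<eta>
      proof -
        have "0 \<in> ball (0::complex) r" using r(1) by simp
        have "continuous_on (ball 0 r \<times> {0..1}) (\<lambda>p. F (seg (ye (fst p)) (snd p)))"
          by (rule continuous_on_compose2[OF F cseg])
            (use r segD in \<open>auto simp: ye_def intro!: continuous_intros continuous_on_coordinatewise_then_product\<close>)
        from this compact_Icc \<open>0 \<in> ball 0 r\<close> \<eta>
        obtain N where N: "(0::complex) \<in> N" "open N" "\<forall>e\<in>N \<inter> ball 0 r. \<forall>s\<in>{0..1}.
            dist (F (seg (ye (fst (e, s))) (snd (e, s)))) (F (seg (ye (fst (0::complex, s))) (snd (0::complex, s)))) \<le> \<eta>"
          by (rule continuous_on_prod_compactE)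
        obtain \<delta> where \<delta>: "\<delta> > 0" "ball 0 \<delta> \<subseteq> N" using N(1,2) openE by blast
        have "norm (F (seg (ye e) s) - F (seg y s)) \<le> \<eta>" if "norm e < min \<delta> r" "s \<in> {0..1}" for e s
        proof -
          have "e \<in> N \<inter> ball 0 r" using that \<delta>(2) by auto
          then show ?thesis using N(3) that(2) by (auto simp: ye0 dist_norm)
        qed
        then show ?thesis using \<delta>(1) r(1) by (intro exI[of _ "min \<delta> r"]) auto
      qed
      have null_A: "uniformly_null (\<lambda>e s. A i a l (seg (ye e) s) - A i a l (seg y s))"
        if ial: "i \<in> I" "a < n" "l < n" for i a l
        unfolding uniformly_null_iff
      proof (intro allI impI)
        fix \<eta> :: real assume \<eta>: "\<eta> > 0"
        obtain \<delta> where "\<delta> > 0" "\<And>e s. norm e < \<delta> \<Longrightarrow> s \<in> {0..1} \<Longrightarrow>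
            norm (A i a l (seg (ye e) s) - A i a l (seg y s)) \<le> \<eta> / 2"
          using null_diff[OF c1_cont[OF A[OF ial]], of "\<eta> / 2"] \<eta> by auto
        then show "\<forall>\<^sub>F e in at 0. \<forall>s\<in>{0..1}. norm (A i a l (seg (ye e) s) - A i a l (seg y s)) < \<eta>"
          unfolding eventually_at using \<eta> by (intro exI[of _ \<delta>]) (force simp: dist_norm)
      qed
      define dd where "dd i a l s = (\<Sum>j\<in>I. k j * dA i a l j (seg y s))" for i a l s
      \<comment> \<open>Remainder of the first-order expansion of \<open>A i\<close> in
        \<open>e\<close>. The point at time \<open>s\<close> moves by \<open>e * s * k\<close>,
        which accounts for the factor \<open>s\<close>.\<close>
      define \<Delta> where "\<Delta> i a l e s = A i a l (seg (ye e) s) - A i a l (seg y s) - e * s * dd i a l s" for i a l e s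
      have null_\<Delta>: "uniformly_null (\<lambda>e s. \<Delta> i a l e s / e)" if ial: "i \<in> I" "a < n" "l < n" for i a l
        unfolding uniformly_null_iff
      proof (intro allI impI)
        fix \<eta> :: real assume \<eta>: "\<eta> > 0"
        have "continuous_on D (\<lambda>z. \<Sum>j\<in>I. k j * dA i a l j z)"
          by (intro continuous_intros c1_cont_grad[OF A[OF ial]])
        from null_diff[OF this, of "\<eta> / 2"] \<eta>
        obtain \<delta> where \<delta>: "\<delta> > 0" "\<delta> \<le> r" "\<And>e s. norm e < \<delta> \<Longrightarrow> s \<in> {0..1} \<Longrightarrow>
            norm ((\<Sum>j\<in>I. k j * dA i a l j (seg (ye e) s)) - dd i a l s) \<le> \<eta> / 2"
          by (auto simp: dd_def)
        have "norm (\<Delta> i a l e s / e) < \<eta>" if e: "norm e < \<delta>" "e \<noteq> 0" and s: "s \<in> {0..1}" for e s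
        proof -
          have seg_eq: "seg (ye e) s = (\<lambda>j. seg y s j + e * (s * k j))" for e
            by (auto simp: seg_def ye_def algebra_simps)
          have dirk: "direction (\<lambda>j. s * k j)" using k by (simp add: direction_def)
          have d: "((\<lambda>e. \<Delta> i a l e s) has_field_derivative
             s * ((\<Sum>j\<in>I. k j * dA i a l j (seg (ye e) s)) - dd i a l s)) (at e within ball 0 \<delta>)"
            if "e \<in> ball 0 \<delta>" for e
          proof -
            have "ye e \<in> D" using that \<delta> by (intro r(2)) auto
            then have "(\<lambda>j. seg y s j + e * (complex_of_real s * k j)) \<in> D"
              using segD[of "ye e" s] s by (simp add: seg_eq)
            then have d1: "((\<lambda>e. A i a l (seg (ye e) s)) has_field_derivative
              (\<Sum>j\<in>I. (s * k j) * dA i a l j (seg (ye e) s))) (at e)"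
              using c1_line[OF A[OF ial] _ dirk, of "seg y s" e] by (simp add: seg_eq)
            have "((\<lambda>e. A i a l (seg (ye e) s) - A i a l (seg y s) - e * s * dd i a l s) has_field_derivative
              (\<Sum>j\<in>I. (s * k j) * dA i a l j (seg (ye e) s)) - 0 - 1 * complex_of_real s * dd i a l s) (at e)"
              by (intro DERIV_diff DERIV_const d1 DERIV_cmult_right DERIV_ident)
            from has_field_derivative_at_within[OF this] show ?thesis
              by (simp add: \<Delta>_def sum_distrib_left ring_distribs mult.assoc)
          qed
          \<comment> \<open>Mean value inequality in \<open>e\<close>: the derivative of the
            remainder is \<open>s\<close> times a change of gradient, which \<open>null_diff\<close>
            makes small.\<close>
          have "norm (\<Delta> i a l e s - \<Delta> i a l 0 s) \<le> \<eta> / 2 * norm (e - 0)"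
          proof (rule field_differentiable_bound[OF convex_ball d])
            fix e' :: complex assume "e' \<in> ball 0 \<delta>"
            then have "norm (s * ((\<Sum>j\<in>I. k j * dA i a l j (seg (ye e') s)) - dd i a l s)) \<le> 1 * (\<eta> / 2)"
              unfolding norm_mult using s \<delta>(3)[of e' s] by (intro mult_mono) auto
            then show "norm (s * ((\<Sum>j\<in>I. k j * dA i a l j (seg (ye e') s)) - dd i a l s)) \<le> \<eta> / 2" by simp
          qed (use e \<delta> in auto)
          moreover have "\<Delta> i a l 0 s = 0" by (simp add: \<Delta>_def ye0)
          ultimately have "norm (\<Delta> i a l e s) \<le> \<eta> / 2 * norm e" by simp
          also have "\<dots> < \<eta> * norm e" using \<eta> e by simp
          finally show ?thesis using e by (simp add: norm_divide field_simps)
        qed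
        then show "\<forall>\<^sub>F e in at 0. \<forall>s\<in>{0..1}. norm (\<Delta> i a l e s / e) < \<eta>"
          unfolding eventually_at using \<delta>(1) by (intro exI[of _ \<delta>]) (auto simp: dist_norm)
      qed
      \<comment> \<open>\<open>\<Omega>\<close> is the connection in the direction \<open>k\<close>
        along the segment, \<open>\<Omega>'\<close> its derivative in \<open>s\<close>.
        \<open>s * \<Theta>\<close> will be the derivative of \<open>B\<close> caused by moving the
        points of the segment.\<close>
      define \<Omega> where "\<Omega> a l s = (\<Sum>i\<in>I. k i * A i a l (seg y s))" for a l s
      define \<Omega>' where "\<Omega>' a l s = (\<Sum>i\<in>I. k i * (\<Sum>j\<in>I. h j * dA i a l j (seg y s)))" for a l s
      define \<Theta> where "\<Theta> a l s = (\<Sum>i\<in>I. h i * dd i a l s)" for a l s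
      have By: "B y a l s = (\<Sum>i\<in>I. h i * A i a l (seg y s))" for a l s by (simp add: B_def h_def)
      \<comment> \<open>Passing from \<open>y\<close> to \<open>y + e k\<close> changes the
        direction of the segment by \<open>e k\<close>, which contributes
        \<open>e * \<Omega>\<close>, and its points by \<open>e * s * k\<close>, which contributes
        \<open>e * s * \<Theta>\<close>. What is left is \<open>o(e)\<close>.\<close>
      define \<rho> where "\<rho> e a l s = B (ye e) a l s - B y a l s - e * (\<Omega> a l s + s * \<Theta> a l s)" for e a l s
      have \<rho>_eq: "\<rho> e a l s = (\<Sum>i\<in>I. h i * \<Delta> i a l e s) + e * (\<Sum>i\<in>I. k i * (A i a l (seg (ye e) s) - A i a l (seg y s)))"
        for e a l s
      proof -
        have "B (ye e) a l s = (\<Sum>i\<in>I. h i * A i a l (seg (ye e) s)) + e * (\<Sum>i\<in>I. k i * A i a l (seg (ye e) s))"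
          by (simp add: B_def h_def ye_def sum_distrib_left sum.distrib[symmetric] algebra_simps)
        then show ?thesis
          by (simp add: \<rho>_def By \<Omega>_def \<Theta>_def \<Delta>_def sum_distrib_left sum_subtractf algebra_simps sum.distrib)
      qed
      have null_\<rho>: "uniformly_null (\<lambda>e s. \<rho> e a l s / e)" if "a < n" "l < n" for a l
      proof (rule uniformly_null_eventually_cong)
        show "uniformly_null (\<lambda>e s. (\<Sum>i\<in>I. h i * (\<Delta> i a l e s / e)) +
            (\<Sum>i\<in>I. k i * (A i a l (seg (ye e) s) - A i a l (seg y s))))"
          by (intro uniformly_null_add uniformly_null_sum uniformly_null_mult null_\<Delta> null_A
              continuous_on_const) (use that in auto)
        show "\<forall>\<^sub>F e in at 0. \<forall>s\<in>{0..1}. \<rho> e a l s / e = (\<Sum>i\<in>I. h i * (\<Delta> i a l e s / e)) +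
            (\<Sum>i\<in>I. k i * (A i a l (seg (ye e) s) - A i a l (seg y s)))"
          unfolding eventually_at
          by (intro exI[of _ 1]) (auto simp: \<rho>_eq add_divide_distrib sum_divide_distrib)
      qed
      have c_seg: "continuous_on {0..1} (seg y)"
        using cseg[of "{0..1}" "\<lambda>_. y" "\<lambda>s. s"] by auto
      have c_\<Omega>: "continuous_on {0..1} (\<Omega> a l)" if "a < n" "l < n" for a l
        unfolding \<Omega>_def using that y
        by (intro continuous_intros continuous_on_compose2[OF c1_cont[OF A] c_seg]) (auto intro: segD)
      have c_\<Theta>: "continuous_on {0..1} (\<Theta> a l)" if "a < n" "l < n" for a l
        unfolding \<Theta>_def dd_def using that y
        by (intro continuous_intros continuous_on_compose2[OF c1_cont_grad[OF A] c_seg]) (auto intro: segD)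
      have null_B: "uniformly_null (\<lambda>e s. B (ye e) a l s - B y a l s)" if "a < n" "l < n" for a l
      proof (rule uniformly_null_eventually_cong)
        show "uniformly_null (\<lambda>e s. e * (\<rho> e a l s / e) + e * (\<Omega> a l s + s * \<Theta> a l s))"
          by (intro uniformly_null_add uniformly_null_scale[OF null_\<rho>] uniformly_null_linear
              continuous_intros c_\<Omega> c_\<Theta>) (use that in auto)
        show "\<forall>\<^sub>F e in at 0. \<forall>s\<in>{0..1}. B (ye e) a l s - B y a l s =
            e * (\<rho> e a l s / e) + e * (\<Omega> a l s + s * \<Theta> a l s)"
          unfolding eventually_at by (intro exI[of _ 1]) (auto simp: \<rho>_def)
      qed
      have c_X: "continuous_on {0..1} (X y a b)" if "a < n" "b < n" for a b
        unfolding continuous_on_eq_continuous_within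
        using dX[OF y that] has_vector_derivative_continuous by blast
      define V where "V a b s = (\<Sum>m<n. \<Omega> a m s * X y m b s)" for a b s
      have c_V: "continuous_on {0..1} (V a b)" if "a < n" "b < n" for a b
        unfolding V_def using that by (intro continuous_intros c_\<Omega> c_X) auto
      \<comment> \<open>The defect of the approximate solution \<open>Z\<close> below in the
        transport equation at \<open>y + e k\<close>. Both terms are \<open>o(e)\<close>.\<close>
      define R where "R e a b s = - ((\<Sum>l<n. \<rho> e a l s * X y l b s) +
          e * s * (\<Sum>l<n. (B (ye e) a l s - B y a l s) * V l b s))" for e a b s
      have null_R: "uniformly_null (\<lambda>e s. R e a b s / e)" if "a < n" "b < n" for a b
      proof (rule uniformly_null_eventually_cong)
        show "uniformly_null (\<lambda>e s. (\<Sum>l<n. (- X y l b s) * (\<rho> e a l s / e)) +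
            (\<Sum>l<n. (- (s * V l b s)) * (B (ye e) a l s - B y a l s)))"
          by (intro uniformly_null_add uniformly_null_sum uniformly_null_mult null_\<rho> null_B
              continuous_intros c_X c_V) (use that in auto)
        show "\<forall>\<^sub>F e in at 0. \<forall>s\<in>{0..1}. R e a b s / e = (\<Sum>l<n. (- X y l b s) * (\<rho> e a l s / e)) +
            (\<Sum>l<n. (- (s * V l b s)) * (B (ye e) a l s - B y a l s))"
          unfolding eventually_at
          by (intro exI[of _ 1]) (auto simp: R_def add_divide_distrib diff_divide_distrib sum_divide_distrib sum_distrib_left
              sum_negf mult_ac)
      qed
      \<comment> \<open>Flatness contracted with the direction \<open>h\<close> of the segment and
        the direction \<open>k\<close> of the perturbation.\<close>
      have flat': "\<Theta> a b s + (\<Sum>l<n. B y a l s * \<Omega> l b s) = \<Omega>' a b s + (\<Sum>l<n. \<Omega> a l s * B y l b s)"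
        if "a < n" "b < n" "s \<in> {0..1}" for a b s
      proof -
        have 1: "\<Theta> a b s + (\<Sum>l<n. B y a l s * \<Omega> l b s) = (\<Sum>i\<in>I. \<Sum>j\<in>I. h i * k j *
            (dA i a b j (seg y s) + (\<Sum>l<n. A i a l (seg y s) * A j l b (seg y s))))"
        proof -
          have "(\<Sum>l<n. B y a l s * \<Omega> l b s) = (\<Sum>l<n. \<Sum>i\<in>I. \<Sum>j\<in>I. h i * k j * (A i a l (seg y s) * A j l b (seg y s)))"
            by (simp add: By \<Omega>_def sum_product mult_ac)
          also have "\<dots> = (\<Sum>i\<in>I. \<Sum>j\<in>I. \<Sum>l<n. h i * k j * (A i a l (seg y s) * A j l b (seg y s)))"
            by (subst sum.swap, subst sum.swap) (rule refl)
          finally show ?thesis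
            by (simp add: \<Theta>_def dd_def sum_distrib_left ring_distribs sum.distrib mult.assoc)
        qed
        have 2: "\<Omega>' a b s + (\<Sum>l<n. \<Omega> a l s * B y l b s) = (\<Sum>j\<in>I. \<Sum>i\<in>I. h i * k j *
            (dA j a b i (seg y s) + (\<Sum>l<n. A j a l (seg y s) * A i l b (seg y s))))"
        proof -
          have "(\<Sum>l<n. \<Omega> a l s * B y l b s) = (\<Sum>l<n. \<Sum>j\<in>I. \<Sum>i\<in>I. h i * k j * (A j a l (seg y s) * A i l b (seg y s)))"
            by (simp add: By \<Omega>_def sum_product)
              (intro sum.cong refl, simp add: mult_ac)
          also have "\<dots> = (\<Sum>j\<in>I. \<Sum>i\<in>I. \<Sum>l<n. h i * k j * (A j a l (seg y s) * A i l b (seg y s)))"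
            by (subst sum.swap, subst sum.swap) (rule refl)
          finally show ?thesis
            by (simp add: \<Omega>'_def sum_distrib_left ring_distribs sum.distrib mult_ac)
        qed
        show ?thesis unfolding 1 2
          by (subst sum.swap) (intro sum.cong refl arg_cong2[of _ _ _ _ "(*)"] flat segD y that; simp)
      qed
      have d\<Omega>: "(\<Omega> a l has_vector_derivative \<Omega>' a l s) (at s within {0..1})"
        if "a < n" "l < n" "s \<in> {0..1}" for a l s
      proof -
        have seg_eq: "seg y s = (\<lambda>j. y0 j + complex_of_real s * h j)" for s
          by (auto simp: seg_def h_def)
        have "((\<lambda>s. A i a l (seg y s)) has_vector_derivative (\<Sum>j\<in>I. h j * dA i a l j (seg y s)))
            (at s within {0..1})" if "i \<in> I" for i
        proof -
          have "((\<lambda>e. A i a l (\<lambda>j. y0 j + e * h j)) has_field_derivative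
             (\<Sum>j\<in>I. h j * dA i a l j (\<lambda>j. y0 j + of_real s * h j))) (at (of_real s))"
            by (rule c1_line[OF A _ h])
              (use \<open>i \<in> I\<close> \<open>a < n\<close> \<open>l < n\<close> \<open>s \<in> {0..1}\<close> segD[OF y, of s] in \<open>auto simp: seg_eq\<close>)
          from has_vector_derivative_real_field[OF this] show ?thesis by (simp add: seg_eq)
        qed
        then show ?thesis unfolding \<Omega>_def \<Omega>'_def
          by (intro has_vector_derivative_sum has_vector_derivative_mult_right)
      qed
      define V' where "V' a b s = (\<Sum>m<n. \<Omega> a m s * (\<Sum>l<n. B y m l s * X y l b s) + \<Omega>' a m s * X y m b s)" for a b s
      have dV: "(V a b has_vector_derivative V' a b s) (at s within {0..1})"
        if "a < n" "b < n" "s \<in> {0..1}" for a b s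
        unfolding V_def V'_def
        by (intro has_vector_derivative_sum has_vector_derivative_mult d\<Omega> dX[OF y]) (use that in auto)
      \<comment> \<open>The derivative of \<open>V = \<Omega> X\<close> in the form that flatness
        gives it. This cancels all terms of first order in \<open>e\<close> from the equation for
        \<open>Z\<close>.\<close>
      have V'_eq: "V' a b s = (\<Sum>l<n. \<Theta> a l s * X y l b s) + (\<Sum>l<n. B y a l s * V l b s)"
        if "a < n" "b < n" "s \<in> {0..1}" for a b s
      proof -
        have "(\<Sum>l<n. \<Theta> a l s * X y l b s) + (\<Sum>l<n. B y a l s * V l b s)
          = (\<Sum>l<n. (\<Theta> a l s + (\<Sum>m<n. B y a m s * \<Omega> m l s)) * X y l b s)"
          unfolding V_def sum_distrib_left
          by (subst sum.swap) (simp add: sum.distrib[symmetric] ring_distribs sum_distrib_right mult.assoc)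
        also have "\<dots> = (\<Sum>l<n. (\<Omega>' a l s + (\<Sum>m<n. \<Omega> a m s * B y m l s)) * X y l b s)"
          using that flat' by (intro sum.cong) auto
        also have "\<dots> = V' a b s"
        proof -
          have "(\<Sum>m<n. \<Omega> a m s * (\<Sum>l<n. B y m l s * X y l b s)) = (\<Sum>l<n. (\<Sum>m<n. \<Omega> a m s * B y m l s) * X y l b s)"
            unfolding sum_distrib_left sum_distrib_right by (subst sum.swap) (simp add: mult.assoc)
          then show ?thesis by (simp add: V'_def sum.distrib ring_distribs)
        qed
        finally show ?thesis by simp
      qed
      \<comment> \<open>First-order guess for the transport to \<open>y + e k\<close>: the factor
        \<open>s\<close> makes it start at the identity, and at \<open>s = 1\<close> it is
        \<open>X + e * \<Omega> X\<close>, which exhibits the derivative.\<close>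
      define Z where "Z e a b s = X y a b s + e * (s * V a b s)" for e a b s
      have dZ: "(Z e a b has_vector_derivative (\<Sum>l<n. B (ye e) a l s * Z e l b s) + R e a b s) (at s within {0..1})"
        if "a < n" "b < n" "s \<in> {0..1}" for e a b s
      proof -
        have "(Z e a b has_vector_derivative
            (\<Sum>l<n. B y a l s * X y l b s) + e * (s * V' a b s + 1 * V a b s)) (at s within {0..1})"
          unfolding Z_def
          by (intro has_vector_derivative_add has_vector_derivative_mult_right has_vector_derivative_mult dX[OF y] dV
              has_vector_derivative_of_real[OF DERIV_ident, unfolded of_real_1]) (use that in auto)
        moreover have "(\<Sum>l<n. B (ye e) a l s * Z e l b s) + R e a b s
          = (\<Sum>l<n. B y a l s * X y l b s) + e * (s * V' a b s + 1 * V a b s)"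
        proof -
          have "B (ye e) a l s = \<rho> e a l s + B y a l s + e * (\<Omega> a l s + s * \<Theta> a l s)" for l
            by (simp add: \<rho>_def)
          then have e1: "(\<Sum>l<n. B (ye e) a l s * X y l b s) = (\<Sum>l<n. \<rho> e a l s * X y l b s) + (\<Sum>l<n. B y a l s * X y l b s)
              + e * (V a b s + s * (\<Sum>l<n. \<Theta> a l s * X y l b s))"
            by (simp add: V_def sum.distrib sum_distrib_left ring_distribs mult.assoc)
          have e2: "(\<Sum>l<n. B (ye e) a l s * Z e l b s) = (\<Sum>l<n. B (ye e) a l s * X y l b s) + e * s * (\<Sum>l<n. B (ye e) a l s * V l b s)"
            by (simp add: Z_def sum.distrib sum_distrib_left ring_distribs mult_ac)
          have e3: "(\<Sum>l<n. (B (ye e) a l s - B y a l s) * V l b s) = (\<Sum>l<n. B (ye e) a l s * V l b s) - (\<Sum>l<n. B y a l s * V l b s)"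
            by (simp add: sum_subtractf ring_distribs)
          show ?thesis unfolding R_def V'_eq[OF that] e2 e1 e3 by (simp add: ring_distribs)
        qed
        ultimately show ?thesis by simp
      qed
      obtain M where M: "M \<ge> 0" "\<And>i j s. i < n \<Longrightarrow> j < n \<Longrightarrow> s \<in> {0..1} \<Longrightarrow> norm (B y i j s) \<le> M"
        using BM[OF y] by blast
      define c where "c = exp (real n * (M + 1))"
      have "\<forall>\<^sub>F e in at 0. \<forall>i\<in>{..<n}. \<forall>j\<in>{..<n}. \<forall>s\<in>{0..1}. norm (B (ye e) i j s - B y i j s) < 1"
        unfolding eventually_ball_finite_distrib[OF finite_lessThan]
        using null_B unfolding uniformly_null_iff by auto
      then have evM: "\<forall>\<^sub>F e in at 0. \<forall>i\<in>{..<n}. \<forall>j\<in>{..<n}. \<forall>s\<in>{0..1}. norm (B (ye e) i j s) \<le> M + 1"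
      proof eventually_elim
        case (elim e)
        show ?case
        proof (intro ballI)
          fix i j s assume "i \<in> {..<n}" "j \<in> {..<n}" "s \<in> {0..1::real}"
          then have "norm (B (ye e) i j s - B y i j s) < 1" "norm (B y i j s) \<le> M" using elim M by auto
          then show "norm (B (ye e) i j s) \<le> M + 1"
            using norm_triangle_ineq[of "B (ye e) i j s - B y i j s" "B y i j s"] by simp
        qed
      qed
      have "((\<lambda>e. (X (ye e) a b 1 - X y a b 1) / e) \<longlongrightarrow> V a b 1) (at 0)"
      proof (rule tendstoI)
        fix \<eta> :: real assume \<eta>: "\<eta> > 0"
        define C where "C = (real n * c)\<^sup>2 + 1"
        have C: "C > 0" by (simp add: C_def add_nonneg_pos)
        have "\<forall>\<^sub>F e in at 0. \<forall>i\<in>{..<n}. \<forall>j\<in>{..<n}. \<forall>s\<in>{0..1}. norm (R e i j s / e) < \<eta> / C"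
          unfolding eventually_ball_finite_distrib[OF finite_lessThan]
          using null_R \<eta> C unfolding uniformly_null_iff by auto
        moreover have "\<forall>\<^sub>F e in at (0::complex). e \<noteq> 0" by (simp add: eventually_at_filter)
        ultimately show "\<forall>\<^sub>F e in at 0. dist ((X (ye e) a b 1 - X y a b 1) / e) (V a b 1) < \<eta>"
          using evM ev
        proof eventually_elim
          case (elim e)
          have bR: "norm (R e i j s) \<le> \<eta> / C * norm e" if "i < n" "j < n" "s \<in> {0..1}" for i j s
          proof -
            have "norm (R e i j s / e) < \<eta> / C" using elim(1) that by blast
            then show ?thesis using elim(2) by (simp add: norm_divide field_simps)
          qed
          have M': "norm (B (ye e) i j s) \<le> M + 1" if "i < n" "j < n" "s \<in> {0..1}" for i j s
            using elim(3) that by blast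
          have "norm (Z e a b 1 - X (ye e) a b 1) \<le> (real n * c)\<^sup>2 * (\<eta> / C * norm e)"
          proof (rule linear_ode_compare[where B = "B (ye e)" and X = "X (ye e)" and W = "W (ye e)" and Z = "Z e"
                and R = "R e"])
            show "Z e i j 0 = (if i = j then 1 else 0)" if "i < n" "j < n" for i j
              using X0[OF y that] by (simp add: Z_def)
          qed (use dX dW X0 W0 elim(4) ab dZ bR M(1) bX[OF elim(4) _ _ _ M'] bW[OF elim(4) _ _ _ M'] in \<open>auto simp: c_def\<close>)
          also have "\<dots> = (C - 1) * (\<eta> / C * norm e)" by (simp add: C_def)
          also have "\<dots> < C * (\<eta> / C * norm e)"
            using C \<eta> elim(2) by (intro mult_strict_right_mono) auto
          also have "\<dots> = \<eta> * norm e" using C by simp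
          finally have "norm (X (ye e) a b 1 - X y a b 1 - e * V a b 1) < \<eta> * norm e"
            by (simp add: Z_def norm_minus_commute algebra_simps)
          moreover have "X (ye e) a b 1 - X y a b 1 - e * V a b 1 = e * ((X (ye e) a b 1 - X y a b 1) / e - V a b 1)"
            using elim(2) by (simp add: field_simps)
          ultimately show ?case using elim(2) by (simp add: norm_mult dist_norm mult.commute)
        qed
      qed
      moreover have "V a b 1 = (\<Sum>i\<in>I. k i * (\<Sum>l<n. A i a l y * X y l b 1))"
      proof -
        have "seg y 1 = y" by (simp add: seg_def)
        then show ?thesis unfolding V_def \<Omega>_def sum_distrib_left sum_distrib_right
          by (subst sum.swap) (simp add: mult.assoc)
      qed
      ultimately show "((\<lambda>e. X (\<lambda>i. y i + e * k i) a b 1) has_field_derivative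
          (\<Sum>i\<in>I. k i * (\<Sum>l<n. A i a l y * X y l b 1))) (at 0)"
        unfolding has_field_derivative_iff by (simp add: ye_def)
    qed
  qed
qed

end

section \<open>Auxiliary linear problems of banded Lax systems\<close>

lemma sum_atMost_band:
  fixes f :: "nat \<Rightarrow> 'a::comm_monoid_add"
  assumes "\<And>m. f m \<noteq> 0 \<Longrightarrow> m \<le> k" "k \<le> K"
  shows "(\<Sum>m\<le>k. f m) = (\<Sum>m\<le>K. f m)"
  by (rule sum.mono_neutral_left) (use assms in auto)

text \<open>
  The auxiliary linear problem \<open>L f = 0\<close>, \<open>\<partial>\<^sub>i f = C\<^sub>i f\<close> of a Lax system of banded semi-infinite
  matrices. The equation \<open>L f = 0\<close> is imposed from row \<open>a\<close> on, where \<open>a\<close> is the lower bandwidth,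
  so that it is a recurrence with a solution space of dimension \<open>d + 1 = a + b\<close>.
\<close>

locale lax_system = coord_domain I D
  for I :: "'i set" and D :: "('i \<Rightarrow> complex) set" +
  fixes a b d hi lmax :: nat and lo :: "'i \<Rightarrow> nat"
    and L :: "nat \<Rightarrow> nat \<Rightarrow> ('i \<Rightarrow> complex) \<Rightarrow> complex"
    and C :: "'i \<Rightarrow> nat \<Rightarrow> nat \<Rightarrow> ('i \<Rightarrow> complex) \<Rightarrow> complex"
    and dC :: "'i \<Rightarrow> nat \<Rightarrow> nat \<Rightarrow> 'i \<Rightarrow> ('i \<Rightarrow> complex) \<Rightarrow> complex"
  assumes ab: "a + b = d + 1" and b_pos: "b \<ge> 1" and a_pos: "a \<ge> 1"
    and L_band: "\<And>n m y. y \<in> D \<Longrightarrow> L n m y \<noteq> 0 \<Longrightarrow> m \<le> n + b \<and> n \<le> m + a"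
    and L_upper: "\<And>n y. y \<in> D \<Longrightarrow> L n (n + b) y \<noteq> 0"
    and L_lower: "\<And>n y. y \<in> D \<Longrightarrow> L (n + a) n y \<noteq> 0"
    and C_band: "\<And>i n m y. i \<in> I \<Longrightarrow> y \<in> D \<Longrightarrow> C i n m y \<noteq> 0 \<Longrightarrow> m \<le> n + hi \<and> n \<le> m + lo i"
    and lo_le: "\<And>i. i \<in> I \<Longrightarrow> lo i \<le> lmax"
    and c1_L: "\<And>n m. c1 (L n m)
       (\<lambda>i y. (\<Sum>k\<le>n + hi. C i n k y * L k m y) - (\<Sum>k\<le>n + b. L n k y * C i k m y))"
    and c1_C: "\<And>i n m. i \<in> I \<Longrightarrow> c1 (C i n m) (dC i n m)"
    and flat: "\<And>i j n m y. i \<in> I \<Longrightarrow> j \<in> I \<Longrightarrow> y \<in> D \<Longrightarrow>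
       dC i n m j y + (\<Sum>k\<le>n + hi. C i n k y * C j k m y) = dC j n m i y + (\<Sum>k\<le>n + hi. C j n k y * C i k m y)"
begin

definition base :: nat where "base = 2 * lmax"

text \<open>
  The solutions of the recurrence that are unit vectors on the base window. The base is large
  enough for the differential equations to hold in all rows that the compatibility conditions
  at the base window involve.
\<close>

function cardinal_solution :: "nat \<Rightarrow> nat \<Rightarrow> ('i \<Rightarrow> complex) \<Rightarrow> complex" where
  "cardinal_solution m k y =
    (if m > base + d then - (\<Sum>l\<in>{m - d - 1..<m}. L (m - b) l y * cardinal_solution l k y) / L (m - b) m y
     else if m < base then - (\<Sum>l\<in>{m<..m + d + 1}. L (m + a) l y * cardinal_solution l k y) / L (m + a) m y
     else if k = m - base then 1 else 0)"
  by pat_completeness auto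
termination
  by (relation "Wellfounded.measure (\<lambda>(m, k, y). if m > base + d then m - (base + d) else base - m)") auto

declare cardinal_solution.simps [simp del]

abbreviation "E \<equiv> cardinal_solution"

lemma E_base: "j \<le> d \<Longrightarrow> E (base + j) k y = (if k = j then 1 else 0)"
  by (simp add: cardinal_solution.simps)

lemma sum_C_band:
  assumes "i \<in> I" "y \<in> D" "n + hi \<le> K"
  shows "(\<Sum>m\<le>n + hi. C i n m y * F m) = (\<Sum>m\<le>K. C i n m y * F m)"
  by (rule sum_atMost_band) (use C_band assms in auto)

lemma sum_L_band:
  assumes "y \<in> D" "n + b \<le> K"
  shows "(\<Sum>m\<le>n + b. L n m y * F m) = (\<Sum>m\<le>K. L n m y * F m)"
  by (rule sum_atMost_band) (use L_band assms in auto)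

text \<open>Row \<open>n + a\<close> sees exactly the entries \<open>n\<close> to
  \<open>n + d + 1\<close>, which is one window and the next entry on either side. Shifting the row
  by \<open>a\<close> keeps all indices nonnegative.\<close>

lemma sum_L_window:
  assumes "y \<in> D"
  shows "(\<Sum>m\<le>n + a + b. L (n + a) m y * F m) = (\<Sum>m\<in>{n..n + d + 1}. L (n + a) m y * F m)"
proof (rule sum.mono_neutral_right)
  show "\<forall>i\<in>{..n + a + b} - {n..n + d + 1}. L (n + a) i y * F i = 0"
  proof
    fix i assume i: "i \<in> {..n + a + b} - {n..n + d + 1}"
    have "L (n + a) i y = 0"
    proof (rule ccontr)
      assume "L (n + a) i y \<noteq> 0"
      from L_band[OF assms this] i ab show False by simp
    qed
    then show "L (n + a) i y * F i = 0" by simp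
  qed
qed (use ab in auto)

lemma E_rows:
  assumes y: "y \<in> D" and n: "n \<ge> a"
  shows "(\<Sum>m\<le>n + b. L n m y * E m k y) = 0"
proof -
  obtain s where s: "n = s + a" using n by (metis add.commute le_Suc_ex)
  have e: "(\<Sum>m\<le>n + b. L n m y * E m k y) = (\<Sum>m\<in>{s..s + d + 1}. L n m y * E m k y)"
    using sum_L_window[OF y, of s "\<lambda>m. E m k y"] s by simp
  have nb: "n + b = s + d + 1" using s ab by simp
  show ?thesis
  proof (cases "s \<ge> base")
    case True
    then have "E (n + b) k y = - (\<Sum>l\<in>{s..<n + b}. L n l y * E l k y) / L n (n + b) y"
    proof -
      have "n + b - d - 1 = s" "base + d < n + b" using nb True by auto
      then show ?thesis by (subst cardinal_solution.simps) simp
    qed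
    then have "L n (n + b) y * E (n + b) k y = - (\<Sum>l\<in>{s..<n + b}. L n l y * E l k y)"
      using L_upper[OF y, of n] by (simp add: field_simps)
    moreover have "{s..s + d + 1} = insert (n + b) {s..<n + b}" using nb by auto
    ultimately show ?thesis unfolding e by simp
  next
    case False
    then have "E s k y = - (\<Sum>l\<in>{s<..s + d + 1}. L n l y * E l k y) / L n s y"
      using s by (subst cardinal_solution.simps) auto
    then have "L n s y * E s k y = - (\<Sum>l\<in>{s<..s + d + 1}. L n l y * E l k y)"
      using L_lower[OF y, of s] s by (simp add: field_simps)
    moreover have "{s..s + d + 1} = insert s {s<..s + d + 1}" by auto
    ultimately show ?thesis unfolding e by simp
  qed
qed

text \<open>Upwards each row determines its last entry, as the upper outer diagonal does not vanish;
  downwards its first one, by the lower outer diagonal. Rows are given from \<open>l + a\<close> on,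
  so the descent stops at \<open>l\<close>.\<close>

lemma recurrence_zero:
  assumes y: "y \<in> D" and rows: "\<And>n. n \<ge> l \<Longrightarrow> (\<Sum>m\<le>n + a + b. L (n + a) m y * g m) = 0"
    and s: "s \<ge> l" and window: "\<And>j. j \<le> d \<Longrightarrow> g (s + j) = 0" and m: "m \<ge> l"
  shows "g m = 0"
proof -
  have rows': "(\<Sum>m\<in>{n..n + d + 1}. L (n + a) m y * g m) = 0" if "n \<ge> l" for n
    using rows[OF that] sum_L_window[OF y] by metis
  have up: "g m = 0" if "m \<ge> s" for m
    using that
  proof (induction m rule: less_induct)
    case (less m)
    show ?case
    proof (cases "m \<le> s + d")
      case True
      then show ?thesis using window[of "m - s"] less.prems by simp
    next
      case False
      define n where "n = m - d - 1"
      have nm: "m = n + d + 1" "n \<ge> s" using False by (auto simp: n_def)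
      have "(\<Sum>k\<in>{n..n + d + 1}. L (n + a) k y * g k) = (\<Sum>k\<in>{m}. L (n + a) k y * g k)"
        using nm less.IH by (intro sum.mono_neutral_right) auto
      then have "L (n + a) m y * g m = 0" using rows'[of n] nm s by simp
      moreover have "m = (n + a) + b" using nm ab by simp
      ultimately show ?thesis using L_upper[OF y, of "n + a"] by simp
    qed
  qed
  have down: "g m = 0" if "m \<le> s" "m \<ge> l" for m
    using that
  proof (induction "s - m" arbitrary: m rule: less_induct)
    case (less k)
    have *: "g m = 0" if "m > k" for m
      using less.hyps[of m] less.prems that up[of m] by (cases "m \<ge> s") auto
    have "(\<Sum>j\<in>{k..k + d + 1}. L (k + a) j y * g j) = (\<Sum>j\<in>{k}. L (k + a) j y * g j)"
      using * by (intro sum.mono_neutral_right) auto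
    then have "L (k + a) k y * g k = 0" using rows'[of k] less.prems by simp
    then show ?case using L_lower[OF y, of k] by simp
  qed
  show ?thesis using up down m by (cases "m \<ge> s") auto
qed

text \<open>Each step of the recurrence divides by an entry of an outer diagonal, which has no zero
  on \<open>D\<close>. Only existence of a gradient is obtained here; \<open>dE_eq\<close> evaluates
  it.\<close>

lemma c1_cardinal_solution: "\<exists>G. c1 (E m k) G"
proof -
  have up: "\<exists>G. c1 (E m k) G" if "m \<ge> base" for m
    using that
  proof (induction m rule: less_induct)
    case (less m)
    show ?case
    proof (cases "m \<le> base + d")
      case True
      then have "E m k = (\<lambda>y. if k = m - base then 1 else 0)"
        using less.prems by (simp add: fun_eq_iff cardinal_solution.simps)
      then show ?thesis using c1_const by metis
    next
      case False
      then have "\<forall>l\<in>{m - d - 1..<m}. \<exists>G. c1 (E l k) G" using less by auto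
      then obtain G where G: "\<And>l. l \<in> {m - d - 1..<m} \<Longrightarrow> c1 (E l k) (G l)" by metis
      have eq: "E m k = (\<lambda>y. (- (\<Sum>l\<in>{m - d - 1..<m}. L (m - b) l y * E l k y)) / L (m - b) m y)"
        using False by (simp add: fun_eq_iff cardinal_solution.simps[of m])
      have nz: "L (m - b) m y \<noteq> 0" if "y \<in> D" for y
        using L_upper[OF that, of "m - b"] False ab a_pos by simp
      show ?thesis unfolding eq
        by (rule exI, rule c1_divide[OF c1_minus[OF c1_sum[OF c1_mult[OF c1_L G]]] c1_L nz])
    qed
  qed
  have down: "\<exists>G. c1 (E m k) G" if "m < base" for m
    using that
  proof (induction "base - m" arbitrary: m rule: less_induct)
    case less
    have "\<forall>l\<in>{m<..m + d + 1}. \<exists>G. c1 (E l k) G"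
    proof
      fix l assume "l \<in> {m<..m + d + 1}"
      then show "\<exists>G. c1 (E l k) G" using less up[of l] by (cases "l < base") auto
    qed
    then obtain G where G: "\<And>l. l \<in> {m<..m + d + 1} \<Longrightarrow> c1 (E l k) (G l)" by metis
    have eq: "E m k = (\<lambda>y. (- (\<Sum>l\<in>{m<..m + d + 1}. L (m + a) l y * E l k y)) / L (m + a) m y)"
      using less.prems by (simp add: fun_eq_iff cardinal_solution.simps[of m])
    show ?case unfolding eq
      by (rule exI, rule c1_divide[OF c1_minus[OF c1_sum[OF c1_mult[OF c1_L G]]] c1_L L_lower])
  qed
  show ?thesis using up down by (cases "m \<ge> base") auto
qed

definition dE :: "nat \<Rightarrow> nat \<Rightarrow> 'i \<Rightarrow> ('i \<Rightarrow> complex) \<Rightarrow> complex" where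
  "dE m k = (SOME G. c1 (E m k) G)"

lemma c1_E: "c1 (E m k) (dE m k)"
  using c1_cardinal_solution unfolding dE_def by (rule someI_ex)

text \<open>A solution of the recurrence is a combination of the cardinal ones with its base window
  as coefficients. This is the matrix that sends those coefficients to the base window of
  \<open>C i f\<close>.\<close>

definition connection :: "'i \<Rightarrow> nat \<Rightarrow> nat \<Rightarrow> ('i \<Rightarrow> complex) \<Rightarrow> complex" where
  "connection i j k y = (\<Sum>m\<le>base + j + hi. C i (base + j) m y * E m k y)"

lemma dC_band:
  assumes "i \<in> I" "j \<in> I" "y \<in> D" "\<not> (m \<le> n + hi \<and> n \<le> m + lo i)"
  shows "dC i n m j y = 0"
proof -
  have "C i n m y = 0" if "y \<in> D" for y using C_band[OF assms(1) that] assms(4) by blast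
  then show ?thesis using c1_unique[OF c1_C[OF assms(1), of n m] c1_const[of 0] _ assms(3,2)] by simp
qed

text \<open>Differentiating \<open>L E = 0\<close> gives
  \<open>L (\<partial>E) = - [C, L] E = L (C E)\<close>, as long as \<open>C\<close> reaches only
  rows where \<open>L E = 0\<close>. Hence the defect \<open>g\<close> solves the recurrence; it
  vanishes on the base window, where \<open>E\<close> is constant, and so everywhere above
  \<open>lo i\<close>.\<close>

lemma dE_eq:
  assumes i: "i \<in> I" and y: "y \<in> D" and m: "m \<ge> lo i"
  shows "dE m k i y = (\<Sum>l\<le>m + hi. C i m l y * E l k y) - (\<Sum>l\<le>d. E m l y * connection i l k y)"
proof -
  define g where "g m = dE m k i y - (\<Sum>l\<le>m + hi. C i m l y * E l k y) + (\<Sum>l\<le>d. E m l y * connection i l k y)" for m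
  have "g m = 0"
  proof (rule recurrence_zero[OF y, where l = "lo i" and s = base])
    show "lo i \<le> base" using lo_le[OF i] by (simp add: base_def)
    show "lo i \<le> m" by (rule m)
    fix j assume j: "j \<le> d"
    have "dE (base + j) k i y = 0"
      by (rule c1_unique[OF c1_E c1_const[of "if k = j then 1 else 0"] _ y i])
        (simp add: E_base[OF j])
    moreover have "(\<Sum>l\<le>d. E (base + j) l y * connection i l k y) = connection i j k y"
      using j by (simp add: E_base if_distrib[of "\<lambda>x. x * _"] cong: if_cong)
    ultimately show "g (base + j) = 0" by (simp add: g_def connection_def)
  next
    fix r assume r: "lo i \<le> r"
    define n where "n = r + a"
    define K where "K = n + b + hi"
    have n: "n \<ge> lo i + a" using r by (simp add: n_def)
    have d0: "(\<Sum>m\<le>n + b. ((\<Sum>q\<le>n + hi. C i n q y * L q m y) - (\<Sum>q\<le>n + b. L n q y * C i q m y)) * E m k y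
        + L n m y * dE m k i y) = 0"
      by (rule c1_unique[OF c1_sum[OF c1_mult[OF c1_L c1_E]] c1_const[of 0] _ y i])
        (use E_rows n in auto)
    define dL where "dL m = (\<Sum>q\<le>n + hi. C i n q y * L q m y) - (\<Sum>q\<le>n + b. L n q y * C i q m y)" for m
    \<comment> \<open>Outside the band the commutator is zero as the derivative of an entry that
      vanishes identically. This permits extending the sum to \<open>K\<close>.\<close>
    have dL0: "dL m = 0" if "m > n + b" for m
    proof -
      have "L n m y = 0" if "y \<in> D" for y using L_band[OF that, of n m] \<open>m > n + b\<close> by fastforce
      then show ?thesis
        using c1_unique[OF c1_L[of n m] c1_const[of 0] _ y i] by (simp add: dL_def)
    qed
    have "(\<Sum>m\<le>n + b. L n m y * dE m k i y) = - (\<Sum>m\<le>n + b. dL m * E m k y)"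
      using d0 by (simp add: dL_def sum.distrib add_eq_0_iff)
    also have "(\<Sum>m\<le>n + b. dL m * E m k y) = (\<Sum>m\<le>K. dL m * E m k y)"
      by (rule sum_atMost_band) (use dL0 not_le in \<open>auto simp: K_def\<close>)
    also have "\<dots> = (\<Sum>q\<le>n + hi. C i n q y * (\<Sum>m\<le>K. L q m y * E m k y)) -
        (\<Sum>q\<le>n + b. L n q y * (\<Sum>m\<le>K. C i q m y * E m k y))"
    proof -
      have "(\<Sum>m\<le>K. dL m * E m k y) = (\<Sum>m\<le>K. \<Sum>q\<le>n + hi. C i n q y * (L q m y * E m k y)) -
          (\<Sum>m\<le>K. \<Sum>q\<le>n + b. L n q y * (C i q m y * E m k y))"
        by (simp add: dL_def left_diff_distrib sum_subtractf sum_distrib_right mult.assoc)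
      also have "\<dots> = (\<Sum>q\<le>n + hi. \<Sum>m\<le>K. C i n q y * (L q m y * E m k y)) -
          (\<Sum>q\<le>n + b. \<Sum>m\<le>K. L n q y * (C i q m y * E m k y))"
        by (rule arg_cong2[of _ _ _ _ "(-)"]) (rule sum.swap)+
      finally show ?thesis by (simp add: sum_distrib_left)
    qed
    also have "(\<Sum>q\<le>n + hi. C i n q y * (\<Sum>m\<le>K. L q m y * E m k y)) = 0"
    proof (rule sum.neutral, rule ballI)
      fix q assume q: "q \<in> {..n + hi}"
      show "C i n q y * (\<Sum>m\<le>K. L q m y * E m k y) = 0"
      proof (cases "C i n q y = 0")
        case False
        \<comment> \<open>Here \<open>n \<ge> lo i + a\<close> enters: \<open>C i\<close> does not
          reach back into the rows below \<open>a\<close>, where the recurrence is not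
          imposed.\<close>
        then have "q \<ge> a" using C_band[OF i y False] n by simp
        have "(\<Sum>m\<le>K. L q m y * E m k y) = (\<Sum>m\<le>q + b. L q m y * E m k y)"
          using q by (intro sum_L_band[OF y, symmetric]) (simp add: K_def)
        then show ?thesis using E_rows[OF y \<open>q \<ge> a\<close>] by simp
      qed simp
    qed
    also have "(\<Sum>q\<le>n + b. L n q y * (\<Sum>m\<le>K. C i q m y * E m k y)) =
        (\<Sum>q\<le>n + b. L n q y * (\<Sum>m\<le>q + hi. C i q m y * E m k y))"
      by (intro sum.cong refl arg_cong2[of _ _ _ _ "(*)"] sum_C_band[OF i y, symmetric]) (auto simp: K_def)
    finally have 1: "(\<Sum>m\<le>n + b. L n m y * dE m k i y) =
        (\<Sum>q\<le>n + b. L n q y * (\<Sum>m\<le>q + hi. C i q m y * E m k y))" by simp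
    have "(\<Sum>m\<le>n + b. L n m y * (\<Sum>l\<le>d. E m l y * connection i l k y)) =
        (\<Sum>l\<le>d. (\<Sum>m\<le>n + b. L n m y * E m l y) * connection i l k y)"
      unfolding sum_distrib_left sum_distrib_right by (subst sum.swap) (simp add: mult.assoc)
    also have "\<dots> = 0" using E_rows[OF y] n by simp
    finally show "(\<Sum>m\<le>r + a + b. L (r + a) m y * g m) = 0"
      using 1 by (simp add: g_def n_def[symmetric] ring_distribs sum.distrib sum_subtractf)
  qed
  then show ?thesis by (simp add: g_def algebra_simps)
qed

definition dconnection :: "'i \<Rightarrow> nat \<Rightarrow> nat \<Rightarrow> 'i \<Rightarrow> ('i \<Rightarrow> complex) \<Rightarrow> complex" where
  "dconnection i j k i' y = (\<Sum>m\<le>base + j + hi.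
     dC i (base + j) m i' y * E m k y + C i (base + j) m y * dE m k i' y)"

lemma c1_connection: "i \<in> I \<Longrightarrow> c1 (connection i j k) (dconnection i j k)"
  unfolding connection_def dconnection_def by (intro c1_sum c1_mult c1_C c1_E)

text \<open>On the base window the connection is \<open>C E\<close>. By \<open>dE_eq\<close> the
  product of connections completes \<open>\<partial>E\<close> to \<open>C E\<close>, so the
  expression becomes \<open>(\<partial>C + C C) E\<close>. Its antisymmetric part in the two
  directions is the curvature of \<open>C\<close>, whence \<open>connection_flat\<close>.\<close>

lemma connection_second_order:
  assumes i: "i \<in> I" and i': "i' \<in> I" and y: "y \<in> D" and K: "base + j + 2 * hi \<le> K"
  shows "dconnection i j k i' y + (\<Sum>l\<le>d. connection i j l y * connection i' l k y) =
    (\<Sum>m\<le>K. (dC i (base + j) m i' y + (\<Sum>q\<le>base + j + hi. C i (base + j) q y * C i' q m y)) * E m k y)"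
proof -
  define n where "n = base + j"
  \<comment> \<open>The reason for the factor \<open>2\<close> in \<open>base\<close>: after
    \<open>C i\<close> has lowered the row by at most \<open>lo i\<close>, the equation in the
    direction \<open>i'\<close> must still hold there.\<close>
  have n: "n \<ge> lo i + lo i'" using lo_le[OF i] lo_le[OF i'] by (simp add: n_def base_def)
  have "dconnection i j k i' y + (\<Sum>l\<le>d. connection i j l y * connection i' l k y)
    = (\<Sum>m\<le>n + hi. dC i n m i' y * E m k y) +
      (\<Sum>m\<le>n + hi. C i n m y * (dE m k i' y + (\<Sum>l\<le>d. E m l y * connection i' l k y)))"
  proof -
    have "(\<Sum>l\<le>d. connection i j l y * connection i' l k y) =
        (\<Sum>m\<le>n + hi. C i n m y * (\<Sum>l\<le>d. E m l y * connection i' l k y))"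
      unfolding connection_def[of i] n_def[symmetric] sum_distrib_left sum_distrib_right
      by (subst sum.swap) (simp add: mult.assoc)
    then show ?thesis
      by (simp add: dconnection_def n_def[symmetric] sum.distrib ring_distribs)
  qed
  also have "(\<Sum>m\<le>n + hi. dC i n m i' y * E m k y) = (\<Sum>m\<le>K. dC i n m i' y * E m k y)"
  proof (rule sum_atMost_band)
    show "m \<le> n + hi" if "dC i n m i' y * E m k y \<noteq> 0" for m
      using dC_band[OF i i' y, of m n] that by fastforce
  qed (use K in \<open>simp add: n_def\<close>)
  also have "(\<Sum>m\<le>n + hi. C i n m y * (dE m k i' y + (\<Sum>l\<le>d. E m l y * connection i' l k y)))
    = (\<Sum>q\<le>n + hi. C i n q y * (\<Sum>m\<le>K. C i' q m y * E m k y))"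
  proof (rule sum.cong[OF refl])
    fix q assume q: "q \<in> {..n + hi}"
    show "C i n q y * (dE q k i' y + (\<Sum>l\<le>d. E q l y * connection i' l k y)) =
        C i n q y * (\<Sum>m\<le>K. C i' q m y * E m k y)"
    proof (cases "C i n q y = 0")
      case False
      then have "q \<ge> lo i'" using C_band[OF i y False] n by simp
      then show ?thesis
        using dE_eq[OF i' y, of q k] sum_C_band[OF i' y, of q K "\<lambda>m. E m k y"] q K by (simp add: n_def)
    qed simp
  qed
  also have "\<dots> = (\<Sum>m\<le>K. (\<Sum>q\<le>n + hi. C i n q y * C i' q m y) * E m k y)"
    unfolding sum_distrib_left sum_distrib_right by (subst sum.swap) (simp add: mult.assoc)
  finally show ?thesis by (simp add: n_def sum.distrib ring_distribs)
qed

lemma connection_flat: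
  assumes i: "i \<in> I" and i': "i' \<in> I" and y: "y \<in> D"
  shows "dconnection i j k i' y + (\<Sum>l\<le>d. connection i j l y * connection i' l k y) =
    dconnection i' j k i y + (\<Sum>l\<le>d. connection i' j l y * connection i l k y)"
  unfolding connection_second_order[OF i i' y order_refl] connection_second_order[OF i' i y order_refl]
  using flat[OF i i' y] by simp

text \<open>With \<open>Y\<close> a fundamental solution of the connection, \<open>f = E Y\<close>
  works: the connection terms cancel in \<open>\<partial>f = (C E - E A) Y + E (A Y)\<close>, where
  \<open>A\<close> is the connection.\<close>

theorem lax_system_solution:
  assumes ne: "D \<noteq> {}"
    and convex: "\<And>y y' s. y \<in> D \<Longrightarrow> y' \<in> D \<Longrightarrow> s \<in> {0..1} \<Longrightarrow> (\<lambda>i. y i + of_real s * (y' i - y i)) \<in> D"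
  obtains f where
    "\<And>m k. continuous_on D (f m k)"
    "\<And>n k y. y \<in> D \<Longrightarrow> n \<ge> a \<Longrightarrow> (\<Sum>m\<le>n + b. L n m y * f m k y) = 0"
    "\<And>i n k y. i \<in> I \<Longrightarrow> y \<in> D \<Longrightarrow> n \<ge> lo i \<Longrightarrow> k \<le> d \<Longrightarrow>
       ((\<lambda>e. f n k (y(i := e))) has_field_derivative (\<Sum>m\<le>n + hi. C i n m y * f m k y)) (at (y i))"
    "\<And>s y c k. y \<in> D \<Longrightarrow> (\<And>j. j \<le> d \<Longrightarrow> (\<Sum>k\<le>d. f (s + j) k y * c k) = 0) \<Longrightarrow> k \<le> d \<Longrightarrow> c k = 0"
proof -
  have fl: "dconnection i j k i' y + (\<Sum>l<Suc d. connection i j l y * connection i' l k y) =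
    dconnection i' j k i y + (\<Sum>l<Suc d. connection i' j l y * connection i l k y)"
    if "i \<in> I" "i' \<in> I" "y \<in> D" for i i' j k y
    using connection_flat[OF that] by (simp add: lessThan_Suc_atMost)
  show thesis
  proof (rule flat_connection_fundamental_solution[where A = connection and n = "Suc d" and dA = dconnection, OF ne])
    show "(\<lambda>i. y i + of_real s * (y' i - y i)) \<in> D" if "y \<in> D" "y' \<in> D" "s \<in> {0..1}" for y y' s
      by (rule convex[OF that])
    show "c1 (connection i j k) (dconnection i j k)" if "i \<in> I" for i j k
      by (rule c1_connection[OF that])
    show "dconnection i j k i' y + (\<Sum>l<Suc d. connection i j l y * connection i' l k y) =
      dconnection i' j k i y + (\<Sum>l<Suc d. connection i' j l y * connection i l k y)"
      if "i \<in> I" "i' \<in> I" "y \<in> D" for i i' j k y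
      by (rule fl[OF that])
  next
    fix Y
    assume Y: "\<And>j k. j < Suc d \<Longrightarrow> k < Suc d \<Longrightarrow> c1 (Y j k) (\<lambda>i y. \<Sum>l<Suc d. connection i j l y * Y l k y)"
      "\<And>y c k. y \<in> D \<Longrightarrow> (\<And>j. j < Suc d \<Longrightarrow> (\<Sum>k<Suc d. Y j k y * c k) = 0) \<Longrightarrow> k < Suc d \<Longrightarrow> c k = 0"
    show thesis
  \<comment> \<open>\<open>Y\<close> is controlled only for columns up to \<open>d\<close>; the
    others are set to zero since continuity and the recurrence are claimed for all
    \<open>k\<close>.\<close>
  proof (rule that[of "\<lambda>n k y. if k \<le> d then \<Sum>l\<le>d. E n l y * Y l k y else 0"])
    show "continuous_on D (\<lambda>y. if k \<le> d then \<Sum>l\<le>d. E m l y * Y l k y else 0)" for m k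
      using c1_cont[OF c1_E] c1_cont[OF Y(1)] by (cases "k \<le> d") (auto intro!: continuous_intros)
  next
    fix n k y assume y: "y \<in> D" "n \<ge> a"
    have "(\<Sum>m\<le>n + b. L n m y * (\<Sum>l\<le>d. E m l y * Y l k y)) = (\<Sum>l\<le>d. (\<Sum>m\<le>n + b. L n m y * E m l y) * Y l k y)"
      unfolding sum_distrib_left sum_distrib_right by (subst sum.swap) (simp add: mult.assoc)
    then show "(\<Sum>m\<le>n + b. L n m y * (if k \<le> d then \<Sum>l\<le>d. E m l y * Y l k y else 0)) = 0"
      using E_rows[OF y] by (cases "k \<le> d") auto
  next
    fix i n k y assume i: "i \<in> I" and y: "y \<in> D" and n: "n \<ge> lo i" and k: "k \<le> d"
    have "c1 (\<lambda>y. \<Sum>l\<le>d. E n l y * Y l k y)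
      (\<lambda>i y. \<Sum>l\<le>d. dE n l i y * Y l k y + E n l y * (\<Sum>l'<Suc d. connection i l l' y * Y l' k y))"
      using k by (intro c1_sum c1_mult c1_E Y(1)) auto
    from c1_partial[OF this y i]
    have d: "((\<lambda>e. \<Sum>l\<le>d. E n l (y(i := e)) * Y l k (y(i := e))) has_field_derivative
      (\<Sum>l\<le>d. dE n l i y * Y l k y + E n l y * (\<Sum>l'\<le>d. connection i l l' y * Y l' k y))) (at (y i))"
      by (simp add: lessThan_Suc_atMost)
    have "(\<Sum>l\<le>d. E n l y * (\<Sum>l'\<le>d. connection i l l' y * Y l' k y)) =
        (\<Sum>l\<le>d. (\<Sum>l'\<le>d. E n l' y * connection i l' l y) * Y l k y)"
      unfolding sum_distrib_left sum_distrib_right by (subst sum.swap) (simp add: mult.assoc)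
    moreover have "(\<Sum>m\<le>n + hi. C i n m y * (\<Sum>l\<le>d. E m l y * Y l k y)) =
        (\<Sum>l\<le>d. (\<Sum>m\<le>n + hi. C i n m y * E m l y) * Y l k y)"
      unfolding sum_distrib_left sum_distrib_right by (subst sum.swap) (simp add: mult.assoc)
    ultimately have "(\<Sum>l\<le>d. dE n l i y * Y l k y + E n l y * (\<Sum>l'\<le>d. connection i l l' y * Y l' k y)) =
        (\<Sum>m\<le>n + hi. C i n m y * (\<Sum>l\<le>d. E m l y * Y l k y))"
      by (simp add: sum.distrib dE_eq[OF i y n] left_diff_distrib sum_subtractf)
    with d k show "((\<lambda>e. if k \<le> d then \<Sum>l\<le>d. E n l (y(i := e)) * Y l k (y(i := e)) else 0) has_field_derivative
       (\<Sum>m\<le>n + hi. C i n m y * (if k \<le> d then \<Sum>l\<le>d. E m l y * Y l k y else 0))) (at (y i))"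
      by simp
  next
    fix s y c k assume y: "y \<in> D" and k: "k \<le> d"
      and z: "\<And>j. j \<le> d \<Longrightarrow> (\<Sum>k\<le>d. (if k \<le> d then \<Sum>l\<le>d. E (s + j) l y * Y l k y else 0) * c k) = 0"
    \<comment> \<open>A combination \<open>g\<close> of solutions that vanishes on one window
      vanishes everywhere, in particular on the base window, where its entries are those of
      \<open>x = Y c\<close>.\<close>
    define x where "x l = (\<Sum>k\<le>d. Y l k y * c k)" for l
    define g where "g m = (\<Sum>l\<le>d. E m l y * x l)" for m
    have "g (s + j) = (\<Sum>k\<le>d. (\<Sum>l\<le>d. E (s + j) l y * Y l k y) * c k)" for j
      unfolding g_def x_def sum_distrib_left sum_distrib_right by (subst sum.swap) (simp add: mult.assoc)
    then have gz: "g (s + j) = 0" if "j \<le> d" for j using z[OF that] by simp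
    have rows: "(\<Sum>m\<le>n + a + b. L (n + a) m y * g m) = 0" for n
    proof -
      have "(\<Sum>m\<le>n + a + b. L (n + a) m y * g m) = (\<Sum>l\<le>d. (\<Sum>m\<le>n + a + b. L (n + a) m y * E m l y) * x l)"
        unfolding g_def sum_distrib_left sum_distrib_right by (subst sum.swap) (simp add: mult.assoc)
      then show ?thesis using E_rows[OF y, of "n + a"] by simp
    qed
    have "g m = 0" for m
      by (rule recurrence_zero[OF y rows, where l = 0 and s = s]) (use gz in auto)
    then have "x j = 0" if "j \<le> d" for j
      using \<open>\<And>m. g m = 0\<close>[of "base + j"] that
      by (simp add: g_def E_base if_distrib[of "\<lambda>x. x * _"] cong: if_cong)
    then show "c k = 0" using Y(2)[OF y, of c k] k by (simp add: x_def lessThan_Suc_atMost)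
  qed
  qed
qed

end

lemma eventually_sum_atMost_band:
  fixes f :: "nat \<Rightarrow> 'a::comm_monoid_add"
  assumes "\<And>m. f m \<noteq> 0 \<Longrightarrow> m \<le> k"
  shows "\<forall>\<^sub>F K in sequentially. (\<Sum>m\<le>K. f m) = (\<Sum>m\<le>k. f m)"
  using eventually_ge_at_top[of k]
  by eventually_elim (use sum_atMost_band[of f k] assms in auto)

text \<open>
  A Lax system for \<open>L = A - z\<close> with \<open>z\<close> a coordinate. The products of banded matrices are written
  as truncated sums, whose value is eventually constant.
\<close>

locale lax_data = coord_domain I D
  for I :: "'i set" and D :: "('i \<Rightarrow> complex) set" +
  fixes zc :: 'i and a b d w :: nat and lo up :: "'i \<Rightarrow> nat"
    and A :: "nat \<Rightarrow> nat \<Rightarrow> ('i \<Rightarrow> complex) \<Rightarrow> complex"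
    and dA :: "nat \<Rightarrow> nat \<Rightarrow> 'i \<Rightarrow> ('i \<Rightarrow> complex) \<Rightarrow> complex"
    and C :: "'i \<Rightarrow> nat \<Rightarrow> nat \<Rightarrow> ('i \<Rightarrow> complex) \<Rightarrow> complex"
    and dC :: "'i \<Rightarrow> nat \<Rightarrow> nat \<Rightarrow> 'i \<Rightarrow> ('i \<Rightarrow> complex) \<Rightarrow> complex"
  assumes zc: "zc \<in> I"
    and ab: "a + b = d + 1" and b_pos: "b \<ge> 1" and a_pos: "a \<ge> 1"
    and A_band: "\<And>n m y. y \<in> D \<Longrightarrow> A n m y \<noteq> 0 \<Longrightarrow> m \<le> n + b \<and> n \<le> m + a"
    and A_upper: "\<And>n y. y \<in> D \<Longrightarrow> A n (n + b) y \<noteq> 0"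
    and A_lower: "\<And>n y. y \<in> D \<Longrightarrow> A (n + a) n y \<noteq> 0"
    and C_band: "\<And>i n m y. i \<in> I \<Longrightarrow> y \<in> D \<Longrightarrow> C i n m y \<noteq> 0 \<Longrightarrow> m \<le> n + up i \<and> n \<le> m + lo i"
    and lo_le: "\<And>i. i \<in> I \<Longrightarrow> lo i \<le> w" and up_le: "\<And>i. i \<in> I \<Longrightarrow> up i \<le> w"
    and c1_A: "\<And>n m. c1 (A n m) (dA n m)"
    and dA: "\<And>i n m y. i \<in> I \<Longrightarrow> i \<noteq> zc \<Longrightarrow> y \<in> D \<Longrightarrow>
       \<forall>\<^sub>F K in sequentially. (\<Sum>k\<le>K. C i n k y * A k m y - A n k y * C i k m y) = dA n m i y"
    and dA_z: "\<And>n m y. y \<in> D \<Longrightarrow> dA n m zc y = 0"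
    and heisenberg: "\<And>n m y. y \<in> D \<Longrightarrow> \<forall>\<^sub>F K in sequentially.
       (\<Sum>k\<le>K. C zc n k y * A k m y - A n k y * C zc k m y) = - (if n = m then 1 else 0)"
    and c1_C: "\<And>i n m. i \<in> I \<Longrightarrow> c1 (C i n m) (dC i n m)"
    and flat: "\<And>i j n m y. i \<in> I \<Longrightarrow> j \<in> I \<Longrightarrow> y \<in> D \<Longrightarrow> \<forall>\<^sub>F K in sequentially.
       dC i n m j y + (\<Sum>k\<le>K. C i n k y * C j k m y - C j n k y * C i k m y) = dC j n m i y"
begin

text \<open>\<open>[C, A]\<close> transposes to the commutator of minus the transpose of
  \<open>C\<close> with the transpose of \<open>A\<close>, and curvature likewise changes only by
  sign and transposition. Upper and lower bandwidths trade places. This yields the dual linear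
  problem.\<close>

lemma transpose_lax_data:
  "lax_data I D zc b a d w up lo (\<lambda>n m. A m n) (\<lambda>n m. dA m n)
     (\<lambda>i n m y. - C i m n y) (\<lambda>i n m j y. - dC i m n j y)"
proof
  show "zc \<in> I" "b + a = d + 1" "a \<ge> 1" "b \<ge> 1" using zc ab b_pos a_pos by auto
  show "m \<le> n + a \<and> n \<le> m + b" if "y \<in> D" "A m n y \<noteq> 0" for n m y using A_band[OF that] by simp
  show "A (n + a) n y \<noteq> 0" "A n (n + b) y \<noteq> 0" if "y \<in> D" for n y
    using A_lower[OF that] A_upper[OF that] by auto
  show "m \<le> n + lo i \<and> n \<le> m + up i" if "i \<in> I" "y \<in> D" "- C i m n y \<noteq> 0" for i n m y
    using C_band[OF that(1,2), of m n] that(3) by simp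
  show "lo i \<le> w" "up i \<le> w" if "i \<in> I" for i using lo_le up_le that by auto
  show "c1 (A m n) (dA m n)" for n m by (rule c1_A)
  have tr: "(\<Sum>k\<le>K. - C i k n y * A m k y - A k n y * - C i m k y) = (\<Sum>k\<le>K. C i m k y * A k n y - A m k y * C i k n y)"
    for i m n y K by (intro sum.cong) (auto simp: algebra_simps)
  show "\<forall>\<^sub>F K in sequentially. (\<Sum>k\<le>K. - C i k n y * A m k y - A k n y * - C i m k y) = dA m n i y"
    if "i \<in> I" "i \<noteq> zc" "y \<in> D" for i n m y
    unfolding tr by (rule dA[OF that])
  show "dA m n zc y = 0" if "y \<in> D" for n m y by (rule dA_z[OF that])
  show "\<forall>\<^sub>F K in sequentially. (\<Sum>k\<le>K. - C zc k n y * A m k y - A k n y * - C zc m k y) = - (if n = m then 1 else 0)"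
    if "y \<in> D" for n m y
    unfolding tr using heisenberg[OF that, of m n] by (auto simp: eq_commute)
  show "c1 (\<lambda>y. - C i m n y) (\<lambda>j y. - dC i m n j y)" if "i \<in> I" for i n m
    by (rule c1_minus[OF c1_C[OF that]])
  show "\<forall>\<^sub>F K in sequentially. - dC i m n j y +
      (\<Sum>k\<le>K. - C i k n y * - C j m k y - - C j k n y * - C i m k y) = - dC j m n i y"
    if "i \<in> I" "j \<in> I" "y \<in> D" for i j n m y
    using flat[OF that, of m n]
  proof eventually_elim
    case (elim K)
    have "(\<Sum>k\<le>K. - C i k n y * - C j m k y - - C j k n y * - C i m k y) =
        - (\<Sum>k\<le>K. C i m k y * C j k n y - C j m k y * C i k n y)"
      unfolding sum_negf[symmetric] by (intro sum.cong) (auto simp: algebra_simps)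
    then show ?case unfolding elim[symmetric] by simp
  qed
qed

definition "L n m y = A n m y - (if n = m then y zc else 0)"

text \<open>The scalar \<open>y zc\<close> commutes with \<open>C\<close>, so
  \<open>[C, L] = [C, A]\<close>. In a deformation direction this is \<open>\<partial>A\<close>; in
  the spectral direction \<open>A\<close> is constant and \<open>heisenberg\<close> supplies the
  derivative \<open>-1\<close> of \<open>- y zc\<close>.\<close>

sublocale lax_system I D a b d w w lo L C dC
proof
  show "a + b = d + 1" "a \<ge> 1" "b \<ge> 1" using ab b_pos a_pos by auto
  show "m \<le> n + b \<and> n \<le> m + a" if "y \<in> D" "L n m y \<noteq> 0" for n m y
    using A_band[OF that(1), of n m] that(2) by (auto simp: L_def split: if_splits)
  show "L n (n + b) y \<noteq> 0" "L (n + a) n y \<noteq> 0" if "y \<in> D" for n y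
    using A_upper[OF that] A_lower[OF that] a_pos b_pos by (auto simp: L_def)
  show "m \<le> n + w \<and> n \<le> m + lo i" if "i \<in> I" "y \<in> D" "C i n m y \<noteq> 0" for i n m y
    using C_band[OF that] up_le[OF that(1)] by simp
  show "lo i \<le> w" if "i \<in> I" for i by (rule lo_le[OF that])
  show "c1 (C i n m) (dC i n m)" if "i \<in> I" for i n m by (rule c1_C[OF that])
  show "dC i n m j y + (\<Sum>k\<le>n + w. C i n k y * C j k m y) = dC j n m i y + (\<Sum>k\<le>n + w. C j n k y * C i k m y)"
    if ij: "i \<in> I" "j \<in> I" and y: "y \<in> D" for i j n m y
  proof -
    have 1: "\<forall>\<^sub>F K in sequentially. (\<Sum>k\<le>K. C i n k y * C j k m y) = (\<Sum>k\<le>n + w. C i n k y * C j k m y)"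
      if "i \<in> I" for i j
      by (rule eventually_sum_atMost_band) (use C_band[OF that y] up_le[OF that] in \<open>fastforce intro: order.trans\<close>)
    have "\<forall>\<^sub>F K in sequentially. dC i n m j y + ((\<Sum>k\<le>n + w. C i n k y * C j k m y) - (\<Sum>k\<le>n + w. C j n k y * C i k m y)) = dC j n m i y"
      using flat[OF ij y, of n m] 1[OF ij(1), of j] 1[OF ij(2), of i]
      by eventually_elim (simp add: sum_subtractf)
    then show ?thesis by (simp add: algebra_simps)
  qed
  show "c1 (L n m) (\<lambda>i y. (\<Sum>k\<le>n + w. C i n k y * L k m y) - (\<Sum>k\<le>n + b. L n k y * C i k m y))" for n m
  proof (rule c1_cong)
    show "c1 (\<lambda>y. A n m y - (if n = m then 1 else 0) * y zc)
        (\<lambda>i y. dA n m i y - (if n = m then 1 else 0) * (if i = zc then 1 else 0))"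
      by (intro c1_diff c1_A c1_cmult c1_coord zc)
    show "L n m y = A n m y - (if n = m then 1 else 0) * y zc" for y by (simp add: L_def)
    fix i y assume i: "i \<in> I" and y: "y \<in> D"
    have 1: "\<forall>\<^sub>F K in sequentially. (\<Sum>k\<le>K. C i n k y * L k m y) = (\<Sum>k\<le>n + w. C i n k y * L k m y)"
      by (rule eventually_sum_atMost_band) (use C_band[OF i y] up_le[OF i] in \<open>fastforce intro: order.trans\<close>)
    have 2: "\<forall>\<^sub>F K in sequentially. (\<Sum>k\<le>K. L n k y * C i k m y) = (\<Sum>k\<le>n + b. L n k y * C i k m y)"
      by (rule eventually_sum_atMost_band)
        (use A_band[OF y, of n] in \<open>fastforce simp: L_def split: if_splits\<close>)
    have 3: "\<forall>\<^sub>F K in sequentially. (\<Sum>k\<le>K. C i n k y * A k m y - A n k y * C i k m y) =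
        dA n m i y - (if n = m then 1 else 0) * (if i = zc then 1 else 0)"
      using dA[OF i _ y, of n m] heisenberg[OF y, of n m] dA_z[OF y, of n m] by (cases "i = zc") auto
    \<comment> \<open>The asserted equation does not contain \<open>K\<close>, so it is enough to
      verify it for one \<open>K\<close> at which all truncated sums have settled.\<close>
    have "\<forall>\<^sub>F K in sequentially. (\<Sum>k\<le>n + w. C i n k y * L k m y) - (\<Sum>k\<le>n + b. L n k y * C i k m y) =
        dA n m i y - (if n = m then 1 else 0) * (if i = zc then 1 else 0)"
      using 1 2 3 eventually_ge_at_top[of "max n m"]
    proof eventually_elim
      case (elim K)
      have "(\<Sum>k\<le>K. C i n k y * L k m y) - (\<Sum>k\<le>K. L n k y * C i k m y) =
          (\<Sum>k\<le>K. C i n k y * A k m y - A n k y * C i k m y) -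
          ((\<Sum>k\<le>K. C i n k y * (if k = m then y zc else 0)) - (\<Sum>k\<le>K. (if n = k then y zc else 0) * C i k m y))"
        by (simp add: L_def sum_subtractf ring_distribs)
      also have "(\<Sum>k\<le>K. C i n k y * (if k = m then y zc else 0)) = C i n m y * y zc"
        using elim(4) by (simp add: if_distrib[of "\<lambda>x. _ * x"] cong: if_cong)
      also have "(\<Sum>k\<le>K. (if n = k then y zc else 0) * C i k m y) = y zc * C i n m y"
        using elim(4) by (simp add: if_distrib[of "\<lambda>x. x * _"] cong: if_cong)
      finally show ?case using elim(1,2,3) by simp
    qed
    then show "(\<Sum>k\<le>n + w. C i n k y * L k m y) - (\<Sum>k\<le>n + b. L n k y * C i k m y) =
        dA n m i y - (if n = m then 1 else 0) * (if i = zc then 1 else 0)" by simp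
  qed
qed

theorem lax_data_solution:
  assumes ne: "D \<noteq> {}"
    and convex: "\<And>y y' s. y \<in> D \<Longrightarrow> y' \<in> D \<Longrightarrow> s \<in> {0..1} \<Longrightarrow> (\<lambda>i. y i + of_real s * (y' i - y i)) \<in> D"
  obtains f where
    "\<And>m k. continuous_on D (f m k)"
    "\<And>n k y. y \<in> D \<Longrightarrow> n \<ge> a \<Longrightarrow> (\<Sum>m\<le>n + b. A n m y * f m k y) = y zc * f n k y"
    "\<And>i n k y. i \<in> I \<Longrightarrow> y \<in> D \<Longrightarrow> n \<ge> lo i \<Longrightarrow> k \<le> d \<Longrightarrow>
       ((\<lambda>e. f n k (y(i := e))) has_field_derivative (\<Sum>m\<le>n + w. C i n m y * f m k y)) (at (y i))"
    "\<And>s y c k. y \<in> D \<Longrightarrow> (\<And>j. j \<le> d \<Longrightarrow> (\<Sum>k\<le>d. f (s + j) k y * c k) = 0) \<Longrightarrow> k \<le> d \<Longrightarrow> c k = 0"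
proof (rule lax_system_solution[OF ne convex], assumption+)
  fix f assume f: "\<And>m k. continuous_on D (f m k)"
    "\<And>n k y. y \<in> D \<Longrightarrow> n \<ge> a \<Longrightarrow> (\<Sum>m\<le>n + b. L n m y * f m k y) = 0"
    "\<And>i n k y. i \<in> I \<Longrightarrow> y \<in> D \<Longrightarrow> n \<ge> lo i \<Longrightarrow> k \<le> d \<Longrightarrow>
       ((\<lambda>e. f n k (y(i := e))) has_field_derivative (\<Sum>m\<le>n + w. C i n m y * f m k y)) (at (y i))"
    "\<And>s y c k. y \<in> D \<Longrightarrow> (\<And>j. j \<le> d \<Longrightarrow> (\<Sum>k\<le>d. f (s + j) k y * c k) = 0) \<Longrightarrow> k \<le> d \<Longrightarrow> c k = 0"
  have "(\<Sum>m\<le>n + b. A n m y * f m k y) = y zc * f n k y" if "y \<in> D" "n \<ge> a" for n k y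
  proof -
    have "(\<Sum>m\<le>n + b. (if n = m then y zc else 0) * f m k y) = y zc * f n k y"
      by (simp add: if_distrib[of "\<lambda>x. x * _"] cong: if_cong)
    then show ?thesis using f(2)[OF that, of k] by (simp add: L_def ring_distribs sum_subtractf)
  qed
  from f(1) this f(3,4) show thesis by (rule that)
qed

end

section \<open>Biorthogonal polynomials and their moments\<close>

text \<open>The bilinear pairing of \<open>f(x)\<close> with \<open>g(y)\<close> whose value on
  \<open>x^i\<close>, \<open>y^j\<close> is the moment \<open>\<mu> i j\<close>.\<close>

definition moment_form :: "(nat \<Rightarrow> nat \<Rightarrow> complex) \<Rightarrow> complex poly \<Rightarrow> complex poly \<Rightarrow> complex" where
  "moment_form \<mu> f g = (\<Sum>i\<le>degree f. \<Sum>j\<le>degree g. coeff f i * coeff g j * \<mu> i j)"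

lemma moment_form_swap: "moment_form \<mu> f g = moment_form (\<lambda>i j. \<mu> j i) g f"
  unfolding moment_form_def by (subst sum.swap) (simp add: mult_ac)

lemma moment_form_bound:
  assumes "degree f \<le> n" "degree g \<le> m"
  shows "moment_form \<mu> f g = (\<Sum>i\<le>n. \<Sum>j\<le>m. coeff f i * coeff g j * \<mu> i j)"
proof -
  have "(\<Sum>j\<le>degree g. coeff f i * coeff g j * \<mu> i j) = (\<Sum>j\<le>m. coeff f i * coeff g j * \<mu> i j)" for i
    by (rule sum_atMost_band) (use assms le_degree in auto)
  moreover have "(\<Sum>i\<le>degree f. \<Sum>j\<le>m. coeff f i * coeff g j * \<mu> i j) = (\<Sum>i\<le>n. \<Sum>j\<le>m. coeff f i * coeff g j * \<mu> i j)"
  proof (rule sum_atMost_band)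
    show "i \<le> degree f" if "(\<Sum>j\<le>m. coeff f i * coeff g j * \<mu> i j) \<noteq> 0" for i
      using that by (intro le_degree) auto
  qed (use assms in auto)
  ultimately show ?thesis by (simp add: moment_form_def)
qed

lemma moment_form_add_left: "moment_form \<mu> (f + f') g = moment_form \<mu> f g + moment_form \<mu> f' g"
proof -
  define n where "n = max (degree f) (degree f')"
  have "degree f \<le> n" "degree f' \<le> n" "degree (f + f') \<le> n"
    by (auto simp: n_def degree_add_le_max)
  then show ?thesis
    by (simp add: moment_form_bound[where n = n and m = "degree g"] sum.distrib ring_distribs)
qed

lemma moment_form_smult_left: "moment_form \<mu> (Polynomial.smult c f) g = c * moment_form \<mu> f g"
  by (simp add: moment_form_bound[where n = "degree f" and m = "degree g"] sum_distrib_left mult_ac)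

lemma moment_form_add_right: "moment_form \<mu> f (g + g') = moment_form \<mu> f g + moment_form \<mu> f g'"
  using moment_form_add_left[of "\<lambda>i j. \<mu> j i" g g' f] by (simp add: moment_form_swap[of \<mu>])

lemma moment_form_smult_right: "moment_form \<mu> f (Polynomial.smult c g) = c * moment_form \<mu> f g"
  using moment_form_smult_left[of "\<lambda>i j. \<mu> j i" c g f] by (simp add: moment_form_swap[of \<mu>])

lemma moment_form_zero_left [simp]: "moment_form \<mu> 0 g = 0"
  by (simp add: moment_form_def)

lemma moment_form_zero_right [simp]: "moment_form \<mu> f 0 = 0"
  by (simp add: moment_form_def)

lemma moment_form_minus_left: "moment_form \<mu> (- f) g = - moment_form \<mu> f g"
  using moment_form_smult_left[of \<mu> "-1" f g] by simp

lemma moment_form_diff_left: "moment_form \<mu> (f - f') g = moment_form \<mu> f g - moment_form \<mu> f' g"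
  using moment_form_add_left[of \<mu> f "- f'" g] by (simp add: moment_form_minus_left)

lemma moment_form_minus_right: "moment_form \<mu> f (- g) = - moment_form \<mu> f g"
  using moment_form_smult_right[of \<mu> f "-1" g] by simp

lemma moment_form_diff_right: "moment_form \<mu> f (g - g') = moment_form \<mu> f g - moment_form \<mu> f g'"
  using moment_form_add_right[of \<mu> f g "- g'"] by (simp add: moment_form_minus_right)

lemma moment_form_sum_left: "moment_form \<mu> (\<Sum>k\<in>A. f k) g = (\<Sum>k\<in>A. moment_form \<mu> (f k) g)"
  by (induction A rule: infinite_finite_induct) (auto simp: moment_form_add_left)

lemma moment_form_sum_right: "moment_form \<mu> f (\<Sum>k\<in>A. g k) = (\<Sum>k\<in>A. moment_form \<mu> f (g k))"
  by (induction A rule: infinite_finite_induct) (auto simp: moment_form_add_right)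

lemma moment_form_monom: "moment_form \<mu> (monom 1 i) (monom 1 j) = \<mu> i j"
proof -
  have "(\<Sum>j'\<le>j. coeff (monom 1 i) i' * coeff (monom 1 j) j' * \<mu> i' j') = (if i' = i then \<mu> i j else 0)" for i'
    by (simp add: coeff_monom if_distrib[of "\<lambda>x. _ * x"] if_distrib[of "\<lambda>x. x * _"] cong: if_cong)
  then show ?thesis
    by (simp add: moment_form_bound[where n = i and m = j] degree_monom_le)
qed

lemma moment_form_shift_left:
  "moment_form \<mu> (monom 1 p * f) g = moment_form (\<lambda>i j. \<mu> (i + p) j) f g"
proof -
  have "degree (monom 1 p * f) \<le> degree f + p"
    using degree_mult_le[of "monom 1 p" f] degree_monom_le[of "1::complex" p] by linarith
  then have "moment_form \<mu> (monom 1 p * f) g =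
      (\<Sum>i\<le>degree f + p. \<Sum>j\<le>degree g. coeff (monom 1 p * f) i * coeff g j * \<mu> i j)"
    by (rule moment_form_bound) simp
  also have "\<dots> = (\<Sum>i\<in>{p..degree f + p}. \<Sum>j\<le>degree g. coeff f (i - p) * coeff g j * \<mu> i j)"
    by (rule sum.mono_neutral_cong_right) (auto simp: coeff_monom_mult)
  also have "\<dots> = (\<Sum>i\<in>{0..degree f}. \<Sum>j\<le>degree g. coeff f i * coeff g j * \<mu> (i + p) j)"
    using sum.shift_bounds_cl_nat_ivl[of "\<lambda>i. \<Sum>j\<le>degree g. coeff f (i - p) * coeff g j * \<mu> i j" 0 p "degree f"]
    by simp
  finally show ?thesis by (simp add: moment_form_def atLeast0AtMost)
qed

lemma moment_form_shift:
  "moment_form \<mu> (monom 1 p * f) (monom 1 q * g) = moment_form (\<lambda>i j. \<mu> (i + p) (j + q)) f g"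
proof -
  have "moment_form \<mu> (monom 1 p * f) (monom 1 q * g) = moment_form (\<lambda>j i. \<mu> (i + p) j) (monom 1 q * g) f"
    using moment_form_shift_left[of \<mu> p f "monom 1 q * g"] moment_form_swap by metis
  also have "\<dots> = moment_form (\<lambda>j i. \<mu> (i + p) (j + q)) g f" by (rule moment_form_shift_left)
  also have "\<dots> = moment_form (\<lambda>i j. \<mu> (i + p) (j + q)) f g" by (rule moment_form_swap)
  finally show ?thesis .
qed

text \<open>Induction on the degree, removing the leading term; biorthogonality identifies the
  coefficient that was removed. Exchanging the arguments of the pairing gives the expansion in the
  dual family from the same lemma.\<close>

lemma biorthogonal_expansion:
  fixes B :: "complex poly \<Rightarrow> 'b \<Rightarrow> complex"
  assumes add: "\<And>f g r. B (f + g) r = B f r + B g r" and smult: "\<And>c f r. B (Polynomial.smult c f) r = c * B f r"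
    and orth: "\<And>k l. B (ps k) (ph l) = (if k = l then 1 else 0)"
    and deg: "\<And>k. degree (ps k) = k"  and nz: "\<And>k. ps k \<noteq> 0"
  shows "degree f \<le> n \<Longrightarrow> f = (\<Sum>k\<le>n. Polynomial.smult (B f (ph k)) (ps k))"
proof (induction n arbitrary: f)
  case 0
  obtain a where a: "f = [:a:]" using 0 degree_eq_zeroE by blast
  obtain c where c: "ps 0 = [:c:]" using deg[of 0] degree_eq_zeroE by blast
  have "c \<noteq> 0" using nz[of 0] c by auto
  then have e: "f = Polynomial.smult (a / c) (ps 0)" using a c by simp
  moreover have "B f (ph 0) = a / c" unfolding e smult orth by simp
  ultimately show ?case by simp
next
  case (Suc n)
  have c: "coeff (ps (Suc n)) (Suc n) \<noteq> 0" using nz[of "Suc n"] deg[of "Suc n"] leading_coeff_neq_0 by metis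
  define c where "c = coeff f (Suc n) / coeff (ps (Suc n)) (Suc n)"
  define f' where "f' = f + Polynomial.smult (- c) (ps (Suc n))"
  have "degree f' \<le> n"
  proof (rule degree_le, intro allI impI)
    fix i assume "n < i"
    then consider "i = Suc n" | "i > Suc n" by linarith
    then show "coeff f' i = 0"
    proof cases
      case 1 then show ?thesis using c by (simp add: f'_def c_def)
    next
      case 2 then show ?thesis using Suc.prems deg[of "Suc n"] by (simp add: f'_def coeff_eq_0)
    qed
  qed
  then have e: "f' = (\<Sum>k\<le>n. Polynomial.smult (B f' (ph k)) (ps k))" by (rule Suc.IH)
  have B': "B f' (ph k) = B f (ph k) - (if k = Suc n then c else 0)" for k
    unfolding f'_def add smult orth by simp
  have z: "B 0 r = 0" for r using smult[of 0 0 r] by simp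
  have Bs: "B (\<Sum>k\<in>S. g k) r = (\<Sum>k\<in>S. B (g k) r)" if "finite S" for S :: "nat set" and g r
    using that by induction (auto simp: add z)
  have "B f' (ph (Suc n)) = (\<Sum>k\<le>n. B (Polynomial.smult (B f' (ph k)) (ps k)) (ph (Suc n)))"
    by (subst e) (rule Bs, simp)
  then have "B f' (ph (Suc n)) = 0" by (simp add: smult orth)
  then have c': "B f (ph (Suc n)) = c" using B'[of "Suc n"] by simp
  have "f = f' + Polynomial.smult c (ps (Suc n))" by (simp add: f'_def)
  also have "f' = (\<Sum>k\<le>n. Polynomial.smult (B f (ph k)) (ps k))"
    by (subst e) (intro sum.cong, auto simp: B')
  finally show ?case using c' by simp
qed

section \<open>Differentiability with an unspecified gradient\<close>

context coord_domain
begin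

definition smooth :: "(('i \<Rightarrow> complex) \<Rightarrow> complex) \<Rightarrow> bool" where
  "smooth F \<longleftrightarrow> (\<exists>G. c1 F G)"

lemma smooth_const: "smooth (\<lambda>y. c)"
  unfolding smooth_def by (rule exI, rule c1_const)

lemma smooth_add: "smooth F \<Longrightarrow> smooth F' \<Longrightarrow> smooth (\<lambda>y. F y + F' y)"
  unfolding smooth_def by (elim exE, rule exI, erule (1) c1_add)

lemma smooth_diff: "smooth F \<Longrightarrow> smooth F' \<Longrightarrow> smooth (\<lambda>y. F y - F' y)"
  unfolding smooth_def by (elim exE, rule exI, erule (1) c1_diff)

lemma smooth_mult: "smooth F \<Longrightarrow> smooth F' \<Longrightarrow> smooth (\<lambda>y. F y * F' y)"
  unfolding smooth_def by (elim exE, rule exI, erule (1) c1_mult)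

lemma smooth_divide:
  assumes "smooth F" "smooth F'" "\<And>y. y \<in> D \<Longrightarrow> F' y \<noteq> 0" shows "smooth (\<lambda>y. F y / F' y)"
  using assms(1,2) unfolding smooth_def by (elim exE) (rule exI, erule (1) c1_divide, rule assms(3))

lemma smooth_cong:
  assumes "smooth F" "\<And>y. y \<in> D \<Longrightarrow> F' y = F y" shows "smooth F'"
  using assms(1) unfolding smooth_def by (elim exE) (rule exI, erule c1_cong, rule assms(2), assumption, rule refl)

lemma smooth_sum: "(\<And>k. k \<in> A \<Longrightarrow> smooth (F k)) \<Longrightarrow> smooth (\<lambda>y. \<Sum>k\<in>A. F k y)"
  by (induction A rule: infinite_finite_induct) (auto intro: smooth_const smooth_add)

text \<open>On \<open>D\<close> the choice is unique by \<open>c1_unique\<close>. For quantities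
  defined recursively the gradient is found afterwards, from the identities they satisfy.\<close>

definition grad :: "(('i \<Rightarrow> complex) \<Rightarrow> complex) \<Rightarrow> 'i \<Rightarrow> ('i \<Rightarrow> complex) \<Rightarrow> complex" where
  "grad F = (SOME G. c1 F G)"

lemma c1_grad: "smooth F \<Longrightarrow> c1 F (grad F)"
  unfolding smooth_def grad_def by (rule someI_ex[of "c1 F"])

lemma c1_imp_smooth: "c1 F G \<Longrightarrow> smooth F"
  by (auto simp: smooth_def)

end

section \<open>Deformation of the biorthogonal system\<close>

datatype dir = DU nat | DV nat | DZ

text \<open>Differentiating the weight in the direction \<open>i\<close> multiplies it by
  \<open>coupling i * x ^ shift_x i * y ^ shift_y i\<close>, as the potentials contain
  \<open>u\<^sub>K / K * x^K\<close> and \<open>v\<^sub>J / J * y^J\<close>. The spectral parameter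
  does not occur in the weight, hence \<open>coupling DZ = 0\<close>.\<close>

fun shift_x :: "dir \<Rightarrow> nat" where "shift_x (DU K) = K" | "shift_x _ = 0"
fun shift_y :: "dir \<Rightarrow> nat" where "shift_y (DV J) = J" | "shift_y _ = 0"
fun coupling :: "dir \<Rightarrow> complex" where
  "coupling (DU K) = - (1 / of_nat K)" | "coupling (DV J) = - (1 / of_nat J)" | "coupling DZ = 0"

text \<open>
  The coordinates \<open>DU K\<close>, \<open>DV J\<close>, \<open>DZ\<close> stand for \<open>u\<^sub>K\<close>, \<open>v\<^sub>J\<close> and the spectral parameter. All that is
  used of the integrals is how the moments depend on the parameters and the two linear relations
  among them that come from integration by parts.
\<close>

locale moment_deformation = coord_domain I D
  for I :: "dir set" and D :: "(dir \<Rightarrow> complex) set" +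
  fixes d1 d2 :: nat and \<mu> :: "nat \<Rightarrow> nat \<Rightarrow> (dir \<Rightarrow> complex) \<Rightarrow> complex"
    and \<pi> \<sigma> :: "nat \<Rightarrow> (dir \<Rightarrow> complex) \<Rightarrow> complex poly"
    and h rt :: "nat \<Rightarrow> (dir \<Rightarrow> complex) \<Rightarrow> complex"
  assumes d1: "d1 \<ge> 1" and d2: "d2 \<ge> 1"
    and I_def: "I = insert DZ (DU ` {1..d1 + 1} \<union> DV ` {1..d2 + 1})"
    and c1_\<mu>: "\<And>j k. c1 (\<mu> j k) (\<lambda>i y. coupling i * \<mu> (j + shift_x i) (k + shift_y i) y)"
    and monic_\<pi>: "\<And>y n. y \<in> D \<Longrightarrow> degree (\<pi> n y) = n \<and> lead_coeff (\<pi> n y) = 1"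
    and monic_\<sigma>: "\<And>y n. y \<in> D \<Longrightarrow> degree (\<sigma> n y) = n \<and> lead_coeff (\<sigma> n y) = 1"
    and biorth: "\<And>y n m. y \<in> D \<Longrightarrow> moment_form (\<lambda>i j. \<mu> i j y) (\<pi> n y) (\<sigma> m y) = (if n = m then h n y else 0)"
    and h_nz: "\<And>y n. y \<in> D \<Longrightarrow> h n y \<noteq> 0"
    and rt_sq: "\<And>y n. y \<in> D \<Longrightarrow> (rt n y)\<^sup>2 = h n y"
    and rt_cont: "\<And>n. continuous_on D (rt n)"
    and lead_u: "\<And>y. y \<in> D \<Longrightarrow> y (DU (d1 + 1)) \<noteq> 0"
    and lead_v: "\<And>y. y \<in> D \<Longrightarrow> y (DV (d2 + 1)) \<noteq> 0"
    and parts_x: "\<And>y j k. y \<in> D \<Longrightarrow>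
      of_nat j * \<mu> (j - 1) k y - (\<Sum>K=1..d1 + 1. y (DU K) * \<mu> (j + K - 1) k y) + \<mu> j (k + 1) y = 0"
    and parts_y: "\<And>y j k. y \<in> D \<Longrightarrow>
      of_nat k * \<mu> j (k - 1) y - (\<Sum>J=1..d2 + 1. y (DV J) * \<mu> j (k + J - 1) y) + \<mu> (j + 1) k y = 0"
begin

abbreviation "form y \<equiv> moment_form (\<lambda>i j. \<mu> i j y)"

lemma rt_nz: "y \<in> D \<Longrightarrow> rt n y \<noteq> 0"
  using rt_sq[of y n] h_nz[of y n] by auto

text \<open>Both families are divided by the same root \<open>rt n\<close>. This makes them
  biorthonormal with equal leading coefficients, the source of the halved diagonal in the
  deformation matrices.\<close>

definition ps :: "nat \<Rightarrow> (dir \<Rightarrow> complex) \<Rightarrow> complex poly" where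
  "ps n y = Polynomial.smult (1 / rt n y) (\<pi> n y)"

definition ph :: "nat \<Rightarrow> (dir \<Rightarrow> complex) \<Rightarrow> complex poly" where
  "ph n y = Polynomial.smult (1 / rt n y) (\<sigma> n y)"

lemma orth: "y \<in> D \<Longrightarrow> form y (ps n y) (ph m y) = (if n = m then 1 else 0)"
  using rt_nz[of y n] rt_sq[of y n]
  by (cases "n = m")
    (auto simp: ps_def ph_def moment_form_smult_left moment_form_smult_right biorth power2_eq_square)

lemma ps_coeff:
  assumes "y \<in> D"
  shows "degree (ps n y) = n" "degree (ph n y) = n" "coeff (ps n y) n = 1 / rt n y" "coeff (ph n y) n = 1 / rt n y"
    "ps n y \<noteq> 0" "ph n y \<noteq> 0"
  using rt_nz[OF assms, of n] monic_\<pi>[OF assms, of n] monic_\<sigma>[OF assms, of n]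
  by (auto simp: ps_def ph_def)

lemma expand_left:
  assumes "y \<in> D" "degree f \<le> n"
  shows "f = (\<Sum>k\<le>n. Polynomial.smult (form y f (ph k y)) (ps k y))"
  by (rule biorthogonal_expansion[where B = "form y" and ph = "\<lambda>k. ph k y" and ps = "\<lambda>k. ps k y"])
    (use assms orth ps_coeff in \<open>auto simp: moment_form_add_left moment_form_smult_left\<close>)

lemma expand_right:
  assumes "y \<in> D" "degree g \<le> n"
  shows "g = (\<Sum>k\<le>n. Polynomial.smult (form y (ps k y) g) (ph k y))"
  by (rule biorthogonal_expansion[where B = "\<lambda>g f. form y f g" and ph = "\<lambda>k. ps k y" and ps = "\<lambda>k. ph k y"])
    (use assms orth ps_coeff in \<open>auto simp: moment_form_add_right moment_form_smult_right\<close>)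

lemma form_left_zero:
  assumes "y \<in> D" "degree f < n" shows "form y f (ph n y) = 0"
proof -
  have "form y f (ph n y) = form y (\<Sum>k\<le>degree f. Polynomial.smult (form y f (ph k y)) (ps k y)) (ph n y)"
    using expand_left[OF assms(1) order_refl, of f] by simp
  also have "\<dots> = 0"
    using assms by (simp add: moment_form_sum_left moment_form_smult_left orth)
  finally show ?thesis .
qed

lemma form_right_zero:
  assumes "y \<in> D" "degree g < n" shows "form y (ps n y) g = 0"
proof -
  have "form y (ps n y) g = form y (ps n y) (\<Sum>k\<le>degree g. Polynomial.smult (form y (ps k y) g) (ph k y))"
    using expand_right[OF assms(1) order_refl, of g] by simp
  also have "\<dots> = 0"
    using assms by (simp add: moment_form_sum_right moment_form_smult_right orth)
  finally show ?thesis .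
qed

lemma form_left_lead:
  assumes "y \<in> D" "degree f \<le> n" shows "form y f (ph n y) = coeff f n * rt n y"
proof -
  have "coeff f n = coeff (\<Sum>k\<le>n. Polynomial.smult (form y f (ph k y)) (ps k y)) n"
    using expand_left[OF assms] by simp
  also have "\<dots> = (\<Sum>k\<le>n. form y f (ph k y) * coeff (ps k y) n)" by (simp add: coeff_sum)
  also have "\<dots> = (\<Sum>k\<in>{n}. form y f (ph k y) * coeff (ps k y) n)"
    by (rule sum.mono_neutral_right) (auto intro!: coeff_eq_0 simp: ps_coeff[OF assms(1)])
  finally show ?thesis using rt_nz[OF assms(1), of n] by (simp add: ps_coeff[OF assms(1)])
qed

lemma form_right_lead:
  assumes "y \<in> D" "degree g \<le> n" shows "form y (ps n y) g = coeff g n * rt n y"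
proof -
  have "coeff g n = coeff (\<Sum>k\<le>n. Polynomial.smult (form y (ps k y) g) (ph k y)) n"
    using expand_right[OF assms] by simp
  also have "\<dots> = (\<Sum>k\<le>n. form y (ps k y) g * coeff (ph k y) n)" by (simp add: coeff_sum)
  also have "\<dots> = (\<Sum>k\<in>{n}. form y (ps k y) g * coeff (ph k y) n)"
    by (rule sum.mono_neutral_right) (auto intro!: coeff_eq_0 simp: ps_coeff[OF assms(1)])
  finally show ?thesis using rt_nz[OF assms(1), of n] by (simp add: ps_coeff[OF assms(1)])
qed

text \<open>Gram--Schmidt expresses the coefficients rationally in the moments.\<close>

lemma gram_schmidt_left:
  assumes y: "y \<in> D"
  shows "\<pi> n y = monom 1 n - (\<Sum>m<n. Polynomial.smult (form y (monom 1 n) (\<sigma> m y) / h m y) (\<pi> m y))"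
proof (cases n)
  case 0
  obtain c where "\<pi> 0 y = [:c:]" using monic_\<pi>[OF y, of 0] degree_eq_zeroE by blast
  then show ?thesis using 0 monic_\<pi>[OF y, of 0] by (simp add: monom_0)
next
  case (Suc n')
  have "degree (monom 1 n - \<pi> n y) \<le> n'"
  proof (rule degree_le, intro allI impI)
    fix i assume "n' < i"
    then consider "i = n" | "i > n" using Suc by linarith
    then show "coeff (monom 1 n - \<pi> n y) i = 0"
      using monic_\<pi>[OF y, of n] by cases (auto simp: coeff_eq_0)
  qed
  from expand_left[OF y this]
  have "monom 1 n - \<pi> n y = (\<Sum>k\<le>n'. Polynomial.smult (form y (monom 1 n - \<pi> n y) (ph k y)) (ps k y))" .
  also have "\<dots> = (\<Sum>k<n. Polynomial.smult (form y (monom 1 n) (\<sigma> k y) / h k y) (\<pi> k y))"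
    unfolding Suc lessThan_Suc_atMost
    using rt_sq[OF y]
    by (intro sum.cong) (auto simp: ps_def ph_def moment_form_diff_left moment_form_smult_right biorth[OF y] Suc
        power2_eq_square field_simps)
  finally show ?thesis by (simp add: algebra_simps)
qed

lemma gram_schmidt_right:
  assumes y: "y \<in> D"
  shows "\<sigma> n y = monom 1 n - (\<Sum>m<n. Polynomial.smult (form y (\<pi> m y) (monom 1 n) / h m y) (\<sigma> m y))"
proof (cases n)
  case 0
  obtain c where "\<sigma> 0 y = [:c:]" using monic_\<sigma>[OF y, of 0] degree_eq_zeroE by blast
  then show ?thesis using 0 monic_\<sigma>[OF y, of 0] by (simp add: monom_0)
next
  case (Suc n')
  have "degree (monom 1 n - \<sigma> n y) \<le> n'"
  proof (rule degree_le, intro allI impI)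
    fix i assume "n' < i"
    then consider "i = n" | "i > n" using Suc by linarith
    then show "coeff (monom 1 n - \<sigma> n y) i = 0"
      using monic_\<sigma>[OF y, of n] by cases (auto simp: coeff_eq_0)
  qed
  from expand_right[OF y this]
  have "monom 1 n - \<sigma> n y = (\<Sum>k\<le>n'. Polynomial.smult (form y (ps k y) (monom 1 n - \<sigma> n y)) (ph k y))" .
  also have "\<dots> = (\<Sum>k<n. Polynomial.smult (form y (\<pi> k y) (monom 1 n) / h k y) (\<sigma> k y))"
    unfolding Suc lessThan_Suc_atMost
    using rt_sq[OF y]
    by (intro sum.cong) (auto simp: ps_def ph_def moment_form_diff_right moment_form_smult_left biorth[OF y] Suc
        power2_eq_square field_simps)
  finally show ?thesis by (simp add: algebra_simps)
qed

lemma smooth_\<mu>: "smooth (\<mu> j k)"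
  using c1_\<mu> by (rule c1_imp_smooth)

lemma smooth_form:
  assumes "\<And>i. i \<le> n \<Longrightarrow> smooth (\<lambda>y. coeff (f y) i)" "\<And>j. j \<le> m \<Longrightarrow> smooth (\<lambda>y. coeff (g y) j)"
    "\<And>y. y \<in> D \<Longrightarrow> degree (f y) \<le> n" "\<And>y. y \<in> D \<Longrightarrow> degree (g y) \<le> m"
  shows "smooth (\<lambda>y. form y (f y) (g y))"
proof (rule smooth_cong)
  show "smooth (\<lambda>y. \<Sum>i\<le>n. \<Sum>j\<le>m. coeff (f y) i * coeff (g y) j * \<mu> i j y)"
    by (intro smooth_sum smooth_mult smooth_\<mu> assms(1,2)) auto
qed (use assms moment_form_bound in auto)

text \<open>Strong induction along Gram-Schmidt: degree \<open>n\<close> is built from forms and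
  \<open>h\<close> of lower index, and then \<open>h n\<close> is the form of the two polynomials of
  degree \<open>n\<close>.\<close>

lemma smooth_coefficients:
  "(\<forall>k. smooth (\<lambda>y. coeff (\<pi> n y) k)) \<and> (\<forall>k. smooth (\<lambda>y. coeff (\<sigma> n y) k)) \<and> smooth (h n)"
proof (induction n rule: less_induct)
  case (less n)
  have deg: "degree (\<pi> m y) \<le> m" "degree (\<sigma> m y) \<le> m" if "y \<in> D" for m y
    using monic_\<pi>[OF that] monic_\<sigma>[OF that] by auto
  have p: "smooth (\<lambda>y. coeff (\<pi> n y) k)" for k
  proof (rule smooth_cong)
    show "smooth (\<lambda>y. (if k = n then 1 else 0) - (\<Sum>m<n. form y (monom 1 n) (\<sigma> m y) / h m y * coeff (\<pi> m y) k))"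
    proof -
      have "smooth (\<lambda>y. form y (monom 1 n) (\<sigma> m y))" if "m < n" for m
        using less[OF that] by (intro smooth_form[where n = n and m = m] smooth_const deg) (auto simp: degree_monom_le)
      then show ?thesis
        using less by (intro smooth_diff smooth_sum smooth_mult smooth_divide smooth_const h_nz) auto
    qed
    show "coeff (\<pi> n y) k = (if k = n then 1 else 0) - (\<Sum>m<n. form y (monom 1 n) (\<sigma> m y) / h m y * coeff (\<pi> m y) k)"
      if "y \<in> D" for y
      by (subst gram_schmidt_left[OF that]) (simp add: coeff_sum coeff_monom)
  qed
  have s: "smooth (\<lambda>y. coeff (\<sigma> n y) k)" for k
  proof (rule smooth_cong)
    show "smooth (\<lambda>y. (if k = n then 1 else 0) - (\<Sum>m<n. form y (\<pi> m y) (monom 1 n) / h m y * coeff (\<sigma> m y) k))"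
    proof -
      have "smooth (\<lambda>y. form y (\<pi> m y) (monom 1 n))" if "m < n" for m
        using less[OF that] by (intro smooth_form[where n = m and m = n] smooth_const deg) (auto simp: degree_monom_le)
      then show ?thesis
        using less by (intro smooth_diff smooth_sum smooth_mult smooth_divide smooth_const h_nz) auto
    qed
    show "coeff (\<sigma> n y) k = (if k = n then 1 else 0) - (\<Sum>m<n. form y (\<pi> m y) (monom 1 n) / h m y * coeff (\<sigma> m y) k)"
      if "y \<in> D" for y
      by (subst gram_schmidt_right[OF that]) (simp add: coeff_sum coeff_monom)
  qed
  have "smooth (h n)"
    by (rule smooth_cong[OF smooth_form[OF p s deg]]) (auto simp: biorth)
  with p s show ?case by blast
qed

lemma smooth_rt: "smooth (rt n)"
proof -
  obtain G where "c1 (h n) G" using smooth_coefficients[of n] by (auto simp: smooth_def)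
  from c1_imp_smooth[OF c1_sqrt[OF this rt_cont rt_sq h_nz]] show ?thesis .
qed

lemma smooth_ps: "smooth (\<lambda>y. coeff (ps n y) k)"
  and smooth_ph: "smooth (\<lambda>y. coeff (ph n y) k)"
  unfolding ps_def ph_def coeff_smult
  using smooth_coefficients[of n]
  by (intro smooth_mult smooth_divide smooth_const smooth_rt rt_nz; blast)+

end

section \<open>Lax matrices\<close>

lemma eq_diff_of_sum_zero:
  fixes u v x :: "'a::ab_group_add"
  assumes "u + v + x = 0" shows "v = - x - u"
  unfolding eq_diff_eq using assms by (simp add: eq_neg_iff_add_eq_0 ac_simps)

lemma eq_half_of_eq_diff:
  fixes u x :: "'a::field_char_0"
  assumes "u = - x - u" shows "u = - x / 2"
proof -
  have "2 * u = - x" using assms unfolding eq_diff_eq by simp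
  then have "2 * u / 2 = - x / 2" by (rule arg_cong)
  then show ?thesis by simp
qed

context moment_deformation
begin

text \<open>In the basis of biorthonormal polynomials this is the matrix product
  \<open>Q^p N^q\<close>, where \<open>Q = M 1 0\<close> is multiplication by \<open>x\<close> and
  \<open>N = M 0 1\<close> will be \<open>- P\<close>. It makes powers accessible without infinite
  matrix products.\<close>

definition M :: "nat \<Rightarrow> nat \<Rightarrow> nat \<Rightarrow> nat \<Rightarrow> (dir \<Rightarrow> complex) \<Rightarrow> complex" where
  "M p q n m y = form y (monom 1 p * ps n y) (monom 1 q * ph m y)"

lemma degree_shift: "degree (monom (1::complex) p * f) \<le> p + degree f"
  using degree_mult_le[of "monom 1 p" f] degree_monom_le[of "1::complex" p] by linarith

lemma M_one: "y \<in> D \<Longrightarrow> M 0 0 n m y = (if n = m then 1 else 0)"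
  by (simp add: M_def orth monom_0 one_pCons[symmetric])

lemma M_zero_left: "y \<in> D \<Longrightarrow> m > n + p \<Longrightarrow> M p 0 n m y = 0"
  unfolding M_def using degree_shift[of p "ps n y"] ps_coeff[of y n]
  by (auto simp: monom_0 one_pCons[symmetric] intro!: form_left_zero)

lemma M_zero_right: "y \<in> D \<Longrightarrow> n > m + q \<Longrightarrow> M 0 q n m y = 0"
  unfolding M_def using degree_shift[of q "ph m y"] ps_coeff[of y m]
  by (auto simp: monom_0 one_pCons[symmetric] intro!: form_right_zero)

text \<open>Expand \<open>x^p * ps n\<close> in the \<open>ps k\<close>; its degree is
  \<open>n + p\<close>, so the expansion is complete from \<open>K = n + p\<close> on.\<close>

lemma M_compose_left:
  assumes y: "y \<in> D" and K: "n + p \<le> K"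
  shows "(\<Sum>k\<le>K. M p 0 n k y * M r q k m y) = M (p + r) q n m y"
proof -
  have "monom 1 p * ps n y = (\<Sum>k\<le>K. Polynomial.smult (M p 0 n k y) (ps k y))"
    using expand_left[OF y, of "monom 1 p * ps n y" K] degree_shift[of p "ps n y"] K ps_coeff(1)[OF y, of n]
    by (simp add: M_def monom_0 one_pCons[symmetric])
  moreover have "monom 1 (p + r) * ps n y = monom 1 r * (monom 1 p * ps n y)"
    by (simp add: mult.assoc[symmetric] mult_monom add.commute)
  ultimately have "monom 1 (p + r) * ps n y = monom 1 r * (\<Sum>k\<le>K. Polynomial.smult (M p 0 n k y) (ps k y))"
    by simp
  also have "\<dots> = (\<Sum>k\<le>K. Polynomial.smult (M p 0 n k y) (monom 1 r * ps k y))"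
    by (simp add: sum_distrib_left)
  finally show ?thesis
    by (simp add: M_def[of "p + r"] moment_form_sum_left moment_form_smult_left M_def[of r])
qed

lemma M_compose_right:
  assumes y: "y \<in> D" and K: "m + r \<le> K"
  shows "(\<Sum>k\<le>K. M p q n k y * M 0 r k m y) = M p (q + r) n m y"
proof -
  have "monom 1 r * ph m y = (\<Sum>k\<le>K. Polynomial.smult (M 0 r k m y) (ph k y))"
    using expand_right[OF y, of "monom 1 r * ph m y" K] degree_shift[of r "ph m y"] K ps_coeff(2)[OF y, of m]
    by (simp add: M_def monom_0 one_pCons[symmetric])
  moreover have "monom 1 (q + r) * ph m y = monom 1 q * (monom 1 r * ph m y)"
    by (simp add: mult.assoc[symmetric] mult_monom)
  ultimately have "monom 1 (q + r) * ph m y = monom 1 q * (\<Sum>k\<le>K. Polynomial.smult (M 0 r k m y) (ph k y))"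
    by simp
  also have "\<dots> = (\<Sum>k\<le>K. Polynomial.smult (M 0 r k m y) (monom 1 q * ph k y))"
    by (simp add: sum_distrib_left)
  finally show ?thesis
    by (simp add: M_def[of p "q + r"] moment_form_sum_right moment_form_smult_right M_def[of p q] mult.commute)
qed

text \<open>The parameter derivatives of \<open>ps n\<close> and \<open>ph n\<close> are taken
  coefficientwise (\<open>S\<close>, \<open>T\<close>) and reassembled into the polynomials
  \<open>dps\<close>, \<open>dph\<close>; \<open>a\<close> and \<open>b\<close> are their
  coordinates in the two families. \<open>X i\<close> is the matrix by which the direction
  \<open>i\<close> acts on the weight, that is \<open>- Q^K / K\<close> or
  \<open>- N^J / J\<close>.\<close>

definition "S n k = grad (\<lambda>y. coeff (ps n y) k)"
definition "T n k = grad (\<lambda>y. coeff (ph n y) k)"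
definition "dps n i y = (\<Sum>k\<le>n. monom (S n k i y) k)"
definition "dph n i y = (\<Sum>k\<le>n. monom (T n k i y) k)"
definition "a i n k y = form y (dps n i y) (ph k y)"
definition "b i m k y = form y (ps k y) (dph m i y)"
definition "X i n m y = coupling i * M (shift_x i) (shift_y i) n m y"

lemma coeff_dps: "coeff (dps n i y) k = (if k \<le> n then S n k i y else 0)"
  by (simp add: dps_def coeff_sum coeff_monom if_distrib cong: if_cong)

lemma coeff_dph: "coeff (dph n i y) k = (if k \<le> n then T n k i y else 0)"
  by (simp add: dph_def coeff_sum coeff_monom if_distrib cong: if_cong)

lemma degree_dps: "degree (dps n i y) \<le> n" and degree_dph: "degree (dph n i y) \<le> n"
  by (auto intro!: degree_le simp: coeff_dps coeff_dph)

lemma c1_ps: "c1 (\<lambda>y. coeff (ps n y) k) (S n k)" and c1_ph: "c1 (\<lambda>y. coeff (ph n y) k) (T n k)"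
  unfolding S_def T_def by (intro c1_grad smooth_ps smooth_ph)+

lemma form_M_sum:
  assumes "degree f \<le> n" "degree g \<le> m"
  shows "form y (monom 1 p * f) (monom 1 q * g) =
    (\<Sum>k\<le>n. \<Sum>l\<le>m. coeff f k * coeff g l * \<mu> (k + p) (l + q) y)"
  unfolding moment_form_shift by (rule moment_form_bound[OF assms])

text \<open>The product rule: the derivative falls on \<open>ps\<close>, on \<open>ph\<close> or on
  the weight.\<close>

definition "dM p q n m i y =
  form y (monom 1 p * dps n i y) (monom 1 q * ph m y) + form y (monom 1 p * ps n y) (monom 1 q * dph m i y)
  + coupling i * M (p + shift_x i) (q + shift_y i) n m y"

lemma c1_M: "c1 (M p q n m) (dM p q n m)"
proof (rule c1_cong)
  show "c1 (\<lambda>y. \<Sum>k\<le>n. \<Sum>l\<le>m. (coeff (ps n y) k * coeff (ph m y) l) * \<mu> (k + p) (l + q) y)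
     (\<lambda>i y. \<Sum>k\<le>n. \<Sum>l\<le>m. (S n k i y * coeff (ph m y) l + coeff (ps n y) k * T m l i y) * \<mu> (k + p) (l + q) y
        + (coeff (ps n y) k * coeff (ph m y) l) * (coupling i * \<mu> (k + p + shift_x i) (l + q + shift_y i) y))"
    by (intro c1_sum c1_mult c1_ps c1_ph c1_\<mu>)
  show "M p q n m y = (\<Sum>k\<le>n. \<Sum>l\<le>m. (coeff (ps n y) k * coeff (ph m y) l) * \<mu> (k + p) (l + q) y)" if "y \<in> D" for y
    unfolding M_def by (rule form_M_sum) (simp_all add: ps_coeff[OF that])
  show "dM p q n m i y = (\<Sum>k\<le>n. \<Sum>l\<le>m. (S n k i y * coeff (ph m y) l + coeff (ps n y) k * T m l i y) * \<mu> (k + p) (l + q) y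
        + (coeff (ps n y) k * coeff (ph m y) l) * (coupling i * \<mu> (k + p + shift_x i) (l + q + shift_y i) y))"
    if "y \<in> D" for y i
  proof -
    have "form y (monom 1 p * dps n i y) (monom 1 q * ph m y) =
        (\<Sum>k\<le>n. \<Sum>l\<le>m. S n k i y * coeff (ph m y) l * \<mu> (k + p) (l + q) y)"
      by (subst form_M_sum[of _ n _ m]) (auto simp: ps_coeff[OF that] degree_dps coeff_dps)
    moreover have "form y (monom 1 p * ps n y) (monom 1 q * dph m i y) =
        (\<Sum>k\<le>n. \<Sum>l\<le>m. coeff (ps n y) k * T m l i y * \<mu> (k + p) (l + q) y)"
      by (subst form_M_sum[of _ n _ m]) (auto simp: ps_coeff[OF that] degree_dph coeff_dph)
    moreover have "M (p + shift_x i) (q + shift_y i) n m y =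
        (\<Sum>k\<le>n. \<Sum>l\<le>m. coeff (ps n y) k * coeff (ph m y) l * \<mu> (k + p + shift_x i) (l + q + shift_y i) y)"
      unfolding M_def by (subst form_M_sum[of _ n _ m]) (auto simp: ps_coeff[OF that] add.assoc)
    ultimately show ?thesis
      unfolding dM_def by (simp add: sum_distrib_left sum.distrib ring_distribs mult_ac)
  qed
qed

lemma a_zero: "y \<in> D \<Longrightarrow> k > n \<Longrightarrow> a i n k y = 0"
  unfolding a_def using degree_dps[of n i y] by (intro form_left_zero) auto

lemma b_zero: "y \<in> D \<Longrightarrow> k > n \<Longrightarrow> b i n k y = 0"
  unfolding b_def using degree_dph[of n i y] by (intro form_right_zero) auto

lemma dM_eq:
  assumes y: "y \<in> D" and K: "K \<ge> n" "K \<ge> m"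
  shows "dM p q n m i y = (\<Sum>k\<le>K. a i n k y * M p q k m y) + (\<Sum>k\<le>K. M p q n k y * b i m k y)
    + coupling i * M (p + shift_x i) (q + shift_y i) n m y"
proof -
  have 1: "dps n i y = (\<Sum>k\<le>K. Polynomial.smult (a i n k y) (ps k y))"
    unfolding a_def by (rule expand_left[OF y]) (use K degree_dps[of n i y] in simp)
  have 2: "dph m i y = (\<Sum>k\<le>K. Polynomial.smult (b i m k y) (ph k y))"
    unfolding b_def by (rule expand_right[OF y]) (use K degree_dph[of m i y] in simp)
  have "form y (monom 1 p * dps n i y) (monom 1 q * ph m y) = (\<Sum>k\<le>K. a i n k y * M p q k m y)"
    by (subst 1) (simp add: sum_distrib_left moment_form_sum_left moment_form_smult_left M_def)
  moreover have "form y (monom 1 p * ps n y) (monom 1 q * dph m i y) = (\<Sum>k\<le>K. M p q n k y * b i m k y)"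
    by (subst 2) (simp add: sum_distrib_left moment_form_sum_right moment_form_smult_right M_def mult.commute)
  ultimately show ?thesis by (simp add: dM_def)
qed

text \<open>Multiplying entrywise by these factors extracts the strictly upper part and half of the
  diagonal, as in the definition of \<open>deformation\<close>.\<close>

definition upper :: "nat \<Rightarrow> nat \<Rightarrow> complex" where
  "upper n m = (if n < m then 1 else if n = m then 1 / 2 else 0)"

definition "P i n m y = upper n m * X i n m y"

text \<open>The derivative of the biorthonormality relation, whose right-hand side is
  constant.\<close>

lemma a_plus_b: 
  assumes y: "y \<in> D" and i: "i \<in> I"
  shows "a i n m y + b i m n y + X i n m y = 0"
proof -
  define K where "K = max n m"
  have "dM 0 0 n m i y = 0"
    by (rule c1_unique[OF c1_M c1_const[of "if n = m then 1 else 0"] _ y i]) (rule M_one)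
  moreover have "dM 0 0 n m i y = a i n m y + b i m n y + X i n m y"
    using dM_eq[OF y, of n K m 0 0 i]
    by (simp add: K_def M_one[OF y] X_def if_distrib[of "\<lambda>x. _ * x"] if_distrib[of "\<lambda>x. x * _"] cong: if_cong)
  ultimately show ?thesis by simp
qed

lemma a_diag_eq_b_diag:
  assumes y: "y \<in> D" and i: "i \<in> I"
  shows "a i n n y = b i n n y"
proof -
  have "S n n i y = T n n i y"
    by (rule c1_unique[OF c1_ps c1_ph _ y i]) (simp add: ps_coeff)
  then show ?thesis
    unfolding a_def b_def
    using form_left_lead[OF y degree_dps, of n i] form_right_lead[OF y degree_dph, of n i]
    by (simp add: coeff_dps coeff_dph)
qed

text \<open>Both \<open>a\<close> and \<open>b\<close> are lower triangular, for differentiation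
  does not raise degrees. So \<open>a\<close> plus the transpose of \<open>b\<close> is the
  splitting of \<open>- X\<close> into lower and upper part, and equal diagonals force the
  halves.\<close>

lemma b_eq:
  assumes y: "y \<in> D" and i: "i \<in> I"
  shows "b i m n y = - P i n m y"
proof -
  have ab: "b i m n y = - X i n m y - a i n m y" for n m
    by (rule eq_diff_of_sum_zero[OF a_plus_b[OF y i]])
  consider "n < m" | "n = m" | "n > m" by linarith
  then show ?thesis
  proof cases
    case 1
    then show ?thesis unfolding ab a_zero[OF y 1, of i] by (simp add: P_def upper_def)
  next
    case 2
    have "b i n n y = - X i n n y - b i n n y"
      using ab[of n n] unfolding a_diag_eq_b_diag[OF y i, of n] .
    then have "b i n n y = - X i n n y / 2" by (rule eq_half_of_eq_diff)
    then show ?thesis unfolding 2 P_def upper_def by simp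
  next
    case 3
    show ?thesis unfolding b_zero[OF y 3] using 3 by (simp add: P_def upper_def)
  qed
qed

text \<open>The coefficients of the derivative of \<open>ps n\<close>. For \<open>\<psi>\<close>,
  the factor \<open>exp (- V\<^sub>1)\<close> adds \<open>X\<close> back in a \<open>u\<close>
  direction and nothing in a \<open>v\<close> direction, which is the case distinction in
  \<open>Cd\<close> below.\<close>

lemma a_eq:
  assumes y: "y \<in> D" and i: "i \<in> I"
  shows "a i n m y = P i n m y - X i n m y"
proof -
  have "a i n m y = (a i n m y + b i m n y + X i n m y) - X i n m y - b i m n y" by simp
  then have "a i n m y = - X i n m y - b i m n y" unfolding a_plus_b[OF y i] by simp
  then show ?thesis unfolding b_eq[OF y i, of m n] by simp
qed

fun is_v :: "dir \<Rightarrow> complex" where "is_v (DV J) = 1" | "is_v _ = 0"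

text \<open>
  The Lax matrices \<open>U\<^sup>K\<close> (direction \<open>u\<^sub>K\<close>) and minus the transpose of \<open>V\<^sup>J\<close> (direction \<open>v\<^sub>J\<close>):
  the upper triangular half of \<open>X\<close>, respectively that half minus \<open>X\<close>.
\<close>

definition "Cd i n m y = P i n m y - is_v i * X i n m y"
definition "dX i n m j y = coupling i * dM (shift_x i) (shift_y i) n m j y"
definition "dCd i n m j y = upper n m * dX i n m j y - is_v i * dX i n m j y"

lemma c1_X: "c1 (X i n m) (dX i n m)"
  unfolding X_def[abs_def] dX_def[abs_def] by (rule c1_cmult[OF c1_M])

lemma c1_Cd: "c1 (Cd i n m) (dCd i n m)"
  unfolding Cd_def[abs_def] dCd_def[abs_def] P_def[abs_def]
  by (rule c1_diff[OF c1_cmult[OF c1_X] c1_cmult[OF c1_X]])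

text \<open>Without a shift in \<open>y\<close>, \<open>X i\<close> is a multiple of a power of
  \<open>Q\<close>, and both products collapse to the same \<open>M\<close>.\<close>

lemma X_commutes_left:
  assumes y: "y \<in> D" and "shift_y i = 0" and K: "K \<ge> n + p" "K \<ge> n + shift_x i"
  shows "(\<Sum>k\<le>K. X i n k y * M p 0 k m y) = (\<Sum>k\<le>K. M p 0 n k y * X i k m y)"
proof -
  have "(\<Sum>k\<le>K. M (shift_x i) 0 n k y * M p 0 k m y) = (\<Sum>k\<le>K. M p 0 n k y * M (shift_x i) 0 k m y)"
    using M_compose_left[OF y K(1), of "shift_x i" 0 m] M_compose_left[OF y K(2), of p 0 m]
    by (simp add: add.commute)
  then show ?thesis
    by (simp add: X_def assms(2) mult.assoc mult.left_commute[of _ "coupling i"] sum_distrib_left[symmetric])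
qed

lemma X_commutes_right:
  assumes y: "y \<in> D" and "shift_x i = 0" and K: "K \<ge> m + q" "K \<ge> m + shift_y i"
  shows "(\<Sum>k\<le>K. X i n k y * M 0 q k m y) = (\<Sum>k\<le>K. M 0 q n k y * X i k m y)"
proof -
  have "(\<Sum>k\<le>K. M 0 (shift_y i) n k y * M 0 q k m y) = (\<Sum>k\<le>K. M 0 q n k y * M 0 (shift_y i) k m y)"
    using M_compose_right[OF y K(1), of 0 "shift_y i" n] M_compose_right[OF y K(2), of 0 q n]
    by (simp add: add.commute)
  then show ?thesis
    by (simp add: X_def assms(2) mult.assoc mult.left_commute[of _ "coupling i"] sum_distrib_left[symmetric])
qed

lemma pure_shift: "is_v i = 0 \<Longrightarrow> shift_y i = 0" "is_v i = 1 \<Longrightarrow> shift_x i = 0"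
  and is_v_cases: "is_v i = 0 \<or> is_v i = 1"
  by (cases i; simp)+

text \<open>By the product rule \<open>\<partial>M = [P, M] - X M\<close> plus the derivative of the
  weight. The last term is \<open>M X\<close> for a power of \<open>Q\<close> and \<open>X M\<close>
  for a power of \<open>N\<close>. Where it is not already the required one, \<open>X\<close> and
  \<open>M\<close> are powers of the same matrix and commute.\<close>

lemma dM_commutator:
  assumes y: "y \<in> D" and i: "i \<in> I" and pq: "p = 0 \<or> q = 0"
    and K: "K \<ge> n + p + shift_x i" "K \<ge> m + q + shift_y i" "K \<ge> n" "K \<ge> m"
  shows "(\<Sum>k\<le>K. Cd i n k y * M p q k m y - M p q n k y * Cd i k m y) = dM p q n m i y"
proof -
  define s where "s U V = (\<Sum>k\<le>K. U n k y * V k m y)" for U V :: "nat \<Rightarrow> nat \<Rightarrow> (dir \<Rightarrow> complex) \<Rightarrow> complex"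
  have dM: "dM p q n m i y = s (P i) (M p q) - s (X i) (M p q) - s (M p q) (P i)
      + coupling i * M (p + shift_x i) (q + shift_y i) n m y"
    unfolding dM_eq[OF y K(3,4)] s_def
    by (simp add: a_eq[OF y i] b_eq[OF y i] sum_subtractf sum_negf ring_distribs)
  have lhs: "(\<Sum>k\<le>K. Cd i n k y * M p q k m y - M p q n k y * Cd i k m y) =
      s (P i) (M p q) - s (M p q) (P i) - is_v i * (s (X i) (M p q) - s (M p q) (X i))"
    by (simp add: s_def Cd_def sum_subtractf ring_distribs sum_distrib_left mult_ac)
  have e1: "coupling i * M (p + shift_x i) (q + shift_y i) n m y = s (M p q) (X i)" if "q = 0"
    using M_compose_left[OF y, of n p K "shift_x i" "shift_y i" m] K that
    by (simp add: s_def X_def mult.left_commute[of _ "coupling i"] sum_distrib_left[symmetric])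
  have e2: "coupling i * M (p + shift_x i) (q + shift_y i) n m y = s (X i) (M p q)" if "p = 0"
    using M_compose_right[OF y, of m q K "shift_x i" "shift_y i" n] K that
    by (simp add: s_def X_def mult.assoc sum_distrib_left[symmetric] add.commute)
  have e3: "s (X i) (M p q) = s (M p q) (X i)" if "q = 0" "is_v i = 0"
    using X_commutes_left[OF y pure_shift(1)[OF that(2)], of n p K m] K that by (simp add: s_def)
  have e4: "s (X i) (M p q) = s (M p q) (X i)" if "p = 0" "is_v i = 1"
    using X_commutes_right[OF y pure_shift(2)[OF that(2)], of m q K n] K that by (simp add: s_def)
  show ?thesis
    unfolding lhs dM using e1 e2 e3 e4 pq is_v_cases[of i] by auto
qed

lemma eventually_dM_commutator:
  assumes "y \<in> D" "i \<in> I" "p = 0 \<or> q = 0"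
  shows "\<forall>\<^sub>F K in sequentially. (\<Sum>k\<le>K. Cd i n k y * M p q k m y - M p q n k y * Cd i k m y) = dM p q n m i y"
  using eventually_ge_at_top[of "n + p + shift_x i + m + q + shift_y i"]
  by eventually_elim (rule dM_commutator[OF assms], auto)

lemma eventually_dX:
  assumes "y \<in> D" "i \<in> I"
  shows "\<forall>\<^sub>F K in sequentially. (\<Sum>k\<le>K. Cd i n k y * X j k m y - X j n k y * Cd i k m y) = dX j n m i y"
proof -
  have "shift_x j = 0 \<or> shift_y j = 0" by (cases j) auto
  from eventually_dM_commutator[OF assms this, of n m] show ?thesis
  proof eventually_elim
    case (elim K)
    show ?case unfolding dX_def elim[symmetric] sum_distrib_left
      by (intro sum.cong) (auto simp: X_def algebra_simps)
  qed
qed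

lemma eventually_X_commute:
  assumes "y \<in> D" "is_v i = is_v j"
  shows "\<forall>\<^sub>F K in sequentially. (\<Sum>k\<le>K. X i n k y * X j k m y) = (\<Sum>k\<le>K. X j n k y * X i k m y)"
  using eventually_ge_at_top[of "n + m + shift_x i + shift_x j + shift_y i + shift_y j"]
proof eventually_elim
  case (elim K)
  consider "is_v i = 0" "is_v j = 0" | "is_v i = 1" "is_v j = 1" using is_v_cases[of i] assms(2) by auto
  then show ?case
  proof cases
    case 1
    from X_commutes_left[OF assms(1) pure_shift(1)[OF 1(1)], of n "shift_x j" K m] elim pure_shift(1)[OF 1(2)]
    show ?thesis
      by (simp add: X_def[of j] mult.left_commute[of _ "coupling j"] sum_distrib_left[symmetric] mult.assoc)
  next
    case 2
    from X_commutes_right[OF assms(1) pure_shift(2)[OF 2(1)], of m "shift_y j" K n] elim pure_shift(2)[OF 2(2)]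
    show ?thesis
      by (simp add: X_def[of j] mult.left_commute[of _ "coupling j"] sum_distrib_left[symmetric] mult.assoc)
  qed
qed

text \<open>
  Zero curvature. With \<open>X = P + R\<close> split into its triangular halves, the curvature is a combination
  of \<open>[P\<^sub>i, P\<^sub>j]\<close>, \<open>[R\<^sub>i, R\<^sub>j]\<close> and \<open>[X\<^sub>i, X\<^sub>j]\<close>; the first two are strictly triangular and the last
  vanishes unless one direction is a \<open>u\<close> and the other a \<open>v\<close>.
\<close>

lemma Cd_flat:
  assumes y: "y \<in> D" and i: "i \<in> I" and j: "j \<in> I"
  shows "\<forall>\<^sub>F K in sequentially. dCd i n m j y +
     (\<Sum>k\<le>K. Cd i n k y * Cd j k m y - Cd j n k y * Cd i k m y) = dCd j n m i y"
proof -
  have "\<forall>\<^sub>F K in sequentially. is_v i = is_v j \<longrightarrow>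
      (\<Sum>k\<le>K. X i n k y * X j k m y) = (\<Sum>k\<le>K. X j n k y * X i k m y)"
    using eventually_X_commute[OF y, of i j n m] by (cases "is_v i = is_v j") auto
  with eventually_dX[OF y i, of n j m] eventually_dX[OF y j, of n i m] show ?thesis
  proof eventually_elim
    case (elim K)
    define br where "br U V = (\<Sum>k\<le>K. U n k y * V k m y - V n k y * U k m y)"
      for U V :: "nat \<Rightarrow> nat \<Rightarrow> (dir \<Rightarrow> complex) \<Rightarrow> complex"
    define A1 B1 B2 D1 where "A1 = br (P i) (P j)" and "B1 = br (P i) (X j)" and "B2 = br (X i) (P j)"
      and "D1 = br (X i) (X j)"
    have dXj: "dX j n m i y = B1 - is_v i * D1"
      unfolding elim(1)[symmetric] B1_def D1_def br_def Cd_def sum_distrib_left sum_subtractf[symmetric]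
      by (intro sum.cong) (auto simp: algebra_simps)
    have dXi: "dX i n m j y = - B2 + is_v j * D1"
      unfolding elim(2)[symmetric] B2_def D1_def br_def Cd_def sum_distrib_left sum_negf[symmetric] sum.distrib[symmetric]
      by (intro sum.cong) (auto simp: algebra_simps)
    have CC: "(\<Sum>k\<le>K. Cd i n k y * Cd j k m y - Cd j n k y * Cd i k m y) =
        A1 - is_v j * B1 - is_v i * B2 + is_v i * is_v j * D1"
      unfolding A1_def B1_def B2_def D1_def br_def Cd_def sum_distrib_left sum_subtractf[symmetric] sum.distrib[symmetric]
      by (intro sum.cong) (auto simp: algebra_simps)
    have RR: "D1 - B2 - B1 + A1 = (\<Sum>k\<le>K. (X i n k y - P i n k y) * (X j k m y - P j k m y)
        - (X j n k y - P j n k y) * (X i k m y - P i k m y))"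
      unfolding A1_def B1_def B2_def D1_def br_def sum_subtractf[symmetric] sum.distrib[symmetric]
      by (intro sum.cong) (auto simp: algebra_simps)
    have same: "D1 = 0" if "is_v i = is_v j"
      using elim(3) that by (simp add: D1_def br_def sum_subtractf)
    \<comment> \<open>The product of upper triangular matrices has diagonal entries that are
      products of diagonal entries, so the commutator vanishes on and below the diagonal.\<close>
    have A0: "A1 = 0" if "n \<ge> m"
      unfolding A1_def br_def using that by (intro sum.neutral) (auto simp: P_def upper_def)
    have R0: "D1 - B2 - B1 + A1 = 0" if "n \<le> m"
      unfolding RR using that by (intro sum.neutral) (auto simp: P_def upper_def)
    have curv: "dCd i n m j y + (\<Sum>k\<le>K. Cd i n k y * Cd j k m y - Cd j n k y * Cd i k m y) - dCd j n m i y
        = upper n m * (- B1 - B2 + (is_v i + is_v j) * D1) + A1 - is_v i * is_v j * D1"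
      unfolding dCd_def dXi dXj CC by (simp add: algebra_simps)
    also have "\<dots> = 0"
    proof -
      consider "n < m" | "n = m" | "n > m" by linarith
      then show ?thesis
      proof cases
        \<comment> \<open>Inserting the value of \<open>A1\<close> leaves
          \<open>- (1 - is_v i) * (1 - is_v j) * D1\<close>. This is zero unless neither direction
          is a \<open>v\<close>, and then \<open>D1 = 0\<close> by \<open>same\<close>.\<close>
        case 1
        then have "D1 - B2 - B1 + A1 = 0" using R0 by simp
        moreover have "A1 = (D1 - B2 - B1 + A1) + B1 + B2 - D1" by simp
        ultimately have "A1 = B1 + B2 - D1" by simp
        then show ?thesis using 1 same is_v_cases[of i] is_v_cases[of j] by (auto simp: upper_def)
      next
        case 2
        then have "A1 = 0" "D1 - B2 - B1 + A1 = 0" using R0 A0 by simp_all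
        moreover have "D1 = (D1 - B2 - B1 + A1) + B1 + B2 - A1" by simp
        ultimately have e: "A1 = 0" "- B1 - B2 = - D1" by simp_all
        show ?thesis unfolding e using 2 same is_v_cases[of i] is_v_cases[of j]
          by (auto simp: upper_def)
      next
        case 3
        then show ?thesis using A0 same is_v_cases[of i] is_v_cases[of j] by (auto simp: upper_def)
      qed
    qed
    finally show ?case by (simp add: algebra_simps)
  qed
qed

end

section \<open>Integration by parts, band structure and the string equation\<close>

lemma poly_linear_induct [case_names monom smult add]:
  fixes f :: "complex poly"
  assumes "\<And>i. Pr (monom 1 i)" "\<And>c p. Pr p \<Longrightarrow> Pr (Polynomial.smult c p)" "\<And>p q. Pr p \<Longrightarrow> Pr q \<Longrightarrow> Pr (p + q)"
  shows "Pr f"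
proof -
  have m: "Pr (monom c i)" for c i using assms(2)[OF assms(1), of c i] by (simp add: smult_monom)
  have "Pr (\<Sum>i\<in>A. monom (coeff f i) i)" if "finite A" for A
    using that m[of 0 0] by induction (auto intro: assms(3) m)
  then show ?thesis using poly_as_sum_of_monoms[of f] by (metis finite_atMost)
qed

context moment_deformation
begin

text \<open>The polynomials \<open>V\<^sub>1'\<close> and \<open>V\<^sub>2'\<close>, so that
  \<open>pderiv f - W1 y * f\<close> is the polynomial part of the derivative of
  \<open>f * exp (- V\<^sub>1)\<close>.\<close>

definition "W1 y = (\<Sum>K=1..d1 + 1. monom (y (DU K)) (K - 1))"
definition "W2 y = (\<Sum>J=1..d2 + 1. monom (y (DV J)) (J - 1))"

lemma form_monom_coeff: 
  "form y (monom c i) (monom c' j) = c * c' * \<mu> i j y"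
  using moment_form_smult_left[of "\<lambda>i j. \<mu> i j y" c "monom 1 i" "monom c' j"]
    moment_form_smult_right[of "\<lambda>i j. \<mu> i j y" "monom 1 i" c' "monom 1 j"]
  by (simp add: smult_monom moment_form_monom)

text \<open>The identity is bilinear in \<open>f\<close> and \<open>g\<close>, and on monomials it
  is the assumed relation among the moments.\<close>

lemma form_parts_x:
  assumes y: "y \<in> D"
  shows "form y (pderiv f - W1 y * f) g + form y f (monom 1 1 * g) = 0"
proof (induction f rule: poly_linear_induct)
  case (monom i)
  show ?case
  proof (induction g rule: poly_linear_induct)
    case (monom j)
    have "form y (W1 y * monom 1 i) (monom 1 j) = (\<Sum>K=1..d1 + 1. y (DU K) * \<mu> (i + K - 1) j y)"
      unfolding W1_def sum_distrib_right moment_form_sum_left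
      by (intro sum.cong) (auto simp: mult_monom form_monom_coeff add.commute)
    then show ?case
      using parts_x[OF y, of i j]
      by (simp add: pderiv_monom form_monom_coeff mult_monom moment_form_diff_left)
  next
    case (smult c p)
    then show ?case by (simp add: moment_form_smult_right ring_distribs[symmetric])
  next
    case (add p q)
    then have "(form y (pderiv (monom 1 i) - W1 y * monom 1 i) p + form y (monom 1 i) (monom 1 1 * p)) +
      (form y (pderiv (monom 1 i) - W1 y * monom 1 i) q + form y (monom 1 i) (monom 1 1 * q)) = 0" by simp
    then show ?case by (simp add: moment_form_add_right ring_distribs add_ac)
  qed
next
  case (smult c p)
  then show ?case by (simp add: pderiv_smult moment_form_smult_left smult_diff_right[symmetric] ring_distribs[symmetric])
next
  case (add p q)
  then have "(form y (pderiv p - W1 y * p) g + form y p (monom 1 1 * g)) +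
     (form y (pderiv q - W1 y * q) g + form y q (monom 1 1 * g)) = 0" by simp
  then show ?case
    by (simp add: pderiv_add moment_form_add_left moment_form_diff_left ring_distribs algebra_simps)
qed

lemma form_parts_y:
  assumes y: "y \<in> D"
  shows "form y f (pderiv g - W2 y * g) + form y (monom 1 1 * f) g = 0"
proof (induction f rule: poly_linear_induct)
  case (monom i)
  show ?case
  proof (induction g rule: poly_linear_induct)
    case (monom j)
    have "form y (monom 1 i) (W2 y * monom 1 j) = (\<Sum>J=1..d2 + 1. y (DV J) * \<mu> i (j + J - 1) y)"
      unfolding W2_def sum_distrib_right moment_form_sum_right
      by (intro sum.cong) (auto simp: mult_monom form_monom_coeff add.commute)
    then show ?case
      using parts_y[OF y, of j i]
      by (simp add: pderiv_monom form_monom_coeff mult_monom moment_form_diff_right)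
  next
    case (smult c p)
    then show ?case
      by (simp add: pderiv_smult moment_form_smult_right smult_diff_right[symmetric] ring_distribs[symmetric])
  next
    case (add p q)
    then have "(form y (monom 1 i) (pderiv p - W2 y * p) + form y (monom 1 1 * monom 1 i) p) +
      (form y (monom 1 i) (pderiv q - W2 y * q) + form y (monom 1 1 * monom 1 i) q) = 0" by simp
    then show ?case
      by (simp add: pderiv_add moment_form_add_right moment_form_diff_right ring_distribs algebra_simps)
  qed
next
  case (smult c p)
  then show ?case by (simp add: moment_form_smult_left ring_distribs[symmetric])
next
  case (add p q)
  then have "(form y p (pderiv g - W2 y * g) + form y (monom 1 1 * p) g) +
     (form y q (pderiv g - W2 y * g) + form y (monom 1 1 * q) g) = 0" by simp
  then show ?case by (simp add: moment_form_add_left ring_distribs add_ac)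
qed

abbreviation "Q \<equiv> M 1 0"
abbreviation "N \<equiv> M 0 1"

text \<open>The polynomial with coefficients \<open>c\<close> plays the role of \<open>V'\<close>
  and has top coefficient \<open>c (d + 1)\<close> in degree \<open>d\<close>; differentiating
  \<open>f\<close> lowers the degree and cannot reach the top.\<close>

lemma degree_sum_monom_mult:
  fixes f :: "complex poly"
  assumes "\<And>n. coeff f n \<noteq> 0 \<Longrightarrow> n \<le> m"
  shows "i > m + d \<Longrightarrow> coeff (pderiv f - (\<Sum>K=1..d + 1. monom (c K) (K - 1)) * f) i = 0"
    and "d \<ge> 1 \<Longrightarrow> coeff (pderiv f - (\<Sum>K=1..d + 1. monom (c K) (K - 1)) * f) (m + d) = - c (d + 1) * coeff f m"
proof -
  have cf: "coeff f j = 0" if "j > m" for j using assms[of j] that by auto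
  have e: "coeff ((\<Sum>K=1..d + 1. monom (c K) (K - 1)) * f) i =
      (\<Sum>K=1..d + 1. if K - 1 \<le> i then c K * coeff f (i - (K - 1)) else 0)" for i
    by (simp only: sum_distrib_right coeff_sum coeff_monom_mult) (rule sum.cong, auto)
  show "coeff (pderiv f - (\<Sum>K=1..d + 1. monom (c K) (K - 1)) * f) i = 0" if "i > m + d"
  proof -
    have "(\<Sum>K=1..d + 1. if K - 1 \<le> i then c K * coeff f (i - (K - 1)) else 0) = 0"
      using that by (intro sum.neutral) (auto intro!: cf)
    then show ?thesis unfolding coeff_diff e using that cf[of "Suc i"] by (simp add: coeff_pderiv)
  qed
  show "coeff (pderiv f - (\<Sum>K=1..d + 1. monom (c K) (K - 1)) * f) (m + d) = - c (d + 1) * coeff f m" if "d \<ge> 1"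
  proof -
    have "(\<Sum>K=1..d + 1. if K - 1 \<le> m + d then c K * coeff f (m + d - (K - 1)) else 0)
        = (\<Sum>K\<in>{d + 1}. if K - 1 \<le> m + d then c K * coeff f (m + d - (K - 1)) else 0)"
      by (intro sum.mono_neutral_right) (auto intro!: cf)
    then show ?thesis unfolding coeff_diff e using that cf[of "Suc (m + d)"] by (simp add: coeff_pderiv)
  qed
qed

text \<open>Multiplication by \<open>y\<close> on the dual side is minus differentiation of
  \<open>\<psi>\<close>, hence \<open>N = - P\<close>.\<close>

lemma N_eq:
  assumes "y \<in> D" shows "N n m y = - form y (pderiv (ps n y) - W1 y * ps n y) (ph m y)"
  using form_parts_x[OF assms, of "ps n y" "ph m y"]
  by (simp add: M_def monom_0 one_pCons[symmetric] add_eq_0_iff)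

lemma Q_eq:
  assumes "y \<in> D" shows "Q n m y = - form y (ps n y) (pderiv (ph m y) - W2 y * ph m y)"
  using form_parts_y[OF assms, of "ps n y" "ph m y"]
  by (simp add: M_def monom_0 one_pCons[symmetric] add_eq_0_iff)

lemma degree_dpsi:
  assumes "y \<in> D" shows "degree (pderiv (ps n y) - W1 y * ps n y) \<le> n + d1"
proof (rule degree_le, intro allI impI)
  fix i assume "n + d1 < i"
  then show "coeff (pderiv (ps n y) - W1 y * ps n y) i = 0"
    unfolding W1_def using le_degree[of "ps n y"] ps_coeff(1)[OF assms, of n]
    by (intro degree_sum_monom_mult(1)[where m = n]) auto
qed

lemma degree_dphi:
  assumes "y \<in> D" shows "degree (pderiv (ph n y) - W2 y * ph n y) \<le> n + d2"
proof (rule degree_le, intro allI impI)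
  fix i assume "n + d2 < i"
  then show "coeff (pderiv (ph n y) - W2 y * ph n y) i = 0"
    unfolding W2_def using le_degree[of "ph n y"] ps_coeff(2)[OF assms, of n]
    by (intro degree_sum_monom_mult(1)[where m = n]) auto
qed

text \<open>Two descriptions of one matrix bound it on both sides: multiplication of
  \<open>ph m\<close> by \<open>y\<close> raises the degree by one, and differentiation of
  \<open>\<psi>\<close> raises the degree of its polynomial part by at most
  \<open>d1\<close>.\<close>

lemma N_band:
  assumes y: "y \<in> D" and "N n m y \<noteq> 0" shows "m \<le> n + d1 \<and> n \<le> m + 1"
proof (rule ccontr)
  assume "\<not> (m \<le> n + d1 \<and> n \<le> m + 1)"
  then consider "m > n + d1" | "n > m + 1" by linarith
  then have "N n m y = 0"
  proof cases
    case 1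
    then have "degree (pderiv (ps n y) - W1 y * ps n y) < m" using degree_dpsi[OF y, of n] by linarith
    then show ?thesis unfolding N_eq[OF y] by (simp add: form_left_zero[OF y])
  qed (use M_zero_right[OF y] in auto)
  with assms(2) show False by simp
qed

lemma Q_band:
  assumes y: "y \<in> D" and "Q n m y \<noteq> 0" shows "m \<le> n + 1 \<and> n \<le> m + d2"
proof (rule ccontr)
  assume "\<not> (m \<le> n + 1 \<and> n \<le> m + d2)"
  then consider "n > m + d2" | "m > n + 1" by linarith
  then have "Q n m y = 0"
  proof cases
    case 1
    then have "degree (pderiv (ph m y) - W2 y * ph m y) < n" using degree_dphi[OF y, of m] by linarith
    then show ?thesis unfolding Q_eq[OF y] by (simp add: form_right_zero[OF y])
  qed (use M_zero_left[OF y] in auto)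
  with assms(2) show False by simp
qed

text \<open>The outermost diagonals are ratios of leading coefficients, for \<open>N_upper\<close>
  and \<open>Q_lower\<close> times the top coefficient of a potential. Their not vanishing lets the
  recurrence run in both directions.\<close>

lemma Q_upper: "y \<in> D \<Longrightarrow> Q n (n + 1) y = rt (n + 1) y / rt n y"
  using form_left_lead[of y "monom 1 1 * ps n y" "n + 1"] degree_shift[of 1 "ps n y"] ps_coeff[of y n]
  by (simp add: M_def monom_0 one_pCons[symmetric] coeff_monom_mult)

lemma N_lower: "y \<in> D \<Longrightarrow> N (n + 1) n y = rt (n + 1) y / rt n y"
  using form_right_lead[of y "monom 1 1 * ph n y" "n + 1"] degree_shift[of 1 "ph n y"] ps_coeff[of y n]
  by (simp add: M_def monom_0 one_pCons[symmetric] coeff_monom_mult)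

lemma N_upper:
  assumes y: "y \<in> D" shows "N n (n + d1) y = y (DU (d1 + 1)) * rt (n + d1) y / rt n y"
proof -
  have "coeff (pderiv (ps n y) - W1 y * ps n y) (n + d1) = - y (DU (d1 + 1)) * coeff (ps n y) n"
    unfolding W1_def using le_degree[of "ps n y"] ps_coeff(1)[OF y, of n] d1
    by (intro degree_sum_monom_mult(2)[where m = n]) auto
  then show ?thesis unfolding N_eq[OF y] form_left_lead[OF y degree_dpsi[OF y]]
    by (simp add: ps_coeff[OF y])
qed

lemma Q_lower:
  assumes y: "y \<in> D" shows "Q (n + d2) n y = y (DV (d2 + 1)) * rt (n + d2) y / rt n y"
proof -
  have "coeff (pderiv (ph n y) - W2 y * ph n y) (n + d2) = - y (DV (d2 + 1)) * coeff (ph n y) n"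
    unfolding W2_def using le_degree[of "ph n y"] ps_coeff(2)[OF y, of n] d2
    by (intro degree_sum_monom_mult(2)[where m = n]) auto
  then show ?thesis unfolding Q_eq[OF y] form_right_lead[OF y degree_dphi[OF y]]
    by (simp add: ps_coeff[OF y])
qed

text \<open>Compute \<open>M 1 1\<close> twice: as \<open>Q N\<close>, and by parts with
  \<open>x * ps n\<close> as the left factor, where the product rule yields the extra
  \<open>ps n\<close> and hence the identity matrix.\<close>

lemma heisenberg:
  assumes y: "y \<in> D" and K: "K \<ge> n + 1" "K \<ge> n + d1"
  shows "(\<Sum>k\<le>K. Q n k y * N k m y) - (\<Sum>k\<le>K. N n k y * Q k m y) = - (if n = m then 1 else 0)"
proof -
  define R where "R = pderiv (ps n y) - W1 y * ps n y"
  have R: "R = (\<Sum>k\<le>K. Polynomial.smult (- N n k y) (ps k y))"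
  proof -
    have e: "- N n k y = form y R (ph k y)" for k by (simp only: N_eq[OF y] R_def minus_minus)
    show ?thesis unfolding e by (rule expand_left[OF y]) (use degree_dpsi[OF y, of n] K in \<open>simp add: R_def\<close>)
  qed
  have q: "form y (monom 1 1 * ps k y) (ph m y) = Q k m y" for k
    by (simp add: M_def monom_0 one_pCons[symmetric])
  have "(\<Sum>k\<le>K. Q n k y * N k m y) = M 1 1 n m y"
    using M_compose_left[OF y K(1), where r = 0 and q = 1] by simp
  also have "\<dots> = - form y (pderiv (monom 1 1 * ps n y) - W1 y * (monom 1 1 * ps n y)) (ph m y)"
    using form_parts_x[OF y, of "monom 1 1 * ps n y" "ph m y"] by (simp add: M_def add_eq_0_iff)
  also have "pderiv (monom 1 1 * ps n y) - W1 y * (monom 1 1 * ps n y) = ps n y + monom 1 1 * R"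
    by (simp add: R_def pderiv_mult pderiv_monom ring_distribs mult_ac monom_0 one_pCons[symmetric])
  also have "form y \<dots> (ph m y) = (if n = m then 1 else 0) - (\<Sum>k\<le>K. N n k y * Q k m y)"
    unfolding moment_form_add_left orth[OF y]
    by (subst R) (simp add: sum_distrib_left moment_form_sum_left moment_form_smult_left
        q[unfolded One_nat_def] sum_negf moment_form_minus_left)
  finally show ?thesis by simp
qed

section \<open>The two Lax systems\<close>

fun up_band :: "nat \<Rightarrow> dir \<Rightarrow> nat" where
  "up_band e (DU K) = K" | "up_band e (DV J) = 0" | "up_band e DZ = e"
fun lo_band :: "nat \<Rightarrow> dir \<Rightarrow> nat" where
  "lo_band e (DU K) = 0" | "lo_band e (DV J) = J" | "lo_band e DZ = e"

lemma Cd_band: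
  assumes y: "y \<in> D" and i: "i \<in> I" "i \<noteq> DZ" and nz: "Cd i n m y \<noteq> 0"
  shows "m \<le> n + up_band e i \<and> n \<le> m + lo_band e' i"
proof (cases i)
  case (DU K)
  have "M K 0 n m y \<noteq> 0" "n \<le> m" using nz DU by (auto simp: Cd_def P_def X_def upper_def split: if_splits)
  then show ?thesis using DU M_zero_left[OF y, of n K m] by fastforce
next
  case (DV J)
  have "M 0 J n m y \<noteq> 0" "n \<ge> m" using nz DV by (auto simp: Cd_def P_def X_def upper_def split: if_splits)
  then show ?thesis using DV M_zero_right[OF y, of m J n] by fastforce
qed (use i in simp)

lemma DZ_in: "DZ \<in> I" by (simp add: I_def)

lemma Cd_DZ: "Cd DZ n m y = 0"
  by (simp add: Cd_def P_def X_def)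

lemma dM_DZ: "y \<in> D \<Longrightarrow> p = 0 \<or> q = 0 \<Longrightarrow> dM p q n m DZ y = 0"
  using dM_commutator[of y DZ p q n "n + m + p + q" m] DZ_in by (simp add: Cd_DZ)

lemma dCd_DZ: "y \<in> D \<Longrightarrow> dCd i n m DZ y = 0"
  by (cases i) (simp_all add: dCd_def dX_def dM_DZ)

text \<open>Common to \<open>L = Q - x\<close> and \<open>L = N - y\<close>: the Lax matrix is
  \<open>M p q\<close> and the spectral direction acts by \<open>s\<close> times the other matrix
  \<open>M q p\<close>. Zero curvature between the spectral and a deformation direction is again
  \<open>dM_commutator\<close>, now for \<open>M q p\<close>.\<close>

lemma lax_instance:
  fixes s :: complex
  assumes pq: "p = 0 \<or> q = 0" and ab: "a' + b' = d + 1" "b' \<ge> 1" "a' \<ge> 1"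
    and band: "\<And>n m y. y \<in> D \<Longrightarrow> M p q n m y \<noteq> 0 \<Longrightarrow> m \<le> n + b' \<and> n \<le> m + a'"
    and upper: "\<And>n y. y \<in> D \<Longrightarrow> M p q n (n + b') y \<noteq> 0"
    and lower: "\<And>n y. y \<in> D \<Longrightarrow> M p q (n + a') n y \<noteq> 0"
    and zband: "\<And>n m y. y \<in> D \<Longrightarrow> M q p n m y \<noteq> 0 \<Longrightarrow> m \<le> n + uz \<and> n \<le> m + lz"
    and zw: "uz \<le> d1 + d2 + 1" "lz \<le> d1 + d2 + 1"
    and heis: "\<And>n m y. y \<in> D \<Longrightarrow> \<forall>\<^sub>F K in sequentially.
      (\<Sum>k\<le>K. s * M q p n k y * M p q k m y - M p q n k y * (s * M q p k m y)) = - (if n = m then 1 else 0)"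
  shows "lax_data I D DZ a' b' d (d1 + d2 + 1) (lo_band lz) (up_band uz) (M p q) (dM p q)
    (\<lambda>i n m y. if i = DZ then s * M q p n m y else Cd i n m y)
    (\<lambda>i n m j y. if i = DZ then s * dM q p n m j y else dCd i n m j y)"
proof
  show "DZ \<in> I" by (rule DZ_in)
  show "a' + b' = d + 1" "b' \<ge> 1" "a' \<ge> 1" by (fact ab)+
  show "m \<le> n + b' \<and> n \<le> m + a'" if "y \<in> D" "M p q n m y \<noteq> 0" for n m y by (rule band[OF that])
  show "M p q n (n + b') y \<noteq> 0" "M p q (n + a') n y \<noteq> 0" if "y \<in> D" for n y
    by (rule upper[OF that], rule lower[OF that])
  show "m \<le> n + up_band uz i \<and> n \<le> m + lo_band lz i"
    if "i \<in> I" "y \<in> D" "(if i = DZ then s * M q p n m y else Cd i n m y) \<noteq> 0" for i n m y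
    using that zband[of y n m] Cd_band[of y i n m uz lz] by (cases "i = DZ") auto
  show "lo_band lz i \<le> d1 + d2 + 1" "up_band uz i \<le> d1 + d2 + 1" if "i \<in> I" for i
    using that zw by (auto simp: I_def)
  show "c1 (M p q n m) (dM p q n m)" for n m by (rule c1_M)
  show "\<forall>\<^sub>F K in sequentially. (\<Sum>k\<le>K. (if i = DZ then s * M q p n k y else Cd i n k y) * M p q k m y -
      M p q n k y * (if i = DZ then s * M q p k m y else Cd i k m y)) = dM p q n m i y"
    if "i \<in> I" "i \<noteq> DZ" "y \<in> D" for i n m y
    using eventually_dM_commutator[OF that(3,1) pq, of n m] that(2) by simp
  show "dM p q n m DZ y = 0" if "y \<in> D" for n m y by (rule dM_DZ[OF that pq])
  show "\<forall>\<^sub>F K in sequentially. (\<Sum>k\<le>K. (if DZ = DZ then s * M q p n k y else Cd DZ n k y) * M p q k m y -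
      M p q n k y * (if DZ = DZ then s * M q p k m y else Cd DZ k m y)) = - (if n = m then 1 else 0)"
    if "y \<in> D" for n m y
    using heis[OF that, of n m] by simp
  show "c1 (\<lambda>y. if i = DZ then s * M q p n m y else Cd i n m y)
     (\<lambda>j y. if i = DZ then s * dM q p n m j y else dCd i n m j y)" if "i \<in> I" for i n m
    using c1_cmult[OF c1_M, of s q p n m] c1_Cd[of i n m] by (cases "i = DZ") simp_all
  fix i j n m y assume ij: "i \<in> I" "j \<in> I" and y: "y \<in> D"
  have pq': "q = 0 \<or> p = 0" using pq by auto
  \<comment> \<open>The spectral matrix is itself a pure power, so its parameter derivative is its
    commutator with \<open>Cd i\<close>. As \<open>Cd\<close> does not vary with the spectral
    parameter, this is the whole mixed curvature.\<close>
  have comm: "\<forall>\<^sub>F K in sequentially. (\<Sum>k\<le>K. Cd i n k y * (s * M q p k m y) - s * M q p n k y * Cd i k m y) = s * dM q p n m i y"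
    if "i \<in> I" for i
    using eventually_dM_commutator[OF y that pq', of n m]
  proof eventually_elim
    case (elim K)
    show ?case unfolding elim[symmetric] sum_distrib_left by (intro sum.cong) (auto simp: algebra_simps)
  qed
  show "\<forall>\<^sub>F K in sequentially. (if i = DZ then s * dM q p n m j y else dCd i n m j y) +
      (\<Sum>k\<le>K. (if i = DZ then s * M q p n k y else Cd i n k y) * (if j = DZ then s * M q p k m y else Cd j k m y) -
        (if j = DZ then s * M q p n k y else Cd j n k y) * (if i = DZ then s * M q p k m y else Cd i k m y)) =
      (if j = DZ then s * dM q p n m i y else dCd j n m i y)"
  proof (cases "i = DZ"; cases "j = DZ")
    assume "i \<noteq> DZ" "j \<noteq> DZ"
    then show ?thesis using Cd_flat[OF y ij, of n m] by simp
  next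
    assume i: "i = DZ" and j: "j \<noteq> DZ"
    show ?thesis using comm[OF ij(2)]
    proof eventually_elim
      case (elim K)
      have "(\<Sum>k\<le>K. s * M q p n k y * Cd j k m y - Cd j n k y * (s * M q p k m y)) = - (s * dM q p n m j y)"
        unfolding elim[symmetric] sum_negf[symmetric] by (intro sum.cong) auto
      then show ?case using i j dCd_DZ[OF y] by simp
    qed
  next
    assume i: "i \<noteq> DZ" and j: "j = DZ"
    show ?thesis using comm[OF ij(1)] i j dCd_DZ[OF y] by simp
  qed simp
qed

text \<open>The linear problem of the functions \<open>\<psi>\<close>: \<open>Q f = x f\<close> with
  \<open>\<partial>\<^sub>x f = P f = - N f\<close>. The sign \<open>-1\<close> turns
  \<open>[Q, N] = -1\<close> into the required commutator.\<close>

lemma lax_Q: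
  "lax_data I D DZ d2 1 d2 (d1 + d2 + 1) (lo_band 1) (up_band d1) Q (dM 1 0)
    (\<lambda>i n m y. if i = DZ then -1 * N n m y else Cd i n m y)
    (\<lambda>i n m j y. if i = DZ then -1 * dM 0 1 n m j y else dCd i n m j y)"
proof (rule lax_instance)
  show "m \<le> n + 1 \<and> n \<le> m + d2" if "y \<in> D" "Q n m y \<noteq> 0" for n m y by (rule Q_band[OF that])
  show "m \<le> n + d1 \<and> n \<le> m + 1" if "y \<in> D" "N n m y \<noteq> 0" for n m y by (rule N_band[OF that])
  show "Q n (n + 1) y \<noteq> 0" if "y \<in> D" for n y unfolding Q_upper[OF that] using rt_nz[OF that] by simp
  show "Q (n + d2) n y \<noteq> 0" if "y \<in> D" for n y unfolding Q_lower[OF that] using rt_nz[OF that] lead_v[OF that] by simp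
  show "\<forall>\<^sub>F K in sequentially. (\<Sum>k\<le>K. -1 * N n k y * Q k m y - Q n k y * (-1 * N k m y)) = - (if n = m then 1 else 0)"
    if "y \<in> D" for n m y
    using eventually_ge_at_top[of "n + d1 + 1"]
  proof eventually_elim
    case (elim K)
    have "(\<Sum>k\<le>K. -1 * N n k y * Q k m y - Q n k y * (-1 * N k m y)) = (\<Sum>k\<le>K. Q n k y * N k m y) - (\<Sum>k\<le>K. N n k y * Q k m y)"
      unfolding sum_subtractf[symmetric] by (intro sum.cong) auto
    also have "\<dots> = - (if n = m then 1 else 0)" by (rule heisenberg[OF that]) (use elim in auto)
    finally show ?case .
  qed
qed (use d2 in auto)

text \<open>The relations that integrals of \<open>exp (x * y) * \<psi>\<close> over
  \<open>x\<close> would satisfy formally: \<open>y\<close> acts as minus the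
  \<open>x\<close>-derivative, giving \<open>N f = y f\<close>, and
  \<open>\<partial>\<^sub>y\<close> acts as multiplication by \<open>x\<close>, giving
  \<open>Q f\<close>.\<close>

lemma lax_N:
  "lax_data I D DZ 1 d1 d1 (d1 + d2 + 1) (lo_band d2) (up_band 1) N (dM 0 1)
    (\<lambda>i n m y. if i = DZ then 1 * Q n m y else Cd i n m y)
    (\<lambda>i n m j y. if i = DZ then 1 * dM 1 0 n m j y else dCd i n m j y)"
proof (rule lax_instance)
  show "m \<le> n + 1 \<and> n \<le> m + d2" if "y \<in> D" "Q n m y \<noteq> 0" for n m y by (rule Q_band[OF that])
  show "m \<le> n + d1 \<and> n \<le> m + 1" if "y \<in> D" "N n m y \<noteq> 0" for n m y by (rule N_band[OF that])
  show "N (n + 1) n y \<noteq> 0" if "y \<in> D" for n y unfolding N_lower[OF that] using rt_nz[OF that] by simp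
  show "N n (n + d1) y \<noteq> 0" if "y \<in> D" for n y unfolding N_upper[OF that] using rt_nz[OF that] lead_u[OF that] by simp
  show "\<forall>\<^sub>F K in sequentially. (\<Sum>k\<le>K. 1 * Q n k y * N k m y - N n k y * (1 * Q k m y)) = - (if n = m then 1 else 0)"
    if "y \<in> D" for n m y
    using eventually_ge_at_top[of "n + d1 + 1"]
  proof eventually_elim
    case (elim K)
    show ?case using heisenberg[OF that, of n K m] elim by (simp add: sum_subtractf)
  qed
qed (use d1 in auto)

section \<open>Identification with the deformation matrices\<close>

lemma inf_mult_eq:
  assumes "\<And>k. A n k \<noteq> 0 \<Longrightarrow> k \<le> K"
  shows "inf_mult A B n m = (\<Sum>k\<le>K. A n k * B k m)"
  unfolding inf_mult_def by (rule sum.mono_neutral_left) (use assms in auto)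

lemma inf_power_Q:
  assumes y: "y \<in> D" shows "inf_power (\<lambda>n m. Q n m y) K n m = M K 0 n m y"
proof (induction K arbitrary: n m)
  case 0 then show ?case by (simp add: M_one[OF y])
next
  case (Suc K)
  have "inf_power (\<lambda>n m. Q n m y) (Suc K) n m = (\<Sum>k\<le>n + 1. Q n k y * M K 0 k m y)"
    unfolding inf_power.simps by (subst inf_mult_eq[where K = "n + 1"]) (use Q_band[OF y] Suc in auto)
  also have "\<dots> = M (Suc K) 0 n m y" using M_compose_left[OF y order_refl, where n = n and p = 1 and r = K and q = 0 and m = m] by simp
  finally show ?case .
qed

lemma inf_power_N:
  assumes y: "y \<in> D" shows "inf_power (\<lambda>n m. N m n y) J n m = M 0 J m n y"
proof (induction J arbitrary: n m)
  case 0 then show ?case by (simp add: M_one[OF y])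
next
  case (Suc J)
  have "inf_power (\<lambda>n m. N m n y) (Suc J) n m = (\<Sum>k\<le>n + 1. N k n y * M 0 J m k y)"
    unfolding inf_power.simps by (subst inf_mult_eq[where K = "n + 1"]) (use N_band[OF y] Suc in auto)
  also have "\<dots> = M 0 (Suc J) m n y"
    using M_compose_right[OF y order_refl, where m = n and r = 1 and p = 0 and q = J and n = m] by (simp add: mult.commute)
  finally show ?case .
qed

lemma deformation_Q:
  assumes "y \<in> D" shows "deformation (\<lambda>n m. Q n m y) K n m = Cd (DU K) n m y"
  unfolding deformation_def inf_power_Q[OF assms] by (simp add: Cd_def P_def X_def upper_def)

text \<open>The upper half of a power of the transpose of \<open>N\<close> is the transposed lower
  half of the power of \<open>N\<close>, and that half is \<open>X - P = - Cd\<close>.\<close>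

lemma deformation_N:
  assumes "y \<in> D" shows "deformation (\<lambda>n m. N m n y) J n m = - Cd (DV J) m n y"
  unfolding deformation_def inf_power_N[OF assms] by (simp add: Cd_def P_def X_def upper_def)

end

section \<open>Windows of solutions\<close>

lemma minv_inverse:
  assumes A: "A \<in> carrier_mat n n" and d: "Determinant.det A \<noteq> 0"
  shows "minv A \<in> carrier_mat n n" "minv A * A = 1\<^sub>m n" "A * minv A = 1\<^sub>m n"
proof -
  obtain B where B: "mat_inverse A = Some B"
    using mat_inverse(1)[OF A, where b = "()"] det_non_zero_imp_unit[OF A d, where b = "()"]
    by (cases "mat_inverse A") auto
  from mat_inverse(2)[OF A B] B
  show "minv A \<in> carrier_mat n n" "minv A * A = 1\<^sub>m n" "A * minv A = 1\<^sub>m n"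
    by (auto simp: minv_def)
qed

lemma det_nonzero_if_trivial_kernel:
  fixes F :: "nat \<Rightarrow> nat \<Rightarrow> complex"
  assumes "\<And>x k. (\<And>i. i \<le> d \<Longrightarrow> (\<Sum>k\<le>d. F i k * x k) = 0) \<Longrightarrow> k \<le> d \<Longrightarrow> x k = 0"
  shows "Determinant.det (Matrix.mat (Suc d) (Suc d) (\<lambda>(i, k). F i k)) \<noteq> 0"
proof
  let ?A = "Matrix.mat (Suc d) (Suc d) (\<lambda>(i, k). F i k)"
  assume "Determinant.det ?A = 0"
  then obtain v where v: "v \<in> carrier_vec (Suc d)" "v \<noteq> 0\<^sub>v (Suc d)" "?A *\<^sub>v v = 0\<^sub>v (Suc d)"
    using det_0_iff_vec_prod_zero[of ?A "Suc d"] by auto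
  have "(\<Sum>k\<le>d. F i k * vec_index v k) = 0" if "i \<le> d" for i
  proof -
    have "vec_index (?A *\<^sub>v v) i = 0" using v(3) that by simp
    then show ?thesis using that v(1)
      by (simp add: scalar_prod_def lessThan_Suc_atMost[symmetric] lessThan_atLeast0)
  qed
  then have "vec_index v k = 0" if "k \<le> d" for k using assms[of "vec_index v"] that by blast
  then have "v = 0\<^sub>v (Suc d)" using v(1) by (intro eq_vecI) auto
  with v(2) show False by simp
qed

lemma msum_carrier [simp]: "msum n F S \<in> carrier_mat n n"
  by (simp add: msum_def)

lemma msum_mult:
  assumes "\<And>j. j \<in> S \<Longrightarrow> F j \<in> carrier_mat n n" "A \<in> carrier_mat n n" "i < n" "k < n"
  shows "(msum n F S * A) $$ (i, k) = (\<Sum>j\<in>S. (F j * A) $$ (i, k))"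
proof -
  have "(msum n F S * A) $$ (i, k) = (\<Sum>l<n. (\<Sum>j\<in>S. F j $$ (i, l)) * A $$ (l, k))"
    using assms by (simp add: msum_def scalar_prod_def lessThan_atLeast0)
  also have "\<dots> = (\<Sum>j\<in>S. \<Sum>l<n. F j $$ (i, l) * A $$ (l, k))"
    unfolding sum_distrib_right by (rule sum.swap)
  also have "\<dots> = (\<Sum>j\<in>S. (F j * A) $$ (i, k))"
    using assms by (intro sum.cong refl) (auto simp: scalar_prod_def lessThan_atLeast0 dest!: assms(1))
  finally show ?thesis .
qed

lemma mult_msum:
  assumes "\<And>j. j \<in> S \<Longrightarrow> F j \<in> carrier_mat n n" "A \<in> carrier_mat n n" "i < n" "k < n"
  shows "(A * msum n F S) $$ (i, k) = (\<Sum>j\<in>S. (A * F j) $$ (i, k))"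
proof -
  have "(A * msum n F S) $$ (i, k) = (\<Sum>l<n. A $$ (i, l) * (\<Sum>j\<in>S. F j $$ (l, k)))"
    using assms by (simp add: msum_def scalar_prod_def lessThan_atLeast0)
  also have "\<dots> = (\<Sum>j\<in>S. \<Sum>l<n. A $$ (i, l) * F j $$ (l, k))"
    unfolding sum_distrib_left by (rule sum.swap)
  also have "\<dots> = (\<Sum>j\<in>S. (A * F j) $$ (i, k))"
    using assms by (intro sum.cong refl) (auto simp: scalar_prod_def lessThan_atLeast0 dest!: assms(1))
  finally show ?thesis .
qed

lemma diag_from_carrier [simp]: "diag_from d g q \<in> carrier_mat (Suc d) (Suc d)"
  by (simp add: diag_from_def)

lemma diag_from_mult:
  "A \<in> carrier_mat (Suc d) (Suc d) \<Longrightarrow> i \<le> d \<Longrightarrow> k \<le> d \<Longrightarrow> (diag_from d g q * A) $$ (i, k) = g (q + i) * A $$ (i, k)"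
  unfolding diag_from_def Suc_eq_plus1[symmetric] by (subst mat_diag_mult_left) auto

lemma mult_diag_from:
  "A \<in> carrier_mat (Suc d) (Suc d) \<Longrightarrow> i \<le> d \<Longrightarrow> k \<le> d \<Longrightarrow> (A * diag_from d g q) $$ (i, k) = g (q + k) * A $$ (i, k)"
  unfolding diag_from_def Suc_eq_plus1[symmetric] by (subst mat_diag_mult_right) (auto simp: mult.commute)

lemma mprod_Nil: "mprod n [] = 1\<^sub>m n" and mprod_Cons: "mprod n (A # As) = A * mprod n As"
  by (simp_all add: mprod_def)

lemma mprod_carrier: "(\<And>A. A \<in> set As \<Longrightarrow> A \<in> carrier_mat n n) \<Longrightarrow> mprod n As \<in> carrier_mat n n"
  by (induction As) (auto simp: mprod_Nil mprod_Cons intro!: mult_carrier_mat[of _ n n])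

lemma mprod_snoc:
  assumes "\<And>A. A \<in> set As \<Longrightarrow> A \<in> carrier_mat n n" "B \<in> carrier_mat n n"
  shows "mprod n (As @ [B]) = mprod n As * B"
  using assms
proof (induction As)
  case Nil then show ?case by (simp add: mprod_Nil mprod_Cons)
next
  case (Cons A As)
  have "mprod n ((A # As) @ [B]) = A * (mprod n As * B)"
    using Cons by (simp add: mprod_Cons)
  also have "\<dots> = A * mprod n As * B"
    by (rule assoc_mult_mat[symmetric, of _ n n _ n _ n]) (use Cons.prems in \<open>auto intro!: mprod_carrier\<close>)
  finally show ?case by (simp add: mprod_Cons)
qed

section \<open>Windows of the unbarred sequences\<close>

locale ladder_sequence =
  fixes d :: nat and c :: "int \<Rightarrow> nat \<Rightarrow> complex" and z :: complex and f :: "nat \<Rightarrow> nat \<Rightarrow> complex"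
  assumes gamma_nz: "\<And>n. c (-1) n \<noteq> 0"
    and trivial_kernel: "\<And>s x k. (\<And>j. j \<le> d \<Longrightarrow> (\<Sum>k\<le>d. f (s + j) k * x k) = 0) \<Longrightarrow> k \<le> d \<Longrightarrow> x k = 0"

locale unbarred_sequence = ladder_sequence +
  assumes recursion: "\<And>n k. n \<ge> d \<Longrightarrow> k \<le> d \<Longrightarrow>
    z * f n k = c (-1) n * f (n + 1) k + (\<Sum>j\<le>d. c (int j) n * f (n - j) k)"
begin

text \<open>Entries \<open>N - d\<close> to \<open>N\<close>, one row each; the columns are the
  independent solutions.\<close>

definition window :: "nat \<Rightarrow> complex mat" where
  "window N = Matrix.mat (Suc d) (Suc d) (\<lambda>(i, k). f (N - d + i) k)"

lemma window_carrier [simp]: "window N \<in> carrier_mat (Suc d) (Suc d)"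
  by (simp add: window_def)

lemma one_mult_window [simp]: "1\<^sub>m (Suc d) * window N = window N"
  by (rule left_mult_one_mat[OF window_carrier])

lemma window_index: "i \<le> d \<Longrightarrow> k \<le> d \<Longrightarrow> window N $$ (i, k) = f (N - d + i) k"
  by (simp add: window_def)

lemma det_window: "Determinant.det (window N) \<noteq> 0"
  unfolding window_def by (rule det_nonzero_if_trivial_kernel) (rule trivial_kernel)

lemma ladder_carrier [simp]: "ladder d c N z \<in> carrier_mat (Suc d) (Suc d)"
  by (simp add: ladder_def)

lemma ladder_window:
  assumes "N \<ge> d" shows "ladder d c N z * window N = window (N + 1)"
proof (rule eq_matI)
  fix i k assume "i < dim_row (window (N + 1))" "k < dim_col (window (N + 1))"
  then have ik: "i \<le> d" "k \<le> d" by (auto simp: window_def)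
  have e: "(ladder d c N z * window N) $$ (i, k) = (\<Sum>l\<le>d. ladder d c N z $$ (i, l) * f (N - d + l) k)"
    using ik by (simp add: window_def ladder_def scalar_prod_def lessThan_Suc_atMost[symmetric] lessThan_atLeast0)
  show "(ladder d c N z * window N) $$ (i, k) = window (N + 1) $$ (i, k)"
  proof (cases "i < d")
    case True
    have "(\<Sum>l\<le>d. ladder d c N z $$ (i, l) * f (N - d + l) k) = (\<Sum>l\<le>d. if l = i + 1 then f (N - d + l) k else 0)"
      using True ik by (intro sum.cong) (auto simp: ladder_def)
    then show ?thesis using True ik assms by (simp add: e window_index Suc_diff_le)
  next
    case False
    then have i: "i = d" using ik by simp
    have "(\<Sum>l\<le>d. ladder d c N z $$ (i, l) * f (N - d + l) k) =
        (\<Sum>l\<le>d. ((if l = d then z * f (N - d + l) k else 0) - c (int (d - l)) N * f (N - d + l) k) / c (-1) N)"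
      using i by (intro sum.cong) (auto simp: ladder_def field_simps)
    also have "\<dots> = (z * f N k - (\<Sum>l\<le>d. c (int (d - l)) N * f (N - d + l) k)) / c (-1) N"
      using assms by (simp add: sum_divide_distrib[symmetric] sum_subtractf)
    also have "(\<Sum>l\<le>d. c (int (d - l)) N * f (N - d + l) k) = (\<Sum>j\<le>d. c (int j) N * f (N - j) k)"
      by (rule sum.reindex_bij_witness[of _ "\<lambda>j. d - j" "\<lambda>j. d - j"]) (use assms in auto)
    also have "(z * f N k - (\<Sum>j\<le>d. c (int j) N * f (N - j) k)) / c (-1) N = f (N + 1) k"
      using recursion[OF assms ik(2)] gamma_nz[of N] by (simp add: field_simps)
    finally show ?thesis unfolding e using i ik assms by (simp add: window_index Suc_diff_le)
  qed
qed (auto simp: window_def ladder_def)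

text \<open>No expansion of the determinant is made: the ladder matrix carries one invertible window
  to another.\<close>

lemma det_ladder:
  assumes "N \<ge> d" shows "Determinant.det (ladder d c N z) \<noteq> 0"
  using det_mult[OF ladder_carrier window_carrier, of N N] ladder_window[OF assms] det_window[of "N + 1"] by auto

lemma ladder_inv_carrier: "N \<ge> d \<Longrightarrow> ladder_inv d c N z \<in> carrier_mat (Suc d) (Suc d)"
  unfolding ladder_inv_def by (rule minv_inverse(1)[OF ladder_carrier det_ladder])

lemma ladder_inv_window:
  assumes "N \<ge> d" shows "ladder_inv d c N z * window (N + 1) = window N"
proof -
  have "ladder_inv d c N z * (ladder d c N z * window N) = (ladder_inv d c N z * ladder d c N z) * window N"
    by (rule assoc_mult_mat[symmetric, OF ladder_inv_carrier[OF assms] ladder_carrier window_carrier])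
  also have "\<dots> = window N"
    unfolding ladder_inv_def minv_inverse(2)[OF ladder_carrier det_ladder[OF assms]] by simp
  finally show ?thesis unfolding ladder_window[OF assms] .
qed

lemma up_prod_carrier: "up_prod d c N j z \<in> carrier_mat (Suc d) (Suc d)"
  unfolding up_prod_def Suc_eq_plus1[symmetric] by (rule mprod_carrier) auto

lemma up_prod_window:
  assumes "N \<ge> d" shows "up_prod d c N j z * window N = window (N + j)"
proof (induction j)
  case 0 then show ?case by (simp add: up_prod_def mprod_Nil)
next
  case (Suc j)
  have "up_prod d c N (Suc j) z = ladder d c (N + j) z * up_prod d c N j z"
    by (simp add: up_prod_def mprod_Cons)
  then have "up_prod d c N (Suc j) z * window N = ladder d c (N + j) z * (up_prod d c N j z * window N)"
    by (simp add: assoc_mult_mat[OF ladder_carrier up_prod_carrier window_carrier, simplified])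
  also have "\<dots> = window (N + j + 1)" unfolding Suc using assms by (intro ladder_window) simp
  finally show ?case by simp
qed

lemma down_prod_carrier: "N \<ge> d + j \<Longrightarrow> down_prod d c N j z \<in> carrier_mat (Suc d) (Suc d)"
  unfolding down_prod_def Suc_eq_plus1[symmetric] by (rule mprod_carrier) (auto intro!: ladder_inv_carrier[simplified])

lemma down_prod_window: "N \<ge> d + j \<Longrightarrow> down_prod d c N j z * window N = window (N - j)"
proof (induction j)
  case 0 then show ?case by (simp add: down_prod_def mprod_Nil)
next
  case (Suc j)
  have "[N - Suc j..<N] = (N - Suc j) # [N - j..<N]"
    using Suc.prems by (simp add: upt_conv_Cons Suc_diff_Suc)
  then have "down_prod d c N (Suc j) z = ladder_inv d c (N - Suc j) z * down_prod d c N j z"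
    by (simp add: down_prod_def mprod_Cons)
  then have "down_prod d c N (Suc j) z * window N = ladder_inv d c (N - Suc j) z * (down_prod d c N j z * window N)"
    using assoc_mult_mat[OF ladder_inv_carrier down_prod_carrier window_carrier, of "N - Suc j" j N N] Suc.prems by simp
  also have "down_prod d c N j z * window N = window (N - Suc j + 1)" using Suc by (simp add: Suc_diff_Suc)
  also have "ladder_inv d c (N - Suc j) z * \<dots> = window (N - Suc j)"
    using Suc.prems by (intro ladder_inv_window) simp
  finally show ?case .
qed

lemma diag_mult_window:
  assumes "A \<in> carrier_mat (Suc d) (Suc d)" "A * window N = window N'" "i \<le> d" "k \<le> d"
  shows "(diag_from d g q * A * window N) $$ (i, k) = g (q + i) * f (N' - d + i) k"
proof -
  have "diag_from d g q * A * window N = diag_from d g q * window N'"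
    unfolding assms(2)[symmetric] by (rule assoc_mult_mat[OF diag_from_carrier assms(1) window_carrier])
  then show ?thesis using diag_from_mult[OF window_carrier assms(3,4), of g q N'] assms(3,4) by (simp add: window_index)
qed

text \<open>The \<open>j\<close>-th product moves the window up by \<open>j\<close>, and the
  diagonal factor weighs it with the \<open>j\<close>-th superdiagonal of \<open>B\<close>. The sum
  is \<open>B f\<close> on the rows of the window, when \<open>B\<close> is supported on the
  superdiagonals \<open>0\<close> to \<open>K\<close>.\<close>

lemma fold_up_window:
  assumes "N \<ge> d" "i \<le> d" "k \<le> d"
  shows "(fold_up d c B K N z * window N) $$ (i, k) = (\<Sum>j=0..K. B (N - d + i) (N - d + i + j) * f (N - d + i + j) k)"
proof -
  have "(fold_up d c B K N z * window N) $$ (i, k) =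
      (\<Sum>j=0..K. (band_diag d B j (N - d) * up_prod d c N j z * window N) $$ (i, k))"
    unfolding fold_up_def Suc_eq_plus1[symmetric] using assms
    by (intro msum_mult) (auto simp: band_diag_def intro!: mult_carrier_mat[OF diag_from_carrier up_prod_carrier, simplified])
  also have "\<dots> = (\<Sum>j=0..K. B (N - d + i) (N - d + i + j) * f (N - d + i + j) k)"
    using assms
    by (intro sum.cong refl) (auto simp: band_diag_def diag_mult_window[OF up_prod_carrier up_prod_window[OF assms(1)]] intro!: arg_cong2[of _ _ _ _ f])
  finally show ?thesis .
qed

text \<open>The window moves down, so row \<open>n\<close> collects the entries
  \<open>B (n - j) n\<close>: it is the transpose of \<open>B\<close> that acts. With
  \<open>N \<ge> d + K\<close> the window never passes row \<open>0\<close>.\<close>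

lemma fold_down_window:
  assumes "N \<ge> d + K" "i \<le> d" "k \<le> d"
  shows "(fold_down d c B K N z * window N) $$ (i, k) = (\<Sum>j=0..K. B (N - d + i - j) (N - d + i) * f (N - d + i - j) k)"
proof -
  have "(fold_down d c B K N z * window N) $$ (i, k) =
      (\<Sum>j=0..K. (band_diag d B j (N - d - j) * down_prod d c N j z * window N) $$ (i, k))"
    unfolding fold_down_def Suc_eq_plus1[symmetric] using assms
    by (intro msum_mult)
      (auto simp: band_diag_def intro!: mult_carrier_mat[OF diag_from_carrier down_prod_carrier, simplified])
  also have "\<dots> = (\<Sum>j=0..K. B (N - d + i - j) (N - d + i) * f (N - d + i - j) k)"
  proof (rule sum.cong[OF refl])
    fix j assume j: "j \<in> {0..K}"
    have e: "N - d - j + i = N - d + i - j" "N - j - d + i = N - d + i - j" "N - d + i - j + j = N - d + i"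
      using assms j by auto
    have "(band_diag d B j (N - d - j) * down_prod d c N j z * window N) $$ (i, k) =
        B (N - d - j + i) (N - d - j + i + j) * f (N - j - d + i) k"
      unfolding band_diag_def
      using assms j by (intro diag_mult_window down_prod_carrier down_prod_window) auto
    then show "(band_diag d B j (N - d - j) * down_prod d c N j z * window N) $$ (i, k) =
        B (N - d + i - j) (N - d + i) * f (N - d + i - j) k" unfolding e .
  qed
  finally show ?thesis .
qed

text \<open>The inverse ladder matrix provides the term below the window, the upward products the
  others. With \<open>b = \<beta>\<close> the result is a row of \<open>- P f\<close>.\<close>

lemma diff_mat_window:
  assumes "N \<ge> d + 1" "i \<le> d" "k \<le> d"
  shows "(diff_mat d e c b N z * window N) $$ (i, k) =
    b (-1) (N - d + i - 1) * f (N - d + i - 1) k + (\<Sum>j=0..e. b (int j) (N - d + i + j) * f (N - d + i + j) k)"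
proof -
  define A1 where "A1 = diag_from d (b (-1)) (N - 1 - d) * ladder_inv d c (N - 1) z"
  define A3 where "A3 = msum (Suc d) (\<lambda>j. diag_from d (b (int j)) (N + j - d) * up_prod d c N j z) {1..e}"
  have N1: "N - 1 \<ge> d" using assms(1) by simp
  have c: "A1 \<in> carrier_mat (Suc d) (Suc d)" "A3 \<in> carrier_mat (Suc d) (Suc d)"
    unfolding A1_def A3_def by (rule mult_carrier_mat[OF diag_from_carrier ladder_inv_carrier[OF N1]], rule msum_carrier)
  have "diff_mat d e c b N z * window N = A1 * window N + diag_from d (b 0) (N - d) * window N + A3 * window N"
    unfolding diff_mat_def Suc_eq_plus1[symmetric] A1_def[symmetric] A3_def[symmetric]
    by (subst add_mult_distrib_mat[OF add_carrier_mat[OF diag_from_carrier] c(2) window_carrier])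
      (simp only: add_mult_distrib_mat[OF c(1) diag_from_carrier window_carrier])
  then have "(diff_mat d e c b N z * window N) $$ (i, k) =
      (A1 * window N) $$ (i, k) + (diag_from d (b 0) (N - d) * window N) $$ (i, k) + (A3 * window N) $$ (i, k)"
    using assms c by (simp add: diag_from_def mat_diag_def window_def)
  also have "(A1 * window N) $$ (i, k) = b (-1) (N - d + i - 1) * f (N - d + i - 1) k"
  proof -
    have w: "ladder_inv d c (N - 1) z * window N = window (N - 1)"
      using ladder_inv_window[OF N1] assms(1) by simp
    have e: "N - 1 - d + i = N - d + i - 1" using assms(1) by simp
    show ?thesis
      unfolding A1_def diag_mult_window[OF ladder_inv_carrier[OF N1] w assms(2,3)] e ..
  qed
  also have "(diag_from d (b 0) (N - d) * window N) $$ (i, k) = b 0 (N - d + i) * f (N - d + i) k"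
    using assms by (simp add: diag_from_mult window_index del: add_2_eq_Suc')
  also have "(A3 * window N) $$ (i, k) = (\<Sum>j=1..e. b (int j) (N - d + i + j) * f (N - d + i + j) k)"
  proof -
    have "(A3 * window N) $$ (i, k) = (\<Sum>j=1..e. (diag_from d (b (int j)) (N + j - d) * up_prod d c N j z * window N) $$ (i, k))"
      unfolding A3_def using assms
      by (intro msum_mult) (auto intro!: mult_carrier_mat[OF diag_from_carrier up_prod_carrier, simplified])
    also have "\<dots> = (\<Sum>j=1..e. b (int j) (N - d + i + j) * f (N - d + i + j) k)"
    proof (rule sum.cong[OF refl])
      fix j assume j: "j \<in> {1..e}"
      have e: "N + j - d + i = N - d + i + j" using assms by auto
      have "d \<le> N" using assms by simp
      show "(diag_from d (b (int j)) (N + j - d) * up_prod d c N j z * window N) $$ (i, k) =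
          b (int j) (N - d + i + j) * f (N - d + i + j) k"
        unfolding diag_mult_window[OF up_prod_carrier up_prod_window[OF \<open>d \<le> N\<close>] assms(2,3)] e ..
    qed
    finally show ?thesis .
  qed
  finally show ?thesis by (simp add: sum.atLeast_Suc_atMost[of 0 e])
qed

end

section \<open>Windows of the barred sequences\<close>

locale barred_sequence = ladder_sequence +
  assumes recursion: "\<And>n k. n \<ge> 1 \<Longrightarrow> k \<le> d \<Longrightarrow>
    z * f n k = c (-1) (n - 1) * f (n - 1) k + (\<Sum>j\<le>d. c (int j) (n + j) * f (n + j) k)"
begin

text \<open>Transposed convention: solutions are rows and the entries \<open>n\<close> to
  \<open>n + d\<close> columns, because the barred ladder matrices act from the right and lower the
  index.\<close>

definition window :: "nat \<Rightarrow> complex mat" where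
  "window n = Matrix.mat (Suc d) (Suc d) (\<lambda>(k, i). f (n + i) k)"

lemma window_carrier [simp]: "window n \<in> carrier_mat (Suc d) (Suc d)"
  by (simp add: window_def)

lemma window_mult_one [simp]: "window N * 1\<^sub>m (Suc d) = window N"
  by (rule right_mult_one_mat[OF window_carrier])

lemma window_index: "i \<le> d \<Longrightarrow> k \<le> d \<Longrightarrow> window n $$ (k, i) = f (n + i) k"
  by (simp add: window_def)

lemma det_window: "Determinant.det (window n) \<noteq> 0"
proof -
  have "Determinant.det (Matrix.mat (Suc d) (Suc d) (\<lambda>(i, k). f (n + i) k)) \<noteq> 0"
    by (rule det_nonzero_if_trivial_kernel) (rule trivial_kernel)
  moreover have "window n = transpose_mat (Matrix.mat (Suc d) (Suc d) (\<lambda>(i, k). f (n + i) k))"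
    by (rule eq_matI) (auto simp: window_def)
  ultimately show ?thesis by (simp add: det_transpose[where n = "Suc d"])
qed

lemma ladder_bar_carrier [simp]: "ladder_bar d c N z \<in> carrier_mat (Suc d) (Suc d)"
  by (simp add: ladder_bar_def)

lemma window_ladder_bar:
  assumes "N \<ge> 1" shows "window N * ladder_bar d c N z = window (N - 1)"
proof (rule eq_matI)
  fix k l assume "k < dim_row (window (N - 1))" "l < dim_col (window (N - 1))"
  then have kl: "k \<le> d" "l \<le> d" by (auto simp: window_def)
  have e: "(window N * ladder_bar d c N z) $$ (k, l) = (\<Sum>i\<le>d. f (N + i) k * ladder_bar d c N z $$ (i, l))"
    using kl by (simp add: window_def ladder_bar_def scalar_prod_def lessThan_Suc_atMost[symmetric] lessThan_atLeast0)
  show "(window N * ladder_bar d c N z) $$ (k, l) = window (N - 1) $$ (k, l)"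
  proof (cases "l = 0")
    case False
    have "(\<Sum>i\<le>d. f (N + i) k * ladder_bar d c N z $$ (i, l)) = (\<Sum>i\<le>d. if i = l - 1 then f (N + i) k else 0)"
      using False kl by (intro sum.cong) (auto simp: ladder_bar_def)
    then show ?thesis using False kl assms by (simp add: e window_index)
  next
    case True
    have "(\<Sum>i\<le>d. f (N + i) k * ladder_bar d c N z $$ (i, l)) =
        (\<Sum>i\<le>d. ((if i = 0 then z * f (N + i) k else 0) - c (int i) (N + i) * f (N + i) k) / c (-1) (N - 1))"
      using True by (intro sum.cong) (auto simp: ladder_bar_def field_simps)
    also have "\<dots> = (z * f N k - (\<Sum>i\<le>d. c (int i) (N + i) * f (N + i) k)) / c (-1) (N - 1)"
      by (simp add: sum_divide_distrib[symmetric] sum_subtractf)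
    also have "\<dots> = f (N - 1) k"
      using recursion[OF assms kl(1)] gamma_nz[of "N - 1"] by (simp add: field_simps)
    finally show ?thesis unfolding e using True kl by (simp add: window_index)
  qed
qed (auto simp: window_def ladder_bar_def)

lemma det_ladder_bar:
  assumes "N \<ge> 1" shows "Determinant.det (ladder_bar d c N z) \<noteq> 0"
  using det_mult[OF window_carrier ladder_bar_carrier, of N N] window_ladder_bar[OF assms] det_window[of "N - 1"] by auto

lemma ladder_bar_inv_carrier: "N \<ge> 1 \<Longrightarrow> ladder_bar_inv d c N z \<in> carrier_mat (Suc d) (Suc d)"
  unfolding ladder_bar_inv_def by (rule minv_inverse(1)[OF ladder_bar_carrier det_ladder_bar])

lemma window_ladder_bar_inv:
  assumes "N \<ge> 1" shows "window (N - 1) * ladder_bar_inv d c N z = window N"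
proof -
  have "(window N * ladder_bar d c N z) * ladder_bar_inv d c N z = window N * (ladder_bar d c N z * ladder_bar_inv d c N z)"
    by (rule assoc_mult_mat[OF window_carrier ladder_bar_carrier ladder_bar_inv_carrier[OF assms]])
  also have "\<dots> = window N"
    unfolding ladder_bar_inv_def minv_inverse(3)[OF ladder_bar_carrier det_ladder_bar[OF assms]] by simp
  finally show ?thesis unfolding window_ladder_bar[OF assms] .
qed

lemma up_prod_bar_carrier: "N \<ge> 1 \<Longrightarrow> up_prod_bar d c N j z \<in> carrier_mat (Suc d) (Suc d)"
  unfolding up_prod_bar_def Suc_eq_plus1[symmetric] by (rule mprod_carrier) (auto intro!: ladder_bar_inv_carrier[simplified])

lemma window_up_prod_bar:
  assumes "N \<ge> 1" shows "window (N - 1) * up_prod_bar d c N j z = window (N - 1 + j)"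
proof (induction j)
  case 0 then show ?case by (simp add: up_prod_bar_def mprod_Nil)
next
  case (Suc j)
  have "up_prod_bar d c N (Suc j) z = up_prod_bar d c N j z * ladder_bar_inv d c (N + j) z"
    unfolding up_prod_bar_def Suc_eq_plus1[symmetric] using assms
    by (simp del: One_nat_def) (rule mprod_snoc, auto intro!: ladder_bar_inv_carrier[simplified])
  then have "window (N - 1) * up_prod_bar d c N (Suc j) z =
      window (N - 1) * up_prod_bar d c N j z * ladder_bar_inv d c (N + j) z"
    using assoc_mult_mat[OF window_carrier up_prod_bar_carrier ladder_bar_inv_carrier, of N "N + j" "N - 1" j] assms by simp
  also have "\<dots> = window (N + j - 1) * ladder_bar_inv d c (N + j) z" unfolding Suc using assms by simp
  also have "\<dots> = window (N + j)" using assms by (intro window_ladder_bar_inv) simp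
  finally show ?case using assms by simp
qed

lemma down_prod_bar_carrier: "down_prod_bar d c N j z \<in> carrier_mat (Suc d) (Suc d)"
  unfolding down_prod_bar_def Suc_eq_plus1[symmetric] by (rule mprod_carrier) auto

lemma window_down_prod_bar: "N \<ge> j + 1 \<Longrightarrow> window (N - 1) * down_prod_bar d c N j z = window (N - 1 - j)"
proof (induction j)
  case 0 then show ?case by (simp add: down_prod_bar_def mprod_Nil)
next
  case (Suc j)
  have "[N - Suc j..<N] = (N - Suc j) # [N - j..<N]"
    using Suc.prems by (simp add: upt_conv_Cons Suc_diff_Suc)
  then have "down_prod_bar d c N (Suc j) z = down_prod_bar d c N j z * ladder_bar d c (N - Suc j) z"
    unfolding down_prod_bar_def Suc_eq_plus1[symmetric] by (simp del: One_nat_def) (rule mprod_snoc, auto)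
  then have "window (N - 1) * down_prod_bar d c N (Suc j) z =
      window (N - 1) * down_prod_bar d c N j z * ladder_bar d c (N - Suc j) z"
    using assoc_mult_mat[OF window_carrier down_prod_bar_carrier ladder_bar_carrier, of "N - 1" N j "N - Suc j"] by simp
  also have "window (N - 1) * down_prod_bar d c N j z = window (N - Suc j)" using Suc by simp
  also have "\<dots> * ladder_bar d c (N - Suc j) z = window (N - Suc j - 1)"
    using Suc.prems by (intro window_ladder_bar) simp
  finally show ?case by simp
qed

lemma window_mult_diag:
  assumes "A \<in> carrier_mat (Suc d) (Suc d)" "window n * A = window n'" "i \<le> d" "k \<le> d"
  shows "(window n * (A * diag_from d g q)) $$ (k, i) = g (q + i) * f (n' + i) k"
proof -
  have "window n * (A * diag_from d g q) = window n' * diag_from d g q"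
    unfolding assms(2)[symmetric] by (rule assoc_mult_mat[symmetric, OF window_carrier assms(1) diag_from_carrier])
  then show ?thesis using mult_diag_from[OF window_carrier assms(4,3), of n' g q] assms(3,4) by (simp add: window_index)
qed

lemma window_fold_up_bar:
  assumes "N \<ge> 1" "i \<le> d" "k \<le> d"
  shows "(window (N - 1) * fold_up_bar d c B K N z) $$ (k, i) = (\<Sum>j=0..K. B (N - 1 + i) (N - 1 + i + j) * f (N - 1 + i + j) k)"
proof -
  have "(window (N - 1) * fold_up_bar d c B K N z) $$ (k, i) =
      (\<Sum>j=0..K. (window (N - 1) * (up_prod_bar d c N j z * band_diag d B j (N - 1))) $$ (k, i))"
    unfolding fold_up_bar_def Suc_eq_plus1[symmetric] using assms
    by (intro mult_msum) (auto simp: band_diag_def intro!: mult_carrier_mat[OF up_prod_bar_carrier diag_from_carrier, simplified])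
  also have "\<dots> = (\<Sum>j=0..K. B (N - 1 + i) (N - 1 + i + j) * f (N - 1 + i + j) k)"
  proof (rule sum.cong[OF refl])
    fix j assume "j \<in> {0..K}"
    have e: "N - 1 + j + i = N - 1 + i + j" by simp
    show "(window (N - 1) * (up_prod_bar d c N j z * band_diag d B j (N - 1))) $$ (k, i) =
        B (N - 1 + i) (N - 1 + i + j) * f (N - 1 + i + j) k"
      unfolding band_diag_def window_mult_diag[OF up_prod_bar_carrier[OF assms(1)] window_up_prod_bar[OF assms(1)] assms(2,3)] e ..
  qed
  finally show ?thesis .
qed

text \<open>Right multiplication by the barred ladder matrices moves the window down without
  inverses; the lowest index reached is \<open>N - 1 - K\<close>, hence the range of
  \<open>N\<close>.\<close>

lemma window_fold_down_bar:
  assumes "N \<ge> K + 1" "i \<le> d" "k \<le> d"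
  shows "(window (N - 1) * fold_down_bar d c B K N z) $$ (k, i) = (\<Sum>j=0..K. B (N - 1 + i - j) (N - 1 + i) * f (N - 1 + i - j) k)"
proof -
  have "(window (N - 1) * fold_down_bar d c B K N z) $$ (k, i) =
      (\<Sum>j=0..K. (window (N - 1) * (down_prod_bar d c N j z * band_diag d B j (N - 1 - j))) $$ (k, i))"
    unfolding fold_down_bar_def Suc_eq_plus1[symmetric] using assms
    by (intro mult_msum) (auto simp: band_diag_def intro!: mult_carrier_mat[OF down_prod_bar_carrier diag_from_carrier, simplified])
  also have "\<dots> = (\<Sum>j=0..K. B (N - 1 + i - j) (N - 1 + i) * f (N - 1 + i - j) k)"
  proof (rule sum.cong[OF refl])
    fix j assume j: "j \<in> {0..K}"
    have e: "N - 1 - j + i = N - 1 + i - j" "N - 1 + i - j + j = N - 1 + i" and Nj: "N \<ge> j + 1" using assms j by auto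
    show "(window (N - 1) * (down_prod_bar d c N j z * band_diag d B j (N - 1 - j))) $$ (k, i) =
        B (N - 1 + i - j) (N - 1 + i) * f (N - 1 + i - j) k"
      unfolding band_diag_def window_mult_diag[OF down_prod_bar_carrier window_down_prod_bar[OF Nj] assms(2,3)] e ..
  qed
  finally show ?thesis .
qed

text \<open>Here the inverse provides the one term above the window and the products those below.
  With \<open>b = \<alpha>\<close> the result is a row of \<open>Q f\<close>.\<close>

lemma window_diff_mat_bar:
  assumes "N \<ge> e + 1" "i \<le> d" "k \<le> d"
  shows "(window (N - 1) * diff_mat_bar d e c b N z) $$ (k, i) =
    b (-1) (N - 1 + i) * f (N + i) k + (\<Sum>j=0..e. b (int j) (N - 1 + i) * f (N - 1 + i - j) k)"
proof -
  define A1 where "A1 = ladder_bar_inv d c N z * diag_from d (b (-1)) (N - 1)"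
  define A3 where "A3 = msum (Suc d) (\<lambda>j. down_prod_bar d c N j z * diag_from d (b (int j)) (N - 1)) {1..e}"
  have N1: "N \<ge> 1" using assms(1) by simp
  have c: "A1 \<in> carrier_mat (Suc d) (Suc d)" "A3 \<in> carrier_mat (Suc d) (Suc d)"
    unfolding A1_def A3_def by (rule mult_carrier_mat[OF ladder_bar_inv_carrier[OF N1] diag_from_carrier], rule msum_carrier)
  have "window (N - 1) * diff_mat_bar d e c b N z =
      window (N - 1) * A1 + window (N - 1) * diag_from d (b 0) (N - 1) + window (N - 1) * A3"
    unfolding diff_mat_bar_def Suc_eq_plus1[symmetric] A1_def[symmetric] A3_def[symmetric]
    by (subst mult_add_distrib_mat[OF window_carrier add_carrier_mat[OF diag_from_carrier] c(2)])
      (simp only: mult_add_distrib_mat[OF window_carrier c(1) diag_from_carrier])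
  then have "(window (N - 1) * diff_mat_bar d e c b N z) $$ (k, i) =
      (window (N - 1) * A1) $$ (k, i) + (window (N - 1) * diag_from d (b 0) (N - 1)) $$ (k, i) + (window (N - 1) * A3) $$ (k, i)"
    using assms c by (simp add: diag_from_def mat_diag_def window_def)
  also have "(window (N - 1) * A1) $$ (k, i) = b (-1) (N - 1 + i) * f (N + i) k"
    unfolding A1_def by (rule window_mult_diag[OF ladder_bar_inv_carrier[OF N1] window_ladder_bar_inv[OF N1] assms(2,3)])
  also have "(window (N - 1) * diag_from d (b 0) (N - 1)) $$ (k, i) = b 0 (N - 1 + i) * f (N - 1 + i) k"
    using assms by (simp add: mult_diag_from window_index)
  also have "(window (N - 1) * A3) $$ (k, i) = (\<Sum>j=1..e. b (int j) (N - 1 + i) * f (N - 1 + i - j) k)"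
  proof -
    have "(window (N - 1) * A3) $$ (k, i) =
        (\<Sum>j=1..e. (window (N - 1) * (down_prod_bar d c N j z * diag_from d (b (int j)) (N - 1))) $$ (k, i))"
      unfolding A3_def using assms
      by (intro mult_msum) (auto intro!: mult_carrier_mat[OF down_prod_bar_carrier diag_from_carrier, simplified])
    also have "\<dots> = (\<Sum>j=1..e. b (int j) (N - 1 + i) * f (N - 1 + i - j) k)"
    proof (rule sum.cong[OF refl])
      fix j assume j: "j \<in> {1..e}"
      have e: "N - 1 - j + i = N - 1 + i - j" and Nj: "N \<ge> j + 1" using assms j by auto
      show "(window (N - 1) * (down_prod_bar d c N j z * diag_from d (b (int j)) (N - 1))) $$ (k, i) =
          b (int j) (N - 1 + i) * f (N - 1 + i - j) k"
        unfolding window_mult_diag[OF down_prod_bar_carrier window_down_prod_bar[OF Nj] assms(2,3)] e ..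
    qed
    finally show ?thesis .
  qed
  finally show ?thesis by (simp add: sum.atLeast_Suc_atMost[of 0 e])
qed

end

section \<open>Differentiability of the moments\<close>

lemma has_field_derivative_quadratic:
  fixes f :: "complex \<Rightarrow> complex"
  assumes "d > 0" "\<And>e. norm e < d \<Longrightarrow> norm (f e - f 0 - e * D) \<le> C * (norm e)\<^sup>2"
  shows "(f has_field_derivative D) (at 0)"
  unfolding has_field_derivative_iff
proof (rule tendsto_iff[THEN iffD2], intro allI impI)
  fix r :: real assume r: "r > 0"
  have "norm ((f e - f 0) / e - D) < r" if e: "e \<noteq> 0" "norm e < min d (r / (\<bar>C\<bar> + 1))" for e
  proof -
    have "norm (f e - f 0 - e * D) \<le> C * (norm e)\<^sup>2" using assms(2) e(2) by simp
    also have "\<dots> \<le> (\<bar>C\<bar> * norm e) * norm e"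
      using mult_right_mono[of C "\<bar>C\<bar>" "(norm e)\<^sup>2"] by (simp add: power2_eq_square mult.assoc)
    finally have "norm (f e - f 0 - e * D) / norm e \<le> \<bar>C\<bar> * norm e" using e(1) by (simp add: pos_divide_le_eq)
    moreover have "(f e - f 0) / e - D = (f e - f 0 - e * D) / e" using e(1) by (simp add: field_simps)
    ultimately have "norm ((f e - f 0) / e - D) \<le> \<bar>C\<bar> * norm e" by (simp add: norm_divide)
    also have "\<dots> \<le> (\<bar>C\<bar> + 1) * norm e" by (intro mult_right_mono) auto
    also have "\<dots> < r" using e(2) by (simp add: pos_less_divide_eq mult.commute)
    finally show ?thesis .
  qed
  then show "\<forall>\<^sub>F e in at 0. dist ((f e - f 0) / (e - 0)) D < r"
    unfolding eventually_at using assms(1) r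
    by (intro exI[of _ "min d (r / (\<bar>C\<bar> + 1))"]) (auto simp: dist_norm)
qed

text \<open>Fubini: one integral over the parameter plane is easier to estimate and to differentiate
  than the iterated contour integrals.\<close>

lemma contour_int2_eq:
  assumes "contour_integrable2 gx gy f"
  shows "contour_int2 gx gy f = (LINT p|(lborel \<Otimes>\<^sub>M lborel).
     f (gx (fst p)) (gy (snd p)) * vector_derivative gx (at (fst p)) * vector_derivative gy (at (snd p)))"
proof -
  define H where "H = (\<lambda>p. f (gx (fst p)) (gy (snd p)) * vector_derivative gx (at (fst p)) * vector_derivative gy (at (snd p)))"
  have "integrable (lborel \<Otimes>\<^sub>M lborel) H"
    using assms unfolding contour_integrable2_def H_def split_beta' .
  from lborel_pair.integral_fst'[OF this]
  have "(LINT s|lborel. LINT t|lborel. H (s, t)) = integral\<^sup>L (lborel \<Otimes>\<^sub>M lborel) H" .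
  moreover have "(LINT t|lborel. H (s, t)) = (LINT t|lborel. f (gx s) (gy t) * vector_derivative gy (at t)) * vector_derivative gx (at s)" for s
    unfolding integral_mult_left_zero[symmetric] by (simp add: H_def mult_ac)
  ultimately show ?thesis by (simp add: contour_int2_def contour_int_def H_def)
qed

lemma integral_double_sum:
  fixes G :: "'i \<Rightarrow> 'l \<Rightarrow> 'a \<Rightarrow> real"
  assumes "\<And>i l. integrable m (G i l)"
  shows "integral\<^sup>L m (\<lambda>p. \<Sum>i\<in>A. \<Sum>l\<in>B. c i l * G i l p) = (\<Sum>i\<in>A. \<Sum>l\<in>B. c i l * integral\<^sup>L m (G i l))"
proof -
  have i: "integrable m (\<lambda>p. c i l * G i l p)" for i l by (rule integrable_mult_right[OF assms])
  have "integral\<^sup>L m (\<lambda>p. \<Sum>i\<in>A. \<Sum>l\<in>B. c i l * G i l p) = (\<Sum>i\<in>A. integral\<^sup>L m (\<lambda>p. \<Sum>l\<in>B. c i l * G i l p))"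
    by (rule Bochner_Integration.integral_sum, rule Bochner_Integration.integrable_sum, rule i)
  also have "\<dots> = (\<Sum>i\<in>A. \<Sum>l\<in>B. integral\<^sup>L m (\<lambda>p. c i l * G i l p))"
    by (rule sum.cong[OF refl], rule Bochner_Integration.integral_sum, rule i)
  finally show ?thesis by simp
qed

section \<open>Moments as functions of the parameters\<close>

locale biorthogonal_on = biorthogonal_family +
  fixes W :: "params set"
  assumes open_W: "open_params d1 d2 W" and W_subset: "W \<subseteq> \<Omega>"
begin

definition "I = insert DZ (DU ` {1..d1 + 1} \<union> DV ` {1..d2 + 1})"

definition point :: "(dir \<Rightarrow> complex) \<Rightarrow> params" where
  "point y = ((\<lambda>K\<in>{1..d1 + 1}. y (DU K)), (\<lambda>J\<in>{1..d2 + 1}. y (DV J)))"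

text \<open>The coordinate copy of \<open>W\<close> times the complex plane: the coordinate
  \<open>DZ\<close> is unrestricted, as it does not enter \<open>point\<close>.\<close>

definition D :: "(dir \<Rightarrow> complex) set" where
  "D = {y. (\<forall>i. i \<notin> I \<longrightarrow> y i = 0) \<and> point y \<in> W}"

lemma finite_I: "finite I" by (simp add: I_def)

lemma continuous_point: "continuous_on S point"
proof -
  have "continuous_on S (\<lambda>y. \<lambda>K\<in>{1..d1 + 1}. y (DU K))"
  proof (rule continuous_on_coordinatewise_then_product)
    fix K show "continuous_on S (\<lambda>y. (\<lambda>K\<in>{1..d1 + 1}. y (DU K)) K)"
    proof (cases "K \<in> {1..d1 + 1}")
      case True
      then show ?thesis
        by (simp only: restrict_apply if_True) (rule continuous_on_subset[OF continuous_on_product_coordinates], simp)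
    qed (simp only: restrict_apply if_False continuous_on_const)
  qed
  moreover have "continuous_on S (\<lambda>y. \<lambda>J\<in>{1..d2 + 1}. y (DV J))"
  proof (rule continuous_on_coordinatewise_then_product)
    fix J show "continuous_on S (\<lambda>y. (\<lambda>J\<in>{1..d2 + 1}. y (DV J)) J)"
    proof (cases "J \<in> {1..d2 + 1}")
      case True
      then show ?thesis
        by (simp only: restrict_apply if_True) (rule continuous_on_subset[OF continuous_on_product_coordinates], simp)
    qed (simp only: restrict_apply if_False continuous_on_const)
  qed
  ultimately show ?thesis unfolding point_def[abs_def] by (rule continuous_on_Pair)
qed

lemma point_in: "point y \<in> param_space d1 d2"
  by (auto simp: point_def param_space_def)

text \<open>A basic open set of the product topology restricts each coordinate separately; on the
  finite set \<open>I\<close> the minimum of the radii works, and elsewhere the coordinates are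
  fixed at zero.\<close>

lemma coord_domain: "coord_domain I D"
proof
  show "finite I" by (rule finite_I)
  show "y i = 0" if "y \<in> D" "i \<notin> I" for y i using that by (simp add: D_def)
  fix y assume y: "y \<in> D"
  obtain T where T: "open T" "W = param_space d1 d2 \<inter> T"
    using open_W unfolding open_params_def openin_open by auto
  have "open (point -` T)" using open_vimage[OF T(1) continuous_point[of UNIV]] .
  then have "openin (product_topology (\<lambda>i. euclidean) UNIV) (point -` T)" by (simp add: open_fun_def)
  moreover have "point y \<in> W" using y by (simp add: D_def)
  then have "y \<in> point -` T" using T(2) by blast
  ultimately obtain X where X: "y \<in> (\<Pi>\<^sub>E i\<in>UNIV. X i)" "\<And>i. openin euclidean (X i)" "(\<Pi>\<^sub>E i\<in>UNIV. X i) \<subseteq> point -` T"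
    using product_topology_open_contains_basis[of "\<lambda>i. euclidean" UNIV "point -` T" y] by auto
  have "\<exists>r>0. ball (y i) r \<subseteq> X i" for i
  proof -
    have "y i \<in> X i" "open (X i)" using X(1,2) by (auto simp: PiE_iff)
    then show ?thesis by (meson openE)
  qed
  then obtain r where r: "\<And>i. r i > 0" "\<And>i. ball (y i) (r i) \<subseteq> X i" by metis
  show "\<exists>r>0. \<forall>y'. (\<forall>i. i \<notin> I \<longrightarrow> y' i = 0) \<longrightarrow> (\<forall>i\<in>I. norm (y' i - y i) < r) \<longrightarrow> y' \<in> D"
  proof (intro exI[of _ "Min (r ` I)"] conjI allI impI)
    show "Min (r ` I) > 0" using finite_I r(1) by (subst Min_gr_iff) (auto simp: I_def)
    fix y' assume 0: "\<forall>i. i \<notin> I \<longrightarrow> y' i = 0" and n: "\<forall>i\<in>I. norm (y' i - y i) < Min (r ` I)"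
    have "y' i \<in> X i" for i
    proof (cases "i \<in> I")
      case True
      then have "norm (y' i - y i) < Min (r ` I)" "Min (r ` I) \<le> r i" using n finite_I by auto
      then have "norm (y' i - y i) < r i" by linarith
      then show ?thesis using r(2)[of i] by (auto simp: dist_norm norm_minus_commute)
    next
      case False
      then have "y' i = y i" using 0 y by (simp add: D_def)
      then show ?thesis using X(1) by (auto simp: PiE_iff)
    qed
    then have "y' \<in> point -` T" using X(3) by (auto simp: PiE_iff)
    then have "point y' \<in> W" using T(2) point_in by blast
    then show "y' \<in> D" using 0 by (simp add: D_def)
  qed
qed

sublocale coord_domain I D by (rule coord_domain)

lemma D_Omega: "y \<in> D \<Longrightarrow> point y \<in> \<Omega>" using W_subset by (auto simp: D_def)

definition expo :: "dir \<Rightarrow> complex \<Rightarrow> complex \<Rightarrow> complex" where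
  "expo i x z = coupling i * x ^ shift_x i * z ^ shift_y i"

lemma sum_I: "(\<Sum>i\<in>I. F i) = F DZ + (\<Sum>K=1..d1 + 1. F (DU K)) + (\<Sum>J=1..d2 + 1. F (DV J))"
  for F :: "dir \<Rightarrow> complex"
proof -
  have "(\<Sum>i\<in>I. F i) = F DZ + (\<Sum>i\<in>DU ` {1..d1 + 1} \<union> DV ` {1..d2 + 1}. F i)"
    unfolding I_def by (subst sum.insert) auto
  also have "(\<Sum>i\<in>DU ` {1..d1 + 1} \<union> DV ` {1..d2 + 1}. F i) =
      (\<Sum>i\<in>DU ` {1..d1 + 1}. F i) + (\<Sum>i\<in>DV ` {1..d2 + 1}. F i)"
    by (rule sum.union_disjoint) auto
  finally show ?thesis by (simp add: sum.reindex inj_on_def add.assoc)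
qed

text \<open>The exponent is affine in the parameters, so a shift of the parameters multiplies the
  integrand by the exponential of \<open>increment\<close>.\<close>

lemma weight_eq: "weight d1 d2 (point y) x z = exp ((\<Sum>i\<in>I. y i * expo i x z) + x * z)"
proof -
  have p1: "potential d1 (fst (point y)) x = - (\<Sum>K=1..d1 + 1. y (DU K) * expo (DU K) x z)"
    unfolding potential_def sum_negf[symmetric] by (intro sum.cong) (auto simp: point_def expo_def)
  have p2: "potential d2 (snd (point y)) z = - (\<Sum>J=1..d2 + 1. y (DV J) * expo (DV J) x z)"
    unfolding potential_def sum_negf[symmetric] by (intro sum.cong) (auto simp: point_def expo_def)
  show ?thesis unfolding weight_def p1 p2 sum_I by (simp add: expo_def[of DZ] del: sum.cl_ivl_Suc)
qed

definition integrand :: "nat \<Rightarrow> nat \<Rightarrow> (dir \<Rightarrow> complex) \<Rightarrow> real \<times> real \<Rightarrow> complex" where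
  "integrand j k y p = gx (fst p) ^ j * gy (snd p) ^ k * weight d1 d2 (point y) (gx (fst p)) (gy (snd p))
     * vector_derivative gx (at (fst p)) * vector_derivative gy (at (snd p))"

abbreviation "plane \<equiv> lborel \<Otimes>\<^sub>M (lborel :: real measure)"

lemma integrable_integrand: "y \<in> D \<Longrightarrow> integrable plane (integrand j k y)"
  using convergent[OF D_Omega, of y j k]
  unfolding contour_integrable2_def integrand_def[abs_def] split_beta' by simp

definition moment :: "nat \<Rightarrow> nat \<Rightarrow> (dir \<Rightarrow> complex) \<Rightarrow> complex" where
  "moment j k y = integral\<^sup>L plane (integrand j k y)"

lemma contour_int2_combination:
  assumes y: "y \<in> D" and "finite S"
    and f: "\<And>x z. f x z = (\<Sum>i\<in>S. c i * (x ^ a i * z ^ b i)) * weight d1 d2 (point y) x z"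
  shows "contour_int2 gx gy f = (\<Sum>i\<in>S. c i * moment (a i) (b i) y)"
proof -
  have e: "f (gx (fst p)) (gy (snd p)) * vector_derivative gx (at (fst p)) * vector_derivative gy (at (snd p))
      = (\<Sum>i\<in>S. c i * integrand (a i) (b i) y p)" for p
    unfolding f integrand_def sum_distrib_right by (simp add: mult_ac)
  have int: "integrable plane (\<lambda>p. \<Sum>i\<in>S. c i * integrand (a i) (b i) y p)"
    using integrable_integrand[OF y] by (intro Bochner_Integration.integrable_sum integrable_mult_right) auto
  then have "contour_integrable2 gx gy f"
    unfolding contour_integrable2_def split_beta' e .
  then have "contour_int2 gx gy f = integral\<^sup>L plane (\<lambda>p. \<Sum>i\<in>S. c i * integrand (a i) (b i) y p)"
    by (simp add: contour_int2_eq e)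
  also have "\<dots> = (\<Sum>i\<in>S. c i * moment (a i) (b i) y)"
    unfolding moment_def using integrable_integrand[OF y]
    by (subst Bochner_Integration.integral_sum) (auto intro!: integrable_mult_right)
  finally show ?thesis .
qed

definition increment :: "(dir \<Rightarrow> complex) \<Rightarrow> real \<times> real \<Rightarrow> complex" where
  "increment v p = (\<Sum>i\<in>I. v i * expo i (gx (fst p)) (gy (snd p)))"

lemma integrand_shift:
  "integrand j k (\<lambda>i. y i + v i) p = integrand j k y p * exp (increment v p)"
  by (simp add: integrand_def weight_eq increment_def ring_distribs sum.distrib exp_add mult_ac)

lemma integrand_times_expo:
  "integrand j k y p * expo i (gx (fst p)) (gy (snd p)) = coupling i * integrand (j + shift_x i) (k + shift_y i) y p"
  by (simp add: integrand_def expo_def power_add mult_ac)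

text \<open>The sum norm of all real and imaginary parts. Its balls are cross-polytopes whose
  vertices are multiples of the coordinate vectors by \<open>units\<close>.\<close>

definition size_norm :: "(dir \<Rightarrow> complex) \<Rightarrow> real" where
  "size_norm v = (\<Sum>i\<in>I. \<bar>Re (v i)\<bar> + \<bar>Im (v i)\<bar>)"

definition units :: "complex set" where "units = {1, -1, \<i>, -\<i>}"

definition vertex :: "(dir \<Rightarrow> complex) \<Rightarrow> real \<Rightarrow> dir \<Rightarrow> complex \<Rightarrow> dir \<Rightarrow> complex" where
  "vertex y r i c = (\<lambda>l. y l + (if l = i then r * c else 0))"

lemma DZ_mem: "DZ \<in> I" by (simp add: I_def)

text \<open>
  The exponent is linear in the parameters, so its real part on a cross-polytope is at most its
  largest value at a vertex. This bounds the integrands near \<open>y\<close> by finitely many integrable ones.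
\<close>

lemma exp_increment_bound:
  assumes "size_norm v \<le> r"
  shows "exp \<bar>Re (increment v p)\<bar> \<le> (\<Sum>i\<in>I. \<Sum>c\<in>units. norm (exp (increment (\<lambda>l. if l = i then r * c else 0) p)))"
proof -
  define m where "m i = expo i (gx (fst p)) (gy (snd p))" for i
  define S where "S = (\<lambda>(i, c). Re (c * m i)) ` (I \<times> units)"
  have fin: "finite S" "S \<noteq> {}" using finite_I by (auto simp: S_def units_def I_def)
  \<comment> \<open>Since \<open>units\<close> contains both signs and both axes, \<open>B\<close>
    dominates the absolute real and imaginary parts of every exponent, while being attained at a
    vertex.\<close>
  define B where "B = Max S"
  have B: "Re (c * m i) \<le> B" if "i \<in> I" "c \<in> units" for i c
    unfolding B_def by (rule Max_ge[OF fin(1)]) (use that in \<open>auto simp: S_def\<close>)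
  have b: "\<bar>Re (m i)\<bar> \<le> B" "\<bar>Im (m i)\<bar> \<le> B" if "i \<in> I" for i
    using B[OF that, of 1] B[OF that, of "-1"] B[OF that, of \<i>] B[OF that, of "-\<i>"] by (auto simp: units_def)
  have B0: "0 \<le> B" using b(1)[OF DZ_mem] abs_ge_zero order.trans by blast
  have "\<bar>Re (increment v p)\<bar> \<le> (\<Sum>i\<in>I. \<bar>Re (v i) * Re (m i) - Im (v i) * Im (m i)\<bar>)"
    unfolding increment_def m_def[symmetric] by (simp add: sum_abs)
  also have "\<dots> \<le> (\<Sum>i\<in>I. (\<bar>Re (v i)\<bar> + \<bar>Im (v i)\<bar>) * B)"
  proof (rule sum_mono)
    fix i assume i: "i \<in> I"
    have "\<bar>Re (v i) * Re (m i) - Im (v i) * Im (m i)\<bar> \<le> \<bar>Re (v i)\<bar> * \<bar>Re (m i)\<bar> + \<bar>Im (v i)\<bar> * \<bar>Im (m i)\<bar>"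
      by (metis abs_mult abs_triangle_ineq4)
    also have "\<dots> \<le> \<bar>Re (v i)\<bar> * B + \<bar>Im (v i)\<bar> * B"
      by (intro add_mono mult_left_mono b[OF i]) auto
    finally show "\<bar>Re (v i) * Re (m i) - Im (v i) * Im (m i)\<bar> \<le> (\<bar>Re (v i)\<bar> + \<bar>Im (v i)\<bar>) * B"
      by (simp add: ring_distribs)
  qed
  also have "\<dots> = size_norm v * B" by (simp add: size_norm_def sum_distrib_right)
  also have "\<dots> \<le> r * B" using assms B0 by (rule mult_right_mono)
  finally have le: "exp \<bar>Re (increment v p)\<bar> \<le> exp (r * B)" by simp
  have "B \<in> S" unfolding B_def using fin by (rule Max_in)
  then obtain i c where ic: "i \<in> I" "c \<in> units" "B = Re (c * m i)" by (auto simp: S_def)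
  have "increment (\<lambda>l. if l = i then r * c else 0) p = r * c * m i"
    using ic(1) finite_I by (simp add: increment_def m_def if_distrib[of "\<lambda>x. x * _"] cong: if_cong)
  then have "exp (r * B) = norm (exp (increment (\<lambda>l. if l = i then r * c else 0) p))"
    using ic(3) by (simp add: mult.assoc)
  also have "\<dots> \<le> (\<Sum>c\<in>units. norm (exp (increment (\<lambda>l. if l = i then r * c else 0) p)))"
    using ic(2) by (intro member_le_sum) (auto simp: units_def)
  also have "\<dots> \<le> (\<Sum>i\<in>I. \<Sum>c\<in>units. norm (exp (increment (\<lambda>l. if l = i then r * c else 0) p)))"
    using ic(1) finite_I
    by (intro member_le_sum[of i I "\<lambda>i. \<Sum>c\<in>units. norm (exp (increment (\<lambda>l. if l = i then r * c else 0) p))"])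
      (auto intro!: sum_nonneg)
  finally show ?thesis using le by linarith
qed

lemma vertices_in_D:
  assumes y: "y \<in> D"
  obtains r where "r > 0" "\<And>i c. i \<in> I \<Longrightarrow> c \<in> units \<Longrightarrow> (\<lambda>l. y l + (if l = i then of_real r * c else 0)) \<in> D"
proof -
  have "\<exists>r>0. \<forall>e. norm e < r \<longrightarrow> (\<lambda>l. y l + e * (if l = i then c else 0)) \<in> D" if "i \<in> I" for i c
  proof -
    have "direction (\<lambda>l. if l = i then c else 0)" using that by (auto simp: direction_def)
    from near_line[OF y this] show ?thesis by blast
  qed
  then obtain r where r: "\<And>i c. i \<in> I \<Longrightarrow> r i c > 0"
    "\<And>i c e. i \<in> I \<Longrightarrow> norm e < r i c \<Longrightarrow> (\<lambda>l. y l + e * (if l = i then c else 0)) \<in> D"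
    by metis
  define s where "s = Min ((\<lambda>(i, c). r i c) ` (I \<times> units))"
  have fin: "finite ((\<lambda>(i, c). r i c) ` (I \<times> units))" using finite_I by (simp add: units_def)
  have s: "s > 0" unfolding s_def
    by (subst Min_gr_iff[OF fin]) (use r(1) DZ_mem in \<open>auto simp: units_def\<close>)
  show thesis
  proof (rule that[of "s / 2"])
    fix i c assume ic: "i \<in> I" "c \<in> units"
    have "s \<le> r i c" unfolding s_def by (rule Min_le[OF fin]) (use ic in auto)
    then have "norm (complex_of_real (s / 2)) < r i c" using s by (simp add: norm_divide)
    from r(2)[OF ic(1) this]
    show "(\<lambda>l. y l + (if l = i then of_real (s / 2) * c else 0)) \<in> D"
      by (simp add: if_distrib[of "\<lambda>x. _ * x"] cong: if_cong)
  qed (use s in simp)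
qed

text \<open>\<open>H j k\<close> adds up the norms of the integrands at the vertices, so one
  integrable function serves all shifts of size at most \<open>r\<close>. A factor
  \<open>expo i\<close> only raises \<open>j\<close> and \<open>k\<close>, which lets powers of
  \<open>increment\<close> be absorbed.\<close>

lemma domination:
  assumes y: "y \<in> D"
  obtains r H where "r > 0" "\<And>j k. integrable plane (H j k :: real \<times> real \<Rightarrow> real)"
    "\<And>j k p. 0 \<le> H j k p"
    "\<And>j k v p. size_norm v \<le> r \<Longrightarrow> norm (integrand j k y p) * exp \<bar>Re (increment v p)\<bar> \<le> H j k p"
    "\<And>i j k p. i \<in> I \<Longrightarrow> norm (expo i (gx (fst p)) (gy (snd p))) * H j k p \<le> H (j + shift_x i) (k + shift_y i) p"
proof -
  obtain r where r: "r > 0" "\<And>i c. i \<in> I \<Longrightarrow> c \<in> units \<Longrightarrow> (\<lambda>l. y l + (if l = i then of_real r * c else 0)) \<in> D"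
    by (rule vertices_in_D[OF y], rule that; assumption)
  define H where "H j k p = (\<Sum>i\<in>I. \<Sum>c\<in>units. norm (integrand j k (\<lambda>l. y l + (if l = i then of_real r * c else 0)) p))" for j k p
  show thesis
  proof (rule that[OF r(1)])
    show "integrable plane (H j k)" for j k
      unfolding H_def[abs_def]
      by (intro Bochner_Integration.integrable_sum integrable_norm integrable_integrand r(2))
    show "0 \<le> H j k p" for j k p unfolding H_def by (intro sum_nonneg) auto
    show "norm (integrand j k y p) * exp \<bar>Re (increment v p)\<bar> \<le> H j k p" if "size_norm v \<le> r" for j k v p
      using mult_left_mono[OF exp_increment_bound[OF that, of p], of "norm (integrand j k y p)"]
      by (simp add: H_def integrand_shift norm_mult sum_distrib_left)
    fix i j k p assume i: "i \<in> I"
    \<comment> \<open>The coupling is minus the reciprocal of a natural number, or zero, including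
      the value \<open>0\<close> of division by zero.\<close>
    have c1: "norm (coupling i) \<le> 1" by (cases i) (auto simp: norm_divide divide_le_eq_1)
    have "norm (expo i (gx (fst p)) (gy (snd p))) * norm (integrand j k y' p) \<le> norm (integrand (j + shift_x i) (k + shift_y i) y' p)" for y'
    proof -
      have "norm (expo i (gx (fst p)) (gy (snd p))) * norm (integrand j k y' p) =
          norm (coupling i) * norm (integrand (j + shift_x i) (k + shift_y i) y' p)"
        unfolding norm_mult[symmetric] integrand_times_expo[symmetric] by (simp add: mult.commute)
      also have "\<dots> \<le> 1 * norm (integrand (j + shift_x i) (k + shift_y i) y' p)"
        by (rule mult_right_mono[OF c1]) simp
      finally show ?thesis by simp
    qed
    then show "norm (expo i (gx (fst p)) (gy (snd p))) * H j k p \<le> H (j + shift_x i) (k + shift_y i) p"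
      unfolding H_def sum_distrib_left by (intro sum_mono) auto
  qed
qed

lemma norm_increment_le:
  "norm (increment v p) \<le> (\<Sum>i\<in>I. norm (v i) * norm (expo i (gx (fst p)) (gy (snd p))))"
  unfolding increment_def norm_mult[symmetric] by (rule norm_sum)

text \<open>Taylor remainders of \<open>exp\<close> of order one and two. The exponential factor in
  the remainder is dominated by \<open>H\<close>, and each factor \<open>increment\<close> is paid
  for by raising the exponents of the moment. The first estimate gives continuity, the second the
  derivative.\<close>

lemma moment_estimates:
  assumes y: "y \<in> D"
  obtains r C where "r > 0"
    "\<And>j k v. size_norm v \<le> r \<Longrightarrow> (\<lambda>i. y i + v i) \<in> D \<Longrightarrow>
       norm (moment j k (\<lambda>i. y i + v i) - moment j k y) \<le> (\<Sum>i\<in>I. norm (v i) * C (j + shift_x i) (k + shift_y i))"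
    "\<And>j k v. size_norm v \<le> r \<Longrightarrow> (\<lambda>i. y i + v i) \<in> D \<Longrightarrow>
       norm (moment j k (\<lambda>i. y i + v i) - moment j k y - (\<Sum>i\<in>I. v i * (coupling i * moment (j + shift_x i) (k + shift_y i) y)))
       \<le> (\<Sum>i\<in>I. \<Sum>l\<in>I. norm (v i) * norm (v l) * C (j + shift_x i + shift_x l) (k + shift_y i + shift_y l))"
proof -
  obtain r H where r: "r > 0" and intH: "\<And>j k. integrable plane (H j k :: real \<times> real \<Rightarrow> real)"
    and H0: "\<And>j k p. 0 \<le> H j k p"
    and H1: "\<And>j k v p. size_norm v \<le> r \<Longrightarrow> norm (integrand j k y p) * exp \<bar>Re (increment v p)\<bar> \<le> H j k p"
    and H2: "\<And>i j k p. i \<in> I \<Longrightarrow> norm (expo i (gx (fst p)) (gy (snd p))) * H j k p \<le> H (j + shift_x i) (k + shift_y i) p"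
    by (rule domination[OF y], rule that; assumption)
  have inc: "norm (increment v p) * H j k p \<le> (\<Sum>i\<in>I. norm (v i) * H (j + shift_x i) (k + shift_y i) p)" for v p j k
  proof -
    have "norm (increment v p) * H j k p \<le> (\<Sum>i\<in>I. norm (v i) * norm (expo i (gx (fst p)) (gy (snd p)))) * H j k p"
      by (rule mult_right_mono[OF norm_increment_le H0])
    also have "\<dots> \<le> (\<Sum>i\<in>I. norm (v i) * H (j + shift_x i) (k + shift_y i) p)"
      unfolding sum_distrib_right mult.assoc by (intro sum_mono mult_left_mono H2) auto
    finally show ?thesis .
  qed
  define C where "C j k = integral\<^sup>L plane (H j k)" for j k
  show thesis
  proof (rule that[OF r])
    fix j k v assume v: "size_norm v \<le> r" and yv: "(\<lambda>i. y i + v i) \<in> D"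
    have i1: "integrable plane (\<lambda>p. integrand j k (\<lambda>i. y i + v i) p - integrand j k y p)"
      by (intro Bochner_Integration.integrable_diff integrable_integrand y yv)
    have b1: "norm (integrand j k (\<lambda>i. y i + v i) p - integrand j k y p) \<le> (\<Sum>i\<in>I. norm (v i) * H (j + shift_x i) (k + shift_y i) p)" for p
    proof -
      have "norm (exp (increment v p) - 1) \<le> exp \<bar>Re (increment v p)\<bar> * norm (increment v p)"
        using Taylor_exp[of "increment v p" 0] by simp
      then have "norm (integrand j k y p) * norm (exp (increment v p) - 1) \<le>
          norm (integrand j k y p) * (exp \<bar>Re (increment v p)\<bar> * norm (increment v p))"
        by (rule mult_left_mono) simp
      also have "\<dots> \<le> H j k p * norm (increment v p)"
        unfolding mult.assoc[symmetric] by (rule mult_right_mono[OF H1[OF v]]) simp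
      also have "\<dots> \<le> (\<Sum>i\<in>I. norm (v i) * H (j + shift_x i) (k + shift_y i) p)"
        using inc[of v p j k] by (simp add: mult.commute)
      finally show ?thesis unfolding integrand_shift norm_mult[symmetric] by (simp add: ring_distribs)
    qed
    have "norm (moment j k (\<lambda>i. y i + v i) - moment j k y) = norm (integral\<^sup>L plane (\<lambda>p. integrand j k (\<lambda>i. y i + v i) p - integrand j k y p))"
      unfolding moment_def
      by (simp only: Bochner_Integration.integral_diff[OF integrable_integrand[OF yv] integrable_integrand[OF y]])
    also have "\<dots> \<le> integral\<^sup>L plane (\<lambda>p. \<Sum>i\<in>I. norm (v i) * H (j + shift_x i) (k + shift_y i) p)"
      by (rule Bochner_Integration.integral_norm_bound_integral[OF i1 _ b1])
        (intro Bochner_Integration.integrable_sum integrable_mult_right intH)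
    also have "\<dots> = (\<Sum>i\<in>I. integral\<^sup>L plane (\<lambda>p. norm (v i) * H (j + shift_x i) (k + shift_y i) p))"
      by (rule Bochner_Integration.integral_sum) (intro integrable_mult_right intH)
    also have "\<dots> = (\<Sum>i\<in>I. norm (v i) * C (j + shift_x i) (k + shift_y i))"
      by (simp add: C_def)
    finally show "norm (moment j k (\<lambda>i. y i + v i) - moment j k y) \<le> (\<Sum>i\<in>I. norm (v i) * C (j + shift_x i) (k + shift_y i))" .
    have lin: "integrand j k y p * increment v p = (\<Sum>i\<in>I. v i * (coupling i * integrand (j + shift_x i) (k + shift_y i) y p))" for p
      unfolding increment_def integrand_times_expo[symmetric] sum_distrib_left by (simp add: mult_ac)
    have b2: "norm (integrand j k (\<lambda>i. y i + v i) p - integrand j k y p - integrand j k y p * increment v p)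
       \<le> (\<Sum>i\<in>I. \<Sum>l\<in>I. norm (v i) * norm (v l) * H (j + shift_x i + shift_x l) (k + shift_y i + shift_y l) p)" for p
    proof -
      have "norm (exp (increment v p) - (1 + increment v p)) \<le> exp \<bar>Re (increment v p)\<bar> * norm (increment v p) ^ 2"
        using Taylor_exp[of "increment v p" 1] by (simp add: power2_eq_square)
      then have "norm (integrand j k y p) * norm (exp (increment v p) - (1 + increment v p)) \<le>
          norm (integrand j k y p) * (exp \<bar>Re (increment v p)\<bar> * norm (increment v p) ^ 2)"
        by (rule mult_left_mono) simp
      also have "\<dots> \<le> H j k p * norm (increment v p) ^ 2"
        unfolding mult.assoc[symmetric] by (rule mult_right_mono[OF H1[OF v]]) simp
      also have "\<dots> = norm (increment v p) * (norm (increment v p) * H j k p)"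
        by (simp add: power2_eq_square)
      also have "\<dots> \<le> norm (increment v p) * (\<Sum>i\<in>I. norm (v i) * H (j + shift_x i) (k + shift_y i) p)"
        by (rule mult_left_mono[OF inc]) simp
      also have "\<dots> = (\<Sum>i\<in>I. norm (v i) * (norm (increment v p) * H (j + shift_x i) (k + shift_y i) p))"
        by (simp add: sum_distrib_left mult.left_commute)
      also have "\<dots> \<le> (\<Sum>i\<in>I. norm (v i) * (\<Sum>l\<in>I. norm (v l) * H (j + shift_x i + shift_x l) (k + shift_y i + shift_y l) p))"
        by (intro sum_mono mult_left_mono inc) auto
      finally have "norm (integrand j k y p) * norm (exp (increment v p) - (1 + increment v p)) \<le>
          (\<Sum>i\<in>I. \<Sum>l\<in>I. norm (v i) * norm (v l) * H (j + shift_x i + shift_x l) (k + shift_y i + shift_y l) p)"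
        by (simp add: sum_distrib_left mult.assoc)
      moreover have "integrand j k (\<lambda>i. y i + v i) p - integrand j k y p - integrand j k y p * increment v p
          = integrand j k y p * (exp (increment v p) - (1 + increment v p))"
        by (simp add: integrand_shift ring_distribs)
      ultimately show ?thesis by (simp only: norm_mult)
    qed
    have i2: "integrable plane (\<lambda>p. integrand j k y p * increment v p)"
      unfolding lin by (intro Bochner_Integration.integrable_sum integrable_mult_right integrable_integrand y)
    have meq: "moment j k (\<lambda>i. y i + v i) - moment j k y - (\<Sum>i\<in>I. v i * (coupling i * moment (j + shift_x i) (k + shift_y i) y))
      = integral\<^sup>L plane (\<lambda>p. integrand j k (\<lambda>i. y i + v i) p - integrand j k y p - integrand j k y p * increment v p)"
    proof -
      have "integral\<^sup>L plane (\<lambda>p. integrand j k y p * increment v p) =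
          (\<Sum>i\<in>I. v i * (coupling i * moment (j + shift_x i) (k + shift_y i) y))"
        unfolding lin moment_def
        by (simp add: Bochner_Integration.integral_sum integrable_mult_right integrable_integrand[OF y])
      moreover have "integral\<^sup>L plane (\<lambda>p. integrand j k (\<lambda>i. y i + v i) p - integrand j k y p) = moment j k (\<lambda>i. y i + v i) - moment j k y"
        unfolding moment_def
        by (rule Bochner_Integration.integral_diff[OF integrable_integrand[OF yv] integrable_integrand[OF y]])
      ultimately show ?thesis by (simp add: Bochner_Integration.integral_diff[OF i1 i2])
    qed
    define GG where "GG i l = H (j + shift_x i + shift_x l) (k + shift_y i + shift_y l)" for i l
    have intG: "integrable plane (GG i l)" for i l unfolding GG_def by (rule intH)
    define T where "T p = (\<Sum>i\<in>I. \<Sum>l\<in>I. (norm (v i) * norm (v l)) * GG i l p)" for p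
    have intT: "integrable plane T" unfolding T_def
      by (intro Bochner_Integration.integrable_sum integrable_mult_right intG)
    have "norm (integral\<^sup>L plane (\<lambda>p. integrand j k (\<lambda>i. y i + v i) p - integrand j k y p - integrand j k y p * increment v p)) \<le> integral\<^sup>L plane T"
      using b2 unfolding T_def GG_def[symmetric]
      by (intro Bochner_Integration.integral_norm_bound_integral[OF Bochner_Integration.integrable_diff[OF i1 i2] intT[unfolded T_def]]) simp
    moreover have "integral\<^sup>L plane T = (\<Sum>i\<in>I. \<Sum>l\<in>I. (norm (v i) * norm (v l)) * integral\<^sup>L plane (GG i l))"
      unfolding T_def by (rule integral_double_sum) (rule intG)
    ultimately show "norm (moment j k (\<lambda>i. y i + v i) - moment j k y - (\<Sum>i\<in>I. v i * (coupling i * moment (j + shift_x i) (k + shift_y i) y)))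
       \<le> (\<Sum>i\<in>I. \<Sum>l\<in>I. norm (v i) * norm (v l) * C (j + shift_x i + shift_x l) (k + shift_y i + shift_y l))"
      unfolding meq by (simp only: GG_def C_def)
  qed
qed

lemma size_norm_le: "size_norm v \<le> (\<Sum>i\<in>I. 2 * norm (v i))"
  unfolding size_norm_def
  by (intro sum_mono) (metis abs_Im_le_cmod abs_Re_le_cmod add_mono mult_2)

lemma continuous_moment: "continuous_on D (moment j k)"
  unfolding continuous_on_def
proof (intro ballI tendstoI)
  fix y and s :: real assume y: "y \<in> D" and s: "s > 0"
  obtain r C where r: "r > 0"
    and est1: "\<And>j k v. size_norm v \<le> r \<Longrightarrow> (\<lambda>i. y i + v i) \<in> D \<Longrightarrow>
       norm (moment j k (\<lambda>i. y i + v i) - moment j k y) \<le> (\<Sum>i\<in>I. norm (v i) * C (j + shift_x i) (k + shift_y i))"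
    and est2: "\<And>j k v. size_norm v \<le> r \<Longrightarrow> (\<lambda>i. y i + v i) \<in> D \<Longrightarrow>
       norm (moment j k (\<lambda>i. y i + v i) - moment j k y - (\<Sum>i\<in>I. v i * (coupling i * moment (j + shift_x i) (k + shift_y i) y)))
       \<le> (\<Sum>i\<in>I. \<Sum>l\<in>I. norm (v i) * norm (v l) * C (j + shift_x i + shift_x l) (k + shift_y i + shift_y l))"
    by (rule moment_estimates[OF y], rule that; assumption)
  have t: "((\<lambda>y'. norm (y' i - y i)) \<longlongrightarrow> 0) (at y within D)" for i
  proof -
    have "continuous_on D (\<lambda>y'. norm (y' i - y i))"
      by (intro continuous_intros continuous_on_subset[OF continuous_on_product_coordinates]) simp
    then show ?thesis using y by (auto simp: continuous_on_def)
  qed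
  have "((\<lambda>y'. \<Sum>i\<in>I. norm (y' i - y i) * C (j + shift_x i) (k + shift_y i)) \<longlongrightarrow> (\<Sum>i\<in>I. 0 * C (j + shift_x i) (k + shift_y i))) (at y within D)"
    by (intro tendsto_sum tendsto_mult t tendsto_const)
  then have e1: "\<forall>\<^sub>F y' in at y within D. (\<Sum>i\<in>I. norm (y' i - y i) * C (j + shift_x i) (k + shift_y i)) < s"
    using s by (intro order_tendstoD(2)) auto
  have "((\<lambda>y'. \<Sum>i\<in>I. 2 * norm (y' i - y i)) \<longlongrightarrow> (\<Sum>i\<in>I. 2 * 0)) (at y within D)"
    by (intro tendsto_sum tendsto_mult t tendsto_const)
  then have e2: "\<forall>\<^sub>F y' in at y within D. (\<Sum>i\<in>I. 2 * norm (y' i - y i)) < r"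
    using r by (intro order_tendstoD(2)) auto
  have "\<forall>\<^sub>F y' in at y within D. y' \<in> D" by (simp add: eventually_at_filter)
  with e1 e2 show "\<forall>\<^sub>F y' in at y within D. dist (moment j k y') (moment j k y) < s"
  proof eventually_elim
    case (elim y')
    have "size_norm (\<lambda>i. y' i - y i) \<le> r" using size_norm_le[of "\<lambda>i. y' i - y i"] elim(2) by simp
    then have "norm (moment j k y' - moment j k y) \<le> (\<Sum>i\<in>I. norm (y' i - y i) * C (j + shift_x i) (k + shift_y i))"
      using est1[of "\<lambda>i. y' i - y i" j k] elim(3) by simp
    with elim(1) show ?case by (simp add: dist_norm)
  qed
qed

text \<open>A remainder quadratic in the shift allows differentiation under the integral along any
  complex line; the coefficients of the linear part are again moments, hence continuous.\<close>

lemma c1_moment: "c1 (moment j k) (\<lambda>i y. coupling i * moment (j + shift_x i) (k + shift_y i) y)"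
proof (rule c1I)
  show "continuous_on D (moment j k)" by (rule continuous_moment)
  show "continuous_on D (\<lambda>y. coupling i * moment (j + shift_x i) (k + shift_y i) y)" for i
    by (intro continuous_intros continuous_moment)
  fix y q assume y: "y \<in> D" and q: "direction q"
  obtain r C where r: "r > 0"
    and est1: "\<And>j k v. size_norm v \<le> r \<Longrightarrow> (\<lambda>i. y i + v i) \<in> D \<Longrightarrow>
       norm (moment j k (\<lambda>i. y i + v i) - moment j k y) \<le> (\<Sum>i\<in>I. norm (v i) * C (j + shift_x i) (k + shift_y i))"
    and est2: "\<And>j k v. size_norm v \<le> r \<Longrightarrow> (\<lambda>i. y i + v i) \<in> D \<Longrightarrow>
       norm (moment j k (\<lambda>i. y i + v i) - moment j k y - (\<Sum>i\<in>I. v i * (coupling i * moment (j + shift_x i) (k + shift_y i) y)))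
       \<le> (\<Sum>i\<in>I. \<Sum>l\<in>I. norm (v i) * norm (v l) * C (j + shift_x i + shift_x l) (k + shift_y i + shift_y l))"
    by (rule moment_estimates[OF y], rule that; assumption)
  obtain s where s: "s > 0" "\<And>e. norm e < s \<Longrightarrow> (\<lambda>i. y i + e * q i) \<in> D" using near_line[OF y q] by blast
  define B where "B = (\<Sum>i\<in>I. 2 * norm (q i)) + 1"
  have B: "B > 0" unfolding B_def by (intro add_nonneg_pos sum_nonneg) auto
  define G where "G = (\<Sum>i\<in>I. q i * (coupling i * moment (j + shift_x i) (k + shift_y i) y))"
  define C' where "C' = (\<Sum>i\<in>I. \<Sum>l\<in>I. norm (q i) * norm (q l) * C (j + shift_x i + shift_x l) (k + shift_y i + shift_y l))"
  show "((\<lambda>e. moment j k (\<lambda>i. y i + e * q i)) has_field_derivative G) (at 0)"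
  proof (rule has_field_derivative_quadratic[where d = "min s (r / B)" and C = C'])
    show "min s (r / B) > 0" using s r B by simp
    fix e :: complex assume e: "norm e < min s (r / B)"
    have "size_norm (\<lambda>i. e * q i) \<le> norm e * (\<Sum>i\<in>I. 2 * norm (q i))"
      using size_norm_le[of "\<lambda>i. e * q i"] by (simp add: norm_mult sum_distrib_left mult_ac)
    also have "\<dots> \<le> norm e * B" unfolding B_def by (intro mult_left_mono) auto
    also have "\<dots> \<le> r" using e B by (simp add: pos_less_divide_eq)
    finally have "size_norm (\<lambda>i. e * q i) \<le> r" .
    moreover have "(\<lambda>i. y i + e * q i) \<in> D" using e by (intro s(2)) simp
    ultimately have "norm (moment j k (\<lambda>i. y i + e * q i) - moment j k y - (\<Sum>i\<in>I. e * q i * (coupling i * moment (j + shift_x i) (k + shift_y i) y)))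
       \<le> (\<Sum>i\<in>I. \<Sum>l\<in>I. norm (e * q i) * norm (e * q l) * C (j + shift_x i + shift_x l) (k + shift_y i + shift_y l))"
      by (rule est2)
    moreover have "(\<Sum>i\<in>I. \<Sum>l\<in>I. norm (e * q i) * norm (e * q l) * C (j + shift_x i + shift_x l) (k + shift_y i + shift_y l)) = C' * (norm e)\<^sup>2"
      unfolding C'_def sum_distrib_right by (intro sum.cong refl) (simp add: norm_mult power2_eq_square)
    moreover have "(\<Sum>i\<in>I. e * q i * (coupling i * moment (j + shift_x i) (k + shift_y i) y)) = e * G"
      unfolding G_def sum_distrib_left by (simp add: mult.assoc)
    ultimately show "norm (moment j k (\<lambda>i. y i + e * q i) - moment j k (\<lambda>i. y i + 0 * q i) - e * G) \<le> C' * (norm e)\<^sup>2"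
      by simp
  qed
qed

section \<open>Linear relations among the moments\<close>

lemma potential_deriv:
  "(potential d u has_field_derivative (\<Sum>K=1..d + 1. u K * x ^ (K - 1))) (at x)"
proof -
  have "((\<lambda>x. \<Sum>K=1..d + 1. u K / of_nat K * x ^ K) has_field_derivative (\<Sum>K=1..d + 1. u K / of_nat K * (of_nat K * x ^ (K - 1)))) (at x)"
    by (intro DERIV_sum DERIV_cmult) (auto intro!: derivative_eq_intros)
  moreover have "(\<Sum>K=1..d + 1. u K / of_nat K * (of_nat K * x ^ (K - 1))) = (\<Sum>K=1..d + 1. u K * x ^ (K - 1))"
    by (intro sum.cong) auto
  ultimately show ?thesis by (simp only: potential_def[abs_def])
qed

text \<open>The integral of the \<open>x\<close>-derivative of \<open>x^j y^k\<close> times the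
  weight vanishes by assumption, and this derivative is a combination of monomials times the weight.
  For \<open>j = 0\<close> the factor \<open>j\<close> removes the term with the truncated
  \<open>j - 1\<close>.\<close>

lemma parts_x:
  assumes y: "y \<in> D"
  shows "of_nat j * moment (j - 1) k y - (\<Sum>K=1..d1 + 1. y (DU K) * moment (j + K - 1) k y) + moment j (k + 1) y = 0"
proof -
  define V where "V x = (\<Sum>K=1..d1 + 1. fst (point y) K * x ^ (K - 1))" for x
  \<comment> \<open>The type \<open>dir\<close> merely labels the terms of the derivative:
    \<open>DZ\<close> stands for the derivative of \<open>x^j\<close>, \<open>DU K\<close> for the
    terms of the potential and \<open>DV 0\<close>, which is no coordinate, for the term from
    \<open>x * y\<close>.\<close>
  define S where "S = insert DZ (insert (DV 0) (DU ` {1..d1 + 1}))"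
  define c where "c i = (case i of DZ \<Rightarrow> of_nat j | DU K \<Rightarrow> - y (DU K) | DV J \<Rightarrow> 1)" for i
  define a where "a i = (case i of DZ \<Rightarrow> j - 1 | DU K \<Rightarrow> j + K - 1 | DV J \<Rightarrow> j)" for i
  define b where "b i = (case i of DZ \<Rightarrow> k | DU K \<Rightarrow> k | DV J \<Rightarrow> k + 1)" for i
  have sumS: "(\<Sum>i\<in>S. F i) = F DZ + F (DV 0) + (\<Sum>K=1..d1 + 1. F (DU K))" for F :: "dir \<Rightarrow> complex"
    unfolding S_def by (subst sum.insert; (subst sum.insert)?) (auto simp: sum.reindex inj_on_def add.assoc)
  have d: "deriv (\<lambda>x. x ^ j * z ^ k * weight d1 d2 (point y) x z) x =
      (\<Sum>i\<in>S. c i * (x ^ a i * z ^ b i)) * weight d1 d2 (point y) x z" for x z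
  proof -
    have dw: "((\<lambda>x. weight d1 d2 (point y) x z) has_field_derivative (- V x + z) * weight d1 d2 (point y) x z) (at x)"
      unfolding weight_def V_def
      by (rule derivative_eq_intros potential_deriv refl | simp)+
    have "((\<lambda>x. x ^ j * z ^ k * weight d1 d2 (point y) x z) has_field_derivative
        (of_nat j * x ^ (j - 1) * z ^ k * weight d1 d2 (point y) x z + x ^ j * z ^ k * ((- V x + z) * weight d1 d2 (point y) x z))) (at x)"
      by (rule derivative_eq_intros dw refl | simp add: algebra_simps)+
    then have "deriv (\<lambda>x. x ^ j * z ^ k * weight d1 d2 (point y) x z) x =
        (of_nat j * (x ^ (j - 1) * z ^ k) + x ^ j * z ^ (k + 1) - x ^ j * z ^ k * V x) * weight d1 d2 (point y) x z"
      by (simp add: DERIV_imp_deriv algebra_simps)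
    also have "x ^ j * z ^ k * V x = (\<Sum>K=1..d1 + 1. y (DU K) * (x ^ (j + K - 1) * z ^ k))"
      unfolding V_def sum_distrib_left by (intro sum.cong) (auto simp: point_def power_add[symmetric])
    finally show ?thesis by (simp add: sumS c_def a_def b_def sum_negf del: sum.cl_ivl_Suc)
  qed
  have "0 = contour_int2 gx gy (\<lambda>x z. deriv (\<lambda>x. x ^ j * z ^ k * weight d1 d2 (point y) x z) x)"
    using no_boundary_x[OF D_Omega[OF y], of j k] by simp
  also have "\<dots> = (\<Sum>i\<in>S. c i * moment (a i) (b i) y)"
    by (rule contour_int2_combination[OF y _ d]) (simp add: S_def)
  finally have "of_nat j * moment (j - 1) k y + moment j (k + 1) y = (\<Sum>K=1..d1 + 1. y (DU K) * moment (j + K - 1) k y)"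
    by (simp add: sumS c_def a_def b_def sum_negf del: sum.cl_ivl_Suc)
  then show ?thesis by (simp only: diff_add_eq right_minus_eq)
qed

lemma parts_y:
  assumes y: "y \<in> D"
  shows "of_nat k * moment j (k - 1) y - (\<Sum>J=1..d2 + 1. y (DV J) * moment j (k + J - 1) y) + moment (j + 1) k y = 0"
proof -
  define V where "V z = (\<Sum>J=1..d2 + 1. snd (point y) J * z ^ (J - 1))" for z
  \<comment> \<open>Labels of the terms as in \<open>parts_x\<close>, with \<open>DU 0\<close> for
    the term from \<open>x * y\<close>.\<close>
  define S where "S = insert DZ (insert (DU 0) (DV ` {1..d2 + 1}))"
  define c where "c i = (case i of DZ \<Rightarrow> of_nat k | DV J \<Rightarrow> - y (DV J) | DU K \<Rightarrow> 1)" for i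
  define a where "a i = (case i of DZ \<Rightarrow> j | DV J \<Rightarrow> j | DU K \<Rightarrow> j + 1)" for i
  define b where "b i = (case i of DZ \<Rightarrow> k - 1 | DV J \<Rightarrow> k + J - 1 | DU K \<Rightarrow> k)" for i
  have sumS: "(\<Sum>i\<in>S. F i) = F DZ + F (DU 0) + (\<Sum>J=1..d2 + 1. F (DV J))" for F :: "dir \<Rightarrow> complex"
    unfolding S_def by (subst sum.insert; (subst sum.insert)?) (auto simp: sum.reindex inj_on_def add.assoc)
  have d: "deriv (\<lambda>z. x ^ j * z ^ k * weight d1 d2 (point y) x z) z =
      (\<Sum>i\<in>S. c i * (x ^ a i * z ^ b i)) * weight d1 d2 (point y) x z" for x z
  proof -
    have dw: "((\<lambda>z. weight d1 d2 (point y) x z) has_field_derivative (- V z + x) * weight d1 d2 (point y) x z) (at z)"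
      unfolding weight_def V_def
      by (rule derivative_eq_intros potential_deriv refl | simp)+
    have "((\<lambda>z. x ^ j * z ^ k * weight d1 d2 (point y) x z) has_field_derivative
        (x ^ j * (of_nat k * z ^ (k - 1)) * weight d1 d2 (point y) x z + x ^ j * z ^ k * ((- V z + x) * weight d1 d2 (point y) x z))) (at z)"
      by (rule derivative_eq_intros dw refl | simp add: algebra_simps)+
    then have "deriv (\<lambda>z. x ^ j * z ^ k * weight d1 d2 (point y) x z) z =
        (of_nat k * (x ^ j * z ^ (k - 1)) + x ^ (j + 1) * z ^ k - x ^ j * z ^ k * V z) * weight d1 d2 (point y) x z"
      by (simp add: DERIV_imp_deriv algebra_simps)
    also have "x ^ j * z ^ k * V z = (\<Sum>J=1..d2 + 1. y (DV J) * (x ^ j * z ^ (k + J - 1)))"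
      unfolding V_def sum_distrib_left by (intro sum.cong) (auto simp: point_def power_add[symmetric])
    finally show ?thesis by (simp add: sumS c_def a_def b_def sum_negf del: sum.cl_ivl_Suc)
  qed
  have "0 = contour_int2 gx gy (\<lambda>x z. deriv (\<lambda>z. x ^ j * z ^ k * weight d1 d2 (point y) x z) z)"
    using no_boundary_y[OF D_Omega[OF y], of j k] by simp
  also have "\<dots> = (\<Sum>i\<in>S. c i * moment (a i) (b i) y)"
    by (rule contour_int2_combination[OF y _ d]) (simp add: S_def)
  finally have "of_nat k * moment j (k - 1) y + moment (j + 1) k y = (\<Sum>J=1..d2 + 1. y (DV J) * moment j (k + J - 1) y)"
    by (simp add: sumS c_def a_def b_def sum_negf del: sum.cl_ivl_Suc)
  then show ?thesis by (simp only: diff_add_eq right_minus_eq)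
qed

lemma form_biorthogonal:
  assumes y: "y \<in> D"
  shows "moment_form (\<lambda>i j. moment i j y) (\<pi> n (point y)) (\<sigma> m (point y)) = (if n = m then h n (point y) else 0)"
proof -
  define f g where "f = \<pi> n (point y)" and "g = \<sigma> m (point y)"
  define S where "S = {..degree f} \<times> {..degree g}"
  have e: "poly f x * poly g z * weight d1 d2 (point y) x z =
      (\<Sum>i\<in>S. coeff f (fst i) * coeff g (snd i) * (x ^ fst i * z ^ snd i)) * weight d1 d2 (point y) x z" for x z
    unfolding S_def poly_altdef sum_product
    by (simp add: sum.cartesian_product case_prod_unfold mult_ac)
  have "(if n = m then h n (point y) else 0) = contour_int2 gx gy (\<lambda>x z. poly f x * poly g z * weight d1 d2 (point y) x z)"
    using biorthogonal[OF D_Omega[OF y], of n m] by (simp add: f_def g_def)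
  also have "\<dots> = (\<Sum>i\<in>S. coeff f (fst i) * coeff g (snd i) * moment (fst i) (snd i) y)"
    by (rule contour_int2_combination[OF y _ e]) (simp add: S_def)
  also have "\<dots> = moment_form (\<lambda>i j. moment i j y) f g"
    unfolding moment_form_def S_def by (simp add: sum.cartesian_product case_prod_unfold)
  finally show ?thesis by (simp add: f_def g_def)
qed

lemma moment_deformation:
  "moment_deformation I D d1 d2 moment (\<lambda>n y. \<pi> n (point y)) (\<lambda>n y. \<sigma> n (point y)) (\<lambda>n y. h n (point y)) (\<lambda>n y. rt n (point y))"
proof
  show "d1 \<ge> 1" "d2 \<ge> 1" by (fact d1, fact d2)
  show "I = insert DZ (DU ` {1..d1 + 1} \<union> DV ` {1..d2 + 1})" by (rule I_def)
  show "c1 (moment j k) (\<lambda>i y. coupling i * moment (j + shift_x i) (k + shift_y i) y)" for j k by (rule c1_moment)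
  show "continuous_on D (\<lambda>y. rt n (point y))" for n
    by (rule continuous_on_compose2[OF rt_continuous continuous_point]) (use D_Omega in auto)
  fix y assume y: "y \<in> D"
  note p = D_Omega[OF y]
  show "degree (\<pi> n (point y)) = n \<and> lead_coeff (\<pi> n (point y)) = 1" for n by (rule monic_pi[OF p])
  show "degree (\<sigma> n (point y)) = n \<and> lead_coeff (\<sigma> n (point y)) = 1" for n by (rule monic_sigma[OF p])
  show "moment_form (\<lambda>i j. moment i j y) (\<pi> n (point y)) (\<sigma> m (point y)) = (if n = m then h n (point y) else 0)" for n m
    by (rule form_biorthogonal[OF y])
  show "h n (point y) \<noteq> 0" "(rt n (point y))\<^sup>2 = h n (point y)" for n
    by (rule h_nonzero[OF p], rule rt_square[OF p])
  show "y (DU (d1 + 1)) \<noteq> 0" "y (DV (d2 + 1)) \<noteq> 0"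
    using leading[of "fst (point y)" "snd (point y)"] p by (auto simp: point_def)
  show "of_nat j * moment (j - 1) k y - (\<Sum>K=1..d1 + 1. y (DU K) * moment (j + K - 1) k y) + moment j (k + 1) y = 0" for j k
    by (rule parts_x[OF y])
  show "of_nat k * moment j (k - 1) y - (\<Sum>J=1..d2 + 1. y (DV J) * moment j (k + J - 1) y) + moment (j + 1) k y = 0" for j k
    by (rule parts_y[OF y])
qed

sublocale moment_deformation I D d1 d2 moment "\<lambda>n y. \<pi> n (point y)" "\<lambda>n y. \<sigma> n (point y)"
  "\<lambda>n y. h n (point y)" "\<lambda>n y. rt n (point y)"
  by (rule moment_deformation)

end

section \<open>Fundamental solutions\<close>

lemma sum_band_up:
  fixes g :: "nat \<Rightarrow> complex"
  assumes "\<And>m. g m \<noteq> 0 \<Longrightarrow> n \<le> m \<and> m \<le> n + K" "n + K \<le> B"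
  shows "(\<Sum>m\<le>B. g m) = (\<Sum>j=0..K. g (n + j))"
proof -
  have "(\<Sum>m\<le>B. g m) = (\<Sum>m\<in>(\<lambda>j. n + j) ` {0..K}. g m)"
  proof (rule sum.mono_neutral_right)
    show "\<forall>m\<in>{..B} - (\<lambda>j. n + j) ` {0..K}. g m = 0"
    proof
      fix m assume m: "m \<in> {..B} - (\<lambda>j. n + j) ` {0..K}"
      show "g m = 0"
      proof (rule ccontr)
        assume "g m \<noteq> 0"
        then have "m = n + (m - n)" "m - n \<in> {0..K}" using assms(1)[of m] by auto
        then show False using m by blast
      qed
    qed
  qed (use assms(2) in auto)
  also have "\<dots> = (\<Sum>j=0..K. g (n + j))" by (subst sum.reindex) (auto simp: inj_on_def)
  finally show ?thesis .
qed

lemma sum_band_down: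
  fixes g :: "nat \<Rightarrow> complex"
  assumes "\<And>m. g m \<noteq> 0 \<Longrightarrow> m \<le> n \<and> n \<le> m + K" "K \<le> n" "n \<le> B"
  shows "(\<Sum>m\<le>B. g m) = (\<Sum>j=0..K. g (n - j))"
proof -
  have "(\<Sum>m\<le>B. g m) = (\<Sum>m\<in>(\<lambda>j. n - j) ` {0..K}. g m)"
  proof (rule sum.mono_neutral_right)
    show "\<forall>m\<in>{..B} - (\<lambda>j. n - j) ` {0..K}. g m = 0"
    proof
      fix m assume m: "m \<in> {..B} - (\<lambda>j. n - j) ` {0..K}"
      show "g m = 0"
      proof (rule ccontr)
        assume "g m \<noteq> 0"
        then have "m = n - (n - m)" "n - m \<in> {0..K}" using assms(1)[of m] by auto
        then show False using m by blast
      qed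
    qed
  qed (use assms(2,3) in auto)
  also have "\<dots> = (\<Sum>j=0..K. g (n - j))" using assms(2) by (subst sum.reindex) (auto simp: inj_on_def)
  finally show ?thesis .
qed

lemma sum_band_up_one:
  fixes g :: "nat \<Rightarrow> complex"
  assumes "\<And>m. g m \<noteq> 0 \<Longrightarrow> n \<le> m + 1 \<and> m \<le> n + K" "n \<ge> 1" "n + K \<le> B"
  shows "(\<Sum>m\<le>B. g m) = g (n - 1) + (\<Sum>j=0..K. g (n + j))"
proof -
  have "(\<Sum>m\<le>B. g m) = (\<Sum>j=0..K + 1. g (n - 1 + j))"
    by (rule sum_band_up) (use assms in fastforce)+
  also have "\<dots> = g (n - 1) + (\<Sum>j=0..K. g (n - 1 + Suc j))"
    unfolding Suc_eq_plus1[symmetric] atLeast0AtMost by (subst sum.atMost_Suc_shift) simp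
  finally show ?thesis using assms(2) by simp
qed

lemma sum_band_down_one:
  fixes g :: "nat \<Rightarrow> complex"
  assumes "\<And>m. g m \<noteq> 0 \<Longrightarrow> m \<le> n + 1 \<and> n \<le> m + K" "K \<le> n" "n + 1 \<le> B"
  shows "(\<Sum>m\<le>B. g m) = g (n + 1) + (\<Sum>j=0..K. g (n - j))"
proof -
  have "(\<Sum>m\<le>B. g m) = (\<Sum>j=0..K + 1. g (n + 1 - j))"
    by (rule sum_band_down) (use assms in fastforce)+
  also have "\<dots> = g (n + 1) + (\<Sum>j=0..K. g (n + 1 - Suc j))"
    unfolding Suc_eq_plus1[symmetric] atLeast0AtMost by (subst sum.atMost_Suc_shift) simp
  finally show ?thesis by simp
qed

lemma invertible_mat_of_det:
  fixes A :: "complex mat"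
  assumes A: "A \<in> carrier_mat n n" and "Determinant.det A \<noteq> 0"
  shows "invertible_mat A"
proof -
  obtain B where "B \<in> carrier_mat n n" "A * B = 1\<^sub>m n" "B * A = 1\<^sub>m n"
    using det_non_zero_imp_unit[OF assms] by (auto simp: Units_def ring_mat_def)
  then have "inverts_mat A B \<and> inverts_mat B A" using A by (auto simp: inverts_mat_def)
  then show ?thesis using A by (auto simp: invertible_mat_def)
qed

lemma poly_eqI_fun:
  fixes f g :: "complex poly"
  assumes "\<And>x. poly f x = poly g x" shows "f = g"
  using assms poly_eq_poly_eq_iff[of f g] by (simp add: fun_eq_iff)

section \<open>Passage between parameters and coordinates\<close>

context biorthogonal_on
begin

definition coords :: "params \<Rightarrow> complex \<Rightarrow> dir \<Rightarrow> complex" where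
  "coords p z i = (case i of DU K \<Rightarrow> if K \<in> {1..d1 + 1} then fst p K else 0
     | DV J \<Rightarrow> if J \<in> {1..d2 + 1} then snd p J else 0 | DZ \<Rightarrow> z)"

lemma W_param: "p \<in> W \<Longrightarrow> p \<in> param_space d1 d2"
  using open_W by (auto simp: open_params_def openin_open)

lemma point_coords:
  assumes "p \<in> W" shows "point (coords p z) = p"
proof -
  obtain u v where p: "p = (u, v)" by (cases p)
  have u: "u \<in> {1..d1 + 1} \<rightarrow>\<^sub>E UNIV" and v: "v \<in> {1..d2 + 1} \<rightarrow>\<^sub>E UNIV"
    using W_param[OF assms] by (auto simp: p param_space_def)
  have "(\<lambda>K\<in>{1..d1 + 1}. coords p z (DU K)) = u"
    using u by (auto simp: fun_eq_iff coords_def p PiE_iff extensional_def)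
  moreover have "(\<lambda>J\<in>{1..d2 + 1}. coords p z (DV J)) = v"
    using v by (auto simp: fun_eq_iff coords_def p PiE_iff extensional_def)
  ultimately show ?thesis by (simp add: point_def p)
qed

lemma coords_in_D:
  assumes "p \<in> W" shows "coords p z \<in> D"
proof -
  have "coords p z i = 0" if "i \<notin> I" for i
    using that by (cases i) (auto simp: coords_def I_def)
  then show ?thesis using assms by (simp add: D_def point_coords)
qed

lemma coords_DZ: "(coords p z)(DZ := w) = coords p w"
  by (auto simp: fun_eq_iff coords_def split: dir.splits)

text \<open>Turns the partial derivative in a coordinate into the derivative in the parameter
  \<open>u\<^sub>K\<close>. It holds for all \<open>w\<close>, so that no neighbourhood of the
  parameter point in \<open>W\<close> has to be discussed.\<close>

lemma coords_DU: "K \<in> {1..d1 + 1} \<Longrightarrow> (coords p z)(DU K := w) = coords ((fst p)(K := w), snd p) z"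
  by (auto simp: fun_eq_iff coords_def split: dir.splits)

lemma coords_DV: "J \<in> {1..d2 + 1} \<Longrightarrow> (coords p z)(DV J := w) = coords (fst p, (snd p)(J := w)) z"
  by (auto simp: fun_eq_iff coords_def split: dir.splits)

lemma continuous_coords: "continuous_on A (\<lambda>(p, z). coords p z)"
proof (rule continuous_on_coordinatewise_then_product)
  fix i
  show "continuous_on A (\<lambda>q. (case q of (p, z) \<Rightarrow> coords p z) i)"
  proof (cases i)
    case (DU K)
    have "continuous_on A (\<lambda>q. fst (fst q) K)"
      by (rule continuous_on_product_then_coordinatewise) (intro continuous_intros)
    then show ?thesis
      by (cases "K \<in> {1..d1 + 1}") (simp_all only: DU coords_def split_beta' dir.case if_True if_False continuous_on_const)
  next
    case (DV K)
    have "continuous_on A (\<lambda>q. snd (fst q) K)"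
      by (rule continuous_on_product_then_coordinatewise) (intro continuous_intros)
    then show ?thesis
      by (cases "K \<in> {1..d2 + 1}") (simp_all only: DV coords_def split_beta' dir.case if_True if_False continuous_on_const)
  next
    case DZ
    show ?thesis unfolding DZ coords_def split_beta' dir.case by (intro continuous_intros)
  qed
qed

lemma continuous_at_coords:
  assumes "continuous_on D g" shows "continuous_on (W \<times> UNIV) (\<lambda>(p, z). g (coords p z))"
proof -
  have "continuous_on (W \<times> UNIV) (\<lambda>q. g (case q of (p, z) \<Rightarrow> coords p z))"
    by (rule continuous_on_compose2[OF assms continuous_coords]) (auto intro: coords_in_D)
  then show ?thesis by (simp add: split_beta')
qed

lemma psi_ps:
  assumes "p \<in> W"
  shows "\<psi> n p x = poly (ps n (coords p z)) x * exp (- potential d1 (fst p) x)"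
  using psi_eq[of p n x] assms W_subset by (auto simp: ps_def point_coords[OF assms])

text \<open>The given recursion for \<open>\<psi>\<close> becomes a polynomial identity after
  cancelling the exponential; pairing it with \<open>ph m\<close> reads off the entry, which shows
  the recursion coefficients to be unique.\<close>

lemma Q_mat_eq:
  assumes p: "p \<in> W"
  shows "Q_mat d2 (\<alpha> p) n m = Q n m (coords p z)"
proof -
  define y where "y = coords p z"
  have y: "y \<in> D" and py: "point y = p" using p by (auto simp: y_def coords_in_D point_coords)
  have pO: "p \<in> \<Omega>" using p W_subset by auto
  define J where "J = {j \<in> {-1..int d2}. 0 \<le> int n - j}"
  have fin: "finite J" unfolding J_def by (rule finite_subset[OF Collect_restrict]) simp
  have "monom 1 1 * ps n y = (\<Sum>j\<in>J. Polynomial.smult (\<alpha> p j n) (ps (nat (int n - j)) y))"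
  proof (rule poly_eqI_fun)
    fix x
    have "exp (- potential d1 (fst p) x) * poly (monom 1 1 * ps n y) x =
       exp (- potential d1 (fst p) x) * poly (\<Sum>j\<in>J. Polynomial.smult (\<alpha> p j n) (ps (nat (int n - j)) y)) x"
      using x_recursion[OF pO, of x n]
      by (simp add: psi_ps[OF p, where z = z] J_def y_def poly_sum poly_monom sum_distrib_left mult_ac)
    then show "poly (monom 1 1 * ps n y) x = poly (\<Sum>j\<in>J. Polynomial.smult (\<alpha> p j n) (ps (nat (int n - j)) y)) x"
      by simp
  qed
  then have "Q n m y = (\<Sum>j\<in>J. \<alpha> p j n * (if nat (int n - j) = m then 1 else 0))"
    unfolding M_def by (simp add: monom_0 one_pCons[symmetric] moment_form_sum_left moment_form_smult_left orth[OF y])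
  also have "\<dots> = (\<Sum>j\<in>J. if j = int n - int m then \<alpha> p j n else 0)"
    by (intro sum.cong) (auto simp: J_def)
  also have "\<dots> = Q_mat d2 (\<alpha> p) n m" using fin by (auto simp: Q_mat_def J_def)
  finally show ?thesis by (simp add: y_def)
qed

text \<open>Same argument for the differential recursion: the derivative of the exponential
  contributes \<open>- W1\<close>, after which the identity is one of polynomials and
  \<open>N_eq\<close> applies.\<close>

lemma P_mat_eq:
  assumes p: "p \<in> W"
  shows "- P_mat d1 (\<beta> p) n m = N n m (coords p z)"
proof -
  define y where "y = coords p z"
  have y: "y \<in> D" and py: "point y = p" using p by (auto simp: y_def coords_in_D point_coords)
  have pO: "p \<in> \<Omega>" using p W_subset by auto
  define J where "J = {j \<in> {-1..int d1}. 0 \<le> int n + j}"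
  have fin: "finite J" unfolding J_def by (rule finite_subset[OF Collect_restrict]) simp
  have W1: "poly (W1 y) x = (\<Sum>K=1..d1 + 1. fst p K * x ^ (K - 1))" for x
    unfolding W1_def poly_sum using py by (intro sum.cong) (auto simp: poly_monom point_def)
  have "pderiv (ps n y) - W1 y * ps n y = - (\<Sum>j\<in>J. Polynomial.smult (\<beta> p j (nat (int n + j))) (ps (nat (int n + j)) y))"
  proof (rule poly_eqI_fun)
    fix x
    define E where "E x = exp (- potential d1 (fst p) x)" for x
    have "((\<lambda>x. poly (ps n y) x * E x) has_field_derivative
        poly (pderiv (ps n y)) x * E x + poly (ps n y) x * (E x * (- poly (W1 y) x))) (at x)"
      unfolding E_def W1
      by (rule derivative_eq_intros poly_DERIV potential_deriv refl | simp)+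
    moreover have "\<psi> n p = (\<lambda>x. poly (ps n y) x * E x)"
      by (auto simp: fun_eq_iff psi_ps[OF p, where z = z] y_def E_def)
    ultimately have "deriv (\<psi> n p) x = poly (pderiv (ps n y)) x * E x + poly (ps n y) x * (E x * (- poly (W1 y) x))"
      by (simp add: DERIV_imp_deriv)
    then have "E x * poly (pderiv (ps n y) - W1 y * ps n y) x =
       E x * poly (- (\<Sum>j\<in>J. Polynomial.smult (\<beta> p j (nat (int n + j))) (ps (nat (int n + j)) y))) x"
      using derivative_recursion[OF pO, of n x]
      by (simp add: psi_ps[OF p, where z = z] J_def y_def E_def poly_sum sum_distrib_left mult_ac algebra_simps)
    note eq = this
    have "E x \<noteq> 0" by (simp add: E_def)
    from iffD1[OF mult_left_cancel[OF this] eq]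
    show "poly (pderiv (ps n y) - W1 y * ps n y) x =
       poly (- (\<Sum>j\<in>J. Polynomial.smult (\<beta> p j (nat (int n + j))) (ps (nat (int n + j)) y))) x" .
  qed
  then have "N n m y = (\<Sum>j\<in>J. \<beta> p j (nat (int n + j)) * (if nat (int n + j) = m then 1 else 0))"
    unfolding N_eq[OF y] by (simp add: moment_form_minus_left moment_form_sum_left moment_form_smult_left orth[OF y])
  also have "\<dots> = (\<Sum>j\<in>J. if j = int m - int n then \<beta> p j m else 0)"
    by (intro sum.cong) (auto simp: J_def)
  also have "\<dots> = - P_mat d1 (\<beta> p) n m" using fin by (auto simp: P_mat_def J_def)
  finally show ?thesis by (simp add: y_def)
qed

lemma U_mat_eq:
  assumes "p \<in> W" shows "U_mat d2 (\<alpha> p) K n m = Cd (DU K) n m (coords p z)"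
proof -
  have "Q_mat d2 (\<alpha> p) = (\<lambda>n m. Q n m (coords p z))"
    by (intro ext) (rule Q_mat_eq[OF assms])
  then show ?thesis unfolding U_mat_def using deformation_Q[OF coords_in_D[OF assms]] by simp
qed

lemma V_mat_eq:
  assumes "p \<in> W" shows "V_mat d1 (\<beta> p) J n m = - Cd (DV J) m n (coords p z)"
proof -
  have "(\<lambda>n m. - P_mat d1 (\<beta> p) m n) = (\<lambda>n m. N m n (coords p z))"
    using P_mat_eq[OF assms] by simp
  then show ?thesis unfolding V_mat_def using deformation_N[OF coords_in_D[OF assms]] by simp
qed

lemma Q_alpha:
  assumes "p \<in> W"
  shows "Q n (n + 1) (coords p z) = \<alpha> p (-1) n"
    and "j \<le> d2 \<Longrightarrow> Q (n + j) n (coords p z) = \<alpha> p (int j) (n + j)"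
    and "j \<le> d2 \<Longrightarrow> j \<le> n \<Longrightarrow> Q n (n - j) (coords p z) = \<alpha> p (int j) n"
  unfolding Q_mat_eq[OF assms, symmetric] by (auto simp: Q_mat_def)

lemma N_beta:
  assumes "p \<in> W"
  shows "N (n + 1) n (coords p z) = \<beta> p (-1) n"
    and "j \<le> d1 \<Longrightarrow> N n (n + j) (coords p z) = \<beta> p (int j) (n + j)"
    and "j \<le> d1 \<Longrightarrow> j \<le> n \<Longrightarrow> N (n - j) n (coords p z) = \<beta> p (int j) n"
  unfolding P_mat_eq[OF assms, symmetric] by (auto simp: P_mat_def)

lemma gamma_nonzero:
  assumes "p \<in> W" shows "\<alpha> p (-1) n \<noteq> 0" "\<beta> p (-1) n \<noteq> 0"
proof -
  have pO: "p \<in> \<Omega>" using assms W_subset by auto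
  have "rt n p \<noteq> 0" for n using rt_square[OF pO, of n] h_nonzero[OF pO, of n] by auto
  then show "\<alpha> p (-1) n \<noteq> 0" "\<beta> p (-1) n \<noteq> 0" using gamma[OF pO, of n] by auto
qed

section \<open>From entrywise equations to matrix systems\<close>

definition trivial_kernels :: "nat \<Rightarrow> (nat \<Rightarrow> nat \<Rightarrow> (dir \<Rightarrow> complex) \<Rightarrow> complex) \<Rightarrow> bool" where
  "trivial_kernels d f \<longleftrightarrow> (\<forall>y\<in>D. \<forall>s x. (\<forall>j\<le>d. (\<Sum>k\<le>d. f (s + j) k y * x k) = 0) \<longrightarrow> (\<forall>k\<le>d. x k = 0))"

lemma has_mat_derivativeI:
  assumes "A \<in> carrier_mat (Suc d) (Suc d)"
    "\<And>i k. i \<le> d \<Longrightarrow> k \<le> d \<Longrightarrow> ((\<lambda>w. G w $$ (i, k)) has_field_derivative A $$ (i, k)) (at z)"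
  shows "has_mat_derivative G A z"
  unfolding has_mat_derivative_def using assms by (auto simp: less_Suc_eq_le)

text \<open>The dimensions of a matrix sum are those of its last summand, here an
  \<open>msum\<close>, so they are known without any condition on the indices.\<close>

lemma dim_row_system_mat:
  "dim_row (diff_mat d e x y n z) = Suc d" "dim_row (fold_up d x B k n z) = Suc d" "dim_row (fold_down d x B k n z) = Suc d"
  by (simp_all add: diff_mat_def fold_up_def fold_down_def msum_def)

lemma dim_col_system_mat:
  "dim_col (diff_mat_bar d e x y n z) = Suc d" "dim_col (fold_up_bar d x B k n z) = Suc d" "dim_col (fold_down_bar d x B k n z) = Suc d"
  by (simp_all add: diff_mat_bar_def fold_up_bar_def fold_down_bar_def msum_def)

text \<open>The common shape of the systems (1) and (2). \<open>U\<close> names the directions whose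
  matrices use upward products with positive sign, \<open>V\<close> those with inverses and negative
  sign; \<open>u\<close> and \<open>v\<close> exchange these roles between \<open>\<Psi>\<close> and
  \<open>\<Phi>\<close>.\<close>

definition unbarred_system ::
  "nat \<Rightarrow> nat \<Rightarrow> (params \<Rightarrow> int \<Rightarrow> nat \<Rightarrow> complex) \<Rightarrow> (params \<Rightarrow> int \<Rightarrow> nat \<Rightarrow> complex) \<Rightarrow>
    (nat \<Rightarrow> dir) \<Rightarrow> (nat \<Rightarrow> dir) \<Rightarrow> (params \<Rightarrow> nat \<Rightarrow> infmat) \<Rightarrow> (params \<Rightarrow> nat \<Rightarrow> infmat) \<Rightarrow>
    nat set \<Rightarrow> nat set \<Rightarrow> (nat \<Rightarrow> (dir \<Rightarrow> complex) \<Rightarrow> complex mat) \<Rightarrow> bool" where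
  "unbarred_system d e c c' U V MU MV SU SV F \<longleftrightarrow>
     fundamental_sequence (d + 1) W {d + 1..} (\<lambda>n p z. F n (coords p z)) \<and>
     (\<forall>n\<ge>d + 1. \<forall>p\<in>W. \<forall>z.
        has_mat_derivative (\<lambda>w. F n (coords p w)) (- (diff_mat d e (c p) (c' p) n z * F n (coords p z))) z \<and>
        (\<forall>K\<in>SU. has_mat_derivative (\<lambda>w. F n ((coords p z)(U K := w)))
          (fold_up d (c p) (MU p K) K n z * F n (coords p z)) (coords p z (U K))) \<and>
        (\<forall>J\<in>SV. n \<ge> d + J \<longrightarrow> has_mat_derivative (\<lambda>w. F n ((coords p z)(V J := w)))
          (- (fold_down d (c p) (MV p J) J n z * F n (coords p z))) (coords p z (V J))) \<and>
        F (n + 1) (coords p z) = ladder d (c p) n z * F n (coords p z))"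

definition barred_system ::
  "nat \<Rightarrow> nat \<Rightarrow> (params \<Rightarrow> int \<Rightarrow> nat \<Rightarrow> complex) \<Rightarrow> (params \<Rightarrow> int \<Rightarrow> nat \<Rightarrow> complex) \<Rightarrow>
    (nat \<Rightarrow> dir) \<Rightarrow> (nat \<Rightarrow> dir) \<Rightarrow> (params \<Rightarrow> nat \<Rightarrow> infmat) \<Rightarrow> (params \<Rightarrow> nat \<Rightarrow> infmat) \<Rightarrow>
    nat set \<Rightarrow> nat set \<Rightarrow> (nat \<Rightarrow> (dir \<Rightarrow> complex) \<Rightarrow> complex mat) \<Rightarrow> bool" where
  "barred_system d e c c' U V MU MV SU SV F \<longleftrightarrow>
     fundamental_sequence (d + 1) W UNIV (\<lambda>n p z. F n (coords p z)) \<and>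
     (\<forall>n\<ge>1. \<forall>p\<in>W. \<forall>z.
        F n (coords p z) * ladder_bar d (c p) n z = F (n - 1) (coords p z) \<and>
        (n \<ge> e + 1 \<longrightarrow> has_mat_derivative (\<lambda>w. F (n - 1) (coords p w))
          (F (n - 1) (coords p z) * diff_mat_bar d e (c p) (c' p) n z) z) \<and>
        (\<forall>K\<in>SU. has_mat_derivative (\<lambda>w. F (n - 1) ((coords p z)(U K := w)))
          (F (n - 1) (coords p z) * fold_up_bar d (c p) (MU p K) K n z) (coords p z (U K))) \<and>
        (\<forall>J\<in>SV. n \<ge> J + 1 \<longrightarrow> has_mat_derivative (\<lambda>w. F (n - 1) ((coords p z)(V J := w)))
          (- (F (n - 1) (coords p z) * fold_down_bar d (c p) (MV p J) J n z)) (coords p z (V J))))"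

text \<open>The window lemmas translate each row equation for \<open>f\<close> into an entry of a
  matrix equation. The hypotheses hold from the lower bandwidth of each direction on, and the first
  row \<open>n - d\<close> of a window must respect it.\<close>

lemma unbarred_solution:
  fixes f :: "nat \<Rightarrow> nat \<Rightarrow> (dir \<Rightarrow> complex) \<Rightarrow> complex"
    and c b :: "params \<Rightarrow> int \<Rightarrow> nat \<Rightarrow> complex" and d e :: nat and U V :: "nat \<Rightarrow> dir"
    and MU MV :: "params \<Rightarrow> nat \<Rightarrow> infmat"
  assumes cont: "\<And>n k. continuous_on D (f n k)"
    and ker: "trivial_kernels d f"
    and gam: "\<And>p n. p \<in> W \<Longrightarrow> c p (-1) n \<noteq> 0"
    and rec: "\<And>p z n k. p \<in> W \<Longrightarrow> n \<ge> d \<Longrightarrow> k \<le> d \<Longrightarrow> z * f n k (coords p z) =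
       c p (-1) n * f (n + 1) k (coords p z) + (\<Sum>j\<le>d. c p (int j) n * f (n - j) k (coords p z))"
    and dz: "\<And>p z n k. p \<in> W \<Longrightarrow> n \<ge> 1 \<Longrightarrow> k \<le> d \<Longrightarrow> ((\<lambda>w. f n k (coords p w)) has_field_derivative
       - (b p (-1) (n - 1) * f (n - 1) k (coords p z) + (\<Sum>j=0..e. b p (int j) (n + j) * f (n + j) k (coords p z)))) (at z)"
    and du: "\<And>K p z n k. K \<in> SU \<Longrightarrow> p \<in> W \<Longrightarrow> k \<le> d \<Longrightarrow>
       ((\<lambda>w. f n k ((coords p z)(U K := w))) has_field_derivative
         (\<Sum>j=0..K. MU p K n (n + j) * f (n + j) k (coords p z))) (at (coords p z (U K)))"
    and dv: "\<And>J p z n k. J \<in> SV \<Longrightarrow> p \<in> W \<Longrightarrow> n \<ge> J \<Longrightarrow> k \<le> d \<Longrightarrow>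
       ((\<lambda>w. f n k ((coords p z)(V J := w))) has_field_derivative
         - (\<Sum>j=0..J. MV p J (n - j) n * f (n - j) k (coords p z))) (at (coords p z (V J)))"
  shows "unbarred_system d e c b U V MU MV SU SV
    (\<lambda>n y. Matrix.mat (Suc d) (Suc d) (\<lambda>(i, k). f (n - d + i) k y))"
proof -
  define F where "F = (\<lambda>n y. Matrix.mat (Suc d) (Suc d) (\<lambda>(i, k). f (n - d + i) k y))"
  have entry: "F n y $$ (i, k) = f (n - d + i) k y" if "i \<le> d" "k \<le> d" for n y i k
    using that by (simp add: F_def)
  have dimF: "dim_row (F n y) = Suc d" "dim_col (F n y) = Suc d" for n y by (simp_all add: F_def)
  have car: "F n y \<in> carrier_mat (Suc d) (Suc d)" for n y by (simp add: F_def)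
  have us: "unbarred_sequence d (c p) z (\<lambda>n k. f n k (coords p z))" if "p \<in> W" for p z
  proof
    show "c p (-1) n \<noteq> 0" for n by (rule gam[OF that])
    show "x k = 0" if "\<And>j. j \<le> d \<Longrightarrow> (\<Sum>k\<le>d. f (s + j) k (coords p z) * x k) = 0" "k \<le> d" for s x k
      using ker that coords_in_D[OF \<open>p \<in> W\<close>] unfolding trivial_kernels_def by blast
  qed (rule rec[OF that])
  have win: "unbarred_sequence.window d (\<lambda>n k. f n k (coords p z)) n = F n (coords p z)" if "p \<in> W" for n p z
    by (simp add: F_def unbarred_sequence.window_def[OF us[OF that]])
  show ?thesis
    unfolding F_def[symmetric] unfolding unbarred_system_def
  proof (intro conjI allI ballI impI)
    show "fundamental_sequence (d + 1) W {d + 1..} (\<lambda>n p z. F n (coords p z))"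
      unfolding fundamental_sequence_def
    proof (intro ballI conjI allI impI)
      fix n p z assume p: "p \<in> W"
      show "F n (coords p z) \<in> carrier_mat (d + 1) (d + 1)" using car by simp
      show "invertible_mat (F n (coords p z))"
        using unbarred_sequence.det_window[OF us[OF p]] unfolding win[OF p] by (rule invertible_mat_of_det[OF car])
    next
      fix n i k assume "i < d + 1" "k < d + 1"
      then have "(\<lambda>(p, z). F n (coords p z) $$ (i, k)) = (\<lambda>(p, z). f (n - d + i) k (coords p z))" by (simp add: F_def)
      then show "continuous_on (W \<times> UNIV) (\<lambda>(p, z). F n (coords p z) $$ (i, k))"
        using continuous_at_coords[OF cont] by simp
    qed
    fix n :: nat and p :: params and z :: complex assume n: "n \<ge> d + 1" and p: "p \<in> W"
    have nd: "n \<ge> d" and r: "n - d + i \<ge> 1" for i using n by auto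
    show "has_mat_derivative (\<lambda>w. F n (coords p w)) (- (diff_mat d e (c p) (b p) n z * F n (coords p z))) z"
    proof (rule has_mat_derivativeI)
      show "- (diff_mat d e (c p) (b p) n z * F n (coords p z)) \<in> carrier_mat (Suc d) (Suc d)"
        by (intro carrier_matI) (simp_all add: dimF dim_row_system_mat dim_col_system_mat)
      fix i k assume ik: "i \<le> d" "k \<le> d"
      have "(- (diff_mat d e (c p) (b p) n z * F n (coords p z))) $$ (i, k) =
          - ((diff_mat d e (c p) (b p) n z * F n (coords p z)) $$ (i, k))"
        using ik by (intro index_uminus_mat) (simp_all add: dimF dim_row_system_mat dim_col_system_mat)
      then show "((\<lambda>w. F n (coords p w) $$ (i, k)) has_field_derivative
          (- (diff_mat d e (c p) (b p) n z * F n (coords p z))) $$ (i, k)) (at z)"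
        unfolding entry[OF ik] using dz[OF p r ik(2), of i z]
          unbarred_sequence.diff_mat_window[OF us[OF p] n ik, of e "b p" z, unfolded win[OF p]] by simp
    qed
    show "has_mat_derivative (\<lambda>w. F n ((coords p z)(U K := w)))
        (fold_up d (c p) (MU p K) K n z * F n (coords p z)) (coords p z (U K))" if K: "K \<in> SU" for K
    proof (rule has_mat_derivativeI)
      show "fold_up d (c p) (MU p K) K n z * F n (coords p z) \<in> carrier_mat (Suc d) (Suc d)"
        by (intro carrier_matI) (simp_all add: dimF dim_row_system_mat dim_col_system_mat)
      fix i k assume ik: "i \<le> d" "k \<le> d"
      show "((\<lambda>w. F n ((coords p z)(U K := w)) $$ (i, k)) has_field_derivative
          (fold_up d (c p) (MU p K) K n z * F n (coords p z)) $$ (i, k)) (at (coords p z (U K)))"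
        unfolding entry[OF ik] unbarred_sequence.fold_up_window[OF us[OF p] nd ik, of "MU p K" K, unfolded win[OF p]]
        by (rule du[OF K p ik(2)])
    qed
    show "has_mat_derivative (\<lambda>w. F n ((coords p z)(V J := w)))
        (- (fold_down d (c p) (MV p J) J n z * F n (coords p z))) (coords p z (V J))"
      if J: "J \<in> SV" and nJ: "n \<ge> d + J" for J
    proof (rule has_mat_derivativeI)
      show "- (fold_down d (c p) (MV p J) J n z * F n (coords p z)) \<in> carrier_mat (Suc d) (Suc d)"
        by (intro carrier_matI) (simp_all add: dimF dim_row_system_mat dim_col_system_mat)
      fix i k assume ik: "i \<le> d" "k \<le> d"
      have r: "J \<le> n - d + i" using nJ by simp
      have "(- (fold_down d (c p) (MV p J) J n z * F n (coords p z))) $$ (i, k) =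
          - ((fold_down d (c p) (MV p J) J n z * F n (coords p z)) $$ (i, k))"
        using ik by (intro index_uminus_mat) (simp_all add: dimF dim_row_system_mat dim_col_system_mat)
      then show "((\<lambda>w. F n ((coords p z)(V J := w)) $$ (i, k)) has_field_derivative
          (- (fold_down d (c p) (MV p J) J n z * F n (coords p z))) $$ (i, k)) (at (coords p z (V J)))"
        unfolding entry[OF ik] using dv[OF J p r ik(2), of z]
          unbarred_sequence.fold_down_window[OF us[OF p] nJ ik, of "MV p J", unfolded win[OF p]] by simp
    qed
    show "F (n + 1) (coords p z) = ladder d (c p) n z * F n (coords p z)"
      using unbarred_sequence.ladder_window[OF us[OF p] nd] unfolding win[OF p] by simp
  qed
qed

text \<open>The same translation for windows written as columns. The spectral equation now has lower
  bandwidth \<open>e\<close>, since the spectral matrix is the other Lax matrix, read in the barred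
  orientation.\<close>

lemma barred_solution:
  fixes f :: "nat \<Rightarrow> nat \<Rightarrow> (dir \<Rightarrow> complex) \<Rightarrow> complex"
    and c b :: "params \<Rightarrow> int \<Rightarrow> nat \<Rightarrow> complex" and d e :: nat and U V :: "nat \<Rightarrow> dir"
    and MU MV :: "params \<Rightarrow> nat \<Rightarrow> infmat"
  assumes cont: "\<And>n k. continuous_on D (f n k)"
    and ker: "trivial_kernels d f"
    and gam: "\<And>p n. p \<in> W \<Longrightarrow> c p (-1) n \<noteq> 0"
    and rec: "\<And>p z n k. p \<in> W \<Longrightarrow> n \<ge> 1 \<Longrightarrow> k \<le> d \<Longrightarrow> z * f n k (coords p z) =
       c p (-1) (n - 1) * f (n - 1) k (coords p z) + (\<Sum>j\<le>d. c p (int j) (n + j) * f (n + j) k (coords p z))"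
    and dz: "\<And>p z n k. p \<in> W \<Longrightarrow> n \<ge> e \<Longrightarrow> k \<le> d \<Longrightarrow> ((\<lambda>w. f n k (coords p w)) has_field_derivative
       (b p (-1) n * f (n + 1) k (coords p z) + (\<Sum>j=0..e. b p (int j) n * f (n - j) k (coords p z)))) (at z)"
    and du: "\<And>K p z n k. K \<in> SU \<Longrightarrow> p \<in> W \<Longrightarrow> k \<le> d \<Longrightarrow>
       ((\<lambda>w. f n k ((coords p z)(U K := w))) has_field_derivative
         (\<Sum>j=0..K. MU p K n (n + j) * f (n + j) k (coords p z))) (at (coords p z (U K)))"
    and dv: "\<And>J p z n k. J \<in> SV \<Longrightarrow> p \<in> W \<Longrightarrow> n \<ge> J \<Longrightarrow> k \<le> d \<Longrightarrow>
       ((\<lambda>w. f n k ((coords p z)(V J := w))) has_field_derivative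
         - (\<Sum>j=0..J. MV p J (n - j) n * f (n - j) k (coords p z))) (at (coords p z (V J)))"
  shows "barred_system d e c b U V MU MV SU SV
    (\<lambda>n y. Matrix.mat (Suc d) (Suc d) (\<lambda>(k, i). f (n + i) k y))"
proof -
  define F where "F = (\<lambda>n y. Matrix.mat (Suc d) (Suc d) (\<lambda>(k, i). f (n + i) k y))"
  have entry: "F n y $$ (k, i) = f (n + i) k y" if "i \<le> d" "k \<le> d" for n y i k
    using that by (simp add: F_def)
  have dimF: "dim_row (F n y) = Suc d" "dim_col (F n y) = Suc d" for n y by (simp_all add: F_def)
  have car: "F n y \<in> carrier_mat (Suc d) (Suc d)" for n y by (simp add: F_def)
  have us: "barred_sequence d (c p) z (\<lambda>n k. f n k (coords p z))" if "p \<in> W" for p z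
  proof
    show "c p (-1) n \<noteq> 0" for n by (rule gam[OF that])
    show "x k = 0" if "\<And>j. j \<le> d \<Longrightarrow> (\<Sum>k\<le>d. f (s + j) k (coords p z) * x k) = 0" "k \<le> d" for s x k
      using ker that coords_in_D[OF \<open>p \<in> W\<close>] unfolding trivial_kernels_def by blast
  qed (rule rec[OF that])
  have win: "barred_sequence.window d (\<lambda>n k. f n k (coords p z)) n = F n (coords p z)" if "p \<in> W" for n p z
    by (simp add: F_def barred_sequence.window_def[OF us[OF that]])
  show ?thesis
    unfolding F_def[symmetric] unfolding barred_system_def
  proof (intro conjI allI ballI impI)
    show "fundamental_sequence (d + 1) W UNIV (\<lambda>n p z. F n (coords p z))"
      unfolding fundamental_sequence_def
    proof (intro ballI conjI allI impI)
      fix n p z assume p: "p \<in> W"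
      show "F n (coords p z) \<in> carrier_mat (d + 1) (d + 1)" using car by simp
      show "invertible_mat (F n (coords p z))"
        using barred_sequence.det_window[OF us[OF p]] unfolding win[OF p] by (rule invertible_mat_of_det[OF car])
    next
      fix n i k assume "i < d + 1" "k < d + 1"
      then have "(\<lambda>(p, z). F n (coords p z) $$ (i, k)) = (\<lambda>(p, z). f (n + k) i (coords p z))" by (simp add: F_def)
      then show "continuous_on (W \<times> UNIV) (\<lambda>(p, z). F n (coords p z) $$ (i, k))"
        using continuous_at_coords[OF cont] by simp
    qed
    fix n :: nat and p :: params and z :: complex assume n: "n \<ge> 1" and p: "p \<in> W"
    show "F n (coords p z) * ladder_bar d (c p) n z = F (n - 1) (coords p z)"
      using barred_sequence.window_ladder_bar[OF us[OF p] n] unfolding win[OF p] by simp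
    show "has_mat_derivative (\<lambda>w. F (n - 1) (coords p w))
        (F (n - 1) (coords p z) * diff_mat_bar d e (c p) (b p) n z) z" if ne: "n \<ge> e + 1"
    proof (rule has_mat_derivativeI)
      show "F (n - 1) (coords p z) * diff_mat_bar d e (c p) (b p) n z \<in> carrier_mat (Suc d) (Suc d)"
        by (intro carrier_matI) (simp_all add: dimF dim_row_system_mat dim_col_system_mat)
      fix k i assume ik: "k \<le> d" "i \<le> d"
      \<comment> \<open>All entries of the window \<open>n - 1\<close> have index at least
        \<open>e\<close>, as the spectral equation demands.\<close>
      have r: "e \<le> n - 1 + i" "n - 1 + i + 1 = n + i" using ne by auto
      show "((\<lambda>w. F (n - 1) (coords p w) $$ (k, i)) has_field_derivative
          (F (n - 1) (coords p z) * diff_mat_bar d e (c p) (b p) n z) $$ (k, i)) (at z)"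
        unfolding entry[OF ik(2,1)]
          barred_sequence.window_diff_mat_bar[OF us[OF p] ne ik(2,1), where b = "b p", unfolded win[OF p]]
        using dz[OF p r(1) ik(1), of z] unfolding r(2) .
    qed
    show "has_mat_derivative (\<lambda>w. F (n - 1) ((coords p z)(U K := w)))
        (F (n - 1) (coords p z) * fold_up_bar d (c p) (MU p K) K n z) (coords p z (U K))" if K: "K \<in> SU" for K
    proof (rule has_mat_derivativeI)
      show "F (n - 1) (coords p z) * fold_up_bar d (c p) (MU p K) K n z \<in> carrier_mat (Suc d) (Suc d)"
        by (intro carrier_matI) (simp_all add: dimF dim_row_system_mat dim_col_system_mat)
      fix k i assume ik: "k \<le> d" "i \<le> d"
      show "((\<lambda>w. F (n - 1) ((coords p z)(U K := w)) $$ (k, i)) has_field_derivative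
          (F (n - 1) (coords p z) * fold_up_bar d (c p) (MU p K) K n z) $$ (k, i)) (at (coords p z (U K)))"
        unfolding entry[OF ik(2,1)]
          barred_sequence.window_fold_up_bar[OF us[OF p] n ik(2,1), where B = "MU p K" and K = K, unfolded win[OF p]]
        by (rule du[OF K p ik(1)])
    qed
    show "has_mat_derivative (\<lambda>w. F (n - 1) ((coords p z)(V J := w)))
        (- (F (n - 1) (coords p z) * fold_down_bar d (c p) (MV p J) J n z)) (coords p z (V J))"
      if J: "J \<in> SV" and nJ: "n \<ge> J + 1" for J
    proof (rule has_mat_derivativeI)
      show "- (F (n - 1) (coords p z) * fold_down_bar d (c p) (MV p J) J n z) \<in> carrier_mat (Suc d) (Suc d)"
        by (intro carrier_matI) (simp_all add: dimF dim_row_system_mat dim_col_system_mat)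
      fix k i assume ik: "k \<le> d" "i \<le> d"
      have r: "J \<le> n - 1 + i" using nJ by simp
      have "(- (F (n - 1) (coords p z) * fold_down_bar d (c p) (MV p J) J n z)) $$ (k, i) =
          - ((F (n - 1) (coords p z) * fold_down_bar d (c p) (MV p J) J n z) $$ (k, i))"
        using ik by (intro index_uminus_mat) (simp_all add: dimF dim_row_system_mat dim_col_system_mat)
      then show "((\<lambda>w. F (n - 1) ((coords p z)(V J := w)) $$ (k, i)) has_field_derivative
          (- (F (n - 1) (coords p z) * fold_down_bar d (c p) (MV p J) J n z)) $$ (k, i)) (at (coords p z (V J)))"
        unfolding entry[OF ik(2,1)] using dv[OF J p r ik(1), of z]
          barred_sequence.window_fold_down_bar[OF us[OF p] nJ ik(2,1), where B = "MV p J", unfolded win[OF p]] by simp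
    qed
  qed
qed

end

section \<open>The four linear problems\<close>

context biorthogonal_on
begin

text \<open>From row \<open>d2\<close> on, the band lies inside the matrix and no subtraction
  \<open>n - j\<close> is truncated, so the row is given by the full set of recursion
  coefficients.\<close>

lemma Q_row:
  assumes "p \<in> W" "d2 \<le> n" "n + 1 \<le> B"
  shows "(\<Sum>m\<le>B. Q n m (coords p z) * g m) =
    \<alpha> p (-1) n * g (n + 1) + (\<Sum>j=0..d2. \<alpha> p (int j) n * g (n - j))"
proof -
  have "(\<Sum>m\<le>B. Q n m (coords p z) * g m) =
      Q n (n + 1) (coords p z) * g (n + 1) + (\<Sum>j=0..d2. Q n (n - j) (coords p z) * g (n - j))"
    by (rule sum_band_down_one) (use Q_band[OF coords_in_D[OF assms(1)]] assms in auto)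
  also have "(\<Sum>j=0..d2. Q n (n - j) (coords p z) * g (n - j)) = (\<Sum>j=0..d2. \<alpha> p (int j) n * g (n - j))"
    by (intro sum.cong refl) (subst Q_alpha(3)[OF assms(1)], use assms(2) in auto)
  finally show ?thesis unfolding Q_alpha(1)[OF assms(1)] .
qed

lemma Q_column:
  assumes "p \<in> W" "n \<ge> 1" "n + d2 \<le> B"
  shows "(\<Sum>m\<le>B. Q m n (coords p z) * g m) =
    \<alpha> p (-1) (n - 1) * g (n - 1) + (\<Sum>j=0..d2. \<alpha> p (int j) (n + j) * g (n + j))"
proof -
  have "(\<Sum>m\<le>B. Q m n (coords p z) * g m) =
      Q (n - 1) n (coords p z) * g (n - 1) + (\<Sum>j=0..d2. Q (n + j) n (coords p z) * g (n + j))"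
    by (rule sum_band_up_one) (use Q_band[OF coords_in_D[OF assms(1)]] assms in auto)
  also have "(\<Sum>j=0..d2. Q (n + j) n (coords p z) * g (n + j)) = (\<Sum>j=0..d2. \<alpha> p (int j) (n + j) * g (n + j))"
    by (intro sum.cong refl) (subst Q_alpha(2)[OF assms(1)], auto)
  also have "Q (n - 1) n (coords p z) = \<alpha> p (-1) (n - 1)"
    using Q_alpha(1)[OF assms(1), of "n - 1" z] assms(2) by simp
  finally show ?thesis .
qed

lemma N_row:
  assumes "p \<in> W" "n \<ge> 1" "n + d1 \<le> B"
  shows "(\<Sum>m\<le>B. N n m (coords p z) * g m) =
    \<beta> p (-1) (n - 1) * g (n - 1) + (\<Sum>j=0..d1. \<beta> p (int j) (n + j) * g (n + j))"
proof -
  have "(\<Sum>m\<le>B. N n m (coords p z) * g m) =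
      N n (n - 1) (coords p z) * g (n - 1) + (\<Sum>j=0..d1. N n (n + j) (coords p z) * g (n + j))"
    by (rule sum_band_up_one) (use N_band[OF coords_in_D[OF assms(1)]] assms in auto)
  also have "(\<Sum>j=0..d1. N n (n + j) (coords p z) * g (n + j)) = (\<Sum>j=0..d1. \<beta> p (int j) (n + j) * g (n + j))"
    by (intro sum.cong refl) (subst N_beta(2)[OF assms(1)], auto)
  also have "N n (n - 1) (coords p z) = \<beta> p (-1) (n - 1)"
    using N_beta(1)[OF assms(1), of "n - 1" z] assms(2) by simp
  finally show ?thesis .
qed

lemma N_column:
  assumes "p \<in> W" "d1 \<le> n" "n + 1 \<le> B"
  shows "(\<Sum>m\<le>B. N m n (coords p z) * g m) =
    \<beta> p (-1) n * g (n + 1) + (\<Sum>j=0..d1. \<beta> p (int j) n * g (n - j))"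
proof -
  have "(\<Sum>m\<le>B. N m n (coords p z) * g m) =
      N (n + 1) n (coords p z) * g (n + 1) + (\<Sum>j=0..d1. N (n - j) n (coords p z) * g (n - j))"
    by (rule sum_band_down_one) (use N_band[OF coords_in_D[OF assms(1)]] assms in auto)
  also have "(\<Sum>j=0..d1. N (n - j) n (coords p z) * g (n - j)) = (\<Sum>j=0..d1. \<beta> p (int j) n * g (n - j))"
    by (intro sum.cong refl) (subst N_beta(3)[OF assms(1)], use assms(2) in auto)
  finally show ?thesis unfolding N_beta(1)[OF assms(1)] .
qed

lemma DU_in: "K \<in> {1..d1 + 1} \<Longrightarrow> DU K \<in> I" and DV_in: "J \<in> {1..d2 + 1} \<Longrightarrow> DV J \<in> I"
  by (simp_all add: I_def)

lemma Cd_DU_band: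
  assumes "p \<in> W" "K \<in> {1..d1 + 1}" "Cd (DU K) n m (coords p z) \<noteq> 0"
  shows "n \<le> m \<and> m \<le> n + K"
  using Cd_band[OF coords_in_D[OF assms(1)] DU_in[OF assms(2)] _ assms(3)] by simp

lemma Cd_DV_band:
  assumes "p \<in> W" "J \<in> {1..d2 + 1}" "Cd (DV J) n m (coords p z) \<noteq> 0"
  shows "m \<le> n \<and> n \<le> m + J"
  using Cd_band[OF coords_in_D[OF assms(1)] DV_in[OF assms(2)] _ assms(3)] by simp

lemma U_row:
  assumes "p \<in> W" "K \<in> {1..d1 + 1}" "n + K \<le> B"
  shows "(\<Sum>m\<le>B. Cd (DU K) n m (coords p z) * g m) = (\<Sum>j=0..K. U_mat d2 (\<alpha> p) K n (n + j) * g (n + j))"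
  unfolding U_mat_eq[OF assms(1), where z = z]
  by (rule sum_band_up) (use Cd_DU_band[OF assms(1,2)] assms(3) in auto)

lemma U_column:
  assumes "p \<in> W" "K \<in> {1..d1 + 1}" "K \<le> n" "n \<le> B"
  shows "(\<Sum>m\<le>B. - Cd (DU K) m n (coords p z) * g m) = - (\<Sum>j=0..K. U_mat d2 (\<alpha> p) K (n - j) n * g (n - j))"
proof -
  have "(\<Sum>m\<le>B. - Cd (DU K) m n (coords p z) * g m) = (\<Sum>j=0..K. - Cd (DU K) (n - j) n (coords p z) * g (n - j))"
    by (rule sum_band_down) (use Cd_DU_band[OF assms(1,2)] assms(3,4) in auto)
  then show ?thesis by (simp add: sum_negf U_mat_eq[OF assms(1), where z = z])
qed

lemma V_row:
  assumes "p \<in> W" "J \<in> {1..d2 + 1}" "J \<le> n" "n \<le> B"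
  shows "(\<Sum>m\<le>B. Cd (DV J) n m (coords p z) * g m) = - (\<Sum>j=0..J. V_mat d1 (\<beta> p) J (n - j) n * g (n - j))"
proof -
  have "(\<Sum>m\<le>B. Cd (DV J) n m (coords p z) * g m) = (\<Sum>j=0..J. Cd (DV J) n (n - j) (coords p z) * g (n - j))"
    by (rule sum_band_down) (use Cd_DV_band[OF assms(1,2)] assms(3,4) in auto)
  then show ?thesis by (simp add: sum_negf V_mat_eq[OF assms(1), where z = z])
qed

lemma V_column:
  assumes "p \<in> W" "J \<in> {1..d2 + 1}" "n + J \<le> B"
  shows "(\<Sum>m\<le>B. - Cd (DV J) m n (coords p z) * g m) = (\<Sum>j=0..J. V_mat d1 (\<beta> p) J n (n + j) * g (n + j))"
  unfolding V_mat_eq[OF assms(1), where z = z]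
  by (rule sum_band_up) (use Cd_DV_band[OF assms(1,2)] assms(3) in auto)

lemma coords_at:
  "coords p z DZ = z" "K \<in> {1..d1 + 1} \<Longrightarrow> coords p z (DU K) = fst p K"
  "J \<in> {1..d2 + 1} \<Longrightarrow> coords p z (DV J) = snd p J"
  by (simp_all add: coords_def)

lemma ball_W: "(\<forall>p\<in>W. R p) \<longleftrightarrow> (\<forall>u v. (u, v) \<in> W \<longrightarrow> R (u, v))"
  by auto

lemma D_nonempty: "W \<noteq> {} \<Longrightarrow> D \<noteq> {}"
  using coords_in_D by blast

text \<open>\<open>point\<close> is compatible with affine combinations, and the spectral coordinate
  is free.\<close>

lemma convex_D:
  assumes "convex_params d1 d2 W" "y \<in> D" "y' \<in> D" "s \<in> {0..1::real}"
  shows "(\<lambda>i. y i + of_real s * (y' i - y i)) \<in> D"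
proof -
  have "point y \<in> W" "point y' \<in> W" using assms(2,3) by (auto simp: D_def)
  then have "((\<lambda>K\<in>{1..d1+1}. of_real (1 - s) * fst (point y) K + of_real s * fst (point y') K),
      (\<lambda>J\<in>{1..d2+1}. of_real (1 - s) * snd (point y) J + of_real s * snd (point y') J)) \<in> W"
    using assms(1,4) unfolding convex_params_def by (auto simp: split_beta)
  also have "((\<lambda>K\<in>{1..d1+1}. of_real (1 - s) * fst (point y) K + of_real s * fst (point y') K),
      (\<lambda>J\<in>{1..d2+1}. of_real (1 - s) * snd (point y) J + of_real s * snd (point y') J)) =
      point (\<lambda>i. y i + of_real s * (y' i - y i))"
    by (auto simp: point_def fun_eq_iff algebra_simps)
  finally show ?thesis using assms(2,3) by (simp add: D_def)
qed

context
  assumes nonempty: "W \<noteq> {}" and convex: "convex_params d1 d2 W"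
begin

text \<open>The problem \<open>Q f = x f\<close>, solved on rows from \<open>d2\<close> on. The
  \<open>u\<close> directions act by upper triangular matrices and need no lower bound on the row;
  the \<open>v\<close> directions act by lower triangular ones.\<close>

lemma Psi_solution:
  "\<exists>F. unbarred_system d2 d1 \<alpha> \<beta> DU DV (\<lambda>p. U_mat d2 (\<alpha> p)) (\<lambda>p. V_mat d1 (\<beta> p)) {1..d1 + 1} {1..d2 + 1} F"
proof (rule lax_data.lax_data_solution[OF lax_Q D_nonempty[OF nonempty] convex_D[OF convex]], assumption+)
  let ?C = "\<lambda>i n m y. if i = DZ then -1 * N n m y else Cd i n m y"
  fix f
  assume cont: "\<And>m k. continuous_on D (f m k)"
    and rows: "\<And>n k y. y \<in> D \<Longrightarrow> n \<ge> d2 \<Longrightarrow> (\<Sum>m\<le>n + 1. Q n m y * f m k y) = y DZ * f n k y"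
    and der: "\<And>i n k y. i \<in> I \<Longrightarrow> y \<in> D \<Longrightarrow> n \<ge> lo_band 1 i \<Longrightarrow> k \<le> d2 \<Longrightarrow>
       ((\<lambda>e. f n k (y(i := e))) has_field_derivative (\<Sum>m\<le>n + (d1 + d2 + 1). ?C i n m y * f m k y)) (at (y i))"
    and kernel: "\<And>s y c k. y \<in> D \<Longrightarrow> (\<And>j. j \<le> d2 \<Longrightarrow> (\<Sum>k\<le>d2. f (s + j) k y * c k) = 0) \<Longrightarrow> k \<le> d2 \<Longrightarrow> c k = 0"
  have ker: "trivial_kernels d2 f" unfolding trivial_kernels_def by (blast intro: kernel)
  have rec: "z * f n k (coords p z) =
      \<alpha> p (-1) n * f (n + 1) k (coords p z) + (\<Sum>j\<le>d2. \<alpha> p (int j) n * f (n - j) k (coords p z))"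
    if p: "p \<in> W" and n: "n \<ge> d2" for p z n k
    using rows[OF coords_in_D[OF p] n, of z k] Q_row[OF p n, of "n + 1" z "\<lambda>m. f m k (coords p z)"]
    by (simp add: coords_at atLeast0AtMost)
  have dz: "((\<lambda>w. f n k (coords p w)) has_field_derivative
       - (\<beta> p (-1) (n - 1) * f (n - 1) k (coords p z) + (\<Sum>j=0..d1. \<beta> p (int j) (n + j) * f (n + j) k (coords p z)))) (at z)"
    if p: "p \<in> W" and n: "n \<ge> 1" and k: "k \<le> d2" for p z n k
  proof -
    have "((\<lambda>w. f n k (coords p w)) has_field_derivative
        - (\<Sum>m\<le>n + (d1 + d2 + 1). N n m (coords p z) * f m k (coords p z))) (at z)"
      using der[OF DZ_in coords_in_D[OF p] _ k, of n z] n by (simp add: coords_at coords_DZ sum_negf)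
    then show ?thesis by (subst (asm) N_row[OF p n]) simp_all
  qed
  have du: "((\<lambda>w. f n k ((coords p z)(DU K := w))) has_field_derivative
       (\<Sum>j=0..K. U_mat d2 (\<alpha> p) K n (n + j) * f (n + j) k (coords p z))) (at (coords p z (DU K)))"
    if K: "K \<in> {1..d1 + 1}" and p: "p \<in> W" and k: "k \<le> d2" for K p z n k
    using der[OF DU_in[OF K] coords_in_D[OF p] _ k, of n z] K
      U_row[OF p K, of n "n + (d1 + d2 + 1)" z "\<lambda>m. f m k (coords p z)"]
    by simp
  have dv: "((\<lambda>w. f n k ((coords p z)(DV J := w))) has_field_derivative
       - (\<Sum>j=0..J. V_mat d1 (\<beta> p) J (n - j) n * f (n - j) k (coords p z))) (at (coords p z (DV J)))"
    if J: "J \<in> {1..d2 + 1}" and p: "p \<in> W" and n: "n \<ge> J" and k: "k \<le> d2" for J p z n k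
    using der[OF DV_in[OF J] coords_in_D[OF p] _ k, of n z] n
      V_row[OF p J n, of "n + (d1 + d2 + 1)" z "\<lambda>m. f m k (coords p z)"]
    by simp
  show ?thesis
    using unbarred_solution[where c = \<alpha> and b = \<beta> and U = DU and V = DV and MU = "\<lambda>p. U_mat d2 (\<alpha> p)" and MV = "\<lambda>p. V_mat d1 (\<beta> p)"
      and SU = "{1..d1 + 1}" and SV = "{1..d2 + 1}", OF cont ker gamma_nonzero(1) rec dz du dv] by blast
qed

text \<open>The transpose of \<open>N f = y f\<close>. Transposition makes the \<open>v\<close>
  matrices upper and the \<open>u\<close> matrices lower triangular, so the roles in
  \<open>unbarred_system\<close> are exchanged.\<close>

lemma Phi_solution:
  "\<exists>F. unbarred_system d1 d2 \<beta> \<alpha> DV DU (\<lambda>p. V_mat d1 (\<beta> p)) (\<lambda>p. U_mat d2 (\<alpha> p)) {1..d2 + 1} {1..d1 + 1} F"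
proof (rule lax_data.lax_data_solution[OF lax_data.transpose_lax_data[OF lax_N] D_nonempty[OF nonempty] convex_D[OF convex]], assumption+)
  let ?C = "\<lambda>i n m y. - (if i = DZ then 1 * Q m n y else Cd i m n y)"
  fix f
  assume cont: "\<And>m k. continuous_on D (f m k)"
    and rows: "\<And>n k y. y \<in> D \<Longrightarrow> n \<ge> d1 \<Longrightarrow> (\<Sum>m\<le>n + 1. N m n y * f m k y) = y DZ * f n k y"
    and der: "\<And>i n k y. i \<in> I \<Longrightarrow> y \<in> D \<Longrightarrow> n \<ge> up_band 1 i \<Longrightarrow> k \<le> d1 \<Longrightarrow>
       ((\<lambda>e. f n k (y(i := e))) has_field_derivative (\<Sum>m\<le>n + (d1 + d2 + 1). ?C i n m y * f m k y)) (at (y i))"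
    and kernel: "\<And>s y c k. y \<in> D \<Longrightarrow> (\<And>j. j \<le> d1 \<Longrightarrow> (\<Sum>k\<le>d1. f (s + j) k y * c k) = 0) \<Longrightarrow> k \<le> d1 \<Longrightarrow> c k = 0"
  have ker: "trivial_kernels d1 f" unfolding trivial_kernels_def by (blast intro: kernel)
  have rec: "z * f n k (coords p z) =
      \<beta> p (-1) n * f (n + 1) k (coords p z) + (\<Sum>j\<le>d1. \<beta> p (int j) n * f (n - j) k (coords p z))"
    if p: "p \<in> W" and n: "n \<ge> d1" for p z n k
    using rows[OF coords_in_D[OF p] n, of z k] N_column[OF p n, of "n + 1" z "\<lambda>m. f m k (coords p z)"]
    by (simp add: coords_at atLeast0AtMost)
  have dz: "((\<lambda>w. f n k (coords p w)) has_field_derivative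
       - (\<alpha> p (-1) (n - 1) * f (n - 1) k (coords p z) + (\<Sum>j=0..d2. \<alpha> p (int j) (n + j) * f (n + j) k (coords p z)))) (at z)"
    if p: "p \<in> W" and n: "n \<ge> 1" and k: "k \<le> d1" for p z n k
  proof -
    have "((\<lambda>w. f n k (coords p w)) has_field_derivative
        - (\<Sum>m\<le>n + (d1 + d2 + 1). Q m n (coords p z) * f m k (coords p z))) (at z)"
      using der[OF DZ_in coords_in_D[OF p] _ k, of n z] n by (simp add: coords_at coords_DZ sum_negf)
    then show ?thesis by (subst (asm) Q_column[OF p n]) simp_all
  qed
  have du: "((\<lambda>w. f n k ((coords p z)(DV J := w))) has_field_derivative
       (\<Sum>j=0..J. V_mat d1 (\<beta> p) J n (n + j) * f (n + j) k (coords p z))) (at (coords p z (DV J)))"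
    if J: "J \<in> {1..d2 + 1}" and p: "p \<in> W" and k: "k \<le> d1" for J p z n k
    using der[OF DV_in[OF J] coords_in_D[OF p] _ k, of n z] J
      V_column[OF p J, of n "n + (d1 + d2 + 1)" z "\<lambda>m. f m k (coords p z)"]
    by simp
  have dv: "((\<lambda>w. f n k ((coords p z)(DU K := w))) has_field_derivative
       - (\<Sum>j=0..K. U_mat d2 (\<alpha> p) K (n - j) n * f (n - j) k (coords p z))) (at (coords p z (DU K)))"
    if K: "K \<in> {1..d1 + 1}" and p: "p \<in> W" and n: "n \<ge> K" and k: "k \<le> d1" for K p z n k
    using der[OF DU_in[OF K] coords_in_D[OF p] _ k, of n z] n
      U_column[OF p K n, of "n + (d1 + d2 + 1)" z "\<lambda>m. f m k (coords p z)"]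
    by simp
  show ?thesis
    using unbarred_solution[where c = \<beta> and b = \<alpha> and U = DV and V = DU and MU = "\<lambda>p. V_mat d1 (\<beta> p)" and MV = "\<lambda>p. U_mat d2 (\<alpha> p)"
      and SU = "{1..d2 + 1}" and SV = "{1..d1 + 1}", OF cont ker gamma_nonzero(2) rec dz du dv] by blast
qed

text \<open>The problem \<open>N f = y f\<close>: its rows have one entry below the diagonal and
  \<open>d1\<close> above, which is the barred form of the recursion. The spectral derivative is a
  row of \<open>Q\<close>, complete from row \<open>d2\<close> on.\<close>

lemma Psi_bar_solution:
  "\<exists>F. barred_system d1 d2 \<beta> \<alpha> DU DV (\<lambda>p. U_mat d2 (\<alpha> p)) (\<lambda>p. V_mat d1 (\<beta> p)) {1..d1 + 1} {1..d2 + 1} F"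
proof (rule lax_data.lax_data_solution[OF lax_N D_nonempty[OF nonempty] convex_D[OF convex]], assumption+)
  let ?C = "\<lambda>i n m y. if i = DZ then 1 * Q n m y else Cd i n m y"
  fix f
  assume cont: "\<And>m k. continuous_on D (f m k)"
    and rows: "\<And>n k y. y \<in> D \<Longrightarrow> n \<ge> 1 \<Longrightarrow> (\<Sum>m\<le>n + d1. N n m y * f m k y) = y DZ * f n k y"
    and der: "\<And>i n k y. i \<in> I \<Longrightarrow> y \<in> D \<Longrightarrow> n \<ge> lo_band d2 i \<Longrightarrow> k \<le> d1 \<Longrightarrow>
       ((\<lambda>e. f n k (y(i := e))) has_field_derivative (\<Sum>m\<le>n + (d1 + d2 + 1). ?C i n m y * f m k y)) (at (y i))"
    and kernel: "\<And>s y c k. y \<in> D \<Longrightarrow> (\<And>j. j \<le> d1 \<Longrightarrow> (\<Sum>k\<le>d1. f (s + j) k y * c k) = 0) \<Longrightarrow> k \<le> d1 \<Longrightarrow> c k = 0"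
  have ker: "trivial_kernels d1 f" unfolding trivial_kernels_def by (blast intro: kernel)
  have rec: "z * f n k (coords p z) =
      \<beta> p (-1) (n - 1) * f (n - 1) k (coords p z) + (\<Sum>j\<le>d1. \<beta> p (int j) (n + j) * f (n + j) k (coords p z))"
    if p: "p \<in> W" and n: "n \<ge> 1" for p z n k
    using rows[OF coords_in_D[OF p] n, of z k] N_row[OF p n, of "n + d1" z "\<lambda>m. f m k (coords p z)"]
    by (simp add: coords_at atLeast0AtMost)
  have dz: "((\<lambda>w. f n k (coords p w)) has_field_derivative
       (\<alpha> p (-1) n * f (n + 1) k (coords p z) + (\<Sum>j=0..d2. \<alpha> p (int j) n * f (n - j) k (coords p z)))) (at z)"
    if p: "p \<in> W" and n: "n \<ge> d2" and k: "k \<le> d1" for p z n k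
  proof -
    have "((\<lambda>w. f n k (coords p w)) has_field_derivative
        (\<Sum>m\<le>n + (d1 + d2 + 1). Q n m (coords p z) * f m k (coords p z))) (at z)"
      using der[OF DZ_in coords_in_D[OF p] _ k, of n z] n by (simp add: coords_at coords_DZ)
    then show ?thesis by (subst (asm) Q_row[OF p n]) simp_all
  qed
  have du: "((\<lambda>w. f n k ((coords p z)(DU K := w))) has_field_derivative
       (\<Sum>j=0..K. U_mat d2 (\<alpha> p) K n (n + j) * f (n + j) k (coords p z))) (at (coords p z (DU K)))"
    if K: "K \<in> {1..d1 + 1}" and p: "p \<in> W" and k: "k \<le> d1" for K p z n k
    using der[OF DU_in[OF K] coords_in_D[OF p] _ k, of n z] K
      U_row[OF p K, of n "n + (d1 + d2 + 1)" z "\<lambda>m. f m k (coords p z)"]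
    by simp
  have dv: "((\<lambda>w. f n k ((coords p z)(DV J := w))) has_field_derivative
       - (\<Sum>j=0..J. V_mat d1 (\<beta> p) J (n - j) n * f (n - j) k (coords p z))) (at (coords p z (DV J)))"
    if J: "J \<in> {1..d2 + 1}" and p: "p \<in> W" and n: "n \<ge> J" and k: "k \<le> d1" for J p z n k
    using der[OF DV_in[OF J] coords_in_D[OF p] _ k, of n z] n
      V_row[OF p J n, of "n + (d1 + d2 + 1)" z "\<lambda>m. f m k (coords p z)"]
    by simp
  show ?thesis
    using barred_solution[where c = \<beta> and b = \<alpha> and U = DU and V = DV and MU = "\<lambda>p. U_mat d2 (\<alpha> p)" and MV = "\<lambda>p. V_mat d1 (\<beta> p)"
      and SU = "{1..d1 + 1}" and SV = "{1..d2 + 1}", OF cont ker gamma_nonzero(2) rec dz du dv] by blast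
qed

text \<open>The transpose of \<open>Q f = x f\<close>: the columns of \<open>Q\<close> have the
  barred form. The spectral derivative is a column of \<open>N\<close>, complete from index
  \<open>d1\<close> on.\<close>

lemma Phi_bar_solution:
  "\<exists>F. barred_system d2 d1 \<alpha> \<beta> DV DU (\<lambda>p. V_mat d1 (\<beta> p)) (\<lambda>p. U_mat d2 (\<alpha> p)) {1..d2 + 1} {1..d1 + 1} F"
proof (rule lax_data.lax_data_solution[OF lax_data.transpose_lax_data[OF lax_Q] D_nonempty[OF nonempty] convex_D[OF convex]], assumption+)
  let ?C = "\<lambda>i n m y. - (if i = DZ then -1 * N m n y else Cd i m n y)"
  fix f
  assume cont: "\<And>m k. continuous_on D (f m k)"
    and rows: "\<And>n k y. y \<in> D \<Longrightarrow> n \<ge> 1 \<Longrightarrow> (\<Sum>m\<le>n + d2. Q m n y * f m k y) = y DZ * f n k y"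
    and der: "\<And>i n k y. i \<in> I \<Longrightarrow> y \<in> D \<Longrightarrow> n \<ge> up_band d1 i \<Longrightarrow> k \<le> d2 \<Longrightarrow>
       ((\<lambda>e. f n k (y(i := e))) has_field_derivative (\<Sum>m\<le>n + (d1 + d2 + 1). ?C i n m y * f m k y)) (at (y i))"
    and kernel: "\<And>s y c k. y \<in> D \<Longrightarrow> (\<And>j. j \<le> d2 \<Longrightarrow> (\<Sum>k\<le>d2. f (s + j) k y * c k) = 0) \<Longrightarrow> k \<le> d2 \<Longrightarrow> c k = 0"
  have ker: "trivial_kernels d2 f" unfolding trivial_kernels_def by (blast intro: kernel)
  have rec: "z * f n k (coords p z) =
      \<alpha> p (-1) (n - 1) * f (n - 1) k (coords p z) + (\<Sum>j\<le>d2. \<alpha> p (int j) (n + j) * f (n + j) k (coords p z))"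
    if p: "p \<in> W" and n: "n \<ge> 1" for p z n k
    using rows[OF coords_in_D[OF p] n, of z k] Q_column[OF p n, of "n + d2" z "\<lambda>m. f m k (coords p z)"]
    by (simp add: coords_at atLeast0AtMost)
  have dz: "((\<lambda>w. f n k (coords p w)) has_field_derivative
       (\<beta> p (-1) n * f (n + 1) k (coords p z) + (\<Sum>j=0..d1. \<beta> p (int j) n * f (n - j) k (coords p z)))) (at z)"
    if p: "p \<in> W" and n: "n \<ge> d1" and k: "k \<le> d2" for p z n k
  proof -
    have "((\<lambda>w. f n k (coords p w)) has_field_derivative
        (\<Sum>m\<le>n + (d1 + d2 + 1). N m n (coords p z) * f m k (coords p z))) (at z)"
      using der[OF DZ_in coords_in_D[OF p] _ k, of n z] n by (simp add: coords_at coords_DZ)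
    then show ?thesis by (subst (asm) N_column[OF p n]) simp_all
  qed
  have du: "((\<lambda>w. f n k ((coords p z)(DV J := w))) has_field_derivative
       (\<Sum>j=0..J. V_mat d1 (\<beta> p) J n (n + j) * f (n + j) k (coords p z))) (at (coords p z (DV J)))"
    if J: "J \<in> {1..d2 + 1}" and p: "p \<in> W" and k: "k \<le> d2" for J p z n k
    using der[OF DV_in[OF J] coords_in_D[OF p] _ k, of n z] J
      V_column[OF p J, of n "n + (d1 + d2 + 1)" z "\<lambda>m. f m k (coords p z)"]
    by simp
  have dv: "((\<lambda>w. f n k ((coords p z)(DU K := w))) has_field_derivative
       - (\<Sum>j=0..K. U_mat d2 (\<alpha> p) K (n - j) n * f (n - j) k (coords p z))) (at (coords p z (DU K)))"
    if K: "K \<in> {1..d1 + 1}" and p: "p \<in> W" and n: "n \<ge> K" and k: "k \<le> d2" for K p z n k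
    using der[OF DU_in[OF K] coords_in_D[OF p] _ k, of n z] n
      U_column[OF p K n, of "n + (d1 + d2 + 1)" z "\<lambda>m. f m k (coords p z)"]
    by simp
  show ?thesis
    using barred_solution[where c = \<alpha> and b = \<beta> and U = DV and V = DU and MU = "\<lambda>p. V_mat d1 (\<beta> p)" and MV = "\<lambda>p. U_mat d2 (\<alpha> p)"
      and SU = "{1..d2 + 1}" and SV = "{1..d1 + 1}", OF cont ker gamma_nonzero(1) rec dz du dv] by blast
qed

end

end

text \<open>Solutions are claimed on convex open parts \<open>W\<close> of \<open>\<Omega>\<close>,
  since a flat connection on a set that is not simply connected can have monodromy. The spectral
  variable runs through the whole plane.\<close>

theorem proposition3p3:
  fixes d1 d2 :: nat
    and gx gy :: "real \<Rightarrow> complex"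
    and \<Omega> W :: "params set"
    and \<pi> \<sigma> :: "nat \<Rightarrow> params \<Rightarrow> complex poly"
    and h rt :: "nat \<Rightarrow> params \<Rightarrow> complex"
    and \<psi> :: "nat \<Rightarrow> params \<Rightarrow> complex \<Rightarrow> complex"
    and \<alpha> \<beta> :: "params \<Rightarrow> int \<Rightarrow> nat \<Rightarrow> complex"
  assumes "biorthogonal_family d1 d2 gx gy \<Omega> \<pi> \<sigma> h rt \<psi> \<alpha> \<beta>"
    and "open_params d1 d2 W" and "W \<subseteq> \<Omega>" and "convex_params d1 d2 W"
  shows
    "(\<exists>\<Psi>. fundamental_sequence (d2 + 1) W {d2 + 1..} \<Psi> \<and>
       (\<forall>N\<ge>d2 + 1. \<forall>u v x. (u, v) \<in> W \<longrightarrow>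
          has_mat_derivative (\<lambda>z. \<Psi> N (u, v) z)
            (- (D1 d1 d2 (\<alpha> (u, v)) (\<beta> (u, v)) N x * \<Psi> N (u, v) x)) x \<and>
          (\<forall>K\<in>{1..d1 + 1}.
             has_mat_derivative (\<lambda>z. \<Psi> N (u(K := z), v) x)
               (U_Psi d1 d2 (\<alpha> (u, v)) (\<beta> (u, v)) K N x * \<Psi> N (u, v) x) (u K)) \<and>
          (\<forall>J\<in>{1..d2 + 1}. N \<ge> d2 + J \<longrightarrow>
             has_mat_derivative (\<lambda>z. \<Psi> N (u, v(J := z)) x)
               (- (V_Psi d1 d2 (\<alpha> (u, v)) (\<beta> (u, v)) J N x * \<Psi> N (u, v) x)) (v J)) \<and>
          \<Psi> (N + 1) (u, v) x = ladder d2 (\<alpha> (u, v)) N x * \<Psi> N (u, v) x))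
     \<and>
     (\<exists>\<Phi>. fundamental_sequence (d1 + 1) W {d1 + 1..} \<Phi> \<and>
       (\<forall>N\<ge>d1 + 1. \<forall>u v y. (u, v) \<in> W \<longrightarrow>
          has_mat_derivative (\<lambda>z. \<Phi> N (u, v) z)
            (- (D2 d1 d2 (\<alpha> (u, v)) (\<beta> (u, v)) N y * \<Phi> N (u, v) y)) y \<and>
          (\<forall>K\<in>{1..d1 + 1}. N \<ge> d1 + K \<longrightarrow>
             has_mat_derivative (\<lambda>z. \<Phi> N (u(K := z), v) y)
               (- (U_Phi d1 d2 (\<alpha> (u, v)) (\<beta> (u, v)) K N y * \<Phi> N (u, v) y)) (u K)) \<and>
          (\<forall>J\<in>{1..d2 + 1}.
             has_mat_derivative (\<lambda>z. \<Phi> N (u, v(J := z)) y)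
               (V_Phi d1 d2 (\<alpha> (u, v)) (\<beta> (u, v)) J N y * \<Phi> N (u, v) y) (v J)) \<and>
          \<Phi> (N + 1) (u, v) y = ladder d1 (\<beta> (u, v)) N y * \<Phi> N (u, v) y))
     \<and>
     (\<exists>\<Psi>b. fundamental_sequence (d1 + 1) W UNIV \<Psi>b \<and>
       (\<forall>N\<ge>1. \<forall>u v y. (u, v) \<in> W \<longrightarrow>
          \<Psi>b (N - 1) (u, v) y = \<Psi>b N (u, v) y * ladder_bar d1 (\<beta> (u, v)) N y \<and>
          (N \<ge> d1 + 1 \<and> N \<ge> d2 + 1 \<longrightarrow>
             has_mat_derivative (\<lambda>z. \<Psi>b (N - 1) (u, v) z)
               (\<Psi>b (N - 1) (u, v) y * D2_bar d1 d2 (\<alpha> (u, v)) (\<beta> (u, v)) N y) y) \<and>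
          (\<forall>K\<in>{1..d1 + 1}.
             has_mat_derivative (\<lambda>z. \<Psi>b (N - 1) (u(K := z), v) y)
               (\<Psi>b (N - 1) (u, v) y * U_Psi_bar d1 d2 (\<alpha> (u, v)) (\<beta> (u, v)) K N y) (u K)) \<and>
          (\<forall>J\<in>{1..d2 + 1}. N \<ge> J + 1 \<longrightarrow>
             has_mat_derivative (\<lambda>z. \<Psi>b (N - 1) (u, v(J := z)) y)
               (- (\<Psi>b (N - 1) (u, v) y * V_Psi_bar d1 d2 (\<alpha> (u, v)) (\<beta> (u, v)) J N y)) (v J))))
     \<and>
     (\<exists>\<Phi>b. fundamental_sequence (d2 + 1) W UNIV \<Phi>b \<and>
       (\<forall>N\<ge>1. \<forall>u v x. (u, v) \<in> W \<longrightarrow>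
          \<Phi>b (N - 1) (u, v) x = \<Phi>b N (u, v) x * ladder_bar d2 (\<alpha> (u, v)) N x \<and>
          (N \<ge> d2 + 1 \<and> N \<ge> d1 + 1 \<longrightarrow>
             has_mat_derivative (\<lambda>z. \<Phi>b (N - 1) (u, v) z)
               (\<Phi>b (N - 1) (u, v) x * D1_bar d1 d2 (\<alpha> (u, v)) (\<beta> (u, v)) N x) x) \<and>
          (\<forall>K\<in>{1..d1 + 1}. N \<ge> K + 1 \<longrightarrow>
             has_mat_derivative (\<lambda>z. \<Phi>b (N - 1) (u(K := z), v) x)
               (- (\<Phi>b (N - 1) (u, v) x * U_Phi_bar d1 d2 (\<alpha> (u, v)) (\<beta> (u, v)) K N x)) (u K)) \<and>
          (\<forall>J\<in>{1..d2 + 1}.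
             has_mat_derivative (\<lambda>z. \<Phi>b (N - 1) (u, v(J := z)) x)
               (\<Phi>b (N - 1) (u, v) x * V_Phi_bar d1 d2 (\<alpha> (u, v)) (\<beta> (u, v)) J N x) (v J))))"
\<comment> \<open>The transport needs a base point; for empty \<open>W\<close> all requirements are
  vacuous.\<close>
proof (cases "W = {}")
  case True
  then show ?thesis by (simp add: fundamental_sequence_def)
next
  case False
  interpret biorthogonal_on d1 d2 gx gy \<Omega> \<pi> \<sigma> h rt \<psi> \<alpha> \<beta> W
    using assms(1-3) by (simp add: biorthogonal_on_def biorthogonal_on_axioms_def)
  note simps = unbarred_system_def barred_system_def ball_W coords_DU coords_DV coords_at
    D1_def D2_def D1_bar_def D2_bar_def U_Psi_def V_Psi_def U_Phi_def V_Phi_def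
    U_Psi_bar_def V_Psi_bar_def U_Phi_bar_def V_Phi_bar_def
  show ?thesis
  proof (intro conjI, goal_cases)
    case 1
    obtain F where F: "unbarred_system d2 d1 \<alpha> \<beta> DU DV (\<lambda>p. U_mat d2 (\<alpha> p)) (\<lambda>p. V_mat d1 (\<beta> p)) {1..d1 + 1} {1..d2 + 1} F"
      using Psi_solution[OF False assms(4)] ..
    show ?case
      \<comment> \<open>Membership in the index interval is kept folded and made available under the
        bounded quantifier, because \<open>coords_DU\<close>, \<open>coords_DV\<close> and
        \<open>coords_at\<close> have it as a premise.\<close>
      by (rule exI[where x = "\<lambda>n p z. F n (coords p z)"])
        (use F in \<open>auto simp: simps simp del: atLeastAtMost_iff cong: ball_cong_simp\<close>)
  next
    case 2
    obtain F where F: "unbarred_system d1 d2 \<beta> \<alpha> DV DU (\<lambda>p. V_mat d1 (\<beta> p)) (\<lambda>p. U_mat d2 (\<alpha> p)) {1..d2 + 1} {1..d1 + 1} F"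
      using Phi_solution[OF False assms(4)] ..
    show ?case
      by (rule exI[where x = "\<lambda>n p z. F n (coords p z)"])
        (use F in \<open>auto simp: simps simp del: atLeastAtMost_iff cong: ball_cong_simp\<close>)
  next
    case 3
    obtain F where F: "barred_system d1 d2 \<beta> \<alpha> DU DV (\<lambda>p. U_mat d2 (\<alpha> p)) (\<lambda>p. V_mat d1 (\<beta> p)) {1..d1 + 1} {1..d2 + 1} F"
      using Psi_bar_solution[OF False assms(4)] ..
    show ?case
      by (rule exI[where x = "\<lambda>n p z. F n (coords p z)"])
        (use F in \<open>auto simp: simps simp del: atLeastAtMost_iff cong: ball_cong_simp\<close>)
  next
    case 4
    obtain F where F: "barred_system d2 d1 \<alpha> \<beta> DV DU (\<lambda>p. V_mat d1 (\<beta> p)) (\<lambda>p. U_mat d2 (\<alpha> p)) {1..d2 + 1} {1..d1 + 1} F"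
      using Phi_bar_solution[OF False assms(4)] ..
    show ?case
      by (rule exI[where x = "\<lambda>n p z. F n (coords p z)"])
        (use F in \<open>auto simp: simps simp del: atLeastAtMost_iff cong: ball_cong_simp\<close>)
  qed
qed

end
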